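(* Let $\gamma_f=\gamma_h=0$ and let $(\bar f_0,\bar g_0)=(f_0-\langle f_0\rangle,\,g_0-\langle g_0\rangle)\in(\dot H^1(\mathbb T))^2$ be the initial datum for the system $$\partial_t\bar f=\partial_x\big[(\bar f+\langle f_0\rangle)(b_\rho\partial_x\bar f+b\,\partial_x\bar g)\big],\qquad \partial_t\bar g=\partial_x\big[(\bar g+\langle g_0\rangle)(b_\mu\partial_x\bar f+b_\mu\partial_x\bar g)\big]\qquad(\mathrm M_0)$$ on $\mathbb T$, such that $$\mathcal E_0(\bar f_0,\bar g_0)<\min\{\langle f_0\rangle,\langle g_0\rangle\},\qquad\min\{\sigma_{1,b},\sigma_{2,b}\}>0$$ and in addition $$\langle f_0\rangle b_\rho-\tfrac12\big(\langle g_0\rangle b_\mu+\langle f_0\rangle b\big)-\Big(b_\rho+b_\mu+\frac{5b_\mu}{2}+\frac{5b}{2}\Big)\mathcal E_0(\bar f_0,\bar g_0)>0,$$ $$\langle g_0\rangle b_\mu-\tfrac12\big(\langle g_0\rangle b_\mu+\langle f_0\rangle b\big)-\Big(b_\rho+b_\mu+\frac{5b_\mu}{2}+\frac{5b}{2}\Big)\mathcal E_0(\bar f_0,\bar g_0)>0.$$ Then there is a global weak solution $(\bar f,\bar g)$ of $(\mathrm M_0)$ with this initial datum which has, for every $T>0$ and every $\alpha\in[0,\frac12)$, the regularity $$\Big(L^\infty([0,T]\times\mathbb T)\cap L^2(0,T;W^{1,\infty}(\mathbb T))\cap L^1(0,T;C^{1+\alpha}(\mathbb T))\cap\mathcal M(0,T;W^{2,\infty}(\mathbb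 T))\cap L^2(0,T;\dot H^1(\mathbb T))\Big)^2,$$ satisfies $\|\bar f(T)\|_{L^\infty}+\|\bar g(T)\|_{L^\infty}\le\mathcal E_0(\bar f_0,\bar g_0)e^{-\delta_bT}$ for almost every $T>0$ with a positive constant $\delta_b=\delta_b(\bar f_0,\bar g_0,\rho_\pm,\mu_\pm)$, and which also satisfies, for all $T>0$, $$(\bar f,\bar g)\in\big(C([0,T];\dot H^1(\mathbb T))\cap L^2(0,T;\dot H^2(\mathbb T))\big)^2$$ together with (i) $E_1(\bar f(T),\bar g(T))+c_1\int_0^TE_2(\bar f(s),\bar g(s))\,ds\le c_2$, (ii) $E_s(\bar f(T),\bar g(T))\le c_3e^{-cT}$ for all $0\le s<1$, for certain positive constants $c=c(\bar f_0,\bar g_0,\rho_\pm,\mu_\pm,s)$ and $c_i=c_i(\bar f_0,\bar g_0,\rho_\pm,\mu_\pm)$, $i=1,2,3$.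
   Context: $\mathbb T=[-\pi,\pi]$ with periodic boundary conditions; $\langle u\rangle=\frac1{2\pi}\int_{-\pi}^{\pi}u\,dx$; $\hat u(k)=\frac1{2\pi}\int_{\mathbb T}u(x)e^{-ikx}dx$. For $\alpha\ge0$, $A^\alpha(\mathbb T)=\{u\in L^1(\mathbb T):\sum_{k\in\mathbb Z}(1+|k|^\alpha)|\hat u(k)|<\infty\}$, $A=A^0$, and $\dot A^\alpha(\mathbb T)$, $\dot H^\alpha(\mathbb T)$ are the subspaces of zero-mean functions of $A^\alpha(\mathbb T)$ and of the Sobolev space $H^\alpha(\mathbb T)$, with norms $\|u\|_{\dot A^\alpha}=\sum_k|k|^\alpha|\hat u(k)|$ and $\|u\|_{\dot H^\alpha}^2=\sum_k|k|^{2\alpha}|\hat u(k)|^2$; $\dot A=\dot A^0$. $\mathcal M(0,T;X)$ is the space of Radon measures on $[0,T]$ with values in the Banach space $X$. $\mathcal E_s(\bar f,\bar g)=\|\bar f\|_{\dot A^s}+\|\bar g\|_{\dot A^s}$ and $E_s(\bar f,\bar g)=\|\bar f\|_{\dot H^s}^2+\|\bar g\|_{\dot H^s}^2$. Parameters: $\mu_\pm,\rho_\pm>0$ (viscosities, densities); $b=\rho_+$, $b_\mu=\frac{\mu_-}{\mu_+}b$, $b_\rho=\frac{\rho_-}{\rho_+}b=\rho_-$. $f_0,g_0$ are positive $2\pi$-periodic functions (initial thicknesses of the two fluid layers). Moreover $$\sigma_{1,b}=\langle f_0\rangle b_\rho-\langle g_0\rangle b_\mu-\mathcal E_0(\bar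 f_0,\bar g_0)(2b_\rho+2b+4b_\mu),$$ $$\sigma_{2,b}=\langle g_0\rangle b_\mu-\langle f_0\rangle b-\mathcal E_0(\bar f_0,\bar g_0)(2b_\rho+2b+4b_\mu).$$ Weak solution (without surface tension): a pair of zero-mean functions $(\bar f,\bar g)\in(L^1(0,T;W^{1,1}(\mathbb T)))^2$ is a weak solution of $(\mathrm M_0)$ on $[0,T]$ with initial datum $(\bar f_0,\bar g_0)$ if for all $\phi,\psi\in C^1_c([0,T)\times\mathbb T)$ $$-\int_{\mathbb T}\bar f_0\phi(0)dx-\int_0^T\!\!\int_{\mathbb T}\bar f\,\partial_t\phi\,dxdt=-\int_0^T\!\!\int_{\mathbb T}(\bar f+\langle f_0\rangle)(b_\rho\partial_x\bar f+b\partial_x\bar g)\partial_x\phi\,dxdt,$$ $$-\int_{\mathbb T}\bar g_0\psi(0)dx-\int_0^T\!\!\int_{\mathbb T}\bar g\,\partial_t\psi\,dxdt=-\int_0^T\!\!\int_{\mathbb T}(\bar g+\langle g_0\rangle)b_\mu(\partial_x\bar f+\partial_x\bar g)\partial_x\psi\,dxdt.$$ A global weak solution is a pair on $(0,\infty)\times\mathbb T$ that is a weak solution on $[0,T]$ for every $T>0$. *)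

theory Defs
  imports "HOL-Analysis.Analysis" "HOL-Probability.Essential_Supremum"
begin

(* A function on the torus is a 2 pi-periodic function on the real line, integrated over one
   period.  Functions are representatives: apart from C1_holder, which concerns the function
   itself, every space and norm below depends only on the function almost everywhere. *)

abbreviation torus :: "real measure" where
  "torus \<equiv> lebesgue_on {-pi..pi}"

definition periodic :: "(real \<Rightarrow> real) \<Rightarrow> bool" where
  "periodic u \<longleftrightarrow> (\<forall>x. u (x + 2 * pi) = u x)"

definition mean :: "(real \<Rightarrow> real) \<Rightarrow> real" where
  "mean u = (LINT x|torus. u x) / (2 * pi)"

definition fourier :: "(real \<Rightarrow> real) \<Rightarrow> int \<Rightarrow> complex" where
  "fourier u k =
     (LINT x|torus. complex_of_real (u x) * exp (- \<i> * of_int k * complex_of_real x))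
       / complex_of_real (2 * pi)"


section \<open>Spaces of functions on the torus\<close>

definition L1 :: "(real \<Rightarrow> real) set" where
  "L1 = {u. periodic u \<and> integrable torus u}"

definition L1_norm :: "(real \<Rightarrow> real) \<Rightarrow> real" where
  "L1_norm u = (LINT x|torus. \<bar>u x\<bar>)"

definition L2 :: "(real \<Rightarrow> real) set" where
  "L2 = {u. periodic u \<and> u \<in> borel_measurable torus \<and> integrable torus (\<lambda>x. (u x)\<^sup>2)}"

definition Linf :: "(real \<Rightarrow> real) set" where
  "Linf = {u. periodic u \<and> u \<in> borel_measurable torus \<and>
              esssup torus (\<lambda>x. ereal \<bar>u x\<bar>) < \<infinity>}"

definition Linf_norm :: "(real \<Rightarrow> real) \<Rightarrow> real" where
  "Linf_norm u = real_of_ereal (esssup torus (\<lambda>x. ereal \<bar>u x\<bar>))"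

definition weak_deriv :: "(real \<Rightarrow> real) \<Rightarrow> (real \<Rightarrow> real) \<Rightarrow> bool" where
  "weak_deriv u v \<longleftrightarrow> u \<in> L1 \<and> v \<in> L1 \<and>
     (\<forall>\<phi> \<phi>'. periodic \<phi> \<and> (\<forall>x. (\<phi> has_real_derivative \<phi>' x) (at x)) \<and> continuous_on UNIV \<phi>' \<longrightarrow>
        (LINT x|torus. u x * \<phi>' x) = - (LINT x|torus. v x * \<phi> x))"

(* The weak derivative is unique up to null sets, so the choice does not affect integrals or norms. *)
definition wderiv :: "(real \<Rightarrow> real) \<Rightarrow> real \<Rightarrow> real" where
  "wderiv u = (SOME v. weak_deriv u v)"

definition W11 :: "(real \<Rightarrow> real) set" where
  "W11 = {u \<in> L1. \<exists>v\<in>L1. weak_deriv u v}"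

definition W11_norm :: "(real \<Rightarrow> real) \<Rightarrow> real" where
  "W11_norm u = L1_norm u + L1_norm (wderiv u)"

definition W1inf :: "(real \<Rightarrow> real) set" where
  "W1inf = {u \<in> Linf. \<exists>v\<in>Linf. weak_deriv u v}"

definition W1inf_norm :: "(real \<Rightarrow> real) \<Rightarrow> real" where
  "W1inf_norm u = Linf_norm u + Linf_norm (wderiv u)"

definition W2inf :: "(real \<Rightarrow> real) set" where
  "W2inf = {u \<in> Linf. \<exists>v\<in>W1inf. weak_deriv u v}"

definition W2inf_norm :: "(real \<Rightarrow> real) \<Rightarrow> real" where
  "W2inf_norm u = Linf_norm u + W1inf_norm (wderiv u)"

(* C^{1+a}; for a = 0 the Hoelder condition only says that the derivative is bounded, and the
   space is C^1. *)
definition C1_holder :: "real \<Rightarrow> (real \<Rightarrow> real) set" where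
  "C1_holder a = {u. periodic u \<and> (\<forall>x. u differentiable (at x)) \<and> continuous_on UNIV (deriv u) \<and>
     (\<exists>K. \<forall>x y. x \<noteq> y \<longrightarrow> \<bar>deriv u x - deriv u y\<bar> \<le> K * \<bar>x - y\<bar> powr a)}"

definition C1_holder_norm :: "real \<Rightarrow> (real \<Rightarrow> real) \<Rightarrow> real" where
  "C1_holder_norm a u = (SUP x. \<bar>u x\<bar>) + (SUP x. \<bar>deriv u x\<bar>) +
     (SUP p\<in>{(x, y). x \<noteq> y}. \<bar>deriv u (fst p) - deriv u (snd p)\<bar> / \<bar>fst p - snd p\<bar> powr a)"

(* Below, 0 powr s = 0 for every s, so the mode k = 0 never contributes to the homogeneous
   norms; on zero-mean functions it vanishes anyway. *)

definition Hdot :: "real \<Rightarrow> (real \<Rightarrow> real) set" where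
  "Hdot s = {u \<in> L2. mean u = 0 \<and>
     (\<lambda>k::int. (1 + \<bar>of_int k\<bar> powr (2 * s)) * (cmod (fourier u k))\<^sup>2) summable_on UNIV}"

definition Hdot_norm :: "real \<Rightarrow> (real \<Rightarrow> real) \<Rightarrow> real" where
  "Hdot_norm s u = sqrt (\<Sum>\<^sub>\<infinity>k::int. \<bar>of_int k\<bar> powr (2 * s) * (cmod (fourier u k))\<^sup>2)"

definition Adot_norm :: "real \<Rightarrow> (real \<Rightarrow> real) \<Rightarrow> real" where
  "Adot_norm s u = (\<Sum>\<^sub>\<infinity>k::int. \<bar>of_int k\<bar> powr s * cmod (fourier u k))"

definition wiener_energy :: "real \<Rightarrow> (real \<Rightarrow> real) \<Rightarrow> (real \<Rightarrow> real) \<Rightarrow> real" where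
  "wiener_energy s u v = Adot_norm s u + Adot_norm s v"

definition sobolev_energy :: "real \<Rightarrow> (real \<Rightarrow> real) \<Rightarrow> (real \<Rightarrow> real) \<Rightarrow> real" where
  "sobolev_energy s u v = (Hdot_norm s u)\<^sup>2 + (Hdot_norm s v)\<^sup>2"


section \<open>Spaces of functions of time and space\<close>

(* A function of time and space is written as u t x.  A Banach space of functions on the torus
   is given by its set X of elements and its norm N. *)

definition Linf_spacetime :: "real \<Rightarrow> (real \<Rightarrow> real \<Rightarrow> real) set" where
  "Linf_spacetime T = {u.
     (\<lambda>(t, x). u t x) \<in> borel_measurable (lebesgue_on ({0..T} \<times> {-pi..pi})) \<and>
     esssup (lebesgue_on ({0..T} \<times> {-pi..pi})) (\<lambda>(t, x). ereal \<bar>u t x\<bar>) < \<infinity>}"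

definition strongly_measurable ::
  "real \<Rightarrow> (real \<Rightarrow> real) set \<Rightarrow> ((real \<Rightarrow> real) \<Rightarrow> real) \<Rightarrow> (real \<Rightarrow> real \<Rightarrow> real) \<Rightarrow> bool" where
  "strongly_measurable T X N u \<longleftrightarrow>
     (\<exists>s :: nat \<Rightarrow> real \<Rightarrow> real \<Rightarrow> real.
        (\<forall>n. simple_function (lebesgue_on {0..T}) (s n) \<and> (\<forall>t\<in>{0..T}. s n t \<in> X)) \<and>
        (AE t in lebesgue_on {0..T}. u t \<in> X \<and> (\<lambda>n. N (\<lambda>x. u t x - s n t x)) \<longlonglongrightarrow> 0))"

definition bochner_Lp ::
  "real \<Rightarrow> real \<Rightarrow> (real \<Rightarrow> real) set \<Rightarrow> ((real \<Rightarrow> real) \<Rightarrow> real) \<Rightarrow> (real \<Rightarrow> real \<Rightarrow> real) set" where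
  "bochner_Lp p T X N = {u. strongly_measurable T X N u \<and>
     integrable (lebesgue_on {0..T}) (\<lambda>t. N (u t) powr p)}"

definition continuous_into ::
  "real \<Rightarrow> (real \<Rightarrow> real) set \<Rightarrow> ((real \<Rightarrow> real) \<Rightarrow> real) \<Rightarrow> (real \<Rightarrow> real \<Rightarrow> real) set" where
  "continuous_into T X N = {u. \<forall>t\<in>{0..T}. u t \<in> X \<and>
     ((\<lambda>s. N (\<lambda>x. u s x - u t x)) \<longlongrightarrow> 0) (at t within {0..T})}"

(* Countably additive X-valued Borel measures of bounded variation on [0,T]; on a compact
   interval these are automatically regular. *)
definition radon_vector_measure ::
  "real \<Rightarrow> (real \<Rightarrow> real) set \<Rightarrow> ((real \<Rightarrow> real) \<Rightarrow> real) \<Rightarrow> (real set \<Rightarrow> real \<Rightarrow> real) \<Rightarrow> bool" where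
  "radon_vector_measure T X N \<mu> \<longleftrightarrow>
     (\<forall>B \<in> sets (restrict_space borel {0..T}). \<mu> B \<in> X) \<and>
     (\<forall>B :: nat \<Rightarrow> real set. range B \<subseteq> sets (restrict_space borel {0..T}) \<and> disjoint_family B \<longrightarrow>
        (\<lambda>n. N (\<lambda>x. \<mu> (\<Union>i. B i) x - (\<Sum>i<n. \<mu> (B i) x))) \<longlonglongrightarrow> 0) \<and>
     (\<exists>C. \<forall>P. finite P \<and> P \<subseteq> sets (restrict_space borel {0..T}) \<and> disjoint P \<longrightarrow>
        (\<Sum>B\<in>P. N (\<mu> B)) \<le> C)"

(* A function u belongs to M(0,T;X) if u(t) dt is an X-valued Radon measure. *)
definition radon_measures ::
  "real \<Rightarrow> (real \<Rightarrow> real) set \<Rightarrow> ((real \<Rightarrow> real) \<Rightarrow> real) \<Rightarrow> (real \<Rightarrow> real \<Rightarrow> real) set" where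
  "radon_measures T X N = {u. \<exists>\<mu>. radon_vector_measure T X N \<mu> \<and>
     (\<forall>B \<in> sets (restrict_space borel {0..T}). AE x in torus.
        integrable (lebesgue_on B) (\<lambda>t. u t x) \<and> \<mu> B x = (LINT t|lebesgue_on B. u t x))}"


section \<open>Weak solutions\<close>

(* phi is in C^1_c([0,T) x torus), with partial derivatives phi_t (one-sided at t = 0) and phi_x. *)
definition test_function ::
  "real \<Rightarrow> (real \<Rightarrow> real \<Rightarrow> real) \<Rightarrow> (real \<Rightarrow> real \<Rightarrow> real) \<Rightarrow> (real \<Rightarrow> real \<Rightarrow> real) \<Rightarrow> bool" where
  "test_function T \<phi> \<phi>t \<phi>x \<longleftrightarrow>
     (\<forall>t\<in>{0..<T}. periodic (\<phi> t)) \<and>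
     (\<forall>t\<in>{0..<T}. \<forall>x. ((\<lambda>s. \<phi> s x) has_real_derivative \<phi>t t x) (at t within {0..<T})) \<and>
     (\<forall>t\<in>{0..<T}. \<forall>x. (\<phi> t has_real_derivative \<phi>x t x) (at x)) \<and>
     continuous_on ({0..<T} \<times> UNIV) (\<lambda>(t, x). \<phi>t t x) \<and>
     continuous_on ({0..<T} \<times> UNIV) (\<lambda>(t, x). \<phi>x t x) \<and>
     (\<exists>T'<T. \<forall>t\<in>{0..<T}. T' \<le> t \<longrightarrow> (\<forall>x. \<phi> t x = 0))"

(* Weak form of  d_t u = d_x q  on [0,T] with initial datum u0 and flux q. *)
definition weak_conservation_law ::
  "real \<Rightarrow> (real \<Rightarrow> real) \<Rightarrow> (real \<Rightarrow> real \<Rightarrow> real) \<Rightarrow> (real \<Rightarrow> real \<Rightarrow> real) \<Rightarrow> bool" where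
  "weak_conservation_law T u0 u q \<longleftrightarrow>
     (\<forall>\<phi> \<phi>t \<phi>x. test_function T \<phi> \<phi>t \<phi>x \<longrightarrow>
        - (LINT x|torus. u0 x * \<phi> 0 x)
        - (LINT t|lebesgue_on {0..T}. LINT x|torus. u t x * \<phi>t t x)
        = - (LINT t|lebesgue_on {0..T}. LINT x|torus. q t x * \<phi>x t x))"

(* F and G are the mean heights.  For functions that are merely in L^1(0,T;W^{1,1}) the fluxes
   need not be integrable in time; their integrability is required so that the right-hand sides of
   the weak equations make sense. *)
definition weak_solution_M0 ::
  "real \<Rightarrow> real \<Rightarrow> real \<Rightarrow> real \<Rightarrow> real \<Rightarrow> real \<Rightarrow> (real \<Rightarrow> real) \<Rightarrow> (real \<Rightarrow> real) \<Rightarrow>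
   (real \<Rightarrow> real \<Rightarrow> real) \<Rightarrow> (real \<Rightarrow> real \<Rightarrow> real) \<Rightarrow> bool" where
  "weak_solution_M0 b b\<^sub>\<mu> b\<^sub>\<rho> F G T f0 g0 f g \<longleftrightarrow>
     (let qf = (\<lambda>t x. (f t x + F) * (b\<^sub>\<rho> * wderiv (f t) x + b * wderiv (g t) x));
          qg = (\<lambda>t x. (g t x + G) * (b\<^sub>\<mu> * (wderiv (f t) x + wderiv (g t) x)))
      in f \<in> bochner_Lp 1 T W11 W11_norm \<and> g \<in> bochner_Lp 1 T W11 W11_norm \<and>
         (AE t in lebesgue_on {0..T}. mean (f t) = 0 \<and> mean (g t) = 0) \<and>
         integrable (lebesgue_on {0..T}) (\<lambda>t. LINT x|torus. \<bar>qf t x\<bar>) \<and>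
         integrable (lebesgue_on {0..T}) (\<lambda>t. LINT x|torus. \<bar>qg t x\<bar>) \<and>
         weak_conservation_law T f0 f qf \<and>
         weak_conservation_law T g0 g qg)"

definition global_weak_solution_M0 ::
  "real \<Rightarrow> real \<Rightarrow> real \<Rightarrow> real \<Rightarrow> real \<Rightarrow> (real \<Rightarrow> real) \<Rightarrow> (real \<Rightarrow> real) \<Rightarrow>
   (real \<Rightarrow> real \<Rightarrow> real) \<Rightarrow> (real \<Rightarrow> real \<Rightarrow> real) \<Rightarrow> bool" where
  "global_weak_solution_M0 b b\<^sub>\<mu> b\<^sub>\<rho> F G f0 g0 f g \<longleftrightarrow>
     (\<forall>T>0. weak_solution_M0 b b\<^sub>\<mu> b\<^sub>\<rho> F G T f0 g0 f g)"

end

(* The solution is constructed on the Fourier side, as a limit of truncated explicit Euler schemes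
   for the coefficients.  For k = l + m one has |k| |l| <= 3/2 l^2 + 1/2 m^2, so the k-th coefficient
   of d_x(u d_x v) is at most 3/2 (|u| * |l^2 v|)(k) + 1/2 (|m^2 u| * |v|)(k), where * is convolution.
   Hence, as long as the Wiener energy stays below E, the quadratic terms are absorbed by the linear
   ones, both in the Wiener norm (this is sigma_1, sigma_2 > 0, giving the rate sig) and in the
   H^1 energy (by these and the additional hypotheses, giving the rate kap).  An Euler step contributes
   a further quadratic error in the H^1 energy, which the dissipation absorbs once the step size is
   small compared with n^(-2).  All bounds are therefore uniform in the truncation n.  Each
   coefficient is Lipschitz in time, a diagonal argument gives a limit in every mode, and H^1
   bounds suffice to pass to the limit in the convolutions.

   The limit satisfies the coefficient equations and, by Fatou, the decay and dissipation bounds.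
   The remaining claims follow from L^2(0,T; H^2): it embeds in the Bochner spaces because
   the sum over k /= 0 of |k|^(2 alpha - 2) converges for alpha < 1/2; continuity in H^1 follows
   because k^2 |f_k(t)|^2 is dominated, uniformly in t, by a sequence summable over k; the weak formulation
   holds for partial sums of the Fourier series, where everything is smooth in x, and then in the
   limit.  The W^(2,infinity)-valued measure has the time-integrable density f(t, .), since
   the Wiener norm of second order is dissipated. *)
theory Submission
  imports Defs "HOL-Complex_Analysis.Great_Picard"
begin

section \<open>Convolutions on the integers\<close>

text \<open>Explicit Euler steps suit the Wiener norm: the modulus of a coefficient is not
  differentiable at 0, whereas for a small step the factor in front of the old coefficient is
  nonnegative and the moduli obey an exact inequality. The two estimates are coupled in one
  direction only: the Wiener bound \<open>E\<close> is what makes the quadratic terms small in the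
  H^1 energy. Both exponential rates come from \<open>\<bar>k\<bar> \<ge> 1\<close> on the nonzero
  modes. The obstacle is that a limit taken mode by mode says nothing about convergence in norm.
  Norm bounds survive because every norm, or its square, is a supremum of sums over finite bands.
  Products survive because a first-order bound makes the part of a convolution in which one
  frequency exceeds J of order 1/J, uniformly along the sequence. Second-order norms are finite only
  at almost every time, while the coefficients are continuous at all times. Statements about
  derivatives and fluxes therefore hold almost everywhere in time, and measurability is obtained
  through limits of partial sums.\<close>

lemma infsum_shift:
  fixes a :: "int \<Rightarrow> 'a::{comm_monoid_add,t2_space}"
  shows "(\<Sum>\<^sub>\<infinity>l. a (k - l)) = (\<Sum>\<^sub>\<infinity>l. a l)"
  by (rule infsum_reindex_bij_witness[where i="\<lambda>l. k - l" and j="\<lambda>l. k - l"]) auto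

lemma summable_on_shift:
  fixes a :: "int \<Rightarrow> 'a::{comm_monoid_add,t2_space}"
  assumes "a summable_on UNIV"
  shows "(\<lambda>l. a (k - l)) summable_on UNIV"
proof -
  have "(\<lambda>l. a (k - l)) summable_on UNIV \<longleftrightarrow> a summable_on UNIV"
    by (rule summable_on_reindex_bij_witness[where i="\<lambda>l. k - l" and j="\<lambda>l. k - l"]) auto
  then show ?thesis using assms by simp
qed

lemma summable_on_sum:
  fixes f :: "'i \<Rightarrow> 'a \<Rightarrow> 'b::{topological_comm_monoid_add,t2_space}"
  assumes "finite K" "\<And>i. i \<in> K \<Longrightarrow> f i summable_on A"
  shows "(\<lambda>x. \<Sum>i\<in>K. f i x) summable_on A"
  using assms by (induction K) (auto intro: summable_on_add)

lemma infsum_sum: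
  fixes f :: "'i \<Rightarrow> 'a \<Rightarrow> 'b::{topological_comm_monoid_add,t2_space}"
  assumes "finite K" "\<And>i. i \<in> K \<Longrightarrow> f i summable_on A"
  shows "(\<Sum>\<^sub>\<infinity>x\<in>A. \<Sum>i\<in>K. f i x) = (\<Sum>i\<in>K. \<Sum>\<^sub>\<infinity>x\<in>A. f i x)"
  using assms
proof (induction K)
  case (insert i K)
  have "(\<Sum>\<^sub>\<infinity>x\<in>A. f i x + (\<Sum>j\<in>K. f j x)) = (\<Sum>\<^sub>\<infinity>x\<in>A. f i x) + (\<Sum>\<^sub>\<infinity>x\<in>A. \<Sum>j\<in>K. f j x)"
    using insert by (intro infsum_add summable_on_sum) auto
  with insert show ?case by simp
qed simp

text \<open>Serves as a real majorant of the complex convolutions below; it is applied to sequences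
  of moduli and their squares.\<close>

definition conv :: "(int \<Rightarrow> real) \<Rightarrow> (int \<Rightarrow> real) \<Rightarrow> int \<Rightarrow> real" where
  "conv a v k = (\<Sum>\<^sub>\<infinity>l. a (k - l) * v l)"

lemma conv_commute: "conv a v k = conv v a k"
  unfolding conv_def
  by (rule infsum_reindex_bij_witness[where i="\<lambda>l. k - l" and j="\<lambda>l. k - l"]) auto

lemma summable_on_le_infsum:
  fixes a :: "'a \<Rightarrow> real"
  assumes "a summable_on UNIV" "\<And>k. 0 \<le> a k"
  shows "a k \<le> (\<Sum>\<^sub>\<infinity>k. a k)"
  using finite_sum_le_infsum[of a UNIV "{k}"] assms by auto

lemma summable_on_mult_bounded:
  fixes a v :: "'a \<Rightarrow> real"
  assumes "v summable_on UNIV" "\<And>k. 0 \<le> v k" "\<And>k. 0 \<le> a k" "\<And>k. a k \<le> C"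
  shows "(\<lambda>l. a l * v l) summable_on UNIV"
proof (rule summable_on_comparison_test)
  show "(\<lambda>l. C * v l) summable_on UNIV" using assms(1) by (rule summable_on_cmult_right)
qed (use assms in \<open>auto intro!: mult_right_mono\<close>)

lemma conv_summable:
  fixes a v :: "int \<Rightarrow> real"
  assumes "a summable_on UNIV" "\<And>k. 0 \<le> a k" "v summable_on UNIV" "\<And>k. 0 \<le> v k"
  shows "(\<lambda>l. a (k - l) * v l) summable_on UNIV"
  by (rule summable_on_mult_bounded[where C="\<Sum>\<^sub>\<infinity>k. a k"])
    (use assms in \<open>auto intro: summable_on_le_infsum\<close>)

text \<open>Young's inequality in the l^1 * l^1 case. With a finite outer sum the order of summation
  is exchanged without a double series, and each translate of \<open>a\<close> sums to at most the
  full sum. The finite set \<open>K\<close> of output indices is the form in which the truncated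
  scheme uses all these estimates.\<close>

lemma sum_conv_le:
  assumes "a summable_on UNIV" "\<And>k. 0 \<le> a k" "v summable_on UNIV" "\<And>k. 0 \<le> v k" "finite K"
  shows "(\<Sum>k\<in>K. conv a v k) \<le> (\<Sum>\<^sub>\<infinity>k. a k) * (\<Sum>\<^sub>\<infinity>k. v k)"
proof -
  have "(\<Sum>k\<in>K. conv a v k) = (\<Sum>\<^sub>\<infinity>l. \<Sum>k\<in>K. a (k - l) * v l)"
    unfolding conv_def by (rule infsum_sum[symmetric]) (use assms conv_summable in auto)
  also have "\<dots> \<le> (\<Sum>\<^sub>\<infinity>l. (\<Sum>\<^sub>\<infinity>k. a k) * v l)"
  proof (rule infsum_mono)
    show "(\<lambda>l. \<Sum>k\<in>K. a (k - l) * v l) summable_on UNIV"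
      by (rule summable_on_sum) (use assms conv_summable in auto)
    show "(\<lambda>l. (\<Sum>\<^sub>\<infinity>k. a k) * v l) summable_on UNIV" using assms(3) by (rule summable_on_cmult_right)
    fix l
    have "(\<Sum>k\<in>K. a (k - l)) = sum a ((\<lambda>k. k - l) ` K)"
      by (subst sum.reindex) (auto simp: inj_on_def)
    also have "\<dots> \<le> (\<Sum>\<^sub>\<infinity>k. a k)" using assms by (intro finite_sum_le_infsum) auto
    finally show "(\<Sum>k\<in>K. a (k - l) * v l) \<le> (\<Sum>\<^sub>\<infinity>k. a k) * v l"
      using assms by (auto simp: sum_distrib_right[symmetric] intro: mult_right_mono)
  qed
  also have "\<dots> = (\<Sum>\<^sub>\<infinity>k. a k) * (\<Sum>\<^sub>\<infinity>k. v k)" by (rule infsum_cmult_right')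
  finally show ?thesis .
qed

lemma summable_on_square:
  fixes v :: "'a \<Rightarrow> real"
  assumes "v summable_on UNIV" "\<And>k. 0 \<le> v k"
  shows "(\<lambda>k. (v k)\<^sup>2) summable_on UNIV"
  unfolding power2_eq_square
  by (rule summable_on_mult_bounded[where C="\<Sum>\<^sub>\<infinity>k. v k"])
    (use assms in \<open>auto intro: summable_on_le_infsum\<close>)

text \<open>The l^1 * l^2 Young inequality in dual form: each product \<open>w k * v l\<close> is
  split by the arithmetic-geometric mean inequality, and what remains is of l^1 * l^1 type. The
  right-hand side keeps a sum of squares rather than a product of norms, which is the shape of the
  energy terms that have to absorb it.\<close>

lemma sum_mult_conv_le:
  assumes "a summable_on UNIV" "\<And>k. 0 \<le> a k" "v summable_on UNIV" "\<And>k. 0 \<le> v k" "finite K"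
  shows "(\<Sum>k\<in>K. w k * conv a v k) \<le> (\<Sum>\<^sub>\<infinity>k. a k) * ((\<Sum>k\<in>K. (w k)\<^sup>2) + (\<Sum>\<^sub>\<infinity>k. (v k)\<^sup>2)) / 2"
proof -
  have sq: "(\<lambda>k. (v k)\<^sup>2) summable_on UNIV" using assms summable_on_square by auto
  have "w k * conv a v k \<le> ((\<Sum>\<^sub>\<infinity>k. a k) * (w k)\<^sup>2 + conv a (\<lambda>l. (v l)\<^sup>2) k) / 2" for k
  proof -
    have "w k * conv a v k = (\<Sum>\<^sub>\<infinity>l. w k * (a (k - l) * v l))"
      unfolding conv_def by (rule infsum_cmult_right'[symmetric])
    also have "\<dots> \<le> (\<Sum>\<^sub>\<infinity>l. (w k)\<^sup>2 / 2 * a (k - l) + 1/2 * (a (k - l) * (v l)\<^sup>2))"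
    proof (rule infsum_mono)
      show "(\<lambda>l. w k * (a (k - l) * v l)) summable_on UNIV"
        by (intro summable_on_cmult_right conv_summable assms)
      show "(\<lambda>l. (w k)\<^sup>2 / 2 * a (k - l) + 1/2 * (a (k - l) * (v l)\<^sup>2)) summable_on UNIV"
        by (intro summable_on_add summable_on_cmult_right conv_summable summable_on_shift assms sq) auto
      fix l
      have "0 \<le> a (k - l) * (w k - v l)\<^sup>2" using assms by simp
      then show "w k * (a (k - l) * v l) \<le> (w k)\<^sup>2 / 2 * a (k - l) + 1/2 * (a (k - l) * (v l)\<^sup>2)"
        by (simp add: power2_diff algebra_simps)
    qed
    also have "\<dots> = (\<Sum>\<^sub>\<infinity>l. (w k)\<^sup>2 / 2 * a (k - l)) + (\<Sum>\<^sub>\<infinity>l. 1/2 * (a (k - l) * (v l)\<^sup>2))"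
      by (intro infsum_add summable_on_cmult_right conv_summable summable_on_shift assms sq) auto
    also have "\<dots> = ((\<Sum>\<^sub>\<infinity>k. a k) * (w k)\<^sup>2 + conv a (\<lambda>l. (v l)\<^sup>2) k) / 2"
      unfolding infsum_cmult_right' infsum_shift conv_def by (simp add: field_simps)
    finally show ?thesis .
  qed
  then have "(\<Sum>k\<in>K. w k * conv a v k) \<le> (\<Sum>k\<in>K. ((\<Sum>\<^sub>\<infinity>k. a k) * (w k)\<^sup>2 + conv a (\<lambda>l. (v l)\<^sup>2) k) / 2)"
    by (intro sum_mono)
  also have "\<dots> = ((\<Sum>\<^sub>\<infinity>k. a k) * (\<Sum>k\<in>K. (w k)\<^sup>2) + (\<Sum>k\<in>K. conv a (\<lambda>l. (v l)\<^sup>2) k)) / 2"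
    by (simp add: sum.distrib sum_divide_distrib sum_distrib_left add_divide_distrib)
  also have "\<dots> \<le> ((\<Sum>\<^sub>\<infinity>k. a k) * (\<Sum>k\<in>K. (w k)\<^sup>2) + (\<Sum>\<^sub>\<infinity>k. a k) * (\<Sum>\<^sub>\<infinity>k. (v k)\<^sup>2)) / 2"
    using sum_conv_le[of a "\<lambda>l. (v l)\<^sup>2" K] assms sq by auto
  finally show ?thesis by (simp add: algebra_simps)
qed

text \<open>The dual estimate is tested with the convolution itself, scaled by \<open>1 / A\<close>.
  It then reads \<open>Q / A \<le> (Q / A + A * V) / 2\<close>, where \<open>V\<close> is the sum of
  the squares of \<open>v\<close>, and the left side absorbs half of itself. The scaling excludes
  \<open>A = 0\<close>, where the convolution vanishes.\<close>

lemma sum_conv_square_le: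
  assumes "a summable_on UNIV" "\<And>k. 0 \<le> a k" "v summable_on UNIV" "\<And>k. 0 \<le> v k" "finite K"
  shows "(\<Sum>k\<in>K. (conv a v k)\<^sup>2) \<le> (\<Sum>\<^sub>\<infinity>k. a k)\<^sup>2 * (\<Sum>\<^sub>\<infinity>k. (v k)\<^sup>2)"
proof -
  define A where "A = (\<Sum>\<^sub>\<infinity>k. a k)"
  define Q where "Q = (\<Sum>k\<in>K. (conv a v k)\<^sup>2)"
  show ?thesis
  proof (cases "A = 0")
    case True
    then have "a k = 0" for k using summable_on_le_infsum[of a k] assms by (simp add: A_def antisym)
    then show ?thesis by (simp add: conv_def)
  next
    case False
    then have "A > 0" using infsum_nonneg[of UNIV a] assms by (simp add: A_def less_le)
    have "(\<Sum>k\<in>K. conv a v k / A * conv a v k) \<le> A * ((\<Sum>k\<in>K. (conv a v k / A)\<^sup>2) + (\<Sum>\<^sub>\<infinity>k. (v k)\<^sup>2)) / 2"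
      unfolding A_def by (rule sum_mult_conv_le) fact+
    also have "(\<Sum>k\<in>K. conv a v k / A * conv a v k) = Q / A"
      by (simp add: Q_def sum_divide_distrib power2_eq_square)
    also have "(\<Sum>k\<in>K. (conv a v k / A)\<^sup>2) = Q / A\<^sup>2"
      by (simp add: Q_def sum_divide_distrib power_divide)
    finally show ?thesis using \<open>A > 0\<close>
      unfolding A_def[symmetric] Q_def[symmetric] by (simp add: field_simps power2_eq_square)
  qed
qed

text \<open>The bilinear map is \<open>u, v \<mapsto> \<partial>\<^sub>x (u \<partial>\<^sub>x v)\<close> on Fourier coefficients.\<close>

definition wprod :: "(int \<Rightarrow> complex) \<Rightarrow> (int \<Rightarrow> complex) \<Rightarrow> int \<Rightarrow> complex" where
  "wprod u v k = (\<Sum>\<^sub>\<infinity>l. u (k - l) * (of_int l * v l))"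

definition bil :: "(int \<Rightarrow> complex) \<Rightarrow> (int \<Rightarrow> complex) \<Rightarrow> int \<Rightarrow> complex" where
  "bil u v k = - of_int k * wprod u v k"

text \<open>Since \<open>0 ^ 0 = 1\<close>, the weight of order 0 keeps the mode 0, in contrast to
  the \<open>powr\<close> weights in the norms of the theorem. Comparisons between different orders
  therefore ask for \<open>c 0 = 0\<close>.\<close>

definition wmod :: "nat \<Rightarrow> (int \<Rightarrow> complex) \<Rightarrow> int \<Rightarrow> real" where
  "wmod p c k = \<bar>of_int k\<bar> ^ p * cmod (c k)"

abbreviation wsummable :: "nat \<Rightarrow> (int \<Rightarrow> complex) \<Rightarrow> bool" where
  "wsummable p c \<equiv> wmod p c summable_on UNIV"

definition wnorm :: "nat \<Rightarrow> (int \<Rightarrow> complex) \<Rightarrow> real" where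
  "wnorm p c = (\<Sum>\<^sub>\<infinity>k. wmod p c k)"

abbreviation ssummable :: "nat \<Rightarrow> (int \<Rightarrow> complex) \<Rightarrow> bool" where
  "ssummable p c \<equiv> (\<lambda>k. (wmod p c k)\<^sup>2) summable_on UNIV"

definition snorm :: "nat \<Rightarrow> (int \<Rightarrow> complex) \<Rightarrow> real" where
  "snorm p c = (\<Sum>\<^sub>\<infinity>k. (wmod p c k)\<^sup>2)"

lemma wmod_nonneg [simp]: "0 \<le> wmod p c k"
  by (simp add: wmod_def)

text \<open>The Poincare inequality mode by mode, because \<open>\<bar>k\<bar> \<ge> 1\<close> on
  the modes that remain. Summed up, it turns dissipation of second-order norms into exponential
  decay.\<close>

lemma wmod_mono: "c 0 = 0 \<Longrightarrow> p \<le> q \<Longrightarrow> wmod p c k \<le> wmod q c k"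
  unfolding wmod_def
  by (cases "k = 0") (auto intro!: mult_right_mono power_increasing)

lemma wsummable_mono: "c 0 = 0 \<Longrightarrow> p \<le> q \<Longrightarrow> wsummable q c \<Longrightarrow> wsummable p c"
  by (rule summable_on_comparison_test[of "wmod q c"]) (auto intro: wmod_mono)

lemma ssummable_mono: "c 0 = 0 \<Longrightarrow> p \<le> q \<Longrightarrow> ssummable q c \<Longrightarrow> ssummable p c"
  by (rule summable_on_comparison_test[of "\<lambda>k. (wmod q c k)\<^sup>2"]) (auto intro: power_mono wmod_mono)

lemma wsummable_imp_ssummable: "wsummable p c \<Longrightarrow> ssummable p c"
  by (rule summable_on_square) auto

lemma wnorm_nonneg [simp]: "0 \<le> wnorm p c"
  by (simp add: wnorm_def infsum_nonneg)

lemma snorm_nonneg [simp]: "0 \<le> snorm p c"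
  by (simp add: snorm_def infsum_nonneg)

section \<open>Bounds for the bilinear term by second-order norms\<close>

lemma bil_bound:
  assumes "u 0 = 0" "v 0 = 0" "wsummable 2 u" "wsummable 2 v"
  shows "cmod (bil u v k) \<le> 3/2 * conv (wmod 0 u) (wmod 2 v) k + 1/2 * conv (wmod 2 u) (wmod 0 v) k"
proof -
  have s: "wsummable 0 u" "wsummable 0 v" "wsummable 1 u" "wsummable 1 v"
    using assms by (auto intro: wsummable_mono[where q=2])
  have "cmod (bil u v k) = cmod (\<Sum>\<^sub>\<infinity>l. of_int k * (u (k - l) * (of_int l * v l)))"
    by (simp add: bil_def wprod_def norm_mult infsum_cmult_right')
  also have "\<dots> \<le> (\<Sum>\<^sub>\<infinity>l. 3/2 * (wmod 0 u (k - l) * wmod 2 v l) + 1/2 * (wmod 2 u (k - l) * wmod 0 v l))"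
  proof (rule norm_infsum_le)
    have "(\<lambda>l. cmod (of_int k * (u (k - l) * (of_int l * v l)))) summable_on UNIV"
    proof -
      have "(\<lambda>l. \<bar>of_int k\<bar> * (wmod 0 u (k - l) * wmod 1 v l)) summable_on UNIV"
        by (intro summable_on_cmult_right conv_summable s) auto
      then show ?thesis by (simp add: wmod_def norm_mult mult_ac)
    qed
    then show "((\<lambda>l. of_int k * (u (k - l) * (of_int l * v l))) has_sum
        (\<Sum>\<^sub>\<infinity>l. of_int k * (u (k - l) * (of_int l * v l)))) UNIV"
      by (intro has_sum_infsum) (rule abs_summable_summable)
    show "((\<lambda>l. 3/2 * (wmod 0 u (k - l) * wmod 2 v l) + 1/2 * (wmod 2 u (k - l) * wmod 0 v l)) has_sum
      (\<Sum>\<^sub>\<infinity>l. 3/2 * (wmod 0 u (k - l) * wmod 2 v l) + 1/2 * (wmod 2 u (k - l) * wmod 0 v l))) UNIV"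
      by (intro has_sum_infsum summable_on_add summable_on_cmult_right conv_summable s assms) auto
    fix l
    define m where "m = k - l"
    have "\<bar>real_of_int k\<bar> * \<bar>real_of_int l\<bar> \<le> 3/2 * \<bar>real_of_int l\<bar>^2 + 1/2 * \<bar>real_of_int m\<bar>^2"
    proof -
      have "\<bar>real_of_int k\<bar> \<le> \<bar>real_of_int m\<bar> + \<bar>real_of_int l\<bar>" unfolding m_def by simp
      then have "\<bar>real_of_int k\<bar> * \<bar>real_of_int l\<bar> \<le> (\<bar>real_of_int m\<bar> + \<bar>real_of_int l\<bar>) * \<bar>real_of_int l\<bar>"
        by (rule mult_right_mono) simp
      moreover have "0 \<le> (\<bar>real_of_int m\<bar> - \<bar>real_of_int l\<bar>)^2" by simp
      ultimately show ?thesis by (simp only: power2_eq_square algebra_simps)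
    qed
    then have "(\<bar>real_of_int k\<bar> * \<bar>real_of_int l\<bar>) * (cmod (u m) * cmod (v l)) \<le>
        (3/2 * \<bar>real_of_int l\<bar>^2 + 1/2 * \<bar>real_of_int m\<bar>^2) * (cmod (u m) * cmod (v l))"
      by (rule mult_right_mono) simp
    then show "cmod (of_int k * (u (k - l) * (of_int l * v l)))
      \<le> 3/2 * (wmod 0 u (k - l) * wmod 2 v l) + 1/2 * (wmod 2 u (k - l) * wmod 0 v l)"
      unfolding m_def[symmetric] by (simp add: wmod_def norm_mult algebra_simps)
  qed
  also have "\<dots> = (\<Sum>\<^sub>\<infinity>l. 3/2 * (wmod 0 u (k - l) * wmod 2 v l)) + (\<Sum>\<^sub>\<infinity>l. 1/2 * (wmod 2 u (k - l) * wmod 0 v l))"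
    by (intro infsum_add summable_on_cmult_right conv_summable s assms) auto
  also have "\<dots> = 3/2 * conv (wmod 0 u) (wmod 2 v) k + 1/2 * conv (wmod 2 u) (wmod 0 v) k"
    unfolding conv_def infsum_cmult_right' ..
  finally show ?thesis .
qed

lemma sum_bil_le:
  assumes "u 0 = 0" "v 0 = 0" "wsummable 2 u" "wsummable 2 v" "finite K"
  shows "(\<Sum>k\<in>K. cmod (bil u v k)) \<le> 3/2 * wnorm 0 u * wnorm 2 v + 1/2 * wnorm 2 u * wnorm 0 v"
proof -
  have s: "wsummable 0 u" "wsummable 0 v" using assms by (auto intro: wsummable_mono[where q=2])
  have "(\<Sum>k\<in>K. cmod (bil u v k)) \<le> (\<Sum>k\<in>K. 3/2 * conv (wmod 0 u) (wmod 2 v) k + 1/2 * conv (wmod 2 u) (wmod 0 v) k)"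
    by (intro sum_mono bil_bound assms)
  also have "\<dots> = 3/2 * (\<Sum>k\<in>K. conv (wmod 0 u) (wmod 2 v) k) + 1/2 * (\<Sum>k\<in>K. conv (wmod 2 u) (wmod 0 v) k)"
    by (simp add: sum.distrib sum_distrib_left)
  also have "\<dots> \<le> 3/2 * (wnorm 0 u * wnorm 2 v) + 1/2 * (wnorm 2 u * wnorm 0 v)"
    unfolding wnorm_def by (intro add_mono mult_left_mono sum_conv_le s assms) auto
  finally show ?thesis by simp
qed

text \<open>The weight enters only through its square sum; in the energy estimate \<open>w\<close>
  is \<open>wmod 2 u\<close>, so that sum is again the dissipated norm. The second convolution is
  commuted so that the factor measured in l^1 comes first in both terms. The constants 3/4 and 1/4
  are those of \<open>bil_bound\<close>, halved by the duality estimate.\<close>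

lemma sum_bil_weighted_le:
  assumes "u 0 = 0" "v 0 = 0" "wsummable 2 u" "wsummable 2 v" "finite K" "\<And>k. 0 \<le> w k"
  shows "(\<Sum>k\<in>K. w k * cmod (bil u v k)) \<le>
    3/4 * wnorm 0 u * ((\<Sum>k\<in>K. (w k)\<^sup>2) + snorm 2 v) + 1/4 * wnorm 0 v * ((\<Sum>k\<in>K. (w k)\<^sup>2) + snorm 2 u)"
proof -
  have s: "wsummable 0 u" "wsummable 0 v" using assms by (auto intro: wsummable_mono[where q=2])
  have "(\<Sum>k\<in>K. w k * cmod (bil u v k)) \<le> (\<Sum>k\<in>K. w k * (3/2 * conv (wmod 0 u) (wmod 2 v) k + 1/2 * conv (wmod 0 v) (wmod 2 u) k))"
    by (intro sum_mono mult_left_mono) (use bil_bound conv_commute assms in metis, use assms in auto)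
  also have "\<dots> = 3/2 * (\<Sum>k\<in>K. w k * conv (wmod 0 u) (wmod 2 v) k) + 1/2 * (\<Sum>k\<in>K. w k * conv (wmod 0 v) (wmod 2 u) k)"
    by (simp add: sum.distrib sum_distrib_left algebra_simps)
  also have "\<dots> \<le> 3/2 * (wnorm 0 u * ((\<Sum>k\<in>K. (w k)\<^sup>2) + snorm 2 v) / 2) + 1/2 * (wnorm 0 v * ((\<Sum>k\<in>K. (w k)\<^sup>2) + snorm 2 u) / 2)"
    unfolding wnorm_def snorm_def by (intro add_mono mult_left_mono sum_mult_conv_le s assms) auto
  finally show ?thesis by simp
qed

lemma square_add_le: "(x + y)\<^sup>2 \<le> 2 * x\<^sup>2 + 2 * y\<^sup>2" for x y :: real
  using zero_le_power2[of "x - y"] by (simp add: power2_sum power2_diff)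

text \<open>Controls the quadratic error of an Euler step and later the square integrability of the
  velocity. The constants are twice the squares of 3/2 and 1/2.\<close>

lemma sum_bil_square_le:
  assumes "u 0 = 0" "v 0 = 0" "wsummable 2 u" "wsummable 2 v" "finite K"
  shows "(\<Sum>k\<in>K. (cmod (bil u v k))\<^sup>2) \<le> 9/2 * (wnorm 0 u)\<^sup>2 * snorm 2 v + 1/2 * (wnorm 0 v)\<^sup>2 * snorm 2 u"
proof -
  have s: "wsummable 0 u" "wsummable 0 v" using assms by (auto intro: wsummable_mono[where q=2])
  have "(cmod (bil u v k))\<^sup>2 \<le> 9/2 * (conv (wmod 0 u) (wmod 2 v) k)\<^sup>2 + 1/2 * (conv (wmod 0 v) (wmod 2 u) k)\<^sup>2" for k
  proof -
    have "(cmod (bil u v k))\<^sup>2 \<le> (3/2 * conv (wmod 0 u) (wmod 2 v) k + 1/2 * conv (wmod 0 v) (wmod 2 u) k)\<^sup>2"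
      using bil_bound[OF assms(1-4), of k] conv_commute by (intro power_mono) (metis, simp)
    also have "\<dots> \<le> 2 * (3/2 * conv (wmod 0 u) (wmod 2 v) k)\<^sup>2 + 2 * (1/2 * conv (wmod 0 v) (wmod 2 u) k)\<^sup>2"
      by (rule square_add_le)
    finally show ?thesis by (simp add: power_mult_distrib power_divide)
  qed
  then have "(\<Sum>k\<in>K. (cmod (bil u v k))\<^sup>2) \<le> (\<Sum>k\<in>K. 9/2 * (conv (wmod 0 u) (wmod 2 v) k)\<^sup>2 + 1/2 * (conv (wmod 0 v) (wmod 2 u) k)\<^sup>2)"
    by (intro sum_mono)
  also have "\<dots> = 9/2 * (\<Sum>k\<in>K. (conv (wmod 0 u) (wmod 2 v) k)\<^sup>2) + 1/2 * (\<Sum>k\<in>K. (conv (wmod 0 v) (wmod 2 u) k)\<^sup>2)"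
    by (simp add: sum.distrib sum_distrib_left)
  also have "\<dots> \<le> 9/2 * ((wnorm 0 u)\<^sup>2 * snorm 2 v) + 1/2 * ((wnorm 0 v)\<^sup>2 * snorm 2 u)"
    unfolding wnorm_def snorm_def by (intro add_mono mult_left_mono sum_conv_square_le s assms) auto
  finally show ?thesis by simp
qed

section \<open>The truncated Euler scheme\<close>

text \<open>Coefficients of a real function of mean zero. The condition at 0 is built in because
  every comparison between weights of different order relies on it.\<close>

definition hermitian :: "(int \<Rightarrow> complex) \<Rightarrow> bool" where
  "hermitian c \<longleftrightarrow> c 0 = 0 \<and> (\<forall>k. c (- k) = cnj (c k))"

definition band :: "nat \<Rightarrow> int set" where
  "band n = {- int n..int n}"

lemma finite_band [simp]: "finite (band n)" by (simp add: band_def)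

lemma mem_band: "k \<in> band n \<longleftrightarrow> \<bar>k\<bar> \<le> int n" by (auto simp: band_def)

lemma band_abs_le: "k \<in> band n \<Longrightarrow> \<bar>real_of_int k\<bar> \<le> real n"
  using of_int_le_iff[of "\<bar>k\<bar>" "int n", where 'a=real] by (simp add: mem_band)

definition trig_poly :: "nat \<Rightarrow> (int \<Rightarrow> complex) \<Rightarrow> bool" where
  "trig_poly n c \<longleftrightarrow> hermitian c \<and> (\<forall>k. k \<notin> band n \<longrightarrow> c k = 0)"

lemma hermitian_minus: "hermitian c \<Longrightarrow> c (- k) = cnj (c k)" by (simp add: hermitian_def)
lemma hermitian_zero: "hermitian c \<Longrightarrow> c 0 = 0" by (simp add: hermitian_def)

lemma trig_poly_zero: "trig_poly n c \<Longrightarrow> c 0 = 0" by (simp add: trig_poly_def hermitian_def)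

lemma trig_poly_wsummable: "trig_poly n c \<Longrightarrow> wsummable p c"
  by (rule finite_nonzero_values_imp_summable_on)
    (rule finite_subset[OF _ finite_band[of n]], auto simp: trig_poly_def wmod_def)

lemma trig_poly_ssummable: "trig_poly n c \<Longrightarrow> ssummable p c"
  by (intro wsummable_imp_ssummable trig_poly_wsummable)

lemma trig_poly_wnorm: "trig_poly n c \<Longrightarrow> wnorm p c = (\<Sum>k\<in>band n. wmod p c k)"
  unfolding wnorm_def
  by (subst infsum_cong_neutral[of "band n" _ _ "wmod p c"]) (auto simp: trig_poly_def wmod_def)

lemma trig_poly_snorm: "trig_poly n c \<Longrightarrow> snorm p c = (\<Sum>k\<in>band n. (wmod p c k)\<^sup>2)"
  unfolding snorm_def
  by (subst infsum_cong_neutral[of "band n" _ _ "\<lambda>k. (wmod p c k)\<^sup>2"]) (auto simp: trig_poly_def wmod_def)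

text \<open>Reflecting the summation index conjugates every summand up to the sign of the factor
  \<open>l\<close>; the outer factor \<open>k\<close> changes sign as well and compensates. This
  keeps the scheme within real functions.\<close>

lemma bil_minus:
  assumes "hermitian u" "hermitian v"
  shows "bil u v (- k) = cnj (bil u v k)"
proof -
  have "wprod u v (- k) = (\<Sum>\<^sub>\<infinity>l. u (- k + l) * (of_int (- l) * v (- l)))"
    unfolding wprod_def
    by (rule infsum_reindex_bij_witness[where i="\<lambda>l. - l" and j="\<lambda>l. - l"]) auto
  also have "\<dots> = (\<Sum>\<^sub>\<infinity>l. - cnj (u (k - l) * (of_int l * v l)))"
  proof (rule infsum_cong)
    fix l
    have "u (- k + l) = cnj (u (k - l))" using hermitian_minus[OF assms(1), of "k - l"] by simp
    then show "u (- k + l) * (of_int (- l) * v (- l)) = - cnj (u (k - l) * (of_int l * v l))"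
      using assms(2) by (simp add: hermitian_minus)
  qed
  also have "\<dots> = - cnj (wprod u v k)" by (simp add: infsum_uminus wprod_def flip: infsum_cnj)
  finally show ?thesis by (simp add: bil_def)
qed

lemma bil_zero [simp]: "bil u v 0 = 0" by (simp add: bil_def)

text \<open>\<open>br\<close>, \<open>b\<close>, \<open>bm\<close> stand for the coefficients of the
  system and \<open>F\<close>, \<open>G\<close> for the mean heights. \<open>E\<close> is the level
  below which the Wiener norm stays; it will be the Wiener energy of the datum.\<close>

locale film =
  fixes br b bm F G E :: real
  assumes pos: "br > 0" "b > 0" "bm > 0" "E \<ge> 0" "E < F" "E < G"
    and sig1: "F * br - G * bm - E * (2 * br + 2 * b + 4 * bm) > 0"
    and sig2: "G * bm - F * b - E * (2 * br + 2 * b + 4 * bm) > 0"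
    and enough: "G * bm - 1/2 * (G * bm + F * b) - (br + bm + 5 * bm / 2 + 5 * b / 2) * E > 0"
begin

text \<open>The net damping of \<open>wnorm 2 f\<close> and of \<open>wnorm 2 g\<close> once the
  Wiener estimates of both equations are added: the diagonal coefficient of the unknown, minus the
  coupling that feeds it into the other equation, minus the quadratic terms at level
  \<open>E\<close>.\<close>

definition "sig = min (F * br - G * bm - E * (2 * br + 2 * b + 4 * bm)) (G * bm - F * b - E * (2 * br + 2 * b + 4 * bm))"

text \<open>The counterpart of \<open>sig\<close> for squares. Each coupling term, with coefficient
  \<open>F * b\<close> or \<open>G * bm\<close>, is split by the arithmetic-geometric mean
  inequality, so half of each coefficient is charged to either unknown.\<close>

definition "kap = min (F * br - 1/2 * (G * bm + F * b) - E * (2 * br + b + bm)) (G * bm - 1/2 * (G * bm + F * b) - E * (b + 3 * bm))"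

text \<open>The right-hand side of the equation for f on Fourier coefficients. The mean height
  yields the diagonal second-order part, the fluctuation the bilinear part.\<close>

definition Vf :: "(int \<Rightarrow> complex) \<Rightarrow> (int \<Rightarrow> complex) \<Rightarrow> int \<Rightarrow> complex" where
  "Vf f g k = - of_real (\<bar>of_int k\<bar>\<^sup>2 * F * br) * f k - of_real (\<bar>of_int k\<bar>\<^sup>2 * F * b) * g k
     + of_real br * bil f f k + of_real b * bil f g k"

definition Vg :: "(int \<Rightarrow> complex) \<Rightarrow> (int \<Rightarrow> complex) \<Rightarrow> int \<Rightarrow> complex" where
  "Vg f g k = - of_real (\<bar>of_int k\<bar>\<^sup>2 * G * bm) * g k - of_real (\<bar>of_int k\<bar>\<^sup>2 * G * bm) * f k
     + of_real bm * bil g g k + of_real bm * bil g f k"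

lemma FG_pos: "F > 0" "G > 0" using pos by auto

lemma sig_pos: "sig > 0" using sig1 sig2 by (simp add: sig_def)

text \<open>The first argument of the minimum is at least the sum of the expression in
  \<open>sig1\<close> and half of that in \<open>sig2\<close>; the second is at least the expression
  in \<open>enough\<close>.\<close>

lemma kap_pos: "kap > 0"
proof -
  have e: "0 \<le> E * br" "0 \<le> E * b" "0 \<le> E * bm" using pos by auto
  have "F * br - 1/2 * (G * bm + F * b) - E * (2 * br + b + bm) > 0"
    using sig1 sig2 e by (simp add: algebra_simps)
  moreover have "G * bm - 1/2 * (G * bm + F * b) - E * (b + 3 * bm) > 0"
    using enough e by (simp add: algebra_simps)
  ultimately show ?thesis by (simp add: kap_def)
qed

lemma V_zero [simp]: "Vf f g 0 = 0" "Vg f g 0 = 0"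
  by (auto simp: Vf_def Vg_def)

lemma V_minus:
  assumes "hermitian f" "hermitian g"
  shows "Vf f g (- k) = cnj (Vf f g k)" "Vg f g (- k) = cnj (Vg f g k)"
  using assms by (simp_all add: Vf_def Vg_def bil_minus hermitian_minus)

section \<open>One Euler step in the Wiener norm\<close>

definition step :: "nat \<Rightarrow> real \<Rightarrow> ((int \<Rightarrow> complex) \<Rightarrow> (int \<Rightarrow> complex) \<Rightarrow> int \<Rightarrow> complex) \<Rightarrow> (int \<Rightarrow> complex) \<Rightarrow>
    (int \<Rightarrow> complex) \<Rightarrow> (int \<Rightarrow> complex) \<Rightarrow> int \<Rightarrow> complex" where
  "step n \<tau> V u f g k = (if k \<in> band n then u k + of_real \<tau> * V f g k else 0)"

lemma step_trig_poly:
  assumes "trig_poly n f" "trig_poly n g"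
  shows "trig_poly n (step n \<tau> Vf f f g)" "trig_poly n (step n \<tau> Vg g f g)"
  using assms V_minus[of f g]
  unfolding trig_poly_def step_def hermitian_def by (auto simp: mem_band)

text \<open>Under \<open>\<tau> * lam \<le> 1\<close> the factor \<open>1 - \<tau> * lam\<close> is
  nonnegative, so taking moduli loses nothing on the diagonal term and the damping keeps its sign.
  All other terms are estimated by their moduli.\<close>

lemma euler_mode:
  fixes u v P Q :: complex
  assumes "0 \<le> \<tau>" "0 \<le> lam" "0 \<le> mu" "\<tau> * lam \<le> 1" "0 \<le> p" "0 \<le> q"
  shows "cmod (u + of_real \<tau> * (- of_real lam * u - of_real mu * v + of_real p * P + of_real q * Q))
    \<le> cmod u - \<tau> * (lam * cmod u) + \<tau> * (mu * cmod v) + \<tau> * (p * cmod P + q * cmod Q)"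
proof -
  have "u + of_real \<tau> * (- of_real lam * u - of_real mu * v + of_real p * P + of_real q * Q)
     = of_real (1 - \<tau> * lam) * u + (- of_real (\<tau> * mu) * v + (of_real (\<tau> * p) * P + of_real (\<tau> * q) * Q))"
    by (simp add: algebra_simps)
  also have "cmod \<dots> \<le> cmod (of_real (1 - \<tau> * lam) * u) + (cmod (- of_real (\<tau> * mu) * v) +
     (cmod (of_real (\<tau> * p) * P) + cmod (of_real (\<tau> * q) * Q)))"
    by (meson add_left_mono norm_triangle_ineq order_trans)
  also have "\<dots> = (1 - \<tau> * lam) * cmod u + (\<tau> * mu * cmod v + (\<tau> * p * cmod P + \<tau> * q * cmod Q))"
    using assms unfolding norm_mult norm_of_real norm_minus_cancel by (simp add: norm_mult abs_of_nonneg)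
  finally show ?thesis by (simp add: algebra_simps)
qed

lemma wiener_step:
  assumes "trig_poly n f" "trig_poly n g" "wnorm 0 f + wnorm 0 g \<le> E"
    and tau: "0 \<le> \<tau>" "\<tau> * (real n)\<^sup>2 * (F * br) \<le> 1" "\<tau> * (real n)\<^sup>2 * (G * bm) \<le> 1"
  shows "wnorm 0 (step n \<tau> Vf f f g) + wnorm 0 (step n \<tau> Vg g f g) + \<tau> * sig * (wnorm 2 f + wnorm 2 g)
    \<le> wnorm 0 f + wnorm 0 g"
proof -
  define A D X Y where "A = wnorm 0 f" "D = wnorm 0 g" "X = wnorm 2 f" "Y = wnorm 2 g"
  note nn = wnorm_nonneg[of 0 f, folded A_D_X_Y_def] wnorm_nonneg[of 0 g, folded A_D_X_Y_def]
    wnorm_nonneg[of 2 f, folded A_D_X_Y_def] wnorm_nonneg[of 2 g, folded A_D_X_Y_def]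
  have AD: "A + D \<le> E" using assms(3) by (simp add: A_D_X_Y_def)
  note z = trig_poly_zero[OF assms(1)] trig_poly_zero[OF assms(2)]
  note ws = trig_poly_wsummable[OF assms(1), of 2] trig_poly_wsummable[OF assms(2), of 2]
  have k2: "\<bar>real_of_int k\<bar>\<^sup>2 \<le> (real n)\<^sup>2" if "k \<in> band n" for k
    using band_abs_le[OF that] by (intro power_mono) auto
  have cfl: "\<tau> * (\<bar>of_int k\<bar>\<^sup>2 * F * br) \<le> 1" "\<tau> * (\<bar>of_int k\<bar>\<^sup>2 * G * bm) \<le> 1" if "k \<in> band n" for k
  proof -
    have "\<tau> * \<bar>of_int k\<bar>\<^sup>2 \<le> \<tau> * (real n)\<^sup>2" using k2[OF that] tau(1) by (intro mult_left_mono)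
    then have "(\<tau> * \<bar>of_int k\<bar>\<^sup>2) * (F * br) \<le> \<tau> * (real n)\<^sup>2 * (F * br)"
      "(\<tau> * \<bar>of_int k\<bar>\<^sup>2) * (G * bm) \<le> \<tau> * (real n)\<^sup>2 * (G * bm)"
      using pos FG_pos by (auto intro!: mult_right_mono)
    with tau show "\<tau> * (\<bar>of_int k\<bar>\<^sup>2 * F * br) \<le> 1" "\<tau> * (\<bar>of_int k\<bar>\<^sup>2 * G * bm) \<le> 1"
      by (simp_all add: mult.assoc)
  qed
  have "wnorm 0 (step n \<tau> Vf f f g) = (\<Sum>k\<in>band n. cmod (f k + of_real \<tau> * Vf f g k))"
    unfolding trig_poly_wnorm[OF step_trig_poly(1)[OF assms(1,2)]] by (simp add: wmod_def step_def)
  also have "\<dots> \<le> (\<Sum>k\<in>band n. wmod 0 f k - \<tau> * (F * br * wmod 2 f k) + \<tau> * (F * b * wmod 2 g k)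
      + \<tau> * (br * cmod (bil f f k) + b * cmod (bil f g k)))"
  proof (rule sum_mono)
    fix k assume k: "k \<in> band n"
    show "cmod (f k + of_real \<tau> * Vf f g k) \<le> wmod 0 f k - \<tau> * (F * br * wmod 2 f k) + \<tau> * (F * b * wmod 2 g k)
      + \<tau> * (br * cmod (bil f f k) + b * cmod (bil f g k))"
      using euler_mode[of \<tau> "\<bar>of_int k\<bar>\<^sup>2 * F * br" "\<bar>of_int k\<bar>\<^sup>2 * F * b" br b "f k" "g k" "bil f f k" "bil f g k"]
        cfl[OF k] tau(1) pos FG_pos
      by (simp add: Vf_def wmod_def mult_ac)
  qed
  also have "\<dots> = A - \<tau> * (F * br * X) + \<tau> * (F * b * Y)
      + \<tau> * (br * (\<Sum>k\<in>band n. cmod (bil f f k)) + b * (\<Sum>k\<in>band n. cmod (bil f g k)))"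
    unfolding A_D_X_Y_def trig_poly_wnorm[OF assms(1)] trig_poly_wnorm[OF assms(2)]
    by (simp only: sum.distrib sum_subtractf sum_distrib_left[symmetric])
  also have "\<dots> \<le> A - \<tau> * (F * br * X) + \<tau> * (F * b * Y)
      + \<tau> * (br * (3/2 * A * X + 1/2 * X * A) + b * (3/2 * A * Y + 1/2 * X * D))"
    unfolding A_D_X_Y_def using pos tau(1)
    by (intro add_mono mult_left_mono sum_bil_le z ws order_refl) auto
  finally have 1: "wnorm 0 (step n \<tau> Vf f f g) \<le> A - \<tau> * (F * br * X) + \<tau> * (F * b * Y)
      + \<tau> * (br * (3/2 * A * X + 1/2 * X * A) + b * (3/2 * A * Y + 1/2 * X * D))" .
  have "wnorm 0 (step n \<tau> Vg g f g) = (\<Sum>k\<in>band n. cmod (g k + of_real \<tau> * Vg f g k))"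
    unfolding trig_poly_wnorm[OF step_trig_poly(2)[OF assms(1,2)]] by (simp add: wmod_def step_def)
  also have "\<dots> \<le> (\<Sum>k\<in>band n. wmod 0 g k - \<tau> * (G * bm * wmod 2 g k) + \<tau> * (G * bm * wmod 2 f k)
      + \<tau> * (bm * cmod (bil g g k) + bm * cmod (bil g f k)))"
  proof (rule sum_mono)
    fix k assume k: "k \<in> band n"
    show "cmod (g k + of_real \<tau> * Vg f g k) \<le> wmod 0 g k - \<tau> * (G * bm * wmod 2 g k) + \<tau> * (G * bm * wmod 2 f k)
      + \<tau> * (bm * cmod (bil g g k) + bm * cmod (bil g f k))"
      using euler_mode[of \<tau> "\<bar>of_int k\<bar>\<^sup>2 * G * bm" "\<bar>of_int k\<bar>\<^sup>2 * G * bm" bm bm "g k" "f k" "bil g g k" "bil g f k"]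
        cfl[OF k] tau(1) pos FG_pos
      by (simp add: Vg_def wmod_def mult_ac)
  qed
  also have "\<dots> = D - \<tau> * (G * bm * Y) + \<tau> * (G * bm * X)
      + \<tau> * (bm * (\<Sum>k\<in>band n. cmod (bil g g k)) + bm * (\<Sum>k\<in>band n. cmod (bil g f k)))"
    unfolding A_D_X_Y_def trig_poly_wnorm[OF assms(1)] trig_poly_wnorm[OF assms(2)]
    by (simp only: sum.distrib sum_subtractf sum_distrib_left[symmetric])
  also have "\<dots> \<le> D - \<tau> * (G * bm * Y) + \<tau> * (G * bm * X)
      + \<tau> * (bm * (3/2 * D * Y + 1/2 * Y * D) + bm * (3/2 * D * X + 1/2 * Y * A))"
    unfolding A_D_X_Y_def using pos tau(1)
    by (intro add_mono mult_left_mono sum_bil_le z ws order_refl) auto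
  finally have 2: "wnorm 0 (step n \<tau> Vg g f g) \<le> D - \<tau> * (G * bm * Y) + \<tau> * (G * bm * X)
      + \<tau> * (bm * (3/2 * D * Y + 1/2 * Y * D) + bm * (3/2 * D * X + 1/2 * Y * A))" .
  have e: "br * A \<le> br * E" "b * D \<le> b * E" "b * A \<le> b * E" "bm * D \<le> bm * E" "bm * A \<le> bm * E"
    "0 \<le> br * E" "0 \<le> b * E" "0 \<le> bm * E"
    using AD nn pos by (auto intro!: mult_left_mono)
  have "sig \<le> F * br - G * bm - E * (2 * br + 2 * b + 4 * bm)"
    "sig \<le> G * bm - F * b - E * (2 * br + 2 * b + 4 * bm)" by (auto simp: sig_def)
  \<comment> \<open>The coefficients of \<open>X\<close> collected from both equations:
    \<open>2 * br * A\<close> and \<open>1/2 * b * D\<close> come from the one for f,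
    \<open>3/2 * bm * D\<close> from the one for g. Those of \<open>Y\<close> arise in the same
    way.\<close>
  then have "sig + 2 * br * A + 1/2 * b * D + 3/2 * bm * D \<le> F * br - G * bm"
    "sig + 3/2 * b * A + 2 * bm * D + 1/2 * bm * A \<le> G * bm - F * b"
    using e by (simp_all add: algebra_simps)
  then have "(sig + 2 * br * A + 1/2 * b * D + 3/2 * bm * D) * X \<le> (F * br - G * bm) * X"
    "(sig + 3/2 * b * A + 2 * bm * D + 1/2 * bm * A) * Y \<le> (G * bm - F * b) * Y"
    using nn by (auto intro!: mult_right_mono)
  then have "\<tau> * ((sig + 2 * br * A + 1/2 * b * D + 3/2 * bm * D) * X +
      (sig + 3/2 * b * A + 2 * bm * D + 1/2 * bm * A) * Y) \<le>
      \<tau> * ((F * br - G * bm) * X + (G * bm - F * b) * Y)"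
    using tau(1) by (intro mult_left_mono add_mono) auto
  with 1 2 show ?thesis unfolding A_D_X_Y_def[symmetric] by (simp add: algebra_simps)
qed

end

section \<open>One Euler step in the H^1 energy\<close>

context film begin

text \<open>Bounds the square sum of the velocity by the squared second-order norms, with one
  summand per equation. The factor 4 comes from squaring a sum of four terms, and 5 is 9/2 + 1/2
  from \<open>sum_bil_square_le\<close>.\<close>

definition "VK = 4 * ((F * br)\<^sup>2 + (F * b)\<^sup>2 + 5 * (br * E)\<^sup>2 + 5 * (b * E)\<^sup>2)
  + 4 * ((G * bm)\<^sup>2 + (G * bm)\<^sup>2 + 5 * (bm * E)\<^sup>2 + 5 * (bm * E)\<^sup>2)"

lemma mode_square:
  fixes u v P Q :: complex
  shows "(cmod (- of_real lam * u - of_real mu * v + of_real p * P + of_real q * Q))\<^sup>2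
    \<le> 4 * (lam\<^sup>2 * (cmod u)\<^sup>2 + mu\<^sup>2 * (cmod v)\<^sup>2 + p\<^sup>2 * (cmod P)\<^sup>2 + q\<^sup>2 * (cmod Q)\<^sup>2)"
proof -
  have tri: "(cmod (x + y))\<^sup>2 \<le> 2 * (cmod x)\<^sup>2 + 2 * (cmod y)\<^sup>2" for x y :: complex
    by (meson norm_ge_zero norm_triangle_ineq order_trans power_mono square_add_le)
  have "(cmod ((- of_real lam * u + - of_real mu * v) + (of_real p * P + of_real q * Q)))\<^sup>2
     \<le> 2 * (2 * (cmod (- of_real lam * u))\<^sup>2 + 2 * (cmod (- of_real mu * v))\<^sup>2)
      + 2 * (2 * (cmod (of_real p * P))\<^sup>2 + 2 * (cmod (of_real q * Q))\<^sup>2)"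
    by (rule order_trans[OF tri], intro add_mono mult_left_mono tri) auto
  then show ?thesis by (simp add: norm_mult power_mult_distrib add.assoc)
qed

lemma VK_row:
  fixes n :: nat
  assumes z: "u 0 = 0" "v 0 = 0" and ws: "wsummable 2 u" "wsummable 2 v"
    and small: "wnorm 0 u + wnorm 0 v \<le> E" and "p \<ge> 0" "q \<ge> 0" "lam \<ge> 0" "mu \<ge> 0"
  shows "(\<Sum>k\<in>band n. (cmod (- of_real (\<bar>of_int k\<bar>\<^sup>2 * lam) * u k - of_real (\<bar>of_int k\<bar>\<^sup>2 * mu) * v k
      + of_real p * bil u u k + of_real q * bil u v k))\<^sup>2)
    \<le> 4 * (lam\<^sup>2 + mu\<^sup>2 + 5 * (p * E)\<^sup>2 + 5 * (q * E)\<^sup>2) * (snorm 2 u + snorm 2 v)"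
proof -
  define X Y where "X = snorm 2 u" "Y = snorm 2 v"
  have XY: "0 \<le> X" "0 \<le> Y" by (auto simp: X_Y_def)
  have XYs: "(\<Sum>k\<in>band n. (wmod 2 u k)\<^sup>2) \<le> X" "(\<Sum>k\<in>band n. (wmod 2 v k)\<^sup>2) \<le> Y"
    unfolding X_Y_def snorm_def by (intro finite_sum_le_infsum wsummable_imp_ssummable ws; simp)+
  have A: "(wnorm 0 u)\<^sup>2 \<le> E\<^sup>2" "(wnorm 0 v)\<^sup>2 \<le> E\<^sup>2"
    using small wnorm_nonneg[of 0 u] wnorm_nonneg[of 0 v] by (auto intro!: power_mono simp del: wnorm_nonneg)
  have bb: "(\<Sum>k\<in>band n. (cmod (bil u w k))\<^sup>2) \<le> 5 * E\<^sup>2 * (X + Y)" if "w = u \<or> w = v" for w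
  proof -
    have "(\<Sum>k\<in>band n. (cmod (bil u w k))\<^sup>2) \<le> 9/2 * (wnorm 0 u)\<^sup>2 * snorm 2 w + 1/2 * (wnorm 0 w)\<^sup>2 * snorm 2 u"
      by (rule sum_bil_square_le) (use that z ws in auto)
    also have "\<dots> \<le> 9/2 * E\<^sup>2 * (X + Y) + 1/2 * E\<^sup>2 * (X + Y)"
      using that A XY by (intro add_mono mult_mono) (auto simp: X_Y_def)
    finally show ?thesis by (simp add: field_simps)
  qed
  have "(\<Sum>k\<in>band n. (cmod (- of_real (\<bar>of_int k\<bar>\<^sup>2 * lam) * u k - of_real (\<bar>of_int k\<bar>\<^sup>2 * mu) * v k
      + of_real p * bil u u k + of_real q * bil u v k))\<^sup>2)
    \<le> (\<Sum>k\<in>band n. 4 * (lam\<^sup>2 * (wmod 2 u k)\<^sup>2 + mu\<^sup>2 * (wmod 2 v k)\<^sup>2 + p\<^sup>2 * (cmod (bil u u k))\<^sup>2 + q\<^sup>2 * (cmod (bil u v k))\<^sup>2))"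
    by (rule sum_mono, rule order_trans[OF mode_square]) (simp add: wmod_def power_mult_distrib mult_ac)
  also have "\<dots> = 4 * (lam\<^sup>2 * (\<Sum>k\<in>band n. (wmod 2 u k)\<^sup>2) + mu\<^sup>2 * (\<Sum>k\<in>band n. (wmod 2 v k)\<^sup>2)
      + p\<^sup>2 * (\<Sum>k\<in>band n. (cmod (bil u u k))\<^sup>2) + q\<^sup>2 * (\<Sum>k\<in>band n. (cmod (bil u v k))\<^sup>2))"
    by (simp add: sum.distrib sum_distrib_left algebra_simps)
  also have "\<dots> \<le> 4 * (lam\<^sup>2 * (X + Y) + mu\<^sup>2 * (X + Y) + p\<^sup>2 * (5 * E\<^sup>2 * (X + Y)) + q\<^sup>2 * (5 * E\<^sup>2 * (X + Y)))"
    using XY XYs by (intro mult_left_mono add_mono bb) auto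
  finally show ?thesis unfolding X_Y_def by (simp add: algebra_simps power_mult_distrib)
qed

lemma V_square_sum:
  assumes "f 0 = 0" "g 0 = 0" "wsummable 2 f" "wsummable 2 g" "wnorm 0 f + wnorm 0 g \<le> E"
  shows "(\<Sum>k\<in>band n. (cmod (Vf f g k))\<^sup>2) + (\<Sum>k\<in>band n. (cmod (Vg f g k))\<^sup>2) \<le> VK * (snorm 2 f + snorm 2 g)"
proof -
  have 1: "(\<Sum>k\<in>band n. (cmod (Vf f g k))\<^sup>2) \<le> 4 * ((F * br)\<^sup>2 + (F * b)\<^sup>2 + 5 * (br * E)\<^sup>2 + 5 * (b * E)\<^sup>2) * (snorm 2 f + snorm 2 g)"
    unfolding Vf_def mult.assoc[of _ F] by (rule VK_row) (use assms pos FG_pos in auto)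
  have 2: "(\<Sum>k\<in>band n. (cmod (Vg f g k))\<^sup>2) \<le> 4 * ((G * bm)\<^sup>2 + (G * bm)\<^sup>2 + 5 * (bm * E)\<^sup>2 + 5 * (bm * E)\<^sup>2) * (snorm 2 g + snorm 2 f)"
    unfolding Vg_def mult.assoc[of _ G] by (rule VK_row) (use assms pos FG_pos in auto)
  from 1 2 show ?thesis unfolding VK_def by (simp add: algebra_simps)
qed

lemma VK_nonneg: "VK \<ge> 0" by (simp add: VK_def)

text \<open>The left side is half the time derivative of \<open>(cmod u)\<^sup>2\<close> along the
  flow. Only the diagonal term keeps its sign.\<close>

lemma energy_mode:
  fixes u v P Q :: complex
  assumes "0 \<le> lam" "0 \<le> mu" "0 \<le> p" "0 \<le> q"
  shows "Re (cnj u * (- of_real lam * u - of_real mu * v + of_real p * P + of_real q * Q))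
    \<le> - lam * (cmod u)\<^sup>2 + mu * (cmod u * cmod v) + p * (cmod u * cmod P) + q * (cmod u * cmod Q)"
proof -
  have r: "Re (of_real c * (cnj u * z)) \<le> c * (cmod u * cmod z)" if "0 \<le> c" for c z
  proof -
    have "Re (of_real c * w) = c * Re w" for w by simp
    then show ?thesis
      using mult_left_mono[OF complex_Re_le_cmod[of "cnj u * z"] that] by (simp only: norm_mult complex_mod_cnj)
  qed
  have m: "Re (- (of_real mu * (cnj u * v))) \<le> mu * (cmod u * cmod v)"
    using r[of mu "- v"] assms by simp
  have sq: "Re (of_real lam * (cnj u * u)) = lam * (cmod u)\<^sup>2"
    by (simp add: complex_mult_cnj[symmetric] mult.commute[of "cnj u"] complex_norm_square[symmetric] flip: of_real_power)
  have "cnj u * (- of_real lam * u - of_real mu * v + of_real p * P + of_real q * Q) =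
     - (of_real lam * (cnj u * u)) + (- (of_real mu * (cnj u * v))) + of_real p * (cnj u * P) + of_real q * (cnj u * Q)"
    by (simp add: algebra_simps)
  also have "Re \<dots> \<le> - (lam * (cmod u)\<^sup>2) + mu * (cmod u * cmod v) + p * (cmod u * cmod P) + q * (cmod u * cmod Q)"
    unfolding plus_complex.sel uminus_complex.sel(1)[of "of_real lam * (cnj u * u)"] sq
    by (intro add_mono r m assms) auto
  finally show ?thesis by simp
qed

text \<open>The energy weight times the modulus of \<open>u k\<close> is \<open>wmod 2 u k\<close>,
  so the bilinear terms are paired with exactly the weight for which
  \<open>sum_bil_weighted_le\<close> returns the dissipated norm. In the case of
  \<open>bil u u\<close> the constants 3/4 and 1/4 each meet \<open>snorm 2 u\<close> twice, hence
  the factor 2.\<close>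

lemma energy_row:
  assumes "trig_poly n u" "trig_poly n v" "0 \<le> lam" "0 \<le> mu" "0 \<le> p" "0 \<le> q"
  shows "(\<Sum>k\<in>band n. \<bar>of_int k\<bar>\<^sup>2 * Re (cnj (u k) * (- of_real (\<bar>of_int k\<bar>\<^sup>2 * lam) * u k - of_real (\<bar>of_int k\<bar>\<^sup>2 * mu) * v k
      + of_real p * bil u u k + of_real q * bil u v k)))
    \<le> - lam * snorm 2 u + mu * ((snorm 2 u + snorm 2 v) / 2) + p * (2 * wnorm 0 u * snorm 2 u)
     + q * (3/4 * wnorm 0 u * (snorm 2 u + snorm 2 v) + 1/2 * wnorm 0 v * snorm 2 u)"
proof -
  note z = trig_poly_zero[OF assms(1)] trig_poly_zero[OF assms(2)]
  note ws = trig_poly_wsummable[OF assms(1), of 2] trig_poly_wsummable[OF assms(2), of 2]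
  have "(\<Sum>k\<in>band n. \<bar>of_int k\<bar>\<^sup>2 * Re (cnj (u k) * (- of_real (\<bar>of_int k\<bar>\<^sup>2 * lam) * u k - of_real (\<bar>of_int k\<bar>\<^sup>2 * mu) * v k
      + of_real p * bil u u k + of_real q * bil u v k)))
   \<le> (\<Sum>k\<in>band n. - lam * (wmod 2 u k)\<^sup>2 + mu * (((wmod 2 u k)\<^sup>2 + (wmod 2 v k)\<^sup>2) / 2) + p * (wmod 2 u k * cmod (bil u u k))
      + q * (wmod 2 u k * cmod (bil u v k)))"
  proof (rule sum_mono)
    fix k
    have "\<bar>of_int k\<bar>\<^sup>2 * Re (cnj (u k) * (- of_real (\<bar>of_int k\<bar>\<^sup>2 * lam) * u k - of_real (\<bar>of_int k\<bar>\<^sup>2 * mu) * v k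
        + of_real p * bil u u k + of_real q * bil u v k))
     \<le> \<bar>of_int k\<bar>\<^sup>2 * (- (\<bar>of_int k\<bar>\<^sup>2 * lam) * (cmod (u k))\<^sup>2 + (\<bar>of_int k\<bar>\<^sup>2 * mu) * (cmod (u k) * cmod (v k))
        + p * (cmod (u k) * cmod (bil u u k)) + q * (cmod (u k) * cmod (bil u v k)))"
      by (intro mult_left_mono energy_mode) (use assms in auto)
    also have "\<dots> = - lam * (wmod 2 u k)\<^sup>2 + mu * (wmod 2 u k * wmod 2 v k) + p * (wmod 2 u k * cmod (bil u u k))
      + q * (wmod 2 u k * cmod (bil u v k))"
      by (simp add: wmod_def algebra_simps power2_eq_square)
    also have "mu * (wmod 2 u k * wmod 2 v k) \<le> mu * (((wmod 2 u k)\<^sup>2 + (wmod 2 v k)\<^sup>2) / 2)"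
      using assms(4) sum_squares_bound[of "wmod 2 u k" "wmod 2 v k"] by (intro mult_left_mono) (auto simp: field_simps)
    finally show "\<bar>of_int k\<bar>\<^sup>2 * Re (cnj (u k) * (- of_real (\<bar>of_int k\<bar>\<^sup>2 * lam) * u k - of_real (\<bar>of_int k\<bar>\<^sup>2 * mu) * v k
        + of_real p * bil u u k + of_real q * bil u v k))
      \<le> - lam * (wmod 2 u k)\<^sup>2 + mu * (((wmod 2 u k)\<^sup>2 + (wmod 2 v k)\<^sup>2) / 2) + p * (wmod 2 u k * cmod (bil u u k))
      + q * (wmod 2 u k * cmod (bil u v k))" by simp
  qed
  also have "\<dots> = - lam * snorm 2 u + mu * ((snorm 2 u + snorm 2 v) / 2) + p * (\<Sum>k\<in>band n. wmod 2 u k * cmod (bil u u k))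
     + q * (\<Sum>k\<in>band n. wmod 2 u k * cmod (bil u v k))"
    unfolding trig_poly_snorm[OF assms(1)] trig_poly_snorm[OF assms(2)]
    by (simp only: sum.distrib sum_distrib_left[symmetric] sum_divide_distrib[symmetric])
  also have "\<dots> \<le> - lam * snorm 2 u + mu * ((snorm 2 u + snorm 2 v) / 2) + 
      p * (3/4 * wnorm 0 u * ((\<Sum>k\<in>band n. (wmod 2 u k)\<^sup>2) + snorm 2 u) + 1/4 * wnorm 0 u * ((\<Sum>k\<in>band n. (wmod 2 u k)\<^sup>2) + snorm 2 u))
     + q * (3/4 * wnorm 0 u * ((\<Sum>k\<in>band n. (wmod 2 u k)\<^sup>2) + snorm 2 v) + 1/4 * wnorm 0 v * ((\<Sum>k\<in>band n. (wmod 2 u k)\<^sup>2) + snorm 2 u))"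
    by (intro add_mono mult_left_mono sum_bil_weighted_le order_refl z ws assms) auto
  also have "\<dots> = - lam * snorm 2 u + mu * ((snorm 2 u + snorm 2 v) / 2) + p * (2 * wnorm 0 u * snorm 2 u)
     + q * (3/4 * wnorm 0 u * (snorm 2 u + snorm 2 v) + 1/2 * wnorm 0 v * snorm 2 u)"
    unfolding trig_poly_snorm[OF assms(1), of 2, symmetric] by (simp add: algebra_simps)
  finally show ?thesis .
qed

lemma dissipation:
  assumes "trig_poly n f" "trig_poly n g" "wnorm 0 f + wnorm 0 g \<le> E"
  shows "(\<Sum>k\<in>band n. \<bar>of_int k\<bar>\<^sup>2 * Re (cnj (f k) * Vf f g k)) + (\<Sum>k\<in>band n. \<bar>of_int k\<bar>\<^sup>2 * Re (cnj (g k) * Vg f g k))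
    \<le> - kap * (snorm 2 f + snorm 2 g)"
proof -
  define A D X Y where "A = wnorm 0 f" "D = wnorm 0 g" "X = snorm 2 f" "Y = snorm 2 g"
  have nn: "0 \<le> A" "0 \<le> D" "0 \<le> X" "0 \<le> Y" by (auto simp: A_D_X_Y_def)
  have AD: "A + D \<le> E" using assms(3) by (simp add: A_D_X_Y_def)
  have 1: "(\<Sum>k\<in>band n. \<bar>of_int k\<bar>\<^sup>2 * Re (cnj (f k) * Vf f g k)) \<le>
      - (F * br) * X + (F * b) * ((X + Y) / 2) + br * (2 * A * X) + b * (3/4 * A * (X + Y) + 1/2 * D * X)"
    unfolding Vf_def mult.assoc[of _ F] A_D_X_Y_def by (rule energy_row) (use assms pos FG_pos in auto)
  have 2: "(\<Sum>k\<in>band n. \<bar>of_int k\<bar>\<^sup>2 * Re (cnj (g k) * Vg f g k)) \<le>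
      - (G * bm) * Y + (G * bm) * ((Y + X) / 2) + bm * (2 * D * Y) + bm * (3/4 * D * (Y + X) + 1/2 * A * Y)"
    unfolding Vg_def mult.assoc[of _ G] A_D_X_Y_def by (rule energy_row) (use assms pos FG_pos in auto)
  \<comment> \<open>These are the roundings hidden in \<open>kap\<close>; for instance
    \<open>11/4 * D + 1/2 * A \<le> 3 * E\<close> accounts for the term
    \<open>3 * bm\<close>.\<close>
  have e: "br * A \<le> br * E" "b * (3/4 * A + 1/2 * D) \<le> b * E" "b * A \<le> b * E" "bm * D \<le> bm * E"
    "bm * (11/4 * D + 1/2 * A) \<le> bm * (3 * E)" "0 \<le> br * E" "0 \<le> b * E" "0 \<le> bm * E"
    using AD nn pos by (auto intro!: mult_left_mono)
  have "kap \<le> F * br - 1/2 * (G * bm + F * b) - E * (2 * br + b + bm)"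
    "kap \<le> G * bm - 1/2 * (G * bm + F * b) - E * (b + 3 * bm)" by (auto simp: kap_def)
  then have "kap + 2 * br * A + b * (3/4 * A + 1/2 * D) + 3/4 * bm * D \<le> F * br - 1/2 * (G * bm + F * b)"
    "kap + 3/4 * b * A + (2 + 3/4) * bm * D + 1/2 * bm * A \<le> G * bm - 1/2 * (G * bm + F * b)"
    using e by (simp_all add: algebra_simps)
  then have "(kap + 2 * br * A + b * (3/4 * A + 1/2 * D) + 3/4 * bm * D) * X \<le> (F * br - 1/2 * (G * bm + F * b)) * X"
    "(kap + 3/4 * b * A + (2 + 3/4) * bm * D + 1/2 * bm * A) * Y \<le> (G * bm - 1/2 * (G * bm + F * b)) * Y"
    using nn by (auto intro!: mult_right_mono)
  moreover define S T where "S = (\<Sum>k\<in>band n. \<bar>of_int k\<bar>\<^sup>2 * Re (cnj (f k) * Vf f g k))"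
    "T = (\<Sum>k\<in>band n. \<bar>of_int k\<bar>\<^sup>2 * Re (cnj (g k) * Vg f g k))"
  ultimately have "S + T \<le> - kap * (X + Y)"
    using 1 2 unfolding S_T_def[symmetric] by (simp add: algebra_simps add_divide_distrib diff_divide_distrib)
  then show ?thesis by (simp add: S_T_def A_D_X_Y_def)
qed

text \<open>The first-order part of the step dissipates \<open>2 * \<tau> * kap\<close> times the
  second-order norm. Half of that pays for the quadratic error, in which the weight of the energy is
  at most the square of \<open>n\<close> on the band. This is the origin of the second condition on
  the step size.\<close>

lemma energy_step:
  assumes "trig_poly n f" "trig_poly n g" "wnorm 0 f + wnorm 0 g \<le> E"
    and tau: "0 \<le> \<tau>" "\<tau> * (real n)\<^sup>2 * VK \<le> kap"
  shows "snorm 1 (step n \<tau> Vf f f g) + snorm 1 (step n \<tau> Vg g f g) + \<tau> * kap * (snorm 2 f + snorm 2 g)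
    \<le> snorm 1 f + snorm 1 g"
proof -
  have row: "(\<Sum>k\<in>band n. (wmod 1 (step n \<tau> V u f g) k)\<^sup>2) \<le> (\<Sum>k\<in>band n. (wmod 1 u k)\<^sup>2)
      + 2 * \<tau> * (\<Sum>k\<in>band n. \<bar>of_int k\<bar>\<^sup>2 * Re (cnj (u k) * V f g k)) + \<tau>\<^sup>2 * (real n)\<^sup>2 * (\<Sum>k\<in>band n. (cmod (V f g k))\<^sup>2)"
    for V u
  proof -
    have "(wmod 1 (step n \<tau> V u f g) k)\<^sup>2 \<le> (wmod 1 u k)\<^sup>2
      + 2 * \<tau> * (\<bar>of_int k\<bar>\<^sup>2 * Re (cnj (u k) * V f g k)) + \<tau>\<^sup>2 * (real n)\<^sup>2 * (cmod (V f g k))\<^sup>2" if k: "k \<in> band n" for k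
    proof -
      have "(cmod (u k + of_real \<tau> * V f g k))\<^sup>2 = (cmod (u k))\<^sup>2 + 2 * \<tau> * Re (cnj (u k) * V f g k) + \<tau>\<^sup>2 * (cmod (V f g k))\<^sup>2"
        unfolding cmod_power2 by (simp add: power2_eq_square algebra_simps)
      then have "(wmod 1 (step n \<tau> V u f g) k)\<^sup>2 = (wmod 1 u k)\<^sup>2
        + 2 * \<tau> * (\<bar>of_int k\<bar>\<^sup>2 * Re (cnj (u k) * V f g k)) + \<tau>\<^sup>2 * \<bar>of_int k\<bar>\<^sup>2 * (cmod (V f g k))\<^sup>2"
        using k by (simp add: step_def wmod_def power_mult_distrib algebra_simps)
      moreover have "\<tau>\<^sup>2 * \<bar>of_int k\<bar>\<^sup>2 * (cmod (V f g k))\<^sup>2 \<le> \<tau>\<^sup>2 * (real n)\<^sup>2 * (cmod (V f g k))\<^sup>2"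
        using band_abs_le[OF k] by (intro mult_right_mono mult_left_mono power_mono) auto
      ultimately show ?thesis by linarith
    qed
    then have "(\<Sum>k\<in>band n. (wmod 1 (step n \<tau> V u f g) k)\<^sup>2) \<le> (\<Sum>k\<in>band n. (wmod 1 u k)\<^sup>2
      + 2 * \<tau> * (\<bar>of_int k\<bar>\<^sup>2 * Re (cnj (u k) * V f g k)) + \<tau>\<^sup>2 * (real n)\<^sup>2 * (cmod (V f g k))\<^sup>2)" by (intro sum_mono)
    then show ?thesis by (simp add: sum.distrib sum_distrib_left mult.assoc)
  qed
  define Q where "Q = snorm 2 f + snorm 2 g"
  have Q: "0 \<le> Q" by (simp add: Q_def)
  have "snorm 1 (step n \<tau> Vf f f g) + snorm 1 (step n \<tau> Vg g f g) \<le> snorm 1 f + snorm 1 g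
     + 2 * \<tau> * ((\<Sum>k\<in>band n. \<bar>of_int k\<bar>\<^sup>2 * Re (cnj (f k) * Vf f g k)) + (\<Sum>k\<in>band n. \<bar>of_int k\<bar>\<^sup>2 * Re (cnj (g k) * Vg f g k)))
     + \<tau>\<^sup>2 * (real n)\<^sup>2 * ((\<Sum>k\<in>band n. (cmod (Vf f g k))\<^sup>2) + (\<Sum>k\<in>band n. (cmod (Vg f g k))\<^sup>2))"
    using row[of Vf f] row[of Vg g]
    unfolding trig_poly_snorm[OF assms(1)] trig_poly_snorm[OF assms(2)] trig_poly_snorm[OF step_trig_poly(1)[OF assms(1,2)]]
      trig_poly_snorm[OF step_trig_poly(2)[OF assms(1,2)]]
    by (simp only: distrib_left)
  also have "\<dots> \<le> snorm 1 f + snorm 1 g + 2 * \<tau> * (- kap * Q) + \<tau>\<^sup>2 * (real n)\<^sup>2 * (VK * Q)"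
    unfolding Q_def using tau(1) by (intro add_mono mult_left_mono dissipation V_square_sum assms order_refl trig_poly_zero[OF assms(1)] trig_poly_zero[OF assms(2)]
      trig_poly_wsummable[OF assms(1)] trig_poly_wsummable[OF assms(2)]) auto
  also have "\<tau>\<^sup>2 * (real n)\<^sup>2 * (VK * Q) \<le> \<tau> * kap * Q"
  proof -
    have "\<tau> * (\<tau> * (real n)\<^sup>2 * VK) * Q \<le> \<tau> * kap * Q"
      using tau Q by (intro mult_right_mono mult_left_mono) auto
    then show ?thesis by (simp add: power2_eq_square mult_ac)
  qed
  finally show ?thesis unfolding Q_def[symmetric] by (simp add: algebra_simps)
qed

end

section \<open>Compactness and passage to the limit\<close>

text \<open>Turns sums over Euler steps into time integrals of a piecewise constant function, so
  that dominated convergence becomes available.\<close>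

lemma has_integral_step:
  fixes H :: "nat \<Rightarrow> 'a::banach"
  assumes "\<tau> > 0"
  shows "((\<lambda>s. H (nat \<lfloor>s / \<tau>\<rfloor>)) has_integral \<tau> *\<^sub>R (\<Sum>i<m. H i)) {0..real m * \<tau>}"
proof (induction m)
  case 0
  then show ?case by (simp add: has_integral_refl)
next
  case (Suc m)
  have "((\<lambda>s. H (nat \<lfloor>s / \<tau>\<rfloor>)) has_integral \<tau> *\<^sub>R H m) {real m * \<tau>..real (Suc m) * \<tau>}"
  \<comment> \<open>At the right endpoint the floor already belongs to the next cell; a single point
    does not affect the integral.\<close>
  proof (rule has_integral_spike_finite[of "{real (Suc m) * \<tau>}" _ _ "\<lambda>s. H m"])
    fix s assume s: "s \<in> {real m * \<tau>..real (Suc m) * \<tau>} - {real (Suc m) * \<tau>}"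
    then have "\<lfloor>s / \<tau>\<rfloor> = int m"
      using assms by (intro floor_unique) (auto simp: field_simps)
    then show "H (nat \<lfloor>s / \<tau>\<rfloor>) = H m" by simp
  next
    have "((\<lambda>s. H m) has_integral (real (Suc m) * \<tau> - real m * \<tau>) *\<^sub>R H m) {real m * \<tau>..real (Suc m) * \<tau>}"
      using assms by (intro has_integral_const_real[THEN has_integral_eq_rhs]) auto
    then show "((\<lambda>s. H m) has_integral \<tau> *\<^sub>R H m) {real m * \<tau>..real (Suc m) * \<tau>}"
      by (simp add: algebra_simps)
  qed simp
  from has_integral_combine[OF _ _ Suc.IH this] assms show ?case
    by (simp add: scaleR_add_right)
qed

text \<open>At a time inside a cell, that cell contributes only its elapsed part.\<close>

lemma has_integral_step':
  fixes H :: "nat \<Rightarrow> 'a::banach"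
  assumes "\<tau> > 0" "t \<ge> 0"
  defines "m \<equiv> nat \<lfloor>t / \<tau>\<rfloor>"
  shows "((\<lambda>s. H (nat \<lfloor>s / \<tau>\<rfloor>)) has_integral \<tau> *\<^sub>R (\<Sum>i<m. H i) + (t - real m * \<tau>) *\<^sub>R H m) {0..t}"
proof -
  have m: "real m = of_int \<lfloor>t / \<tau>\<rfloor>" using assms by (simp add: m_def)
  have "real m \<le> t / \<tau>" "t / \<tau> < real (Suc m)" unfolding of_nat_Suc m by linarith+
  then have mt: "real m * \<tau> \<le> t" "t < real (Suc m) * \<tau>"
    using assms(1) by (simp_all only: pos_le_divide_eq pos_divide_less_eq)
  have "((\<lambda>s. H (nat \<lfloor>s / \<tau>\<rfloor>)) has_integral (t - real m * \<tau>) *\<^sub>R H m) {real m * \<tau>..t}"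
  proof (rule has_integral_eq[of _ "\<lambda>s. H m"])
    fix s assume s: "s \<in> {real m * \<tau>..t}"
    then have "\<lfloor>s / \<tau>\<rfloor> = int m"
      using assms mt by (intro floor_unique) (auto simp: field_simps)
    then show "H m = H (nat \<lfloor>s / \<tau>\<rfloor>)" by simp
  next
    show "((\<lambda>s. H m) has_integral (t - real m * \<tau>) *\<^sub>R H m) {real m * \<tau>..t}"
      using mt by (intro has_integral_const_real[THEN has_integral_eq_rhs]) auto
  qed
  from has_integral_combine[OF _ _ has_integral_step[OF assms(1)] this] assms mt show ?thesis
    by simp
qed

text \<open>A form of the Arzela-Ascoli theorem for functions that are only almost Lipschitz: step
  functions jump, and \<open>\<epsilon> n\<close> measures the jumps as a delay in time. A diagonal
  subsequence converges at all rational times and all indices, and the modulus of continuity carries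
  the Cauchy property to the remaining times. The constant \<open>L i\<close> may depend on the
  index, as it must for modes of growing frequency.\<close>

lemma equi_lipschitz_subsequence:
  fixes u :: "nat \<Rightarrow> real \<Rightarrow> 'i::countable \<Rightarrow> complex"
  assumes bound: "\<And>n t i. t \<ge> 0 \<Longrightarrow> cmod (u n t i) \<le> M"
    and lip: "\<And>n t s i. \<lbrakk>t \<ge> 0; s \<ge> 0\<rbrakk> \<Longrightarrow> cmod (u n t i - u n s i) \<le> L i * (\<bar>t - s\<bar> + \<epsilon> n)"
    and eps: "\<epsilon> \<longlonglongrightarrow> 0"
  obtains r c where "strict_mono (r :: nat \<Rightarrow> nat)" "\<And>t i. t \<ge> 0 \<Longrightarrow> (\<lambda>n. u (r n) t i) \<longlonglongrightarrow> c t i"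
proof -
  define S where "S = {q \<in> \<rat>. 0 \<le> (q::real)} \<times> (UNIV :: 'i set)"
  have "countable S" unfolding S_def using countable_rat by (intro countable_SIGMA) (auto intro: countable_subset)
  moreover have "norm (u n (fst x) (snd x)) \<le> M" if "x \<in> S" for n x
    using that bound by (auto simp: S_def)
  ultimately obtain r where r: "strict_mono (r :: nat \<Rightarrow> nat)"
      "\<And>x. x \<in> S \<Longrightarrow> \<exists>l. (\<lambda>n. u (r n) (fst x) (snd x)) \<longlonglongrightarrow> l"
    by (rule function_convergent_subsequence[of S "\<lambda>n x. u n (fst x) (snd x)"]) (assumption | rule that)+
  have er: "(\<lambda>n. \<epsilon> (r n)) \<longlonglongrightarrow> 0" using LIMSEQ_subseq_LIMSEQ[OF eps r(1)] by (simp add: o_def)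
  have "\<exists>l. (\<lambda>n. u (r n) t i) \<longlonglongrightarrow> l" if t: "t \<ge> 0" for t i
  proof -
    have "Cauchy (\<lambda>n. u (r n) t i)"
    proof (rule metric_CauchyI)
      fix e :: real assume e: "e > 0"
      define L' where "L' = \<bar>L i\<bar> + 1"
      have L': "L' > 0" "L i \<le> L'" by (auto simp: L'_def)
      \<comment> \<open>The distance to the rational time and the delay
        \<open>\<epsilon> (r n)\<close> are each at most \<open>d\<close>, so the resulting
        difference is at most \<open>L' * (2 * d)\<close>, a third of \<open>e\<close>.\<close>
      define d where "d = e / (6 * L')"
      have d: "d > 0" using e L' by (simp add: d_def)
      \<comment> \<open>Taken to the right of \<open>t\<close>, so that it is nonnegative even for
        \<open>t = 0\<close>.\<close>
      obtain q where q: "q \<in> \<rat>" "t < q" "q < t + d" using Rats_dense_in_real[of t "t + d"] d by auto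
      have qS: "(q, i) \<in> S" using q t by (auto simp: S_def)
      have "convergent (\<lambda>n. u (r n) q i)" using r(2)[OF qS] by (simp add: convergent_def)
      then have "Cauchy (\<lambda>n. u (r n) q i)" by (rule convergent_Cauchy)
      then obtain N1 where N1: "\<And>m n. m \<ge> N1 \<Longrightarrow> n \<ge> N1 \<Longrightarrow> dist (u (r m) q i) (u (r n) q i) < e / 3"
        using e unfolding Cauchy_def by (meson divide_pos_pos zero_less_numeral)
      from er d have "\<forall>\<^sub>F n in sequentially. dist (\<epsilon> (r n)) 0 < d" by (rule tendstoD)
      then obtain N2 where N2: "\<And>n. n \<ge> N2 \<Longrightarrow> \<bar>\<epsilon> (r n)\<bar> < d"
        unfolding eventually_sequentially by auto
      have near: "dist (u (r n) t i) (u (r n) q i) \<le> e / 3" if "n \<ge> N2" for n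
      proof -
        have "dist (u (r n) t i) (u (r n) q i) \<le> L i * (\<bar>t - q\<bar> + \<epsilon> (r n))"
          using lip[of t q "r n" i] t q by (simp add: dist_norm)
        also have "\<dots> \<le> \<bar>L i\<bar> * \<bar>\<bar>t - q\<bar> + \<epsilon> (r n)\<bar>" by (metis abs_ge_self abs_mult)
        also have "\<dots> \<le> L' * (2 * d)"
          using q N2[OF that] by (intro mult_mono) (auto simp: L'_def)
        also have "\<dots> = e / 3" using L' by (simp add: d_def field_simps)
        finally show ?thesis .
      qed
      show "\<exists>N. \<forall>m\<ge>N. \<forall>n\<ge>N. dist (u (r m) t i) (u (r n) t i) < e"
      proof (intro exI[of _ "max N1 N2"] allI impI)
        fix m n assume "m \<ge> max N1 N2" "n \<ge> max N1 N2"
        then have "dist (u (r m) t i) (u (r m) q i) \<le> e / 3" "dist (u (r n) t i) (u (r n) q i) \<le> e / 3"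
          "dist (u (r m) q i) (u (r n) q i) < e / 3" using near N1 by auto
        then show "dist (u (r m) t i) (u (r n) t i) < e"
          using dist_triangle[of "u (r m) t i" "u (r n) t i" "u (r m) q i"]
            dist_triangle[of "u (r m) q i" "u (r n) t i" "u (r n) q i"] by (simp add: dist_commute)
      qed
    qed
    then show ?thesis by (simp add: Cauchy_convergent_iff convergent_def)
  qed
  then obtain c where "\<And>t i. t \<ge> 0 \<Longrightarrow> (\<lambda>n. u (r n) t i) \<longlonglongrightarrow> c t i" by metis
  with r(1) that show ?thesis by blast
qed

section \<open>Limits of convolutions under H^1 bounds\<close>

lemma wprod_abs_summable:
  assumes "u 0 = 0" "ssummable 1 u" "ssummable 1 v"
  shows "(\<lambda>l. wmod 1 u (k - l) * wmod 1 v l) summable_on UNIV"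
    "(\<lambda>l. cmod (u (k - l) * (of_int l * v l))) summable_on UNIV"
    "(\<Sum>\<^sub>\<infinity>l. wmod 1 u (k - l) * wmod 1 v l) \<le> (snorm 1 u + snorm 1 v) / 2"
proof -
  have s: "(\<lambda>l. ((wmod 1 u (k - l))\<^sup>2 + (wmod 1 v l)\<^sup>2) * (1/2)) summable_on UNIV"
    using summable_on_shift[OF assms(2)] assms(3) by (intro summable_on_cmult_left summable_on_add) 
  have le: "wmod 1 u (k - l) * wmod 1 v l \<le> ((wmod 1 u (k - l))\<^sup>2 + (wmod 1 v l)\<^sup>2) * (1/2)" for l
    using sum_squares_bound[of "wmod 1 u (k - l)" "wmod 1 v l"] by simp
  show 1: "(\<lambda>l. wmod 1 u (k - l) * wmod 1 v l) summable_on UNIV"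
    by (rule summable_on_comparison_test[OF s]) (use le in auto)
  show "(\<lambda>l. cmod (u (k - l) * (of_int l * v l))) summable_on UNIV"
  proof (rule summable_on_comparison_test[OF 1])
    fix l
    have "wmod 0 u (k - l) \<le> wmod 1 u (k - l)" using assms(1) by (intro wmod_mono) auto
    then have "wmod 0 u (k - l) * wmod 1 v l \<le> wmod 1 u (k - l) * wmod 1 v l"
      by (intro mult_right_mono) auto
    then show "cmod (u (k - l) * (of_int l * v l)) \<le> wmod 1 u (k - l) * wmod 1 v l"
      by (simp add: wmod_def norm_mult mult_ac)
  qed auto
  have "(\<Sum>\<^sub>\<infinity>l. wmod 1 u (k - l) * wmod 1 v l) \<le> (\<Sum>\<^sub>\<infinity>l. ((wmod 1 u (k - l))\<^sup>2 + (wmod 1 v l)\<^sup>2) * (1/2))"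
    by (rule infsum_mono[OF 1 s le])
  also have "\<dots> = (\<Sum>\<^sub>\<infinity>l. (wmod 1 u (k - l))\<^sup>2 + (wmod 1 v l)\<^sup>2) * (1/2)"
    by (rule infsum_cmult_left')
  also have "(\<Sum>\<^sub>\<infinity>l. (wmod 1 u (k - l))\<^sup>2 + (wmod 1 v l)\<^sup>2) = snorm 1 u + snorm 1 v"
    unfolding snorm_def using infsum_shift[of "\<lambda>l. (wmod 1 u l)\<^sup>2" k]
    by (subst infsum_add[OF summable_on_shift[OF assms(2)] assms(3)]) simp
  finally show "(\<Sum>\<^sub>\<infinity>l. wmod 1 u (k - l) * wmod 1 v l) \<le> (snorm 1 u + snorm 1 v) / 2"
    by (simp del: One_nat_def)
qed

text \<open>Outside the window the factor \<open>u (k - l)\<close> has frequency at least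
  \<open>J\<close>, so its modulus is at most 1/J times its first-order modulus. Since the bound
  involves only first-order norms, the tail is small uniformly along any sequence bounded in H^1,
  which takes the place of convergence in norm.\<close>

lemma wprod_tail:
  assumes "u 0 = 0" "ssummable 1 u" "ssummable 1 v" "J > 0"
  shows "cmod (wprod u v k - (\<Sum>j\<in>band J. u j * (of_int (k - j) * v (k - j)))) \<le> (snorm 1 u + snorm 1 v) / (2 * real J)"
proof -
  note abs = wprod_abs_summable[OF assms(1-3), of k]
  let ?t = "\<lambda>l. u (k - l) * (of_int l * v l)"
  let ?S = "(\<lambda>j. k - j) ` band J"
  have sm: "?t summable_on UNIV" by (rule abs_summable_summable[OF abs(2)])
  have "(\<Sum>j\<in>band J. u j * (of_int (k - j) * v (k - j))) = sum ?t ?S"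
    by (subst sum.reindex) (auto simp: inj_on_def)
  also have "\<dots> = infsum ?t ?S" by simp
  finally have fin: "(\<Sum>j\<in>band J. u j * (of_int (k - j) * v (k - j))) = infsum ?t ?S" .
  have "wprod u v k = infsum ?t (?S \<union> - ?S)" by (simp add: wprod_def)
  also have "\<dots> = infsum ?t ?S + infsum ?t (- ?S)"
    by (rule infsum_Un_disjoint) (use sm in \<open>auto intro: summable_on_subset_banach\<close>)
  finally have "wprod u v k - (\<Sum>j\<in>band J. u j * (of_int (k - j) * v (k - j))) = infsum ?t (- ?S)"
    using fin by simp
  also have "cmod \<dots> \<le> (\<Sum>\<^sub>\<infinity>l\<in>-?S. (1 / real J) * (wmod 1 u (k - l) * wmod 1 v l))"
  proof (rule norm_infsum_le)
    show "(?t has_sum infsum ?t (- ?S)) (- ?S)"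
      by (rule has_sum_infsum) (use sm in \<open>auto intro: summable_on_subset_banach\<close>)
    show "((\<lambda>l. (1 / real J) * (wmod 1 u (k - l) * wmod 1 v l)) has_sum
       (\<Sum>\<^sub>\<infinity>l\<in>-?S. (1 / real J) * (wmod 1 u (k - l) * wmod 1 v l))) (- ?S)"
      using abs(1) by (intro has_sum_infsum summable_on_cmult_right) (auto intro: summable_on_subset_banach)
    fix l assume "l \<in> - ?S"
    then have "k - l \<notin> band J" by (auto simp: image_iff)
    then have "int J \<le> \<bar>k - l\<bar>" by (simp add: mem_band)
    then have "real J \<le> \<bar>of_int (k - l)\<bar>" by (metis of_int_abs of_int_le_iff of_int_of_nat_eq)
    then have "real J * cmod (u (k - l)) \<le> wmod 1 u (k - l)"
      by (auto simp: wmod_def intro: mult_right_mono)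
    then have "cmod (u (k - l)) \<le> 1 / real J * wmod 1 u (k - l)"
      using assms(4) by (simp add: field_simps)
    then have "cmod (u (k - l)) * wmod 1 v l \<le> 1 / real J * wmod 1 u (k - l) * wmod 1 v l"
      by (rule mult_right_mono) simp
    then show "cmod (?t l) \<le> (1 / real J) * (wmod 1 u (k - l) * wmod 1 v l)"
      by (simp add: norm_mult wmod_def mult_ac)
  qed
  also have "\<dots> = (1 / real J) * (\<Sum>\<^sub>\<infinity>l\<in>-?S. wmod 1 u (k - l) * wmod 1 v l)"
    by (rule infsum_cmult_right')
  also have "(\<Sum>\<^sub>\<infinity>l\<in>-?S. wmod 1 u (k - l) * wmod 1 v l) \<le> (\<Sum>\<^sub>\<infinity>l. wmod 1 u (k - l) * wmod 1 v l)"
    by (rule infsum_mono_neutral) (use abs(1) in \<open>auto intro: summable_on_subset_banach\<close>)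
  also note abs(3)
  finally show ?thesis using assms(4) by (simp add: field_simps)
qed

text \<open>The finite window converges term by term and the tails are covered by
  \<open>wprod_tail\<close>. The filter is arbitrary because the lemma serves both the limit of the
  scheme and the continuity in time of the limit.\<close>

lemma wprod_tendsto:
  fixes u v :: "'x \<Rightarrow> int \<Rightarrow> complex"
  assumes lim: "\<And>j. ((\<lambda>x. u x j) \<longlongrightarrow> u0 j) Fil" "\<And>j. ((\<lambda>x. v x j) \<longlongrightarrow> v0 j) Fil"
    and bound: "\<forall>\<^sub>F x in Fil. u x 0 = 0 \<and> ssummable 1 (u x) \<and> ssummable 1 (v x) \<and> snorm 1 (u x) \<le> M \<and> snorm 1 (v x) \<le> M"
    and "u0 0 = 0" "ssummable 1 u0" "ssummable 1 v0" "snorm 1 u0 \<le> M" "snorm 1 v0 \<le> M"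
  shows "((\<lambda>x. wprod (u x) (v x) k) \<longlongrightarrow> wprod u0 v0 k) Fil"
proof (rule tendstoI)
  fix e :: real assume e: "e > 0"
  obtain J :: nat where J: "real J > 3 * \<bar>M\<bar> / e + 1" using reals_Archimedean2 by blast
  have "0 \<le> 3 * \<bar>M\<bar> / e" using e by simp
  with J have J0: "J > 0" by (cases J) auto
  have MJ: "M / real J < e / 3"
  proof -
    have "3 * \<bar>M\<bar> / e < real J" using J by linarith
    then have "3 * \<bar>M\<bar> < real J * e" using e by (simp add: field_simps)
    then have "3 * M < real J * e" by linarith
    then show ?thesis using J0 by (simp add: field_simps)
  qed
  let ?P = "\<lambda>u v. \<Sum>j\<in>band J. u j * (of_int (k - j) * v (k - j)) :: complex"
  have "((\<lambda>x. ?P (u x) (v x)) \<longlongrightarrow> ?P u0 v0) Fil" by (intro tendsto_intros lim)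
  then have "\<forall>\<^sub>F x in Fil. dist (?P (u x) (v x)) (?P u0 v0) < e / 3" by (rule tendstoD) (use e in simp)
  with bound show "\<forall>\<^sub>F x in Fil. dist (wprod (u x) (v x) k) (wprod u0 v0 k) < e"
  proof eventually_elim
    case (elim x)
    have small: "cmod (wprod u v k - ?P u v) < e / 3" if "u 0 = 0" "ssummable 1 u" "ssummable 1 v" "snorm 1 u \<le> M" "snorm 1 v \<le> M" for u v
    proof -
      have "cmod (wprod u v k - ?P u v) \<le> (snorm 1 u + snorm 1 v) / (2 * real J)" by (rule wprod_tail) (use that J0 in auto)
      also have "\<dots> \<le> (M + M) / (2 * real J)" using that by (intro divide_right_mono) auto
      also have "\<dots> = M / real J" by simp
      finally show ?thesis using MJ by linarith
    qed
    have "cmod (wprod (u x) (v x) k - ?P (u x) (v x)) < e / 3" "cmod (wprod u0 v0 k - ?P u0 v0) < e / 3"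
      by (rule small; use elim assms in blast)+
    moreover have "cmod (?P (u x) (v x) - ?P u0 v0) < e / 3" using elim by (simp add: dist_norm)
    ultimately show ?case
      unfolding dist_norm
      using norm_triangle_ineq[of "wprod (u x) (v x) k - ?P (u x) (v x)" "?P (u x) (v x) - wprod u0 v0 k"]
        norm_triangle_ineq[of "?P (u x) (v x) - ?P u0 v0" "?P u0 v0 - wprod u0 v0 k"]
      by (simp add: norm_minus_commute)
  qed
qed

lemma wmod_le_sqrt_snorm:
  assumes "ssummable p c"
  shows "wmod p c k \<le> sqrt (snorm p c)"
  unfolding snorm_def by (rule real_le_rsqrt) (use assms in \<open>auto intro: summable_on_le_infsum\<close>)

text \<open>An l^1 against l^\<infinity> estimate. The speed of a single mode has to be bounded at
  every time, where no second-order norm is at hand.\<close>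

lemma wprod_bound:
  assumes "wsummable 0 u" "\<And>l. wmod 1 v l \<le> M"
  shows "cmod (wprod u v k) \<le> wnorm 0 u * M"
proof -
  have M: "0 \<le> M" using assms(2)[of 0] wmod_nonneg order_trans by blast
  have le: "cmod (u (k - l) * (of_int l * v l)) \<le> wmod 0 u (k - l) * M" for l
    using mult_left_mono[OF assms(2)[of l], of "cmod (u (k - l))"] by (simp add: norm_mult wmod_def)
  have s: "(\<lambda>l. wmod 0 u (k - l) * M) summable_on UNIV"
    by (intro summable_on_cmult_left summable_on_shift assms)
  have abs: "(\<lambda>l. cmod (u (k - l) * (of_int l * v l))) summable_on UNIV"
    by (rule summable_on_comparison_test[OF s le norm_ge_zero])
  have "cmod (wprod u v k) \<le> (\<Sum>\<^sub>\<infinity>l. wmod 0 u (k - l) * M)"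
    unfolding wprod_def
    by (rule norm_infsum_le[OF has_sum_infsum[OF abs_summable_summable[OF abs]] has_sum_infsum[OF s] le])
  also have "\<dots> = wnorm 0 u * M" by (simp only: infsum_cmult_left' infsum_shift wnorm_def)
  finally show ?thesis .
qed

section \<open>Bounds on finite bands, and truncation\<close>

lemma finite_subset_band:
  assumes "finite (K :: int set)"
  obtains n where "K \<subseteq> band n"
proof
  show "K \<subseteq> band (nat (\<Sum>k\<in>K. \<bar>k\<bar>))"
  proof
    fix k assume "k \<in> K"
    then have "\<bar>k\<bar> \<le> (\<Sum>k\<in>K. \<bar>k\<bar>)" using assms by (intro member_le_sum) auto
    then show "k \<in> band (nat (\<Sum>k\<in>K. \<bar>k\<bar>))" by (simp add: mem_band)
  qed
qed

text \<open>The bands exhaust the integers, so a bound on all band sums of a nonnegative family is a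
  bound on its series. This is Fatou's lemma for the counting measure with summability as part of
  the conclusion, and the way in which every norm bound reaches the limit.\<close>

lemma band_bound_summable:
  fixes a :: "int \<Rightarrow> real"
  assumes "\<And>k. 0 \<le> a k" "\<And>n. sum a (band n) \<le> B"
  shows "a summable_on UNIV" "infsum a UNIV \<le> B"
proof -
  have fin: "sum a K \<le> B" if K: "finite K" for K
  proof -
    obtain n where "K \<subseteq> band n" using finite_subset_band[OF K] by blast
    then have "sum a K \<le> sum a (band n)" using assms(1) by (intro sum_mono2) auto
    with assms(2) show ?thesis using order_trans by blast
  qed
  then show s: "a summable_on UNIV"
    by (intro nonneg_bdd_above_summable_on bdd_aboveI[of _ B]) (auto intro: assms(1))
  show "infsum a UNIV \<le> B" by (rule infsum_le_finite_sums[OF s]) (use fin in auto)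
qed

text \<open>The two components are kept in one bound; separate limits would double the constant in
  front of the decay.\<close>

lemma pair_band_bound_summable:
  fixes a b :: "int \<Rightarrow> real"
  assumes "\<And>k. 0 \<le> a k" "\<And>k. 0 \<le> b k" "\<And>n. sum a (band n) + sum b (band n) \<le> B"
  shows "a summable_on UNIV" "b summable_on UNIV" "infsum a UNIV + infsum b UNIV \<le> B"
proof -
  have "sum a (band n) \<le> B" "sum b (band n) \<le> B" for n
    using assms(3)[of n] sum_nonneg[of "band n" a] sum_nonneg[of "band n" b] assms(1,2) by force+
  then show ab: "a summable_on UNIV" "b summable_on UNIV"
    using assms(1,2) band_bound_summable(1) by blast+
  have "infsum (\<lambda>k. a k + b k) UNIV \<le> B"
    by (rule band_bound_summable(2)) (use assms in \<open>auto simp: sum.distrib\<close>)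
  then show "infsum a UNIV + infsum b UNIV \<le> B" by (simp add: infsum_add ab)
qed

definition trunc :: "nat \<Rightarrow> (int \<Rightarrow> complex) \<Rightarrow> int \<Rightarrow> complex" where
  "trunc n c k = (if k \<in> band n then c k else 0)"

lemma trunc_trig_poly: "hermitian c \<Longrightarrow> trig_poly n (trunc n c)"
  by (auto simp: trig_poly_def hermitian_def trunc_def mem_band)

lemma trunc_wnorm:
  assumes "hermitian c" "wsummable p c"
  shows "wnorm p (trunc n c) \<le> wnorm p c"
proof -
  have "wnorm p (trunc n c) = (\<Sum>k\<in>band n. wmod p c k)"
    unfolding trig_poly_wnorm[OF trunc_trig_poly[OF assms(1)]] by (simp add: trunc_def wmod_def)
  also have "\<dots> \<le> wnorm p c" unfolding wnorm_def by (rule finite_sum_le_infsum) (use assms in auto)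
  finally show ?thesis .
qed

lemma trunc_snorm:
  assumes "hermitian c" "ssummable p c"
  shows "snorm p (trunc n c) \<le> snorm p c"
proof -
  have "snorm p (trunc n c) = (\<Sum>k\<in>band n. (wmod p c k)\<^sup>2)"
    unfolding trig_poly_snorm[OF trunc_trig_poly[OF assms(1)]] by (simp add: trunc_def wmod_def)
  also have "\<dots> \<le> snorm p c" unfolding snorm_def by (rule finite_sum_le_infsum) (use assms in auto)
  finally show ?thesis .
qed

lemma snorm_mono:
  "c 0 = 0 \<Longrightarrow> p \<le> q \<Longrightarrow> ssummable q c \<Longrightarrow> snorm p c \<le> snorm q c"
  unfolding snorm_def by (intro infsum_mono power_mono wmod_mono ssummable_mono[of c p q]) auto

lemma wnorm_mono:
  "c 0 = 0 \<Longrightarrow> p \<le> q \<Longrightarrow> wsummable q c \<Longrightarrow> wnorm p c \<le> wnorm q c"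
  unfolding wnorm_def by (intro infsum_mono wmod_mono wsummable_mono[of c p q]) auto

section \<open>The discrete trajectories and their uniform bounds\<close>

locale film_data = film +
  fixes fh gh :: "int \<Rightarrow> complex"
  assumes herm: "hermitian fh" "hermitian gh"
    and wsm: "wsummable 0 fh" "wsummable 0 gh"
    and small: "wnorm 0 fh + wnorm 0 gh \<le> E"
    and ssm: "ssummable 1 fh" "ssummable 1 gh"
begin

definition "E1 = snorm 1 fh + snorm 1 gh"

lemma E1_nonneg: "0 \<le> E1" by (simp add: E1_def)

text \<open>The step size makes the diagonal part a contraction on every mode up to \<open>n\<close> and makes the
  quadratic Euler error in the energy at most the dissipation.\<close>

definition "tau n = 1 / ((1 + real n)\<^sup>2 * (1 + F * br + G * bm + VK / kap))"

lemma tau_props: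
  "0 < tau n" "tau n * (real n)\<^sup>2 * (F * br) \<le> 1" "tau n * (real n)\<^sup>2 * (G * bm) \<le> 1" "tau n * (real n)\<^sup>2 * VK \<le> kap"
proof -
  define R where "R = 1 + F * br + G * bm + VK / kap"
  have p: "0 < F * br" "0 < G * bm" "0 \<le> VK / kap" using pos FG_pos VK_nonneg kap_pos by auto
  then have R: "R > 0" "F * br \<le> R" "G * bm \<le> R" "VK / kap \<le> R" by (auto simp: R_def)
  show t: "0 < tau n" unfolding tau_def R_def[symmetric] using R by (auto intro!: divide_pos_pos mult_pos_pos)
  have "(real n)\<^sup>2 \<le> (1 + real n)\<^sup>2" by (intro power_mono) auto
  then have "tau n * (real n)\<^sup>2 \<le> tau n * (1 + real n)\<^sup>2" using t by (intro mult_left_mono) auto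
  also have "\<dots> = 1 / R" unfolding tau_def R_def[symmetric] by simp
  finally have le: "tau n * (real n)\<^sup>2 \<le> 1 / R" .
  have "tau n * (real n)\<^sup>2 * x \<le> 1" if "0 \<le> x" "x \<le> R" for x
  proof -
    have "tau n * (real n)\<^sup>2 * x \<le> 1 / R * R" using le that t R by (intro mult_mono) auto
    then show ?thesis using R by simp
  qed
  note this[of "F * br"] this[of "G * bm"] this[of "VK / kap"]
  with p R kap_pos show "tau n * (real n)\<^sup>2 * (F * br) \<le> 1" "tau n * (real n)\<^sup>2 * (G * bm) \<le> 1" "tau n * (real n)\<^sup>2 * VK \<le> kap"
    by (auto simp: field_simps)
qed

lemma tau_tendsto: "tau \<longlonglongrightarrow> 0"
proof -
  define R where "R = 1 + F * br + G * bm + VK / kap"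
  have p: "0 < F * br" "0 < G * bm" "0 \<le> VK / kap" using pos FG_pos VK_nonneg kap_pos by auto
  have "R \<ge> 1" using p by (simp add: R_def)
  have "tau n \<le> inverse (real (Suc n))" for n
  proof -
    have "real (Suc n) * 1 \<le> (1 + real n)\<^sup>2 * R"
      by (intro mult_mono) (use \<open>R \<ge> 1\<close> in \<open>auto simp: power2_eq_square algebra_simps\<close>)
    then show ?thesis unfolding tau_def R_def[symmetric] by (simp add: inverse_eq_divide frac_le)
  qed
  then show ?thesis
    by (intro real_tendsto_sandwich[OF _ _ tendsto_const LIMSEQ_inverse_real_of_nat])
      (auto intro!: always_eventually less_imp_le[OF tau_props(1)])
qed

primrec traj :: "nat \<Rightarrow> nat \<Rightarrow> (int \<Rightarrow> complex) \<times> (int \<Rightarrow> complex)" where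
  "traj n 0 = (trunc n fh, trunc n gh)"
| "traj n (Suc m) = (step n (tau n) Vf (fst (traj n m)) (fst (traj n m)) (snd (traj n m)),
     step n (tau n) Vg (snd (traj n m)) (fst (traj n m)) (snd (traj n m)))"

abbreviation "tf n m \<equiv> fst (traj n m)"
abbreviation "tg n m \<equiv> snd (traj n m)"

lemma traj_trig_poly: "trig_poly n (tf n m)" "trig_poly n (tg n m)"
  by (induction m) (auto simp: trunc_trig_poly herm step_trig_poly)

text \<open>Both bounds go through one induction because the second supplies the smallness that the
  next step asks for. The dissipation telescopes into the first bound. For the decay,
  \<open>wnorm 0\<close> is at most \<open>wnorm 2\<close>, so a step multiplies the norm by at most
  \<open>1 - tau n * sig\<close>, and \<open>1 - x \<le> exp (- x)\<close>.\<close>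

lemma traj_wiener:
  "wnorm 0 (tf n m) + wnorm 0 (tg n m) + tau n * sig * (\<Sum>i<m. wnorm 2 (tf n i) + wnorm 2 (tg n i)) \<le> E"
  "wnorm 0 (tf n m) + wnorm 0 (tg n m) \<le> E * exp (- sig * (tau n * real m))"
proof (induction m)
  case 0
  have "wnorm 0 (trunc n fh) + wnorm 0 (trunc n gh) \<le> wnorm 0 fh + wnorm 0 gh"
    by (intro add_mono trunc_wnorm herm wsm)
  then show "wnorm 0 (tf n 0) + wnorm 0 (tg n 0) + tau n * sig * (\<Sum>i<0. wnorm 2 (tf n i) + wnorm 2 (tg n i)) \<le> E"
     "wnorm 0 (tf n 0) + wnorm 0 (tg n 0) \<le> E * exp (- sig * (tau n * real 0))"
    using small by auto
next
  case (Suc m)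
  have "E * exp (- sig * (tau n * real m)) \<le> E * 1"
    using pos sig_pos tau_props(1)[of n] by (intro mult_left_mono) auto
  with Suc(2) have "wnorm 0 (tf n m) + wnorm 0 (tg n m) \<le> E" by linarith
  from wiener_step[OF traj_trig_poly this less_imp_le[OF tau_props(1)] tau_props(2,3)]
  have st: "wnorm 0 (tf n (Suc m)) + wnorm 0 (tg n (Suc m)) + tau n * sig * (wnorm 2 (tf n m) + wnorm 2 (tg n m))
     \<le> wnorm 0 (tf n m) + wnorm 0 (tg n m)" by simp
  show "wnorm 0 (tf n (Suc m)) + wnorm 0 (tg n (Suc m)) + tau n * sig * (\<Sum>i<Suc m. wnorm 2 (tf n i) + wnorm 2 (tg n i)) \<le> E"
    using st Suc(1) by (simp only: sum.lessThan_Suc distrib_left)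
  have ts: "0 \<le> tau n * sig" using tau_props(1)[of n] sig_pos by simp
  define x where "x = wnorm 0 (tf n m) + wnorm 0 (tg n m)"
  have "wnorm 0 (tf n m) + wnorm 0 (tg n m) \<le> wnorm 2 (tf n m) + wnorm 2 (tg n m)"
    by (intro add_mono wnorm_mono trig_poly_wsummable[OF traj_trig_poly(1)] trig_poly_wsummable[OF traj_trig_poly(2)]
        trig_poly_zero[OF traj_trig_poly(1)] trig_poly_zero[OF traj_trig_poly(2)]) auto
  from mult_left_mono[OF this ts] st
  have "wnorm 0 (tf n (Suc m)) + wnorm 0 (tg n (Suc m)) \<le> x * (1 - tau n * sig)"
    unfolding x_def by (simp only: algebra_simps)
  also have "\<dots> \<le> x * exp (- (tau n * sig))"
    unfolding x_def using exp_ge_add_one_self[of "- (tau n * sig)"] by (intro mult_left_mono) auto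
  also have "\<dots> \<le> E * exp (- sig * (tau n * real m)) * exp (- (tau n * sig))"
    using Suc(2) unfolding x_def by (intro mult_right_mono) auto
  also have "\<dots> = E * exp (- sig * (tau n * real (Suc m)))"
    by (simp add: algebra_simps flip: exp_add)
  finally show "wnorm 0 (tf n (Suc m)) + wnorm 0 (tg n (Suc m)) \<le> E * exp (- sig * (tau n * real (Suc m)))" .
qed

lemma traj_wnorm_le: "wnorm 0 (tf n m) + wnorm 0 (tg n m) \<le> E"
proof -
  have "0 \<le> tau n * sig * (\<Sum>i<m. wnorm 2 (tf n i) + wnorm 2 (tg n i))"
    using tau_props(1)[of n] sig_pos by (intro mult_nonneg_nonneg sum_nonneg add_nonneg_nonneg) auto
  with traj_wiener(1)[of n m] show ?thesis by linarith
qed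

text \<open>The same pattern for the energy, with the smallness in the Wiener norm now available for
  all steps from \<open>traj_wnorm_le\<close>.\<close>

lemma traj_energy:
  "snorm 1 (tf n m) + snorm 1 (tg n m) + tau n * kap * (\<Sum>i<m. snorm 2 (tf n i) + snorm 2 (tg n i)) \<le> E1"
  "snorm 1 (tf n m) + snorm 1 (tg n m) \<le> E1 * exp (- kap * (tau n * real m))"
proof (induction m)
  case 0
  have "snorm 1 (trunc n fh) + snorm 1 (trunc n gh) \<le> E1"
    unfolding E1_def by (intro add_mono trunc_snorm herm ssm)
  then show "snorm 1 (tf n 0) + snorm 1 (tg n 0) + tau n * kap * (\<Sum>i<0. snorm 2 (tf n i) + snorm 2 (tg n i)) \<le> E1"
     "snorm 1 (tf n 0) + snorm 1 (tg n 0) \<le> E1 * exp (- kap * (tau n * real 0))"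
    by auto
next
  case (Suc m)
  from energy_step[OF traj_trig_poly traj_wnorm_le less_imp_le[OF tau_props(1)] tau_props(4)]
  have st: "snorm 1 (tf n (Suc m)) + snorm 1 (tg n (Suc m)) + tau n * kap * (snorm 2 (tf n m) + snorm 2 (tg n m))
     \<le> snorm 1 (tf n m) + snorm 1 (tg n m)" by simp
  show "snorm 1 (tf n (Suc m)) + snorm 1 (tg n (Suc m)) + tau n * kap * (\<Sum>i<Suc m. snorm 2 (tf n i) + snorm 2 (tg n i)) \<le> E1"
    using st Suc(1) by (simp only: sum.lessThan_Suc distrib_left)
  have ts: "0 \<le> tau n * kap" using tau_props(1)[of n] kap_pos by simp
  define x where "x = snorm 1 (tf n m) + snorm 1 (tg n m)"
  have "snorm 1 (tf n m) + snorm 1 (tg n m) \<le> snorm 2 (tf n m) + snorm 2 (tg n m)"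
    by (intro add_mono snorm_mono trig_poly_ssummable[OF traj_trig_poly(1)] trig_poly_ssummable[OF traj_trig_poly(2)]
        trig_poly_zero[OF traj_trig_poly(1)] trig_poly_zero[OF traj_trig_poly(2)]) auto
  from mult_left_mono[OF this ts] st
  have "snorm 1 (tf n (Suc m)) + snorm 1 (tg n (Suc m)) \<le> x * (1 - tau n * kap)"
    unfolding x_def by (simp only: algebra_simps)
  also have "\<dots> \<le> x * exp (- (tau n * kap))"
    unfolding x_def using exp_ge_add_one_self[of "- (tau n * kap)"] by (intro mult_left_mono) auto
  also have "\<dots> \<le> E1 * exp (- kap * (tau n * real m)) * exp (- (tau n * kap))"
    using Suc(2) unfolding x_def by (intro mult_right_mono) auto
  also have "\<dots> = E1 * exp (- kap * (tau n * real (Suc m)))"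
    by (simp add: algebra_simps flip: exp_add)
  finally show "snorm 1 (tf n (Suc m)) + snorm 1 (tg n (Suc m)) \<le> E1 * exp (- kap * (tau n * real (Suc m)))" .
qed

lemma traj_snorm_le: "snorm 1 (tf n m) + snorm 1 (tg n m) \<le> E1"
proof -
  have "0 \<le> tau n * kap * (\<Sum>i<m. snorm 2 (tf n i) + snorm 2 (tg n i))"
    using tau_props(1)[of n] kap_pos by (intro mult_nonneg_nonneg sum_nonneg add_nonneg_nonneg) auto
  with traj_energy(1)[of n m] show ?thesis by linarith
qed

text \<open>The set in which the scheme stays and which the limit inherits. On it every mode of the
  velocity is bounded, and depends continuously on the modes of the pair.\<close>

definition state :: "(int \<Rightarrow> complex) \<Rightarrow> (int \<Rightarrow> complex) \<Rightarrow> bool" where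
  "state f g \<longleftrightarrow> hermitian f \<and> hermitian g \<and> wsummable 0 f \<and> wsummable 0 g \<and> ssummable 1 f \<and> ssummable 1 g \<and>
    wnorm 0 f + wnorm 0 g \<le> E \<and> snorm 1 f + snorm 1 g \<le> E1"

lemma traj_state: "state (tf n m) (tg n m)"
  using traj_trig_poly[of n m] trig_poly_wsummable trig_poly_ssummable traj_wnorm_le traj_snorm_le
  unfolding state_def by (auto simp: trig_poly_def)

lemma state_bounds:
  assumes "state f g"
  shows "wnorm 0 f \<le> E" "wnorm 0 g \<le> E" "snorm 1 f \<le> E1" "snorm 1 g \<le> E1"
    "cmod (f k) \<le> E" "cmod (g k) \<le> E"
proof -
  show *: "wnorm 0 f \<le> E" "wnorm 0 g \<le> E" "snorm 1 f \<le> E1" "snorm 1 g \<le> E1"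
    using assms wnorm_nonneg[of 0 f] wnorm_nonneg[of 0 g] snorm_nonneg[of 1 f] snorm_nonneg[of 1 g]
    unfolding state_def by linarith+
  have "wmod 0 f k \<le> wnorm 0 f" "wmod 0 g k \<le> wnorm 0 g"
    using assms unfolding state_def wnorm_def by (auto intro: summable_on_le_infsum)
  with * show "cmod (f k) \<le> E" "cmod (g k) \<le> E" by (auto simp: wmod_def)
qed

text \<open>The constant in the bound of the speed of mode k by \<open>CV\<close> times its squared
  frequency. The coefficients of both equations are added up so that one constant serves
  both.\<close>

definition "CV = (F * br + F * b + 2 * (G * bm)) * E + (br + b + 2 * bm) * (E * sqrt E1)"

text \<open>The bilinear term carries only one power of the frequency in this estimate; it is
  enlarged to two so that it shares the factor of the linear part.\<close>

lemma bil_le: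
  assumes "wsummable 0 u" "wnorm 0 u \<le> E" "ssummable 1 v" "snorm 1 v \<le> E1"
  shows "cmod (bil u v k) \<le> \<bar>of_int k\<bar>\<^sup>2 * (E * sqrt E1)"
proof -
  have "wmod 1 v l \<le> sqrt E1" for l
    using wmod_le_sqrt_snorm[OF assms(3)] real_sqrt_le_mono[OF assms(4)] order_trans by blast
  then have "cmod (wprod u v k) \<le> wnorm 0 u * sqrt E1" by (intro wprod_bound assms) auto
  also have "\<dots> \<le> E * sqrt E1" using assms E1_nonneg by (intro mult_right_mono) auto
  finally have w: "cmod (wprod u v k) \<le> E * sqrt E1" .
  have "\<bar>real_of_int k\<bar> \<le> \<bar>of_int k\<bar>\<^sup>2"
    using power_increasing[of 1 2 "\<bar>real_of_int k\<bar>"] by (cases "k = 0") auto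
  then have "\<bar>real_of_int k\<bar> * cmod (wprod u v k) \<le> \<bar>of_int k\<bar>\<^sup>2 * (E * sqrt E1)"
    using w by (intro mult_mono) auto
  then show ?thesis by (simp add: bil_def norm_mult)
qed

lemma row_bound:
  fixes u v P Q :: complex
  assumes "0 \<le> lam" "0 \<le> mu" "0 \<le> p" "0 \<le> q" "cmod u \<le> e" "cmod v \<le> e" "cmod P \<le> x" "cmod Q \<le> x"
  shows "cmod (- of_real lam * u - of_real mu * v + of_real p * P + of_real q * Q) \<le> lam * e + mu * e + p * x + q * x"
proof -
  have "cmod (- of_real lam * u - of_real mu * v + of_real p * P + of_real q * Q) \<le>
      cmod (of_real lam * u) + cmod (of_real mu * v) + cmod (of_real p * P) + cmod (of_real q * Q)"
    by (rule norm_triangle_mono norm_triangle_le order_refl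
      | rule order_trans[OF norm_triangle_ineq4] | simp)+
  also have "\<dots> = lam * cmod u + mu * cmod v + p * cmod P + q * cmod Q" using assms by (simp add: norm_mult)
  also have "\<dots> \<le> lam * e + mu * e + p * x + q * x" using assms by (intro add_mono mult_left_mono) auto
  finally show ?thesis .
qed

lemma V_bound:
  assumes "state f g"
  shows "cmod (Vf f g k) \<le> \<bar>of_int k\<bar>\<^sup>2 * CV" "cmod (Vg f g k) \<le> \<bar>of_int k\<bar>\<^sup>2 * CV"
proof -
  note sb = state_bounds[OF assms]
  let ?k = "\<bar>real_of_int k\<bar>\<^sup>2" and ?x = "\<bar>of_int k\<bar>\<^sup>2 * (E * sqrt E1)"
  have b: "cmod (bil f f k) \<le> ?x" "cmod (bil f g k) \<le> ?x" "cmod (bil g f k) \<le> ?x" "cmod (bil g g k) \<le> ?x"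
    by (rule bil_le; use assms sb in \<open>simp add: state_def\<close>)+
  have nn: "0 \<le> ?k * F * br" "0 \<le> ?k * F * b" "0 \<le> ?k * G * bm" "0 \<le> br" "0 \<le> b" "0 \<le> bm" "0 \<le> ?k"
    "0 \<le> F * br * E" "0 \<le> F * b * E" "0 \<le> G * bm * E" "0 \<le> bm * (E * sqrt E1)"
    "0 \<le> br * (E * sqrt E1)" "0 \<le> b * (E * sqrt E1)"
    using pos FG_pos E1_nonneg by auto
  have "cmod (Vf f g k) \<le> ?k * F * br * E + ?k * F * b * E + br * ?x + b * ?x"
    unfolding Vf_def by (rule row_bound) (use nn sb b in auto)
  also have "\<dots> = ?k * ((F * br + F * b) * E + (br + b) * (E * sqrt E1))" by (simp add: algebra_simps)
  also have "\<dots> \<le> ?k * CV" unfolding CV_def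
    by (rule mult_left_mono) (use nn in \<open>simp_all add: algebra_simps\<close>)
  finally show "cmod (Vf f g k) \<le> ?k * CV" .
  have "cmod (Vg f g k) \<le> ?k * G * bm * E + ?k * G * bm * E + bm * ?x + bm * ?x"
    unfolding Vg_def by (rule row_bound) (use nn sb b in auto)
  also have "\<dots> = ?k * ((2 * (G * bm)) * E + (2 * bm) * (E * sqrt E1))" by (simp add: algebra_simps)
  also have "\<dots> \<le> ?k * CV" unfolding CV_def
    by (rule mult_left_mono) (use nn in \<open>simp_all add: algebra_simps\<close>)
  finally show "cmod (Vg f g k) \<le> ?k * CV" .
qed

lemma V_tendsto:
  fixes f g :: "'x \<Rightarrow> int \<Rightarrow> complex"
  assumes "\<And>j. ((\<lambda>x. f x j) \<longlongrightarrow> f0 j) Fil" "\<And>j. ((\<lambda>x. g x j) \<longlongrightarrow> g0 j) Fil"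
    and "\<forall>\<^sub>F x in Fil. state (f x) (g x)" "state f0 g0"
  shows "((\<lambda>x. Vf (f x) (g x) k) \<longlongrightarrow> Vf f0 g0 k) Fil" "((\<lambda>x. Vg (f x) (g x) k) \<longlongrightarrow> Vg f0 g0 k) Fil"
proof -
  have s0: "f0 0 = 0" "g0 0 = 0" "ssummable 1 f0" "ssummable 1 g0" "snorm 1 f0 \<le> E1" "snorm 1 g0 \<le> E1"
    using assms(4) state_bounds[OF assms(4)] by (auto simp: state_def hermitian_zero)
  have ev: "\<forall>\<^sub>F x in Fil. f x 0 = 0 \<and> ssummable 1 (f x) \<and> ssummable 1 (g x) \<and> snorm 1 (f x) \<le> E1 \<and> snorm 1 (g x) \<le> E1"
    "\<forall>\<^sub>F x in Fil. f x 0 = 0 \<and> ssummable 1 (f x) \<and> ssummable 1 (f x) \<and> snorm 1 (f x) \<le> E1 \<and> snorm 1 (f x) \<le> E1"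
    "\<forall>\<^sub>F x in Fil. g x 0 = 0 \<and> ssummable 1 (g x) \<and> ssummable 1 (f x) \<and> snorm 1 (g x) \<le> E1 \<and> snorm 1 (f x) \<le> E1"
    "\<forall>\<^sub>F x in Fil. g x 0 = 0 \<and> ssummable 1 (g x) \<and> ssummable 1 (g x) \<and> snorm 1 (g x) \<le> E1 \<and> snorm 1 (g x) \<le> E1"
    using assms(3) by (eventually_elim, use state_bounds(3,4) in \<open>auto simp: state_def hermitian_zero simp del: One_nat_def\<close>)+
  have "((\<lambda>x. bil (f x) (f x) k) \<longlongrightarrow> bil f0 f0 k) Fil" "((\<lambda>x. bil (f x) (g x) k) \<longlongrightarrow> bil f0 g0 k) Fil"
    "((\<lambda>x. bil (g x) (f x) k) \<longlongrightarrow> bil g0 f0 k) Fil" "((\<lambda>x. bil (g x) (g x) k) \<longlongrightarrow> bil g0 g0 k) Fil"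
    unfolding bil_def by (intro tendsto_intros wprod_tendsto[where M=E1] assms ev s0)+
  then show "((\<lambda>x. Vf (f x) (g x) k) \<longlongrightarrow> Vf f0 g0 k) Fil" "((\<lambda>x. Vg (f x) (g x) k) \<longlongrightarrow> Vg f0 g0 k) Fil"
    unfolding Vf_def Vg_def by (auto intro!: tendsto_intros assms)
qed

end

lemma nat_lipschitz:
  fixes x :: "nat \<Rightarrow> 'a::real_normed_vector"
  assumes "\<And>m. norm (x (Suc m) - x m) \<le> B"
  shows "norm (x m' - x m) \<le> \<bar>real m' - real m\<bar> * B"
proof -
  have le: "norm (x (m + d) - x m) \<le> real d * B" for m d
  proof (induction d)
    case (Suc d)
    have "norm (x (m + Suc d) - x m) \<le> norm (x (Suc (m + d)) - x (m + d)) + norm (x (m + d) - x m)"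
      using norm_triangle_ineq[of "x (Suc (m + d)) - x (m + d)" "x (m + d) - x m"] by simp
    with Suc assms[of "m + d"] show ?case by (simp add: algebra_simps)
  qed simp
  show ?thesis
  proof (cases "m \<le> m'")
    case True
    then show ?thesis using le[of m "m' - m"] by (simp add: of_nat_diff)
  next
    case False
    then show ?thesis using le[of m' "m - m'"] by (simp add: of_nat_diff norm_minus_commute)
  qed
qed

lemma nat_floor_bounds:
  assumes "t \<ge> 0" "\<tau> > 0"
  shows "real (nat \<lfloor>t / \<tau>\<rfloor>) * \<tau> \<le> t" "t < real (nat \<lfloor>t / \<tau>\<rfloor>) * \<tau> + \<tau>"
proof -
  have m: "real (nat \<lfloor>t / \<tau>\<rfloor>) = of_int \<lfloor>t / \<tau>\<rfloor>" using assms by simp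
  have "real (nat \<lfloor>t / \<tau>\<rfloor>) \<le> t / \<tau>" "t / \<tau> < real (nat \<lfloor>t / \<tau>\<rfloor>) + 1" unfolding m by linarith+
  then have "real (nat \<lfloor>t / \<tau>\<rfloor>) * \<tau> \<le> t" "t < (real (nat \<lfloor>t / \<tau>\<rfloor>) + 1) * \<tau>"
    using assms(2) by (simp_all only: pos_le_divide_eq pos_divide_less_eq)
  then show "real (nat \<lfloor>t / \<tau>\<rfloor>) * \<tau> \<le> t" "t < real (nat \<lfloor>t / \<tau>\<rfloor>) * \<tau> + \<tau>"
    by (simp_all add: algebra_simps)
qed

section \<open>Equicontinuity of the trajectories, and their limit\<close>

context film_data begin

lemma CV_nonneg: "0 \<le> CV"
  using pos FG_pos E1_nonneg by (simp add: CV_def)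

lemma traj_step_le:
  "cmod (tf n (Suc m) k - tf n m k) \<le> tau n * (\<bar>of_int k\<bar>\<^sup>2 * CV)"
  "cmod (tg n (Suc m) k - tg n m k) \<le> tau n * (\<bar>of_int k\<bar>\<^sup>2 * CV)"
proof -
  have t: "0 < tau n" by (rule tau_props)
  have nn: "0 \<le> tau n * (\<bar>of_int k\<bar>\<^sup>2 * CV)" using t CV_nonneg by simp
  have z: "tf n m k = 0" "tg n m k = 0" if "k \<notin> band n"
    using traj_trig_poly[of n m] that by (auto simp: trig_poly_def)
  have v: "cmod (of_real (tau n) * z) \<le> tau n * (\<bar>of_int k\<bar>\<^sup>2 * CV)" if "cmod z \<le> \<bar>of_int k\<bar>\<^sup>2 * CV" for z
    unfolding norm_mult norm_of_real using that t by (intro mult_mono) auto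
  show "cmod (tf n (Suc m) k - tf n m k) \<le> tau n * (\<bar>of_int k\<bar>\<^sup>2 * CV)"
    "cmod (tg n (Suc m) k - tg n m k) \<le> tau n * (\<bar>of_int k\<bar>\<^sup>2 * CV)"
    using v[OF V_bound(1)[OF traj_state[of n m], of k]] v[OF V_bound(2)[OF traj_state[of n m], of k]] z nn
    by (auto simp: step_def)
qed

abbreviation "idx n t \<equiv> nat \<lfloor>t / tau n\<rfloor>"

text \<open>The grid times of the cells of \<open>t\<close> and \<open>s\<close> differ by at most
  \<open>\<bar>t - s\<bar> + tau n\<close>; the excess \<open>tau n\<close> is the delay allowed by
  \<open>equi_lipschitz_subsequence\<close>.\<close>

lemma traj_near_lipschitz:
  assumes "t \<ge> 0" "s \<ge> 0"
  shows "cmod (tf n (idx n t) k - tf n (idx n s) k) \<le> (\<bar>of_int k\<bar>\<^sup>2 * CV) * (\<bar>t - s\<bar> + tau n)"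
    "cmod (tg n (idx n t) k - tg n (idx n s) k) \<le> (\<bar>of_int k\<bar>\<^sup>2 * CV) * (\<bar>t - s\<bar> + tau n)"
proof -
  have t: "0 < tau n" by (rule tau_props)
  let ?d = "\<bar>real (idx n t) - real (idx n s)\<bar>"
  have "?d * tau n = \<bar>real (idx n t) * tau n - real (idx n s) * tau n\<bar>"
    using t by (simp add: abs_mult flip: left_diff_distrib)
  also have "\<dots> \<le> \<bar>t - s\<bar> + tau n"
    using nat_floor_bounds[OF assms(1) t] nat_floor_bounds[OF assms(2) t] by linarith
  finally have d: "?d * tau n \<le> \<bar>t - s\<bar> + tau n" .
  have "?d * (tau n * (\<bar>of_int k\<bar>\<^sup>2 * CV)) = (\<bar>of_int k\<bar>\<^sup>2 * CV) * (?d * tau n)" by (simp add: mult_ac)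
  also have "\<dots> \<le> (\<bar>of_int k\<bar>\<^sup>2 * CV) * (\<bar>t - s\<bar> + tau n)" using d CV_nonneg by (intro mult_left_mono) auto
  finally have le: "?d * (tau n * (\<bar>of_int k\<bar>\<^sup>2 * CV)) \<le> (\<bar>of_int k\<bar>\<^sup>2 * CV) * (\<bar>t - s\<bar> + tau n)" .
  show "cmod (tf n (idx n t) k - tf n (idx n s) k) \<le> (\<bar>of_int k\<bar>\<^sup>2 * CV) * (\<bar>t - s\<bar> + tau n)"
    by (rule order_trans[OF nat_lipschitz[of "\<lambda>m. tf n m k"] le]) (rule traj_step_le)
  show "cmod (tg n (idx n t) k - tg n (idx n s) k) \<le> (\<bar>of_int k\<bar>\<^sup>2 * CV) * (\<bar>t - s\<bar> + tau n)"
    by (rule order_trans[OF nat_lipschitz[of "\<lambda>m. tg n m k"] le]) (rule traj_step_le)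
qed

lemma traj_telescope:
  assumes "k \<in> band n"
  shows "tf n m k = fh k + tau n *\<^sub>R (\<Sum>i<m. Vf (tf n i) (tg n i) k)"
    "tg n m k = gh k + tau n *\<^sub>R (\<Sum>i<m. Vg (tf n i) (tg n i) k)"
  using assms by (induction m) (auto simp: trunc_def step_def scaleR_conv_of_real algebra_simps)

text \<open>The incomplete last cell is enlarged to a whole one, which is legitimate because the
  integrand is nonnegative; the sums then run up to \<open>Suc m\<close>, where the telescoped
  bounds still apply. The band \<open>N\<close> is fixed independently of \<open>n\<close>, so that
  the limit can be taken inside a finite sum.\<close>

lemma traj_integral_bound:
  assumes "T \<ge> 0"
  shows "integral {0..T} (\<lambda>t. \<Sum>k\<in>band N. (wmod 2 (tf n (idx n t)) k)\<^sup>2 + (wmod 2 (tg n (idx n t)) k)\<^sup>2) \<le> E1 / kap"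
    "integral {0..T} (\<lambda>t. \<Sum>k\<in>band N. wmod 2 (tf n (idx n t)) k + wmod 2 (tg n (idx n t)) k) \<le> E / sig"
proof -
  have t: "0 < tau n" by (rule tau_props)
  define m where "m = idx n T"
  have main: "integral {0..T} (\<lambda>t. H (idx n t)) \<le> tau n * (\<Sum>i<Suc m. Q i)"
    if "\<And>i. 0 \<le> H i" "\<And>i. H i \<le> Q i" for H Q :: "nat \<Rightarrow> real"
  proof -
    have "integral {0..T} (\<lambda>t. H (idx n t)) = tau n * (\<Sum>i<m. H i) + (T - real m * tau n) * H m"
      unfolding m_def using has_integral_step'[OF t assms, of H] by (simp add: integral_unique)
    also have "\<dots> \<le> tau n * (\<Sum>i<m. H i) + tau n * H m"
      using nat_floor_bounds[OF assms t] that(1) unfolding m_def by (intro add_left_mono mult_right_mono) auto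
    also have "\<dots> = tau n * (\<Sum>i<Suc m. H i)" by (simp add: algebra_simps)
    also have "\<dots> \<le> tau n * (\<Sum>i<Suc m. Q i)" using t that(2) by (intro mult_left_mono sum_mono) auto
    finally show ?thesis .
  qed
  have "integral {0..T} (\<lambda>t. \<Sum>k\<in>band N. (wmod 2 (tf n (idx n t)) k)\<^sup>2 + (wmod 2 (tg n (idx n t)) k)\<^sup>2)
      \<le> tau n * (\<Sum>i<Suc m. snorm 2 (tf n i) + snorm 2 (tg n i))"
  proof (rule main)
    fix i
    show "(\<Sum>k\<in>band N. (wmod 2 (tf n i) k)\<^sup>2 + (wmod 2 (tg n i) k)\<^sup>2) \<le> snorm 2 (tf n i) + snorm 2 (tg n i)"
      unfolding sum.distrib snorm_def
      by (intro add_mono finite_sum_le_infsum trig_poly_ssummable[OF traj_trig_poly(1)] trig_poly_ssummable[OF traj_trig_poly(2)]) auto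
  qed (auto intro: sum_nonneg)
  also have "\<dots> \<le> E1 / kap"
    using traj_energy(1)[of n "Suc m"] snorm_nonneg[of 1 "tf n (Suc m)"] snorm_nonneg[of 1 "tg n (Suc m)"] kap_pos
    by (simp only: pos_le_divide_eq mult_ac)
  finally show "integral {0..T} (\<lambda>t. \<Sum>k\<in>band N. (wmod 2 (tf n (idx n t)) k)\<^sup>2 + (wmod 2 (tg n (idx n t)) k)\<^sup>2) \<le> E1 / kap" .
  have "integral {0..T} (\<lambda>t. \<Sum>k\<in>band N. wmod 2 (tf n (idx n t)) k + wmod 2 (tg n (idx n t)) k)
      \<le> tau n * (\<Sum>i<Suc m. wnorm 2 (tf n i) + wnorm 2 (tg n i))"
  proof (rule main)
    fix i
    show "(\<Sum>k\<in>band N. wmod 2 (tf n i) k + wmod 2 (tg n i) k) \<le> wnorm 2 (tf n i) + wnorm 2 (tg n i)"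
      unfolding sum.distrib wnorm_def
      by (intro add_mono finite_sum_le_infsum trig_poly_wsummable[OF traj_trig_poly(1)] trig_poly_wsummable[OF traj_trig_poly(2)]) auto
  qed (auto intro: sum_nonneg)
  also have "\<dots> \<le> E / sig"
    using traj_wiener(1)[of n "Suc m"] wnorm_nonneg[of 0 "tf n (Suc m)"] wnorm_nonneg[of 0 "tg n (Suc m)"] sig_pos
    by (simp only: pos_le_divide_eq mult_ac)
  finally show "integral {0..T} (\<lambda>t. \<Sum>k\<in>band N. wmod 2 (tf n (idx n t)) k + wmod 2 (tg n (idx n t)) k) \<le> E / sig" .
qed

text \<open>Norms are lower semicontinuous under convergence of all modes. The bounds may vary with
  \<open>n\<close>, so that decay factors at grid times pass to the decay factor at the limiting
  time.\<close>

lemma limit_state: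
  assumes "\<And>k. (\<lambda>n. F' n k) \<longlonglongrightarrow> f k" "\<And>k. (\<lambda>n. G' n k) \<longlonglongrightarrow> g k"
    and "\<And>n. state (F' n) (G' n)"
  shows "hermitian f" "hermitian g"
    and "\<And>e L. (\<And>n. wnorm 0 (F' n) + wnorm 0 (G' n) \<le> e n) \<Longrightarrow> e \<longlonglongrightarrow> L \<Longrightarrow>
      wsummable 0 f \<and> wsummable 0 g \<and> wnorm 0 f + wnorm 0 g \<le> L"
    and "\<And>e L. (\<And>n. snorm 1 (F' n) + snorm 1 (G' n) \<le> e n) \<Longrightarrow> e \<longlonglongrightarrow> L \<Longrightarrow>
      ssummable 1 f \<and> ssummable 1 g \<and> snorm 1 f + snorm 1 g \<le> L"
proof -
  have h: "hermitian c" if "\<And>k. (\<lambda>n. c' n k) \<longlonglongrightarrow> c k" "\<And>n. hermitian (c' n)" for c' and c :: "int \<Rightarrow> complex"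
    unfolding hermitian_def
  proof (intro conjI allI)
    show "c 0 = 0" using LIMSEQ_unique[OF that(1)[of 0]] that(2) by (simp add: hermitian_def)
    fix k
    have "(\<lambda>n. c' n (- k)) \<longlonglongrightarrow> cnj (c k)" using tendsto_cnj[OF that(1)[of k]] that(2) by (simp add: hermitian_def)
    then show "c (- k) = cnj (c k)" using LIMSEQ_unique that(1) by blast
  qed
  show "hermitian f" "hermitian g" using h[of F' f] h[of G' g] assms by (auto simp: state_def)
  have wl: "(\<lambda>n. wmod p (F' n) k) \<longlonglongrightarrow> wmod p f k" "(\<lambda>n. wmod p (G' n) k) \<longlonglongrightarrow> wmod p g k" for p k
    unfolding wmod_def by (intro tendsto_intros assms)+
  show "wsummable 0 f \<and> wsummable 0 g \<and> wnorm 0 f + wnorm 0 g \<le> L"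
    if e: "\<And>n. wnorm 0 (F' n) + wnorm 0 (G' n) \<le> e n" and L: "e \<longlonglongrightarrow> L" for e L
  proof -
    have "sum (wmod 0 f) (band N) + sum (wmod 0 g) (band N) \<le> L" for N
    proof (rule tendsto_le[OF sequentially_bot L])
      show "(\<lambda>n. sum (wmod 0 (F' n)) (band N) + sum (wmod 0 (G' n)) (band N)) \<longlonglongrightarrow>
          sum (wmod 0 f) (band N) + sum (wmod 0 g) (band N)"
        by (intro tendsto_intros wl)
      have "sum (wmod 0 (F' n)) (band N) + sum (wmod 0 (G' n)) (band N) \<le> wnorm 0 (F' n) + wnorm 0 (G' n)" for n
        unfolding wnorm_def using assms(3)[of n] by (intro add_mono finite_sum_le_infsum) (auto simp: state_def)
      then show "\<forall>\<^sub>F n in sequentially. sum (wmod 0 (F' n)) (band N) + sum (wmod 0 (G' n)) (band N) \<le> e n"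
        using e order_trans by (intro always_eventually allI) blast
    qed
    from pair_band_bound_summable[OF _ _ this] show ?thesis by (simp add: wnorm_def)
  qed
  show "ssummable 1 f \<and> ssummable 1 g \<and> snorm 1 f + snorm 1 g \<le> L"
    if e: "\<And>n. snorm 1 (F' n) + snorm 1 (G' n) \<le> e n" and L: "e \<longlonglongrightarrow> L" for e L
  proof -
    have "(\<Sum>k\<in>band N. (wmod 1 f k)\<^sup>2) + (\<Sum>k\<in>band N. (wmod 1 g k)\<^sup>2) \<le> L" for N
    proof (rule tendsto_le[OF sequentially_bot L])
      show "(\<lambda>n. (\<Sum>k\<in>band N. (wmod 1 (F' n) k)\<^sup>2) + (\<Sum>k\<in>band N. (wmod 1 (G' n) k)\<^sup>2)) \<longlonglongrightarrow>
          (\<Sum>k\<in>band N. (wmod 1 f k)\<^sup>2) + (\<Sum>k\<in>band N. (wmod 1 g k)\<^sup>2)"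
        by (intro tendsto_intros wl)
      have "(\<Sum>k\<in>band N. (wmod 1 (F' n) k)\<^sup>2) + (\<Sum>k\<in>band N. (wmod 1 (G' n) k)\<^sup>2) \<le> snorm 1 (F' n) + snorm 1 (G' n)" for n
        unfolding snorm_def using assms(3)[of n] by (intro add_mono finite_sum_le_infsum) (auto simp: state_def)
      then show "\<forall>\<^sub>F n in sequentially. (\<Sum>k\<in>band N. (wmod 1 (F' n) k)\<^sup>2) + (\<Sum>k\<in>band N. (wmod 1 (G' n) k)\<^sup>2) \<le> e n"
        using e order_trans by (intro always_eventually allI) blast
    qed
    from pair_band_bound_summable[OF _ _ this] show ?thesis by (simp add: snorm_def)
  qed
qed

theorem limit_exists:
  obtains f g :: "real \<Rightarrow> int \<Rightarrow> complex" where
    "\<And>t. t \<ge> 0 \<Longrightarrow> state (f t) (g t)"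
    "\<And>t. t \<ge> 0 \<Longrightarrow> wnorm 0 (f t) + wnorm 0 (g t) \<le> E * exp (- sig * t)"
    "\<And>t. t \<ge> 0 \<Longrightarrow> snorm 1 (f t) + snorm 1 (g t) \<le> E1 * exp (- kap * t)"
    "\<And>t k. t \<ge> 0 \<Longrightarrow> f t k = fh k + integral {0..t} (\<lambda>s. Vf (f s) (g s) k)"
    "\<And>t k. t \<ge> 0 \<Longrightarrow> g t k = gh k + integral {0..t} (\<lambda>s. Vg (f s) (g s) k)"
    "\<And>T N. T \<ge> 0 \<Longrightarrow> integral {0..T} (\<lambda>t. \<Sum>k\<in>band N. (wmod 2 (f t) k)\<^sup>2 + (wmod 2 (g t) k)\<^sup>2) \<le> E1 / kap"
    "\<And>T N. T \<ge> 0 \<Longrightarrow> integral {0..T} (\<lambda>t. \<Sum>k\<in>band N. wmod 2 (f t) k + wmod 2 (g t) k) \<le> E / sig"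
    "\<And>t s k. t \<ge> 0 \<Longrightarrow> s \<ge> 0 \<Longrightarrow> cmod (f t k - f s k) \<le> \<bar>of_int k\<bar>\<^sup>2 * CV * \<bar>t - s\<bar>"
    "\<And>t s k. t \<ge> 0 \<Longrightarrow> s \<ge> 0 \<Longrightarrow> cmod (g t k - g s k) \<le> \<bar>of_int k\<bar>\<^sup>2 * CV * \<bar>t - s\<bar>"
proof -
  \<comment> \<open>Both unknowns are packed into one family indexed by
    \<open>bool \<times> int\<close>, so that a single subsequence serves them.\<close>
  define u where "u n t i = (if fst i then tf n (idx n t) (snd i) else tg n (idx n t) (snd i))" for n t and i :: "bool \<times> int"
  have ub: "cmod (u n t i) \<le> E" for n t i using state_bounds(5,6)[OF traj_state] by (simp add: u_def)
  have ul: "cmod (u n t i - u n s i) \<le> \<bar>of_int (snd i)\<bar>\<^sup>2 * CV * (\<bar>t - s\<bar> + tau n)" if "t \<ge> 0" "s \<ge> 0" for n t s i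
    using traj_near_lipschitz[OF that] by (simp add: u_def)
  obtain r c where r: "strict_mono (r :: nat \<Rightarrow> nat)" and lim: "\<And>t i. t \<ge> 0 \<Longrightarrow> (\<lambda>n. u (r n) t i) \<longlonglongrightarrow> c t i"
    by (rule equi_lipschitz_subsequence[OF ub ul tau_tendsto]) (assumption | rule that)+
  define f where "f t k = c t (True, k)" for t k
  define g where "g t k = c t (False, k)" for t k
  have limf: "(\<lambda>n. tf (r n) (idx (r n) t) k) \<longlonglongrightarrow> f t k" if "t \<ge> 0" for t k
    using lim[OF that, of "(True, k)"] by (simp add: u_def f_def)
  have limg: "(\<lambda>n. tg (r n) (idx (r n) t) k) \<longlonglongrightarrow> g t k" if "t \<ge> 0" for t k
    using lim[OF that, of "(False, k)"] by (simp add: u_def g_def)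
  have tau_r: "(\<lambda>n. tau (r n)) \<longlonglongrightarrow> 0" using LIMSEQ_subseq_LIMSEQ[OF tau_tendsto r] by (simp add: o_def)
  \<comment> \<open>The grid time of the cell containing \<open>t\<close> lies between
    \<open>t - tau (r n)\<close> and \<open>t\<close>.\<close>
  have idx_lim: "(\<lambda>n. tau (r n) * real (idx (r n) t)) \<longlonglongrightarrow> t" if t: "t \<ge> 0" for t
  proof (rule real_tendsto_sandwich)
    show "(\<lambda>n. t - tau (r n)) \<longlonglongrightarrow> t" using tendsto_diff[OF tendsto_const tau_r, of t] by simp
    show "(\<lambda>n. t) \<longlonglongrightarrow> t" by simp
  qed (use nat_floor_bounds[OF t tau_props(1)] in \<open>auto simp: mult.commute intro!: always_eventually less_imp_le, simp add: algebra_simps\<close>)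
  have wien: "wsummable 0 (f t) \<and> wsummable 0 (g t) \<and> wnorm 0 (f t) + wnorm 0 (g t) \<le> E * exp (- sig * t)" if t: "t \<ge> 0" for t
  proof (rule limit_state(3)[OF limf limg traj_state])
    show "wnorm 0 (tf (r n) (idx (r n) t)) + wnorm 0 (tg (r n) (idx (r n) t)) \<le> E * exp (- sig * (tau (r n) * real (idx (r n) t)))" for n
      by (rule traj_wiener(2))
    show "(\<lambda>n. E * exp (- sig * (tau (r n) * real (idx (r n) t)))) \<longlonglongrightarrow> E * exp (- sig * t)"
      by (intro tendsto_intros idx_lim t)
  qed (use t in auto)
  have ener: "ssummable 1 (f t) \<and> ssummable 1 (g t) \<and> snorm 1 (f t) + snorm 1 (g t) \<le> E1 * exp (- kap * t)" if t: "t \<ge> 0" for t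
  proof (rule limit_state(4)[OF limf limg traj_state])
    show "snorm 1 (tf (r n) (idx (r n) t)) + snorm 1 (tg (r n) (idx (r n) t)) \<le> E1 * exp (- kap * (tau (r n) * real (idx (r n) t)))" for n
      by (rule traj_energy(2))
    show "(\<lambda>n. E1 * exp (- kap * (tau (r n) * real (idx (r n) t)))) \<longlonglongrightarrow> E1 * exp (- kap * t)"
      by (intro tendsto_intros idx_lim t)
  qed (use t in auto)
  have st: "state (f t) (g t)" if t: "t \<ge> 0" for t
  proof -
    have "E * exp (- sig * t) \<le> E * 1" "E1 * exp (- kap * t) \<le> E1 * 1"
      using t sig_pos kap_pos pos E1_nonneg by (intro mult_left_mono; simp)+
    then show ?thesis
      using limit_state(1,2)[OF limf[OF t] limg[OF t] traj_state] wien[OF t] ener[OF t]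
      unfolding state_def by (auto simp del: One_nat_def)
  qed
  \<comment> \<open>Passage to the limit under the time integral for any quantity that is bounded on
    \<open>state\<close> and converges pointwise; it is applied to the velocities and to the
    dissipation densities on a band.\<close>
  have int_lim: "(\<lambda>n. integral {0..T} (\<lambda>s. h (tf (r n) (idx (r n) s)) (tg (r n) (idx (r n) s)))) \<longlonglongrightarrow> integral {0..T} (\<lambda>s. h (f s) (g s))"
    if T: "T \<ge> 0" and bnd: "\<And>f g. state f g \<Longrightarrow> norm (h f g) \<le> C"
      and cont: "\<And>t. t \<ge> 0 \<Longrightarrow> (\<lambda>n. h (tf (r n) (idx (r n) t)) (tg (r n) (idx (r n) t))) \<longlonglongrightarrow> h (f t) (g t)"
    for h :: "(int \<Rightarrow> complex) \<Rightarrow> (int \<Rightarrow> complex) \<Rightarrow> 'z::euclidean_space" and T C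
  proof (rule dominated_convergence(2)[where h="\<lambda>_. C"])
    show "(\<lambda>s. h (tf (r n) (idx (r n) s)) (tg (r n) (idx (r n) s))) integrable_on {0..T}" for n
      using has_integral_step'[OF tau_props(1)[of "r n"] T, of "\<lambda>i. h (tf (r n) i) (tg (r n) i)"]
      by (rule has_integral_integrable)
    show "norm (h (tf (r n) (idx (r n) s)) (tg (r n) (idx (r n) s))) \<le> C" for n s by (intro bnd traj_state)
  qed (use cont in auto)
  have eq: "x t k = x0 k + integral {0..t} (\<lambda>s. V (f s) (g s) k)"
    if t: "t \<ge> 0" and xl: "(\<lambda>n. y (r n) (idx (r n) t) k) \<longlonglongrightarrow> x t k"
      and Vb: "\<And>f g. state f g \<Longrightarrow> cmod (V f g k) \<le> C"
      and Vl: "\<And>t. t \<ge> 0 \<Longrightarrow> (\<lambda>n. V (tf (r n) (idx (r n) t)) (tg (r n) (idx (r n) t)) k) \<longlonglongrightarrow> V (f t) (g t) k"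
      and tel: "\<And>n m. k \<in> band n \<Longrightarrow> y n m k = x0 k + tau n *\<^sub>R (\<Sum>i<m. V (tf n i) (tg n i) k)"
    for x :: "real \<Rightarrow> int \<Rightarrow> complex" and y x0 V k t C
  proof -
    \<comment> \<open>The Euler sum stops at the last grid time before \<open>t\<close>, the
      integral at \<open>t\<close> itself. \<open>R\<close> is the difference, of the size of one
      step.\<close>
    define R where "R n = (t - real (idx n t) * tau n) *\<^sub>R V (tf n (idx n t)) (tg n (idx n t)) k" for n
    have R: "(\<lambda>n. R (r n)) \<longlonglongrightarrow> 0"
    proof (rule Lim_null_comparison)
      show "\<forall>\<^sub>F n in sequentially. norm (R (r n)) \<le> tau (r n) * C"
        unfolding R_def norm_scaleR using nat_floor_bounds[OF t tau_props(1)] 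
        by (intro always_eventually allI mult_mono Vb traj_state) (auto simp: abs_le_iff, (smt (verit))+)
      show "(\<lambda>n. tau (r n) * C) \<longlonglongrightarrow> 0" using tendsto_mult_right[OF tau_r, of C] by simp
    qed
    \<comment> \<open>Mode \<open>k\<close> obeys the telescoped identity once it lies in the band,
      and \<open>r n \<ge> n\<close> ensures this eventually.\<close>
    have "\<forall>\<^sub>F n in sequentially. n \<ge> nat \<bar>k\<bar>" by (rule eventually_ge_at_top)
    then have "\<forall>\<^sub>F n in sequentially. y (r n) (idx (r n) t) k =
        x0 k + (integral {0..t} (\<lambda>s. V (tf (r n) (idx (r n) s)) (tg (r n) (idx (r n) s)) k) - R (r n))"
    proof eventually_elim
      case (elim n)
      have "k \<in> band (r n)" using elim seq_suble[OF r, of n] by (simp add: mem_band)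
      moreover have "integral {0..t} (\<lambda>s. V (tf (r n) (idx (r n) s)) (tg (r n) (idx (r n) s)) k) =
          tau (r n) *\<^sub>R (\<Sum>i<idx (r n) t. V (tf (r n) i) (tg (r n) i) k) + R (r n)"
        unfolding R_def
        using has_integral_step'[OF tau_props(1)[of "r n"] t, of "\<lambda>i. V (tf (r n) i) (tg (r n) i) k"]
        by (rule integral_unique)
      ultimately show ?case using tel by simp
    qed
    moreover have "(\<lambda>n. x0 k + (integral {0..t} (\<lambda>s. V (tf (r n) (idx (r n) s)) (tg (r n) (idx (r n) s)) k) - R (r n)))
        \<longlonglongrightarrow> x0 k + (integral {0..t} (\<lambda>s. V (f s) (g s) k) - 0)"
      by (intro tendsto_intros R int_lim[of t "\<lambda>f g. V f g k", OF t Vb Vl])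
    ultimately have "(\<lambda>n. y (r n) (idx (r n) t) k) \<longlonglongrightarrow> x0 k + (integral {0..t} (\<lambda>s. V (f s) (g s) k) - 0)"
      by (rule tendsto_cong[THEN iffD2])
    with xl show ?thesis using LIMSEQ_unique by fastforce
  qed
  have Vl: "(\<lambda>n. Vf (tf (r n) (idx (r n) t)) (tg (r n) (idx (r n) t)) k) \<longlonglongrightarrow> Vf (f t) (g t) k"
    "(\<lambda>n. Vg (tf (r n) (idx (r n) t)) (tg (r n) (idx (r n) t)) k) \<longlonglongrightarrow> Vg (f t) (g t) k" if "t \<ge> 0" for t k
    using that by (intro V_tendsto limf limg always_eventually allI traj_state st; simp)+
  have wl: "(\<lambda>n. wmod p (tf (r n) (idx (r n) t)) k) \<longlonglongrightarrow> wmod p (f t) k"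
      "(\<lambda>n. wmod p (tg (r n) (idx (r n) t)) k) \<longlonglongrightarrow> wmod p (g t) k" if "t \<ge> 0" for p t k
    unfolding wmod_def by (intro tendsto_intros limf limg that)+
  have wb: "wmod 2 f k \<le> \<bar>of_int k\<bar>^2 * E" "wmod 2 g k \<le> \<bar>of_int k\<bar>^2 * E" if "state f g" for f g k
    unfolding wmod_def using state_bounds(5,6)[OF that] by (auto intro: mult_left_mono)
  show ?thesis
  proof
    show "state (f t) (g t)" if "t \<ge> 0" for t by (rule st[OF that])
    show "wnorm 0 (f t) + wnorm 0 (g t) \<le> E * exp (- sig * t)" if "t \<ge> 0" for t using wien[OF that] by blast
    show "snorm 1 (f t) + snorm 1 (g t) \<le> E1 * exp (- kap * t)" if "t \<ge> 0" for t using ener[OF that] by blast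
    show "f t k = fh k + integral {0..t} (\<lambda>s. Vf (f s) (g s) k)" if t: "t \<ge> 0" for t k
      by (rule eq[of t "\<lambda>n m. tf n m" k f Vf _ fh, OF t limf[OF t] V_bound(1) Vl(1) traj_telescope(1)])
    show "g t k = gh k + integral {0..t} (\<lambda>s. Vg (f s) (g s) k)" if t: "t \<ge> 0" for t k
      by (rule eq[of t "\<lambda>n m. tg n m" k g Vg _ gh, OF t limg[OF t] V_bound(2) Vl(2) traj_telescope(2)])
    show "integral {0..T} (\<lambda>t. \<Sum>k\<in>band N. (wmod 2 (f t) k)\<^sup>2 + (wmod 2 (g t) k)\<^sup>2) \<le> E1 / kap" if T: "T \<ge> 0" for T N
    proof (rule LIMSEQ_le_const2[OF int_lim[of T "\<lambda>f g. \<Sum>k\<in>band N. (wmod 2 f k)\<^sup>2 + (wmod 2 g k)\<^sup>2", OF T]])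
      show "norm (\<Sum>k\<in>band N. (wmod 2 f k)\<^sup>2 + (wmod 2 g k)\<^sup>2) \<le> (\<Sum>k\<in>band N. (\<bar>of_int k\<bar>^2 * E)\<^sup>2 + (\<bar>of_int k\<bar>^2 * E)\<^sup>2)"
        if "state f g" for f g
        unfolding real_norm_def by (subst abs_of_nonneg, rule sum_nonneg, simp) (intro sum_mono add_mono power_mono wb[OF that] wmod_nonneg)
      show "(\<lambda>n. \<Sum>k\<in>band N. (wmod 2 (tf (r n) (idx (r n) t)) k)\<^sup>2 + (wmod 2 (tg (r n) (idx (r n) t)) k)\<^sup>2) \<longlonglongrightarrow>
          (\<Sum>k\<in>band N. (wmod 2 (f t) k)\<^sup>2 + (wmod 2 (g t) k)\<^sup>2)" if "t \<ge> 0" for t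
        by (intro tendsto_intros wl that)
    qed (use traj_integral_bound(1)[OF T] in blast)
    show "integral {0..T} (\<lambda>t. \<Sum>k\<in>band N. wmod 2 (f t) k + wmod 2 (g t) k) \<le> E / sig" if T: "T \<ge> 0" for T N
    proof (rule LIMSEQ_le_const2[OF int_lim[of T "\<lambda>f g. \<Sum>k\<in>band N. wmod 2 f k + wmod 2 g k", OF T]])
      show "norm (\<Sum>k\<in>band N. wmod 2 f k + wmod 2 g k) \<le> (\<Sum>k\<in>band N. \<bar>of_int k\<bar>^2 * E + \<bar>of_int k\<bar>^2 * E)"
        if "state f g" for f g
        unfolding real_norm_def by (subst abs_of_nonneg, rule sum_nonneg, simp) (intro sum_mono add_mono wb[OF that])
      show "(\<lambda>n. \<Sum>k\<in>band N. wmod 2 (tf (r n) (idx (r n) t)) k + wmod 2 (tg (r n) (idx (r n) t)) k) \<longlonglongrightarrow>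
          (\<Sum>k\<in>band N. wmod 2 (f t) k + wmod 2 (g t) k)" if "t \<ge> 0" for t
        by (intro tendsto_intros wl that)
    qed (use traj_integral_bound(2)[OF T] in blast)
    have lip: "cmod (a - b) \<le> K * \<bar>t - s\<bar>" if "(\<lambda>n. a' n) \<longlonglongrightarrow> a" "(\<lambda>n. b' n) \<longlonglongrightarrow> b" "\<And>n. cmod (a' n - b' n) \<le> K * (\<bar>t - s\<bar> + tau (r n))"
      for a b a' b' K t s
    proof (rule LIMSEQ_le)
      show "(\<lambda>n. cmod (a' n - b' n)) \<longlonglongrightarrow> cmod (a - b)" by (intro tendsto_intros that)
      have "(\<lambda>n. K * (\<bar>t - s\<bar> + tau (r n))) \<longlonglongrightarrow> K * (\<bar>t - s\<bar> + 0)" by (intro tendsto_intros tau_r)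
      then show "(\<lambda>n. K * (\<bar>t - s\<bar> + tau (r n))) \<longlonglongrightarrow> K * \<bar>t - s\<bar>" by simp
    qed (use that in auto)
    show "cmod (f t k - f s k) \<le> \<bar>of_int k\<bar>\<^sup>2 * CV * \<bar>t - s\<bar>" if "t \<ge> 0" "s \<ge> 0" for t s k
      by (rule lip[OF limf[OF that(1)] limf[OF that(2)] traj_near_lipschitz(1)[OF that]])
    show "cmod (g t k - g s k) \<le> \<bar>of_int k\<bar>\<^sup>2 * CV * \<bar>t - s\<bar>" if "t \<ge> 0" "s \<ge> 0" for t s k
      by (rule lip[OF limg[OF that(1)] limg[OF that(2)] traj_near_lipschitz(2)[OF that]])
  qed
qed

end

section \<open>Fourier series\<close>

lemma filterlim_band: "filterlim band (finite_subsets_at_top UNIV) sequentially"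
  unfolding filterlim_finite_subsets_at_top
proof (intro allI impI)
  fix X :: "int set" assume "finite X \<and> X \<subseteq> UNIV"
  then obtain n where "X \<subseteq> band n" using finite_subset_band by blast
  then have "\<forall>m\<ge>n. X \<subseteq> band m" by (force simp: mem_band)
  then show "\<forall>\<^sub>F m in sequentially. finite (band m) \<and> X \<subseteq> band m \<and> band m \<subseteq> UNIV"
    unfolding eventually_sequentially by auto
qed

text \<open>The bands are cofinal among the finite sets of integers, so unconditional summability
  includes convergence of the symmetric partial sums.\<close>

lemma band_sums:
  fixes a :: "int \<Rightarrow> 'a::{comm_monoid_add,t2_space}"
  assumes "a summable_on UNIV"
  shows "(\<lambda>n. sum a (band n)) \<longlonglongrightarrow> infsum a UNIV"
  using has_sum_infsum[OF assms] filterlim_band unfolding has_sum_def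
  by (rule filterlim_compose)

text \<open>The real part gives a real value for every sequence; for hermitian sequences the series
  is real and nothing is lost.\<close>

definition fser :: "(int \<Rightarrow> complex) \<Rightarrow> real \<Rightarrow> real" where
  "fser c x = Re (\<Sum>\<^sub>\<infinity>k. c k * cis (of_int k * x))"

lemma fser_summable:
  assumes "wsummable 0 c"
  shows "(\<lambda>k. cmod (c k * cis (of_int k * x))) summable_on UNIV" "(\<lambda>k. c k * cis (of_int k * x)) summable_on UNIV"
proof -
  show *: "(\<lambda>k. cmod (c k * cis (of_int k * x))) summable_on UNIV"
    using assms by (simp add: norm_mult wmod_def[abs_def])
  then show "(\<lambda>k. c k * cis (of_int k * x)) summable_on UNIV" by (rule abs_summable_summable)
qed

lemma fser_bound:
  assumes "wsummable 0 c"
  shows "\<bar>fser c x\<bar> \<le> wnorm 0 c"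
proof -
  have "\<bar>fser c x\<bar> \<le> cmod (\<Sum>\<^sub>\<infinity>k. c k * cis (of_int k * x))" unfolding fser_def by (rule abs_Re_le_cmod)
  also have "\<dots> \<le> (\<Sum>\<^sub>\<infinity>k. cmod (c k * cis (of_int k * x)))"
    by (rule norm_infsum_bound) (use fser_summable[OF assms] in auto)
  also have "\<dots> = wnorm 0 c" by (simp add: norm_mult wmod_def wnorm_def)
  finally show ?thesis .
qed

lemma fser_add:
  assumes "wsummable 0 c" "wsummable 0 d"
  shows "fser (\<lambda>k. c k + d k) x = fser c x + fser d x"
  unfolding fser_def distrib_right
  by (subst infsum_add) (use fser_summable assms in auto)

lemma fser_minus: "fser (\<lambda>k. - c k) x = - fser c x"
  unfolding fser_def by (simp add: infsum_uminus)

lemma wsummable_add: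
  assumes "wsummable p c" "wsummable p d"
  shows "wsummable p (\<lambda>k. c k + d k)" "wnorm p (\<lambda>k. c k + d k) \<le> wnorm p c + wnorm p d"
proof -
  have le: "wmod p (\<lambda>k. c k + d k) k \<le> wmod p c k + wmod p d k" for k
    unfolding wmod_def distrib_left[symmetric] by (intro mult_left_mono norm_triangle_ineq) auto
  have s: "(\<lambda>k. wmod p c k + wmod p d k) summable_on UNIV" by (rule summable_on_add[OF assms])
  show w: "wsummable p (\<lambda>k. c k + d k)" by (rule summable_on_comparison_test[OF s le wmod_nonneg])
  show "wnorm p (\<lambda>k. c k + d k) \<le> wnorm p c + wnorm p d"
    unfolding wnorm_def infsum_add[OF assms, symmetric] by (rule infsum_mono[OF w s le])
qed

lemma wsummable_minus: "wsummable p c \<Longrightarrow> wsummable p (\<lambda>k. - c k)" "wnorm p (\<lambda>k. - c k) = wnorm p c"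
  by (auto simp: wnorm_def wmod_def[abs_def])

lemma wsummable_diff:
  assumes "wsummable p c" "wsummable p d"
  shows "wsummable p (\<lambda>k. c k - d k)" "wnorm p (\<lambda>k. c k - d k) \<le> wnorm p c + wnorm p d"
  using wsummable_add[OF assms(1) wsummable_minus(1)[OF assms(2)]] by (auto simp: wsummable_minus(2))

lemma fser_diff:
  assumes "wsummable 0 c" "wsummable 0 d"
  shows "fser (\<lambda>k. c k - d k) x = fser c x - fser d x"
  using fser_add[OF assms(1) wsummable_minus(1)[OF assms(2)]] by (simp add: fser_minus)

lemma trunc_wsummable: "wsummable p (trunc n c)"
  by (rule finite_nonzero_values_imp_summable_on)
    (rule finite_subset[OF _ finite_band[of n]], auto simp: trunc_def wmod_def)

lemma trunc_fser: "fser (trunc n c) x = (\<Sum>k\<in>band n. Re (c k * cis (of_int k * x)))"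
proof -
  have "(\<Sum>\<^sub>\<infinity>k. trunc n c k * cis (of_int k * x)) = (\<Sum>\<^sub>\<infinity>k\<in>band n. c k * cis (of_int k * x))"
    by (rule infsum_cong_neutral) (auto simp: trunc_def)
  then show ?thesis by (simp add: fser_def)
qed

definition wtail :: "nat \<Rightarrow> (int \<Rightarrow> complex) \<Rightarrow> real" where
  "wtail n c = wnorm 0 (\<lambda>k. c k - trunc n c k)"

lemma wtail_eq:
  assumes "wsummable p c"
  shows "wnorm p (\<lambda>k. c k - trunc n c k) = wnorm p c - (\<Sum>k\<in>band n. wmod p c k)"
proof -
  have "wnorm p c = (\<Sum>\<^sub>\<infinity>k. wmod p (\<lambda>k. c k - trunc n c k) k + wmod p (trunc n c) k)"
    unfolding wnorm_def by (rule infsum_cong) (simp add: wmod_def trunc_def)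
  also have "\<dots> = wnorm p (\<lambda>k. c k - trunc n c k) + wnorm p (trunc n c)"
    unfolding wnorm_def by (rule infsum_add) (intro wsummable_diff assms trunc_wsummable)+
  also have "wnorm p (trunc n c) = (\<Sum>\<^sub>\<infinity>k\<in>band n. wmod p c k)"
    unfolding wnorm_def by (rule infsum_cong_neutral) (auto simp: trunc_def wmod_def)
  finally show ?thesis by simp
qed

lemma wtail_tendsto:
  assumes "wsummable 0 c"
  shows "(\<lambda>n. wtail n c) \<longlonglongrightarrow> 0"
proof -
  have "(\<lambda>n. wnorm 0 c - (\<Sum>k\<in>band n. wmod 0 c k)) \<longlonglongrightarrow> wnorm 0 c - wnorm 0 c"
    unfolding wnorm_def by (intro tendsto_intros band_sums assms)
  then show ?thesis unfolding wtail_def wtail_eq[OF assms] by simp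
qed

lemma fser_trunc_diff:
  assumes "wsummable 0 c"
  shows "\<bar>fser c x - fser (trunc n c) x\<bar> \<le> wtail n c"
  unfolding wtail_def fser_diff[OF assms trunc_wsummable, symmetric]
  by (intro fser_bound wsummable_diff assms trunc_wsummable)

lemma fser_uniform_limit:
  assumes "wsummable 0 c"
  shows "uniform_limit UNIV (\<lambda>n. fser (trunc n c)) (fser c) sequentially"
proof (rule uniform_limitI)
  fix e :: real assume "e > 0"
  from tendstoD[OF wtail_tendsto[OF assms] this]
  show "\<forall>\<^sub>F n in sequentially. \<forall>x\<in>UNIV. dist (fser (trunc n c) x) (fser c x) < e"
  proof eventually_elim
    case (elim n)
    then have "wtail n c < e" by simp
    then show ?case using fser_trunc_diff[OF assms, of _ n] by (auto simp: dist_norm abs_minus_commute intro: le_less_trans)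
  qed
qed

lemma fser_trunc_tendsto: "wsummable 0 c \<Longrightarrow> (\<lambda>n. fser (trunc n c) x) \<longlonglongrightarrow> fser c x"
  by (rule tendsto_uniform_limitI[OF fser_uniform_limit]) auto

lemma continuous_fser [continuous_intros]:
  assumes "wsummable 0 c"
  shows "continuous_on S (fser c)"
proof -
  have "continuous_on UNIV (fser (trunc n c))" for n
    unfolding trunc_fser[abs_def] cis.ctr by (auto intro!: continuous_intros)
  then have "continuous_on UNIV (fser c)"
    by (intro uniform_limit_theorem[OF _ fser_uniform_limit[OF assms]]) auto
  then show ?thesis by (rule continuous_on_subset) simp
qed

lemma periodic_fser: "periodic (fser c)"
proof -
  have "cis (of_int k * (x + 2 * pi)) = cis (of_int k * x)" for k x
  proof -
    have "cis (of_int k * (x + 2 * pi)) = cis (of_int k * x) * cis (2 * pi * of_int k)"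
      by (simp add: cis_mult algebra_simps)
    also have "cis (2 * pi * of_int k) = 1" by (rule cis_multiple_2pi) simp
    finally show ?thesis by simp
  qed
  then show ?thesis by (simp add: periodic_def fser_def)
qed

definition dcoef :: "(int \<Rightarrow> complex) \<Rightarrow> int \<Rightarrow> complex" where
  "dcoef c k = \<i> * of_int k * c k"

lemma wmod_dcoef: "wmod p (dcoef c) k = wmod (Suc p) c k"
  by (simp add: wmod_def dcoef_def norm_mult)

lemma wsummable_dcoef [simp]: "wsummable p (dcoef c) \<longleftrightarrow> wsummable (Suc p) c"
  by (simp add: wmod_dcoef[abs_def])

lemma wnorm_dcoef [simp]: "wnorm p (dcoef c) = wnorm (Suc p) c"
  by (simp add: wnorm_def wmod_dcoef)

lemma hermitian_dcoef: "hermitian c \<Longrightarrow> hermitian (dcoef c)"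
  by (auto simp: hermitian_def dcoef_def)

lemma wsummable_Suc0: "c 0 = 0 \<Longrightarrow> wsummable 1 c \<Longrightarrow> wsummable 0 c"
  by (rule wsummable_mono[of c 0 1]) auto

lemma has_real_derivative_trunc_fser:
  "(fser (trunc n c) has_real_derivative fser (trunc n (dcoef c)) x) (at x)"
proof -
  have "((\<lambda>x. Re (c k * cis (of_int k * x))) has_real_derivative Re (dcoef c k * cis (of_int k * x))) (at x)" for k
    unfolding cis.ctr dcoef_def
    by (auto intro!: derivative_eq_intros simp: algebra_simps)
  then show ?thesis unfolding trunc_fser[abs_def] by (intro DERIV_sum) auto
qed

text \<open>Term-by-term differentiation. The derivatives of the partial sums converge uniformly
  because the tail of the first-order Wiener norm tends to zero; the function produced by the
  general theorem is the series by uniqueness of limits.\<close>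

lemma has_real_derivative_fser:
  assumes "c 0 = 0" "wsummable 1 c"
  shows "(fser c has_real_derivative fser (dcoef c) x) (at x)"
proof -
  have d: "wsummable 0 (dcoef c)" using assms by simp
  have w: "wsummable 0 c" by (rule wsummable_Suc0[OF assms])
  have "\<exists>g. \<forall>x\<in>UNIV. (\<lambda>n. fser (trunc n c) x) \<longlonglongrightarrow> g x \<and> (g has_derivative (*) (fser (dcoef c) x)) (at x within UNIV)"
  proof (rule has_derivative_sequence)
    show "(fser (trunc n c) has_derivative (*) (fser (trunc n (dcoef c)) x)) (at x within UNIV)" for n x
      using has_real_derivative_trunc_fser[of n c x] by (simp add: has_field_derivative_def)
    show "\<forall>\<^sub>F n in sequentially. \<forall>x\<in>UNIV. \<forall>h. norm (fser (trunc n (dcoef c)) x * h - fser (dcoef c) x * h) \<le> e * norm h"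
      if "e > 0" for e :: real
      using tendstoD[OF wtail_tendsto[OF d] that]
    proof eventually_elim
      case (elim n)
      then have "\<bar>fser (trunc n (dcoef c)) x - fser (dcoef c) x\<bar> \<le> e" for x
        using fser_trunc_diff[OF d, of x n] by (simp add: abs_minus_commute)
      then show ?case by (auto simp: left_diff_distrib[symmetric] abs_mult intro: mult_right_mono)
    qed
    show "(\<lambda>n. fser (trunc n c) 0) \<longlonglongrightarrow> fser c 0" by (rule fser_trunc_tendsto[OF w])
  qed auto
  then obtain g where g: "\<And>x. (\<lambda>n. fser (trunc n c) x) \<longlonglongrightarrow> g x" "\<And>x. (g has_real_derivative fser (dcoef c) x) (at x)"
    by (auto simp: has_field_derivative_def)
  have "g = fser c" using LIMSEQ_unique[OF g(1) fser_trunc_tendsto[OF w]] by auto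
  with g(2) show ?thesis by simp
qed

section \<open>Fourier coefficients of a Fourier series\<close>

lemma LINT_continuous:
  fixes f :: "real \<Rightarrow> 'b::euclidean_space"
  assumes "continuous_on {a..b} f"
  shows "(LINT x|lebesgue_on {a..b}. f x) = integral {a..b} f"
  by (rule lebesgue_integral_eq_integral) (use continuous_imp_integrable_real[OF assms] in auto)

lemma LINT_cis: "(LINT x|torus. cis (of_int m * x)) = (if m = 0 then 2 * pi else 0)"
proof (cases "m = 0")
  case False
  have "((\<lambda>x. cis (of_int m * x)) has_integral (- \<i> / of_int m * cis (of_int m * pi) - - \<i> / of_int m * cis (of_int m * (-pi)))) {-pi..pi}"
  proof (rule fundamental_theorem_of_calculus)
    show "((\<lambda>x. - \<i> / of_int m * cis (of_int m * x)) has_vector_derivative cis (of_int m * x)) (at x within {-pi..pi})" for x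
      unfolding has_vector_derivative_complex_iff using False
      by (auto intro!: derivative_eq_intros simp: Complex.Re_divide Complex.Im_divide power2_eq_square field_simps)
  qed auto
  moreover have "cis (of_int m * pi) = cis (of_int m * (-pi))"
    by (simp add: complex_eq_iff sin_times_pi_eq_0 mult.commute)
  ultimately have "((\<lambda>x. cis (of_int m * x)) has_integral 0) {-pi..pi}" by simp
  then show ?thesis using False
    by (subst LINT_continuous) (auto intro!: continuous_intros simp: integral_unique)
qed (simp add: measure_restrict_space scaleR_conv_of_real)

lemma exp_eq_cis: "exp (- \<i> * of_int k * complex_of_real x) = cis (- (of_int k * x))"
  by (simp add: cis_conv_exp mult.assoc)

lemma LINT_torus_bound:
  fixes f :: "real \<Rightarrow> 'b::euclidean_space"
  assumes "\<And>x. norm (f x) \<le> B"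
  shows "norm (LINT x|torus. f x) \<le> 2 * pi * B"
proof (cases "integrable torus f")
  case True
  interpret finite_measure torus by (rule finite_measure_lebesgue_on) simp
  have "norm (LINT x|torus. f x) \<le> (LINT x|torus. norm (f x))" by (rule integral_norm_bound)
  also have "\<dots> \<le> (LINT x|torus. B)" using True assms by (intro integral_mono) auto
  also have "\<dots> = 2 * pi * B" by (simp add: measure_restrict_space)
  finally show ?thesis .
next
  \<comment> \<open>A function that is not integrable has integral 0 by convention, so only
    \<open>0 \<le> B\<close> is to be seen.\<close>
  case False
  have "0 \<le> B" using assms[of 0] norm_ge_zero order_trans by blast
  then show ?thesis using False by (simp add: not_integrable_integral_eq)
qed

lemma trunc_fser_complex:
  assumes "hermitian c"
  shows "complex_of_real (fser (trunc n c) x) = (\<Sum>k\<in>band n. c k * cis (of_int k * x))"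
proof -
  let ?S = "\<Sum>k\<in>band n. c k * cis (of_int k * x)"
  have "cnj ?S = (\<Sum>k\<in>band n. c (- k) * cis (of_int (- k) * x))"
    using assms by (simp add: hermitian_minus cis_cnj)
  also have "\<dots> = ?S"
    by (rule sum.reindex_bij_witness[of _ uminus uminus]) (auto simp: mem_band)
  finally have "Im ?S = 0" using Reals_cnj_iff complex_is_Real_iff by blast
  then show ?thesis by (simp add: trunc_fser complex_eq_iff)
qed

lemma fourier_trunc:
  assumes "hermitian c" "k \<in> band n"
  shows "fourier (fser (trunc n c)) k = c k"
proof -
  have "(LINT x|torus. complex_of_real (fser (trunc n c) x) * exp (- \<i> * of_int k * complex_of_real x))
     = (LINT x|torus. (\<Sum>j\<in>band n. c j * cis (of_int (j - k) * x)))"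
    unfolding exp_eq_cis trunc_fser_complex[OF assms(1)] sum_distrib_right
    unfolding mult.assoc cis_mult by (simp add: algebra_simps)
  also have "\<dots> = (\<Sum>j\<in>band n. c j * (LINT x|torus. cis (of_int (j - k) * x)))"
    by (subst Bochner_Integration.integral_sum)
      (auto intro!: continuous_imp_integrable_real continuous_intros)
  also have "\<dots> = (\<Sum>j\<in>band n. if j = k then c k * (2 * pi) else 0)"
    unfolding LINT_cis by (intro sum.cong) auto
  also have "\<dots> = c k * (2 * pi)" using assms(2) by simp
  finally show ?thesis by (simp add: fourier_def)
qed

text \<open>A Fourier coefficient is continuous for uniform convergence, and for the partial sums it
  has the value \<open>c k\<close> as soon as \<open>k\<close> lies in the band.\<close>

lemma fourier_fser:
  assumes "hermitian c" "wsummable 0 c"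
  shows "fourier (fser c) k = c k"
proof -
  have "cmod (fourier (fser c) k - c k) \<le> wtail n c" if "n \<ge> nat \<bar>k\<bar>" for n
  proof -
    let ?e = "\<lambda>x. exp (- \<i> * of_int k * complex_of_real x)"
    have kb: "k \<in> band n" using that by (simp add: mem_band)
    have i: "integrable torus (\<lambda>x. complex_of_real (fser d x) * ?e x)" if "wsummable 0 d" for d
      by (intro continuous_imp_integrable_real continuous_intros that)
    have "fourier (fser c) k - c k = fourier (fser c) k - fourier (fser (trunc n c)) k"
      using fourier_trunc[OF assms(1) kb] by simp
    also have "\<dots> = (LINT x|torus. complex_of_real (fser c x) * ?e x - complex_of_real (fser (trunc n c) x) * ?e x) / complex_of_real (2 * pi)"
      unfolding fourier_def diff_divide_distrib[symmetric]
      by (subst Bochner_Integration.integral_diff[OF i i]) (auto intro: assms trunc_wsummable)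
    also have "cmod \<dots> \<le> (2 * pi * wtail n c) / (2 * pi)"
    proof -
      have "cmod (LINT x|torus. complex_of_real (fser c x) * ?e x - complex_of_real (fser (trunc n c) x) * ?e x) \<le> 2 * pi * wtail n c"
      proof (rule LINT_torus_bound)
        fix x
        have "cmod (complex_of_real (fser c x) * ?e x - complex_of_real (fser (trunc n c) x) * ?e x)
          = cmod (complex_of_real (fser c x - fser (trunc n c) x)) * cmod (?e x)"
          by (simp only: left_diff_distrib[symmetric] norm_mult of_real_diff)
        also have "\<dots> = \<bar>fser c x - fser (trunc n c) x\<bar>" unfolding exp_eq_cis norm_of_real by simp
        finally show "cmod (complex_of_real (fser c x) * ?e x - complex_of_real (fser (trunc n c) x) * ?e x) \<le> wtail n c"
          using fser_trunc_diff[OF assms(2), of x n] by simp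
      qed
      moreover have "cmod (z / complex_of_real (2 * pi)) = cmod z / (2 * pi)" for z by (simp add: norm_divide)
      ultimately show ?thesis by (simp only: divide_right_mono pi_ge_zero mult_nonneg_nonneg zero_le_numeral)
    qed
    finally show ?thesis by simp
  qed
  then have "cmod (fourier (fser c) k - c k) \<le> 0"
    by (intro tendsto_lowerbound[OF wtail_tendsto[OF assms(2)]] eventually_sequentiallyI[of "nat \<bar>k\<bar>"]) auto
  then show ?thesis by simp
qed

lemma mean_eq_fourier: "complex_of_real (mean u) = fourier u 0"
  by (simp add: mean_def fourier_def flip: integral_complex_of_real)

lemma mean_fser:
  assumes "hermitian c" "wsummable 0 c"
  shows "mean (fser c) = 0"
proof -
  have "complex_of_real (mean (fser c)) = 0"
    unfolding mean_eq_fourier fourier_fser[OF assms] using assms(1) by (rule hermitian_zero)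
  then show ?thesis by simp
qed

section \<open>Uniqueness of Fourier coefficients of integrable functions\<close>

lemma borel_measurable_lebesgue_on_AE:
  fixes f :: "real \<Rightarrow> 'b::euclidean_space"
  assumes "f \<in> borel_measurable (lebesgue_on S)" "S \<in> sets lebesgue" "AE x in lebesgue_on S. f x = g x"
  shows "g \<in> borel_measurable (lebesgue_on S)"
proof -
  have "(\<lambda>x. if x \<in> S then f x else 0) \<in> borel_measurable lebesgue"
    using assms by (simp add: borel_measurable_if)
  moreover have "AE x in lebesgue. (if x \<in> S then f x else 0) = (if x \<in> S then g x else 0)"
    using assms(2,3) by (subst (asm) AE_restrict_space_iff) auto
  ultimately have "(\<lambda>x. if x \<in> S then g x else 0) \<in> borel_measurable lebesgue" by (rule borel_measurable_AE)
  then show ?thesis using assms(2) by (simp add: borel_measurable_if)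
qed

text \<open>The Borel sets over which \<open>w\<close> integrates to zero are closed under
  complements and under disjoint unions, the latter by dominated convergence with majorant
  \<open>\<bar>w\<bar>\<close>, so the intervals generate all of them. A Lebesgue set differs from a
  Borel set only by a null set.\<close>

lemma integral_zero_on_borel_subsets:
  fixes w :: "real \<Rightarrow> real"
  assumes w: "integrable (lebesgue_on {p..q}) w"
    and iv: "\<And>a b. \<lbrakk>p \<le> a; a \<le> b; b \<le> q\<rbrakk> \<Longrightarrow> (LINT x|lebesgue_on {p..q}. indicator {a..b} x * w x) = 0"
  shows "AE x in lebesgue_on {p..q}. w x = 0"
proof (cases "p \<le> q")
  case False
  then show ?thesis by (auto intro!: AE_I2)
next
  case pq: True
  let ?M = "lebesgue_on {p..q}"
  have borel_sets: "A \<inter> {p..q} \<in> sets ?M" if "A \<in> sets borel" for A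
    using that by (auto simp: sets_restrict_space)
  have ind: "integrable ?M (\<lambda>x. indicator A x * w x)" if "A \<in> sets borel" for A
  proof -
    have "integrable ?M (\<lambda>x. indicator (A \<inter> {p..q}) x *\<^sub>R w x)"
      by (rule integrable_mult_indicator[OF borel_sets[OF that] w])
    then show ?thesis by (rule Bochner_Integration.integrable_cong[THEN iffD1, rotated 2]) (auto simp: indicator_def)
  qed
  have full: "(LINT x|?M. w x) = 0"
  proof -
    have "(LINT x|?M. indicator {p..q} x * w x) = 0" by (rule iv) (use pq in auto)
    moreover have "(LINT x|?M. indicator {p..q} x * w x) = (LINT x|?M. w x)"
      by (rule Bochner_Integration.integral_cong) auto
    ultimately show ?thesis by simp
  qed
  have bor: "(LINT x|?M. indicator A x * w x) = 0" if "A \<in> sets borel" for A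
    using that
  proof (induction A rule: borel_set_induct)
    case (interval a b)
    show ?case
    proof (cases "max a p \<le> min b q")
      case True
      have "(LINT x|?M. indicator {a..b} x * w x) = (LINT x|?M. indicator {max a p..min b q} x * w x)"
        by (rule Bochner_Integration.integral_cong) (auto simp: indicator_def)
      also have "\<dots> = 0" by (rule iv) (use True in auto)
      finally show ?thesis .
    next
      case False
      then have "indicator {a..b} x * w x = 0" if "x \<in> {p..q}" for x using that by (auto simp: indicator_def)
      then have "(LINT x|?M. indicator {a..b} x * w x) = (LINT x|?M. 0)"
        by (intro Bochner_Integration.integral_cong) auto
      then show ?thesis by simp
    qed
  next
    case (compl A)
    have "(LINT x|?M. indicator (-A) x * w x) = (LINT x|?M. w x - indicator A x * w x)"
      by (rule Bochner_Integration.integral_cong) (auto simp: indicator_def)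
    also have "\<dots> = 0" using compl full by (subst Bochner_Integration.integral_diff[OF w ind]) auto
    finally show ?case .
  next
    case (union f)
    have s: "(\<lambda>i. indicator (f i) x * w x) sums (indicator (\<Union>i. f i) x * w x)" for x
    proof (cases "x \<in> (\<Union>i. f i)")
      case True
      then obtain i where i: "x \<in> f i" by auto
      then have "x \<notin> f j" if "j \<noteq> i" for j using union(1) that by (auto simp: disjoint_family_on_def)
      then have "(\<lambda>j. indicator (f j) x * w x) = (\<lambda>j. if j = i then w x else 0)"
        using i by (auto simp: indicator_def fun_eq_iff)
      then show ?thesis using True sums_single[of i "\<lambda>_. w x"] by simp
    qed auto
    have "(\<lambda>n. LINT x|?M. (\<Sum>i<n. indicator (f i) x * w x)) \<longlonglongrightarrow> (LINT x|?M. indicator (\<Union>i. f i) x * w x)"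
    proof (rule integral_dominated_convergence[where w="\<lambda>x. \<bar>w x\<bar>"])
      show "AE x in ?M. (\<lambda>n. \<Sum>i<n. indicator (f i) x * w x) \<longlonglongrightarrow> indicator (\<Union>i. f i) x * w x"
        using s by (auto simp: sums_def)
      show "AE x in ?M. norm (\<Sum>i<n. indicator (f i) x * w x) \<le> \<bar>w x\<bar>" for n
      proof (rule AE_I2)
        fix x
        have "(\<Sum>i<n. indicator (f i) x :: real) = indicator (\<Union>i<n. f i) x"
          using union(1) by (intro indicator_UN_disjoint[symmetric]) (auto simp: disjoint_family_on_def)
        then show "norm (\<Sum>i<n. indicator (f i) x * w x) \<le> \<bar>w x\<bar>"
          by (simp flip: sum_distrib_right add: abs_mult indicator_def)
      qed
      show "(\<lambda>x. indicator (\<Union>i. f i) x * w x) \<in> borel_measurable ?M"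
        using union(2) by (intro borel_measurable_integrable ind) auto
      show "(\<lambda>x. \<Sum>i<n. indicator (f i) x * w x) \<in> borel_measurable ?M" for n
        using union(2) by (intro borel_measurable_integrable Bochner_Integration.integrable_sum ind) auto
    qed (use w in auto)
    moreover have "(LINT x|?M. (\<Sum>i<n. indicator (f i) x * w x)) = 0" for n
      using union by (subst Bochner_Integration.integral_sum) (auto intro: ind)
    ultimately show ?case by (simp add: LIMSEQ_const_iff)
  qed simp
  interpret finite_measure ?M by (rule finite_measure_lebesgue_on) simp
  show ?thesis
  proof (rule density_zero[OF w])
    fix A assume A: "A \<in> sets ?M"
    then have "A \<in> sets lebesgue" "A \<subseteq> {p..q}" by (auto simp: sets_restrict_space)
    then obtain S N N' where A': "A = S \<union> N" "N \<subseteq> N'" "N' \<in> null_sets lborel" "S \<in> sets lborel"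
      by (elim sets_completionE)
    have "AE x in lebesgue. x \<notin> N'" using A'(3) by (intro AE_not_in null_sets_completionI)
    then have "AE x in ?M. x \<notin> N'" by (subst AE_restrict_space_iff) (auto elim: eventually_mono)
    then have "AE x in ?M. indicator A x *\<^sub>R w x = indicator S x * w x"
      using A'(1,2) by (auto elim!: eventually_mono simp: indicator_def)
    moreover have "(\<lambda>x. indicator A x *\<^sub>R w x) \<in> borel_measurable ?M"
      using integrable_mult_indicator[OF A w] by (rule borel_measurable_integrable)
    moreover have "(\<lambda>x. indicator S x * w x) \<in> borel_measurable ?M"
      using ind[of S] A'(4) by (auto intro: borel_measurable_integrable)
    ultimately have "(LINT x|?M. indicator A x *\<^sub>R w x) = (LINT x|?M. indicator S x * w x)"
      by (intro integral_cong_AE)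
    then show "set_lebesgue_integral ?M A w = 0"
      using bor[of S] A'(4) by (simp add: set_lebesgue_integral_def)
  qed
qed

lemma integrable_bounded_mult:
  fixes w h :: "real \<Rightarrow> 'b::{real_normed_field,banach,second_countable_topology}"
  assumes "integrable M w" "h \<in> borel_measurable M" "\<And>x. norm (h x) \<le> B"
  shows "integrable M (\<lambda>x. w x * h x)"
proof (rule Bochner_Integration.integrable_bound)
  show "integrable M (\<lambda>x. B * norm (w x))" using assms(1) by auto
  show "(\<lambda>x. w x * h x) \<in> borel_measurable M" using assms(1,2) by auto
  have "norm (w x * h x) \<le> B * norm (w x)" for x
    unfolding norm_mult using assms(3)[of x] by (simp add: mult.commute mult_right_mono)
  then show "AE x in M. norm (w x * h x) \<le> norm (B * norm (w x))"
    by (intro AE_I2) (smt (verit) real_norm_def)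
qed

lemma measurable_torus_continuous:
  fixes h :: "real \<Rightarrow> 'b::euclidean_space"
  assumes "continuous_on UNIV h"
  shows "h \<in> borel_measurable (lebesgue_on S)"
  using borel_measurable_continuous_onI[OF assms] by (intro measurable_restrict_space1 measurable_completion) auto

text \<open>\<open>w\<close> is orthogonal to the polynomials in \<open>cos (x - m)\<close>, hence by Weierstrass to continuous
  functions of \<open>cos (x - m)\<close>, hence to the indicators of all arcs centred at \<open>m\<close>.\<close>

lemma fourier_zero_imp_AE_zero:
  assumes w: "integrable torus w" and f0: "\<And>k. fourier w k = 0"
  shows "AE x in torus. w x = 0"
proof -
  let ?w = "\<lambda>x. complex_of_real (w x)"
  have wi: "integrable torus ?w" using w by simp
  have iq: "integrable torus (\<lambda>x. ?w x * h x)" if "continuous_on UNIV h" "\<And>x. norm (h x) \<le> B" for h B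
    by (rule integrable_bounded_mult[OF wi measurable_torus_continuous[OF that(1)] that(2)])
  have e0: "(LINT x|torus. ?w x * cis (of_int k * x)) = 0" for k
    using f0[of "-k"] by (simp add: fourier_def cis_conv_exp mult_ac)
  \<comment> \<open>By induction on the power: a factor \<open>cos (x - m)\<close> is a combination
    of exponentials of frequencies 1 and -1, hence shifts \<open>k\<close> by one in either
    direction. For this reason \<open>k\<close> is general in the induction.\<close>
  have pw: "(LINT x|torus. ?w x * (complex_of_real (cos (x - m) ^ j) * cis (of_int k * x))) = 0" for j m k
  proof (induction j arbitrary: k)
    case 0
    then show ?case using e0 by simp
  next
    case (Suc j)
    have cs: "complex_of_real (cos (x - m)) * cis (of_int k * x) =
        cis (- m) / 2 * cis (of_int (k + 1) * x) + cis m / 2 * cis (of_int (k - 1) * x)" for x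
    proof -
      have "complex_of_real (cos (x - m)) = (cis (x - m) + cis (- (x - m))) / 2"
        by (simp add: complex_eq_iff cos_diff sin_diff)
      then show ?thesis by (simp add: cis_mult algebra_simps add_divide_distrib)
    qed
    have b: "norm (complex_of_real (cos (x - m) ^ j) * cis (of_int k * x)) \<le> 1" for x k
      by (simp add: norm_mult norm_power power_abs power_le_one)
    have c: "continuous_on UNIV (\<lambda>x. complex_of_real (cos (x - m) ^ j) * cis (of_int k * x))" for k
      by (intro continuous_intros)
    have "(LINT x|torus. ?w x * (complex_of_real (cos (x - m) ^ Suc j) * cis (of_int k * x)))
      = (LINT x|torus. cis (- m) / 2 * (?w x * (complex_of_real (cos (x - m) ^ j) * cis (of_int (k + 1) * x)))
        + cis m / 2 * (?w x * (complex_of_real (cos (x - m) ^ j) * cis (of_int (k - 1) * x))))"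
    proof (rule Bochner_Integration.integral_cong[OF refl])
      fix x
      have "?w x * (complex_of_real (cos (x - m) ^ Suc j) * cis (of_int k * x)) =
          ?w x * complex_of_real (cos (x - m) ^ j) * (complex_of_real (cos (x - m)) * cis (of_int k * x))"
        by (simp add: mult_ac)
      also have "\<dots> = cis (- m) / 2 * (?w x * (complex_of_real (cos (x - m) ^ j) * cis (of_int (k + 1) * x)))
        + cis m / 2 * (?w x * (complex_of_real (cos (x - m) ^ j) * cis (of_int (k - 1) * x)))"
        unfolding cs by (simp only: distrib_left mult_ac)
      finally show "?w x * (complex_of_real (cos (x - m) ^ Suc j) * cis (of_int k * x)) = \<dots>" .
    qed
    also have "\<dots> = cis (- m) / 2 * (LINT x|torus. ?w x * (complex_of_real (cos (x - m) ^ j) * cis (of_int (k + 1) * x)))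
       + cis m / 2 * (LINT x|torus. ?w x * (complex_of_real (cos (x - m) ^ j) * cis (of_int (k - 1) * x)))"
      by (subst Bochner_Integration.integral_add, (rule integrable_mult_right, rule iq[OF c b])+)
        (simp only: integral_mult_right_zero)
    also have "\<dots> = 0" unfolding Suc.IH by simp
    finally show ?case .
  qed
  have pw': "(LINT x|torus. w x * cos (x - m) ^ j) = 0" for m j
  proof -
    have "complex_of_real (LINT x|torus. w x * cos (x - m) ^ j) = 0"
      using pw[of m j 0] by (simp flip: integral_complex_of_real)
    then show ?thesis by simp
  qed
  have iqr: "integrable torus (\<lambda>x. w x * h x)" if "continuous_on UNIV h" "\<And>x. norm (h x) \<le> B" for h :: "real \<Rightarrow> real" and B
    by (rule integrable_bounded_mult[OF w measurable_torus_continuous[OF that(1)] that(2)])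
  have cont: "(LINT x|torus. w x * H (cos (x - m))) = 0" if H: "continuous_on UNIV H" for H :: "real \<Rightarrow> real" and m
  proof -
    have hb: "\<exists>B. \<forall>x. \<bar>h (cos (x - m))\<bar> \<le> B" if "continuous_on UNIV h" for h :: "real \<Rightarrow> real"
    proof -
      have "compact (h ` {-1..1})" using that by (intro compact_continuous_image) (auto intro: continuous_on_subset)
      then obtain B where "\<forall>y\<in>h ` {-1..1}. norm y \<le> B" using compact_imp_bounded bounded_iff by blast
      then have "\<forall>x. \<bar>h (cos (x - m))\<bar> \<le> B" by auto
      then show ?thesis ..
    qed
    have cc: "continuous_on UNIV (\<lambda>x. h (cos (x - m)))" if "continuous_on UNIV h" for h :: "real \<Rightarrow> real"
      by (rule continuous_on_compose2[OF that]) (auto intro!: continuous_intros)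
    have ih: "integrable torus (\<lambda>x. w x * h (cos (x - m)))" if "continuous_on UNIV h" for h
    proof -
      obtain B where "\<forall>x. \<bar>h (cos (x - m))\<bar> \<le> B" using hb[OF \<open>continuous_on UNIV h\<close>] by auto
      then show ?thesis by (intro iqr[OF cc[OF \<open>continuous_on UNIV h\<close>], of B]) auto
    qed
    define I where "I = (LINT x|torus. \<bar>w x\<bar>)"
    have I0: "0 \<le> I" by (simp add: I_def)
    have "\<bar>LINT x|torus. w x * H (cos (x - m))\<bar> \<le> e * I" if e: "e > 0" for e
    proof -
      have H1: "continuous_on {-1..1} H" using H by (rule continuous_on_subset) simp
      obtain g where g: "real_polynomial_function g" "\<And>x. x \<in> {-1..1} \<Longrightarrow> \<bar>H x - g x\<bar> < e"
        by (rule Stone_Weierstrass_real_polynomial_function[OF compact_Icc H1 e]) (assumption | rule that)+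
      then obtain a n where ga: "g = (\<lambda>x. \<Sum>i\<le>n. a i * x ^ i)" by (auto simp: real_polynomial_function_iff_sum)
      have gc: "continuous_on UNIV g" unfolding ga by (intro continuous_intros)
      have "(LINT x|torus. w x * g (cos (x - m))) = (LINT x|torus. (\<Sum>i\<le>n. a i * (w x * cos (x - m) ^ i)))"
        by (simp add: ga sum_distrib_left mult_ac)
      also have "\<dots> = (\<Sum>i\<le>n. a i * (LINT x|torus. w x * cos (x - m) ^ i))"
        by (subst Bochner_Integration.integral_sum)
          (auto intro!: Bochner_Integration.integrable_mult_right iqr[where B=1] continuous_intros simp: power_abs power_le_one)
      also have "\<dots> = 0" by (simp add: pw')
      finally have "(LINT x|torus. w x * H (cos (x - m))) = (LINT x|torus. w x * H (cos (x - m)) - w x * g (cos (x - m)))"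
        by (subst Bochner_Integration.integral_diff) (auto intro: ih H gc)
      also have "\<bar>\<dots>\<bar> \<le> (LINT x|torus. e * \<bar>w x\<bar>)"
      proof (rule order_trans[OF integral_abs_bound integral_mono])
        show "integrable torus (\<lambda>x. \<bar>w x * H (cos (x - m)) - w x * g (cos (x - m))\<bar>)"
          by (intro Bochner_Integration.integrable_abs Bochner_Integration.integrable_diff ih H gc)
        fix x
        have "\<bar>H (cos (x - m)) - g (cos (x - m))\<bar> \<le> e" using g(2)[of "cos (x - m)"] by auto
        then show "\<bar>w x * H (cos (x - m)) - w x * g (cos (x - m))\<bar> \<le> e * \<bar>w x\<bar>"
          by (simp add: right_diff_distrib[symmetric] abs_mult mult_right_mono mult.commute[of e] mult_left_mono)
      qed (use w in auto)
      also have "\<dots> = e * I" by (simp add: I_def)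
      finally show ?thesis .
    qed
    then have *: "\<bar>LINT x|torus. w x * H (cos (x - m))\<bar> \<le> e * I" if "e > 0" for e using that by blast
    have "\<bar>LINT x|torus. w x * H (cos (x - m))\<bar> \<le> 0 + e" if "e > 0" for e
    proof -
      have "e / (I + 1) * I \<le> e" using that I0 by (simp add: field_simps)
      then show ?thesis using *[of "e / (I + 1)"] that I0 by simp
    qed
    then have "\<bar>LINT x|torus. w x * H (cos (x - m))\<bar> \<le> 0" by (rule field_le_epsilon)
    then show ?thesis by simp
  qed
  \<comment> \<open>The indicator is the pointwise limit of ramps that are continuous functions of
    \<open>cos (x - m)\<close>. The ramps vanish where the cosine equals \<open>r\<close>, so the
    limit is the indicator of the strict inequality.\<close>
  have openiv: "(LINT x|torus. w x * indicator {x. cos (x - m) > r} x) = 0" for m r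
  proof -
    have "(\<lambda>n. LINT x|torus. w x * min 1 (max 0 (real n * (cos (x - m) - r)))) \<longlonglongrightarrow> (LINT x|torus. w x * indicator {x. cos (x - m) > r} x)"
    proof (rule integral_dominated_convergence[where w="\<lambda>x. \<bar>w x\<bar>"])
      show "AE x in torus. (\<lambda>n. w x * min 1 (max 0 (real n * (cos (x - m) - r)))) \<longlonglongrightarrow> w x * indicator {x. cos (x - m) > r} x"
      proof (rule AE_I2, rule tendsto_mult_left)
        fix x
        show "(\<lambda>n. min 1 (max 0 (real n * (cos (x - m) - r)))) \<longlonglongrightarrow> indicator {x. cos (x - m) > r} x"
        proof (cases "cos (x - m) > r")
          case True
          obtain N where N: "real N * (cos (x - m) - r) > 1" using reals_Archimedean3[of "cos (x - m) - r"] True by auto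
          have one: "1 \<le> real n * (cos (x - m) - r)" if "n \<ge> N" for n
          proof -
            have "real N * (cos (x - m) - r) \<le> real n * (cos (x - m) - r)"
              using True that by (intro mult_right_mono) auto
            with N show ?thesis by linarith
          qed
          have "min 1 (max 0 (real n * (cos (x - m) - r))) = 1" if "n \<ge> N" for n
            using one[OF that] by (simp add: min_def max_def)
          then show ?thesis using True by (intro tendsto_eventually eventually_sequentiallyI[of N]) auto
        next
          case False
          have "max 0 (real n * (cos (x - m) - r)) = 0" for n
            using False by (intro max_absorb1 mult_nonneg_nonpos) auto
          then show ?thesis using False by simp
        qed
      qed
      have "(\<lambda>x. indicator {x. cos (x - m) > r} x :: real) \<in> borel_measurable torus"
      proof -
        have "open {x. cos (x - m) > r}" by (intro open_Collect_less continuous_intros)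
        then have "{x. cos (x - m) > r} \<in> sets borel" by simp
        then show ?thesis by (intro measurable_restrict_space1 measurable_completion) auto
      qed
      then show "(\<lambda>x. w x * indicator {x. cos (x - m) > r} x) \<in> borel_measurable torus"
        using w by auto
      show "(\<lambda>x. w x * min 1 (max 0 (real n * (cos (x - m) - r)))) \<in> borel_measurable torus" for n
        by (intro borel_measurable_integrable iqr[where B=1] continuous_intros) auto
    qed (use w in \<open>auto simp: abs_mult intro!: mult_left_le\<close>)
    moreover have "(LINT x|torus. w x * min 1 (max 0 (real n * (cos (x - m) - r)))) = 0" for n
      by (rule cont[of "\<lambda>y. min 1 (max 0 (real n * (y - r)))"]) (intro continuous_intros)
    ultimately show ?thesis by (simp add: LIMSEQ_const_iff)
  qed
  show ?thesis
  proof (rule integral_zero_on_borel_subsets[OF w])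
    fix a b :: real assume ab: "- pi \<le> a" "a \<le> b" "b \<le> pi"
    define m d where "m = (a + b) / 2" and "d = (b - a) / 2"
    have d: "0 \<le> d" "d \<le> pi" using ab by (auto simp: d_def)
    \<comment> \<open>With \<open>y = \<bar>x - m\<bar>\<close> the claim is that the cosine exceeds
      \<open>cos d\<close> exactly for \<open>y < d\<close>. Up to pi this is monotonicity. Beyond
      pi, \<open>y\<close> is reflected to \<open>2 * pi - y\<close>, and
      \<open>y \<le> 2 * pi - d\<close> keeps the reflected point at distance at least
      \<open>d\<close>, so the arc does not reappear at the other end of the period.\<close>
    have iff: "cos (x - m) > cos d \<longleftrightarrow> a < x \<and> x < b" if x: "x \<in> {-pi..pi}" for x
    proof -
      define y where "y = \<bar>x - m\<bar>"
      have cy: "cos (x - m) = cos y" by (simp add: y_def)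
      have y2: "y \<le> 2 * pi - d" using x ab by (auto simp: y_def m_def d_def field_simps)
      have "a < x \<and> x < b \<longleftrightarrow> y < d" by (auto simp: y_def m_def d_def field_simps)
      moreover have "cos d < cos y \<longleftrightarrow> y < d"
      proof (cases "y \<le> pi")
        case True
        then show ?thesis using d by (intro cos_mono_less_eq) (auto simp: y_def)
      next
        case False
        have "cos y = cos (2 * pi - y)" by (simp add: cos_diff)
        moreover have "cos (2 * pi - y) \<le> cos d" using False y2 d by (intro cos_monotone_0_pi_le) auto
        ultimately show ?thesis using False d by auto
      qed
      ultimately show ?thesis using cy by simp
    qed
    have "(LINT x|torus. indicator {a..b} x * w x) = (LINT x|torus. w x * indicator {x. cos (x - m) > cos d} x)"
    proof (rule integral_cong_AE)
      have ae: "AE x in torus. x \<notin> {a, b}"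
        by (rule AE_restrict_space_iff[THEN iffD2]) (auto intro!: eventually_mono[OF AE_not_in[of "{a,b}" lebesgue]] simp: finite_imp_null_set_lborel null_sets_completionI)
      have "AE x in torus. x \<in> {-pi..pi}" by (rule AE_I2) simp
      with ae show "AE x in torus. indicator {a..b} x * w x = w x * indicator {x. cos (x - m) > cos d} x"
        by eventually_elim (auto simp: indicator_def iff)
      have "(\<lambda>x. indicator {a..b} x :: real) \<in> borel_measurable torus"
        by (intro measurable_restrict_space1 measurable_completion) auto
      then show "(\<lambda>x. indicator {a..b} x * w x) \<in> borel_measurable torus" using w by auto
      have "open {x. cos (x - m) > cos d}" by (intro open_Collect_less continuous_intros)
      then have "{x. cos (x - m) > cos d} \<in> sets borel" by simp
      then have "(\<lambda>x. indicator {x. cos (x - m) > cos d} x :: real) \<in> borel_measurable torus"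
        by (intro measurable_restrict_space1 measurable_completion) auto
      then show "(\<lambda>x. w x * indicator {x. cos (x - m) > cos d} x) \<in> borel_measurable torus" using w by auto
    qed
    then show "(LINT x|torus. indicator {a..b} x * w x) = 0" using openiv by simp
  qed
qed

section \<open>Weak derivatives and norms of Fourier series\<close>

lemma measurable_fser: "wsummable 0 c \<Longrightarrow> fser c \<in> borel_measurable (lebesgue_on S)"
  by (rule measurable_torus_continuous) (rule continuous_fser)

lemma integrable_fser: "wsummable 0 c \<Longrightarrow> integrable torus (fser c)"
  by (rule continuous_imp_integrable_real) (rule continuous_fser)

lemma fser_L1: "wsummable 0 c \<Longrightarrow> fser c \<in> L1"
  by (simp add: L1_def periodic_fser integrable_fser)

lemma fser_L2: "wsummable 0 c \<Longrightarrow> fser c \<in> L2"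
  by (auto simp: L2_def periodic_fser measurable_fser intro!: continuous_imp_integrable_real continuous_intros)

lemma integral_by_parts_periodic:
  assumes u: "periodic u" "\<And>x. (u has_real_derivative u' x) (at x)" "continuous_on UNIV u'"
    and v: "periodic v" "\<And>x. (v has_real_derivative v' x) (at x)" "continuous_on UNIV v'"
  shows "(LINT x|torus. u x * v' x) = - (LINT x|torus. u' x * v x)"
proof -
  have cu: "continuous_on S u" and cv: "continuous_on S v" for S
    using u(2) v(2) by (meson DERIV_isCont continuous_at_imp_continuous_on)+
  have cu': "continuous_on S u'" and cv': "continuous_on S v'" for S
    using u(3) v(3) by (auto intro: continuous_on_subset)
  have "((\<lambda>x. u x * v' x + u' x * v x) has_integral (u pi * v pi - u (- pi) * v (- pi))) {-pi..pi}"
  proof (rule fundamental_theorem_of_calculus)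
    show "((\<lambda>x. u x * v x) has_vector_derivative u x * v' x + u' x * v x) (at x within {-pi..pi})" for x
      using DERIV_mult[OF u(2)[of x] v(2)[of x]]
      by (auto simp: has_real_derivative_iff_has_vector_derivative algebra_simps intro: has_vector_derivative_at_within)
  qed simp
  moreover have "u pi = u (- pi)" "v pi = v (- pi)"
    using u(1)[unfolded periodic_def, rule_format, of "-pi"] v(1)[unfolded periodic_def, rule_format, of "-pi"] by simp_all
  ultimately have "integral {-pi..pi} (\<lambda>x. u x * v' x + u' x * v x) = 0" by (simp add: integral_unique)
  then have "(LINT x|torus. u x * v' x + u' x * v x) = 0"
    by (subst LINT_continuous) (auto intro!: continuous_intros cu cv cu' cv')
  moreover have "(LINT x|torus. u x * v' x + u' x * v x) = (LINT x|torus. u x * v' x) + (LINT x|torus. u' x * v x)"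
    by (rule Bochner_Integration.integral_add) (auto intro!: continuous_imp_integrable_real continuous_intros cu cv cu' cv')
  ultimately show ?thesis by simp
qed

lemma weak_deriv_fser:
  assumes "c 0 = 0" "wsummable 1 c"
  shows "weak_deriv (fser c) (fser (dcoef c))"
  unfolding weak_deriv_def
proof (intro conjI allI impI)
  have d: "wsummable 0 (dcoef c)" using assms by simp
  show "fser c \<in> L1" "fser (dcoef c) \<in> L1" by (intro fser_L1 wsummable_Suc0[OF assms] d)+
  fix \<phi> \<phi>' assume "periodic \<phi> \<and> (\<forall>x. (\<phi> has_real_derivative \<phi>' x) (at x)) \<and> continuous_on UNIV \<phi>'"
  then show "(LINT x|torus. fser c x * \<phi>' x) = - (LINT x|torus. fser (dcoef c) x * \<phi> x)"
    by (intro integral_by_parts_periodic periodic_fser has_real_derivative_fser assms continuous_fser d) auto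
qed

text \<open>Cosines and sines are admissible test functions, so all Fourier coefficients of the
  difference vanish.\<close>

lemma weak_deriv_unique:
  assumes "weak_deriv u v" "weak_deriv u w"
  shows "AE x in torus. v x = w x"
proof -
  have i: "integrable torus v" "integrable torus w" using assms by (auto simp: weak_deriv_def L1_def)
  have eq: "(LINT x|torus. v x * \<phi> x) = (LINT x|torus. w x * \<phi> x)"
    if "periodic \<phi>" "\<And>x. (\<phi> has_real_derivative \<phi>' x) (at x)" "continuous_on UNIV \<phi>'" for \<phi> \<phi>'
  proof -
    have "(LINT x|torus. u x * \<phi>' x) = - (LINT x|torus. v x * \<phi> x)" "(LINT x|torus. u x * \<phi>' x) = - (LINT x|torus. w x * \<phi> x)"
      using assms that unfolding weak_deriv_def by blast+
    then show ?thesis by linarith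
  qed
  have "fourier (\<lambda>x. v x - w x) k = 0" for k
  proof -
    have pc: "periodic (\<lambda>x. cos (of_int k * x))" "periodic (\<lambda>x. sin (of_int k * x))"
    proof -
      have "cos (of_int k * x + 2 * pi * of_int k) = cos (of_int k * x) \<and> sin (of_int k * x + 2 * pi * of_int k) = sin (of_int k * x)" for x
        by (simp add: cos_add sin_add sin_int_2pin[of k, simplified mult_ac] cos_int_2pin[of k, simplified mult_ac] mult_ac)
      then show "periodic (\<lambda>x. cos (of_int k * x))" "periodic (\<lambda>x. sin (of_int k * x))"
        by (simp_all add: periodic_def distrib_left mult_ac)
    qed
    have c: "(LINT x|torus. v x * cos (of_int k * x)) = (LINT x|torus. w x * cos (of_int k * x))"
      by (rule eq[where \<phi>'="\<lambda>x. - of_int k * sin (of_int k * x)"])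
        (auto intro!: pc derivative_eq_intros continuous_intros)
    have s: "(LINT x|torus. v x * sin (of_int k * x)) = (LINT x|torus. w x * sin (of_int k * x))"
      by (rule eq[where \<phi>'="\<lambda>x. of_int k * cos (of_int k * x)"])
        (auto intro!: pc derivative_eq_intros continuous_intros)
    have ib: "integrable torus (\<lambda>x. u x * cos (of_int k * x))" "integrable torus (\<lambda>x. u x * sin (of_int k * x))"
      if "integrable torus u" for u :: "real \<Rightarrow> real"
      using that by (auto intro!: integrable_bounded_mult[where B=1] measurable_torus_continuous continuous_intros)
    have "(LINT x|torus. complex_of_real (v x - w x) * exp (- \<i> * of_int k * complex_of_real x)) =
        (LINT x|torus. complex_of_real (v x * cos (of_int k * x) - w x * cos (of_int k * x))
         - \<i> * complex_of_real (v x * sin (of_int k * x) - w x * sin (of_int k * x)))"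
      unfolding exp_eq_cis by (intro Bochner_Integration.integral_cong) (auto simp: complex_eq_iff algebra_simps)
    also have "\<dots> = complex_of_real (LINT x|torus. v x * cos (of_int k * x) - w x * cos (of_int k * x))
         - \<i> * complex_of_real (LINT x|torus. v x * sin (of_int k * x) - w x * sin (of_int k * x))"
      by (subst Bochner_Integration.integral_diff)
        (auto intro!: integrable_mult_right integrable_of_real Bochner_Integration.integrable_diff ib i simp del: of_real_diff of_real_mult)
    also have "\<dots> = 0" by (simp add: ib i c s)
    finally show ?thesis by (simp add: fourier_def)
  qed
  then have "AE x in torus. v x - w x = 0" by (intro fourier_zero_imp_AE_zero) (auto intro: i)
  then show ?thesis by simp
qed

lemma wderiv_weak_deriv: "weak_deriv u v \<Longrightarrow> weak_deriv u (wderiv u)"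
  unfolding wderiv_def by (rule someI[where P="weak_deriv u"])

lemma wderiv_AE: "weak_deriv u v \<Longrightarrow> AE x in torus. wderiv u x = v x"
  using weak_deriv_unique wderiv_weak_deriv by blast

lemma wderiv_fser_AE: "c 0 = 0 \<Longrightarrow> wsummable 1 c \<Longrightarrow> AE x in torus. wderiv (fser c) x = fser (dcoef c) x"
  by (rule wderiv_AE) (rule weak_deriv_fser)

lemma wderiv_fser_L1: "c 0 = 0 \<Longrightarrow> wsummable 1 c \<Longrightarrow> wderiv (fser c) \<in> L1"
  using wderiv_weak_deriv[OF weak_deriv_fser] by (auto simp: weak_deriv_def)

lemma L1_measurable: "u \<in> L1 \<Longrightarrow> u \<in> borel_measurable torus"
  by (auto simp: L1_def)

lemma Linf_norm_cong_AE:
  assumes "u \<in> borel_measurable torus" "v \<in> borel_measurable torus" "AE x in torus. u x = v x"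
  shows "Linf_norm u = Linf_norm v"
  unfolding Linf_norm_def by (subst esssup_AE_cong[of _ _ "\<lambda>x. ereal \<bar>v x\<bar>"]) (use assms in \<open>auto elim: eventually_mono\<close>)

lemma L1_norm_cong_AE:
  assumes "u \<in> borel_measurable torus" "v \<in> borel_measurable torus" "AE x in torus. u x = v x"
  shows "L1_norm u = L1_norm v"
  unfolding L1_norm_def by (rule integral_cong_AE) (use assms in \<open>auto elim: eventually_mono\<close>)

lemma torus_not_null: "emeasure torus (space torus) \<noteq> 0"
  by (simp add: emeasure_restrict_space)

text \<open>\<open>real_of_ereal\<close> sends infinite values to 0, so the norm carries information
  only after the essential supremum has been placed between 0 and \<open>B\<close>. The lower bound
  uses that the torus has positive measure.\<close>

lemma Linf_norm_eq:
  assumes "u \<in> borel_measurable torus" "AE x in torus. \<bar>u x\<bar> \<le> B"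
  shows "esssup torus (\<lambda>x. ereal \<bar>u x\<bar>) = ereal (Linf_norm u)" "0 \<le> Linf_norm u" "Linf_norm u \<le> B"
    "AE x in torus. \<bar>u x\<bar> \<le> Linf_norm u"
proof -
  let ?e = "esssup torus (\<lambda>x. ereal \<bar>u x\<bar>)"
  have le: "?e \<le> ereal B" by (rule esssup_I) (use assms in auto)
  have "esssup torus (\<lambda>x. 0) \<le> ?e" by (rule esssup_AE_mono) auto
  then have ge: "0 \<le> ?e" using esssup_const[OF torus_not_null] by metis
  from le ge show eq: "?e = ereal (Linf_norm u)" unfolding Linf_norm_def by (cases ?e) auto
  from ge show "0 \<le> Linf_norm u" unfolding eq by simp
  from le show "Linf_norm u \<le> B" unfolding eq by simp
  have "AE x in torus. ereal \<bar>u x\<bar> \<le> ?e" by (rule esssup_AE)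
  then show "AE x in torus. \<bar>u x\<bar> \<le> Linf_norm u" unfolding eq by simp
qed

lemma fser_Linf_bound: "wsummable 0 c \<Longrightarrow> AE x in torus. \<bar>fser c x\<bar> \<le> wnorm 0 c"
  by (intro AE_I2 fser_bound)

lemma Linf_norm_fser_le: "wsummable 0 c \<Longrightarrow> Linf_norm (fser c) \<le> wnorm 0 c"
  by (rule Linf_norm_eq(3)[OF measurable_fser fser_Linf_bound])

text \<open>A triangle inequality routed through the coefficients, in the shape that
  \<open>h2_seminorm\<close> asks for.\<close>

lemma Linf_norm_fser_lip:
  assumes "wsummable 0 c" "wsummable 0 d"
  shows "Linf_norm (fser c) \<le> Linf_norm (fser d) + wnorm 0 (\<lambda>k. c k - d k)"
proof (rule Linf_norm_eq(3)[OF measurable_fser[OF assms(1)]])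
  show "AE x in torus. \<bar>fser c x\<bar> \<le> Linf_norm (fser d) + wnorm 0 (\<lambda>k. c k - d k)"
    using Linf_norm_eq(4)[OF measurable_fser[OF assms(2)] fser_Linf_bound[OF assms(2)]]
  proof eventually_elim
    case (elim x)
    have "\<bar>fser c x - fser d x\<bar> \<le> wnorm 0 (\<lambda>k. c k - d k)"
      unfolding fser_diff[OF assms, symmetric] by (intro fser_bound wsummable_diff assms)
    with elim show ?case by linarith
  qed
qed

lemma L1_norm_fser_lip:
  assumes "wsummable 0 c" "wsummable 0 d"
  shows "L1_norm (fser c) \<le> L1_norm (fser d) + 2 * pi * wnorm 0 (\<lambda>k. c k - d k)"
proof -
  interpret finite_measure torus by (rule finite_measure_lebesgue_on) simp
  have "L1_norm (fser c) \<le> (LINT x|torus. \<bar>fser d x\<bar> + wnorm 0 (\<lambda>k. c k - d k))"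
    unfolding L1_norm_def
  proof (rule integral_mono)
    fix x
    have "\<bar>fser c x - fser d x\<bar> \<le> wnorm 0 (\<lambda>k. c k - d k)"
      unfolding fser_diff[OF assms, symmetric] by (intro fser_bound wsummable_diff assms)
    then show "\<bar>fser c x\<bar> \<le> \<bar>fser d x\<bar> + wnorm 0 (\<lambda>k. c k - d k)" by linarith
  qed (auto intro!: integrable_fser assms)
  also have "\<dots> = L1_norm (fser d) + 2 * pi * wnorm 0 (\<lambda>k. c k - d k)"
    unfolding L1_norm_def by (subst Bochner_Integration.integral_add)
      (auto intro!: integrable_fser assms simp: measure_restrict_space)
  finally show ?thesis .
qed

lemma fser_Linf:
  assumes "wsummable 0 c"
  shows "fser c \<in> Linf"
  using Linf_norm_eq(1)[OF measurable_fser[OF assms] fser_Linf_bound[OF assms]]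
  by (simp add: Linf_def periodic_fser measurable_fser assms)

lemma dcoef_zero [simp]: "dcoef c 0 = 0" by (simp add: dcoef_def)

lemma dcoef_diff: "dcoef (\<lambda>k. c k - d k) = (\<lambda>k. dcoef c k - dcoef d k)"
  by (auto simp: dcoef_def algebra_simps)

lemma Linf_norm_wderiv_fser:
  assumes "c 0 = 0" "wsummable 1 c"
  shows "Linf_norm (wderiv (fser c)) = Linf_norm (fser (dcoef c))"
  by (intro Linf_norm_cong_AE L1_measurable wderiv_fser_L1 wderiv_fser_AE measurable_fser assms) (use assms in simp)

lemma L1_norm_wderiv_fser:
  assumes "c 0 = 0" "wsummable 1 c"
  shows "L1_norm (wderiv (fser c)) = L1_norm (fser (dcoef c))"
  by (intro L1_norm_cong_AE L1_measurable wderiv_fser_L1 wderiv_fser_AE measurable_fser assms) (use assms in simp)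

lemma fser_W11:
  assumes "c 0 = 0" "wsummable 1 c"
  shows "fser c \<in> W11"
  unfolding W11_def using weak_deriv_fser[OF assms] by (auto simp: weak_deriv_def)

lemma fser_W1inf:
  assumes "c 0 = 0" "wsummable 1 c"
  shows "fser c \<in> W1inf"
  unfolding W1inf_def using weak_deriv_fser[OF assms] fser_Linf wsummable_Suc0[OF assms] assms(2) by force

lemma fser_W2inf:
  assumes "c 0 = 0" "wsummable 2 c"
  shows "fser c \<in> W2inf"
proof -
  have w: "wsummable 1 c" "wsummable 0 c" using assms by (auto intro: wsummable_mono[of c _ 2])
  have "fser (dcoef c) \<in> W1inf" by (rule fser_W1inf) (use assms in \<open>auto simp: numeral_2_eq_2\<close>)
  then show ?thesis
    unfolding W2inf_def using weak_deriv_fser[OF assms(1) w(1)] fser_Linf[OF w(2)] by blast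
qed

lemma W11_norm_fser:
  assumes "c 0 = 0" "wsummable 1 c"
  shows "W11_norm (fser c) = L1_norm (fser c) + L1_norm (fser (dcoef c))"
  by (simp add: W11_norm_def L1_norm_wderiv_fser[OF assms])

lemma W1inf_norm_fser:
  assumes "c 0 = 0" "wsummable 1 c"
  shows "W1inf_norm (fser c) = Linf_norm (fser c) + Linf_norm (fser (dcoef c))"
  by (simp add: W1inf_norm_def Linf_norm_wderiv_fser[OF assms])

text \<open>Second weak derivatives need this: \<open>wderiv\<close> selects a representative that
  agrees with the differentiated Fourier series only almost everywhere, and this representative is
  differentiated again.\<close>

lemma weak_deriv_cong_AE:
  assumes "weak_deriv u w" "v \<in> L1" "AE x in torus. u x = v x"
  shows "weak_deriv v w"
  unfolding weak_deriv_def
proof (intro conjI allI impI)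
  show "v \<in> L1" "w \<in> L1" using assms by (auto simp: weak_deriv_def)
  fix \<phi> \<phi>' assume \<phi>: "periodic \<phi> \<and> (\<forall>x. (\<phi> has_real_derivative \<phi>' x) (at x)) \<and> continuous_on UNIV \<phi>'"
  have um: "u \<in> borel_measurable torus" "v \<in> borel_measurable torus" using assms by (auto simp: weak_deriv_def L1_def)
  have pm: "\<phi>' \<in> borel_measurable torus" using \<phi> by (intro measurable_torus_continuous) auto
  have "(LINT x|torus. v x * \<phi>' x) = (LINT x|torus. u x * \<phi>' x)"
    by (rule integral_cong_AE) (use um pm assms(3) in \<open>auto elim: eventually_mono\<close>)
  then show "(LINT x|torus. v x * \<phi>' x) = - (LINT x|torus. w x * \<phi> x)"
    using assms(1) \<phi> by (auto simp: weak_deriv_def)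
qed

text \<open>The three sup norms are at most the Wiener norms of order 0, 1 and 2, each of which is
  at most the one of order 2.\<close>

lemma W2inf_norm_fser_le:
  assumes "c 0 = 0" "wsummable 2 c"
  shows "W2inf_norm (fser c) \<le> 3 * wnorm 2 c" "0 \<le> W2inf_norm (fser c)"
proof -
  have w: "wsummable 1 c" "wsummable 0 c" using assms by (auto intro: wsummable_mono[of c _ 2])
  have d: "wsummable 1 (dcoef c)" "wsummable 0 (dcoef c)" "wsummable 0 (dcoef (dcoef c))"
    using assms(2) w by (auto simp: numeral_2_eq_2)
  have wn: "wnorm 0 c \<le> wnorm 2 c" "wnorm 1 c \<le> wnorm 2 c" using assms by (auto intro: wnorm_mono)
  define v where "v = wderiv (fser c)"
  have vL: "v \<in> L1" unfolding v_def by (rule wderiv_fser_L1) fact+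
  have ae: "AE x in torus. fser (dcoef c) x = v x"
    using wderiv_fser_AE[OF assms(1) w(1)] unfolding v_def by (auto elim: eventually_mono)
  have wd: "weak_deriv v (fser (dcoef (dcoef c)))"
    by (rule weak_deriv_cong_AE[OF weak_deriv_fser vL ae]) (use d in auto)
  have "Linf_norm (wderiv v) = Linf_norm (fser (dcoef (dcoef c)))"
    by (rule Linf_norm_cong_AE[OF _ measurable_fser[OF d(3)] wderiv_AE[OF wd]])
      (use wderiv_weak_deriv[OF wd] in \<open>auto simp: weak_deriv_def L1_def\<close>)
  moreover have "Linf_norm v = Linf_norm (fser (dcoef c))"
    unfolding v_def by (rule Linf_norm_wderiv_fser) fact+
  ultimately have eq: "W2inf_norm (fser c) = Linf_norm (fser c) + (Linf_norm (fser (dcoef c)) + Linf_norm (fser (dcoef (dcoef c))))"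
    by (simp add: W2inf_norm_def W1inf_norm_def v_def)
  have "Linf_norm (fser c) \<le> wnorm 0 c" "Linf_norm (fser (dcoef c)) \<le> wnorm 1 c" "Linf_norm (fser (dcoef (dcoef c))) \<le> wnorm 2 c"
    using Linf_norm_fser_le[OF w(2)] Linf_norm_fser_le[OF d(2)] Linf_norm_fser_le[OF d(3)] by (simp_all add: numeral_2_eq_2)
  with eq wn show "W2inf_norm (fser c) \<le> 3 * wnorm 2 c" by linarith
  have "0 \<le> Linf_norm (fser x)" if "wsummable 0 x" for x
    using Linf_norm_eq(2)[OF measurable_fser fser_Linf_bound] that by blast
  with w d eq show "0 \<le> W2inf_norm (fser c)" by simp
qed

section \<open>Bochner spaces\<close>

text \<open>Monotone convergence along the nested bands. Measurability of the infinite sum is part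
  of the result: it is a limit of measurable functions only almost everywhere, which suffices
  because Lebesgue measure is complete.\<close>

lemma infsum_levi:
  fixes a :: "int \<Rightarrow> real \<Rightarrow> real"
  assumes S: "S \<in> sets lebesgue"
    and i: "\<And>k. integrable (lebesgue_on S) (a k)" and nn: "\<And>k t. 0 \<le> a k t"
    and B: "\<And>N. (LINT t|lebesgue_on S. (\<Sum>k\<in>band N. a k t)) \<le> B"
  shows "AE t in lebesgue_on S. (\<lambda>k. a k t) summable_on UNIV"
    "integrable (lebesgue_on S) (\<lambda>t. \<Sum>\<^sub>\<infinity>k. a k t)" "(LINT t|lebesgue_on S. (\<Sum>\<^sub>\<infinity>k. a k t)) \<le> B"
proof -
  let ?M = "lebesgue_on S"
  define f where "f N t = (\<Sum>k\<in>band N. a k t)" for N t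
  have fi: "integrable ?M (f N)" for N unfolding f_def by (intro Bochner_Integration.integrable_sum i)
  have fnn: "0 \<le> f N t" for N t unfolding f_def by (intro sum_nonneg nn)
  have mono: "mono (\<lambda>N. f N t)" for t
    unfolding f_def by (intro monoI sum_mono2) (auto simp: mem_band nn)
  have "(\<integral>\<^sup>+t. (SUP N. ennreal (f N t)) \<partial>?M) = (SUP N. \<integral>\<^sup>+t. ennreal (f N t) \<partial>?M)"
    by (intro nn_integral_monotone_convergence_SUP incseq_SucI le_funI)
      (use fi mono in \<open>auto intro!: ennreal_leI simp: mono_def\<close>)
  also have "\<dots> \<le> ennreal B"
  proof (rule SUP_least)
    fix N
    show "(\<integral>\<^sup>+t. ennreal (f N t) \<partial>?M) \<le> ennreal B"
      using B[of N] unfolding f_def[symmetric]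
      by (subst nn_integral_eq_integral[OF fi]) (auto simp: fnn intro: ennreal_leI)
  qed
  finally have "(\<integral>\<^sup>+t. (SUP N. ennreal (f N t)) \<partial>?M) \<noteq> \<infinity>" by (auto simp: top_unique)
  then have "AE t in ?M. (SUP N. ennreal (f N t)) \<noteq> \<infinity>"
    using fi by (intro nn_integral_noteq_infinite) auto
  then show ae: "AE t in ?M. (\<lambda>k. a k t) summable_on UNIV"
  proof eventually_elim
    case (elim t)
    then obtain r where r: "(SUP N. ennreal (f N t)) = ennreal r" "0 \<le> r" by (cases "SUP N. ennreal (f N t)") auto
    have "f N t \<le> r" for N
    proof -
      have "ennreal (f N t) \<le> ennreal r" using SUP_upper[of N UNIV "\<lambda>N. ennreal (f N t)"] r by simp
      then show ?thesis using r(2) by (simp add: ennreal_le_iff)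
    qed
    then show ?case unfolding f_def by (intro band_bound_summable(1)[of "\<lambda>k. a k t" r] nn)
  qed
  have lim: "AE t in ?M. (\<lambda>N. f N t) \<longlonglongrightarrow> (\<Sum>\<^sub>\<infinity>k. a k t)"
    using ae by eventually_elim (simp add: f_def band_sums)
  have ael: "AE t in ?M. lim (\<lambda>N. f N t) = (\<Sum>\<^sub>\<infinity>k. a k t)"
    using lim by eventually_elim (rule limI)
  have "(\<lambda>t. lim (\<lambda>N. f N t)) \<in> borel_measurable ?M"
    using fi by (intro borel_measurable_lim_metric) auto
  then have um: "(\<lambda>t. \<Sum>\<^sub>\<infinity>k. a k t) \<in> borel_measurable ?M"
    by (rule borel_measurable_lebesgue_on_AE[OF _ S ael])
  have inc: "incseq (\<lambda>N. integral\<^sup>L ?M (f N))"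
    using mono by (intro incseq_SucI integral_mono fi) (auto simp: mono_def)
  have fB: "\<forall>N. integral\<^sup>L ?M (f N) \<le> B" using B unfolding f_def by blast
  from incseq_convergent[OF inc this] obtain x where x: "(\<lambda>N. integral\<^sup>L ?M (f N)) \<longlonglongrightarrow> x" by blast
  have monoAE: "AE t in ?M. mono (\<lambda>N. f N t)" using mono by simp
  show "integrable ?M (\<lambda>t. \<Sum>\<^sub>\<infinity>k. a k t)"
    by (rule integrable_monotone_convergence[OF fi monoAE lim x um])
  have "integral\<^sup>L ?M (\<lambda>t. \<Sum>\<^sub>\<infinity>k. a k t) = x"
    by (rule integral_monotone_convergence[OF fi monoAE lim x um])
  moreover have "x \<le> B" by (rule LIMSEQ_le_const2[OF x]) (use fB in blast)
  ultimately show "(LINT t|?M. (\<Sum>\<^sub>\<infinity>k. a k t)) \<le> B" by simp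
qed

text \<open>Coefficients of the real mean-zero functions in H^2. The solution has this regularity at
  almost every time, and every norm of the Bochner spaces is controlled on this class.\<close>

definition adm :: "(int \<Rightarrow> complex) \<Rightarrow> bool" where
  "adm c \<longleftrightarrow> hermitian c \<and> ssummable 2 c"

lemma ssummable_add:
  assumes "ssummable p c" "ssummable p d"
  shows "ssummable p (\<lambda>k. c k + d k)"
proof (rule summable_on_comparison_test)
  show "(\<lambda>k. 2 * (wmod p c k)\<^sup>2 + 2 * (wmod p d k)\<^sup>2) summable_on UNIV"
    by (intro summable_on_add summable_on_cmult_right assms)
  fix k
  have "wmod p (\<lambda>k. c k + d k) k \<le> wmod p c k + wmod p d k"
    unfolding wmod_def distrib_left[symmetric] by (intro mult_left_mono norm_triangle_ineq) auto
  then have "(wmod p (\<lambda>k. c k + d k) k)\<^sup>2 \<le> (wmod p c k + wmod p d k)\<^sup>2" by (intro power_mono) auto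
  then show "(wmod p (\<lambda>k. c k + d k) k)\<^sup>2 \<le> 2 * (wmod p c k)\<^sup>2 + 2 * (wmod p d k)\<^sup>2"
    using square_add_le order_trans by blast
qed simp

lemma ssummable_diff:
  assumes "ssummable p c" "ssummable p d"
  shows "ssummable p (\<lambda>k. c k - d k)"
proof -
  have "ssummable p (\<lambda>k. - d k)" using assms(2) by (simp add: wmod_def)
  from ssummable_add[OF assms(1) this] show ?thesis by simp
qed

lemma hermitian_diff: "hermitian c \<Longrightarrow> hermitian d \<Longrightarrow> hermitian (\<lambda>k. c k - d k)"
  by (simp add: hermitian_def)

lemma adm_diff: "adm c \<Longrightarrow> adm d \<Longrightarrow> adm (\<lambda>k. c k - d k)"
  by (simp add: adm_def hermitian_diff ssummable_diff)

lemma adm_zero: "adm (\<lambda>_. 0)"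
  by (simp add: adm_def hermitian_def wmod_def)

lemma trig_poly_adm: "trig_poly n c \<Longrightarrow> adm c"
  by (simp add: adm_def trig_poly_ssummable) (simp add: trig_poly_def)

lemma snorm_triangle:
  assumes "ssummable p c" "ssummable p d"
  shows "sqrt (snorm p c) \<le> sqrt (snorm p d) + sqrt (snorm p (\<lambda>k. c k - d k))"
proof -
  let ?e = "\<lambda>k. c k - d k"
  have e: "ssummable p ?e" by (rule ssummable_diff[OF assms])
  let ?R = "sqrt (snorm p d) + sqrt (snorm p ?e)"
  have fin: "L2_set (wmod p x) (band n) \<le> sqrt (snorm p x)" if "ssummable p x" for x n
    unfolding L2_set_def snorm_def by (intro real_sqrt_le_mono finite_sum_le_infsum that) auto
  have "(\<Sum>k\<in>band n. (wmod p c k)\<^sup>2) \<le> ?R\<^sup>2" for n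
  proof -
    have "L2_set (wmod p c) (band n) \<le> L2_set (\<lambda>k. wmod p d k + wmod p ?e k) (band n)"
    proof (rule L2_set_mono)
      fix k
      have "cmod (c k) \<le> cmod (d k) + cmod (?e k)" using norm_triangle_ineq[of "d k" "c k - d k"] by simp
      then show "wmod p c k \<le> wmod p d k + wmod p ?e k"
        unfolding wmod_def distrib_left[symmetric] by (intro mult_left_mono) auto
    qed simp
    also have "\<dots> \<le> L2_set (wmod p d) (band n) + L2_set (wmod p ?e) (band n)" by (rule L2_set_triangle_ineq)
    also have "\<dots> \<le> ?R" by (intro add_mono fin assms e)
    finally have "sqrt (\<Sum>k\<in>band n. (wmod p c k)\<^sup>2) \<le> ?R" by (simp add: L2_set_def)
    then show ?thesis by (simp add: sqrt_le_D)
  qed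
  then have "snorm p c \<le> ?R\<^sup>2" unfolding snorm_def by (intro band_bound_summable(2)) auto
  then show ?thesis by (intro real_le_lsqrt) auto
qed

text \<open>The homogeneous Wiener norm of order \<open>1 + \<alpha>\<close>. Up to a factor 2 it
  dominates the \<alpha>-Hoelder seminorm of the derivative.\<close>

definition holder_sum :: "real \<Rightarrow> (int \<Rightarrow> complex) \<Rightarrow> real" where
  "holder_sum \<alpha> c = (\<Sum>\<^sub>\<infinity>k. \<bar>of_int k\<bar> powr (1 + \<alpha>) * cmod (c k))"

lemma summable_int_powr:
  assumes "s < -1"
  shows "(\<lambda>k::int. \<bar>real_of_int k\<bar> powr s) summable_on UNIV"
proof -
  have n: "(\<lambda>n::nat. real n powr s) summable_on UNIV"
    by (rule summable_nonneg_imp_summable_on) (use assms in \<open>auto simp: summable_real_powr_iff\<close>)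
  have "(\<lambda>k::int. \<bar>real_of_int k\<bar> powr s) summable_on range int"
    by (subst summable_on_reindex) (auto simp: o_def n)
  moreover have "(\<lambda>k::int. \<bar>real_of_int k\<bar> powr s) summable_on range (\<lambda>n. - int n)"
    by (subst summable_on_reindex) (auto simp: o_def n inj_on_def)
  ultimately have "(\<lambda>k::int. \<bar>real_of_int k\<bar> powr s) summable_on (range int \<union> range (\<lambda>n. - int n))"
    by (rule summable_on_union)
  moreover have "range int \<union> range (\<lambda>n. - int n) = UNIV"
    by (auto simp: image_iff) (metis int_cases2)
  ultimately show ?thesis by simp
qed

text \<open>Cauchy-Schwarz after writing the weight of order \<open>1 + \<alpha>\<close> as the
  weight of order \<open>\<alpha> - 1\<close> times that of order 2. The negative power is harmless
  at the mode 0 because \<open>0 powr s = 0\<close>.\<close>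

lemma holder_sum_le:
  assumes "\<alpha> < 1/2" "ssummable 2 c"
  defines "Z \<equiv> \<Sum>\<^sub>\<infinity>k::int. \<bar>real_of_int k\<bar> powr (2 * \<alpha> - 2)"
  shows "(\<lambda>k. \<bar>of_int k\<bar> powr (1 + \<alpha>) * cmod (c k)) summable_on UNIV" "holder_sum \<alpha> c \<le> sqrt Z * sqrt (snorm 2 c)"
proof -
  have Zs: "(\<lambda>k::int. \<bar>real_of_int k\<bar> powr (2 * \<alpha> - 2)) summable_on UNIV"
    by (rule summable_int_powr) (use assms in auto)
  have Z0: "0 \<le> Z" unfolding Z_def by (rule infsum_nonneg) simp
  have "(\<Sum>k\<in>band n. \<bar>of_int k\<bar> powr (1 + \<alpha>) * cmod (c k)) \<le> sqrt Z * sqrt (snorm 2 c)" for n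
  proof -
    have "(\<Sum>k\<in>band n. \<bar>of_int k\<bar> powr (1 + \<alpha>) * cmod (c k)) = (\<Sum>k\<in>band n. \<bar>of_int k\<bar> powr (\<alpha> - 1) * wmod 2 c k)"
    proof (rule sum.cong[OF refl])
      fix k :: int
      show "\<bar>of_int k\<bar> powr (1 + \<alpha>) * cmod (c k) = \<bar>of_int k\<bar> powr (\<alpha> - 1) * wmod 2 c k"
      proof (cases "k = 0")
        case False
        then have "\<bar>real_of_int k\<bar> powr (\<alpha> - 1) * \<bar>real_of_int k\<bar>\<^sup>2 = \<bar>real_of_int k\<bar> powr (\<alpha> - 1 + 2)"
          unfolding powr_add by (subst powr_numeral) auto
        then show ?thesis unfolding wmod_def mult.assoc[symmetric] by (simp add: add.commute)
      qed (simp add: wmod_def)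
    qed
    also have "\<dots> \<le> L2_set (\<lambda>k. \<bar>of_int k\<bar> powr (\<alpha> - 1)) (band n) * L2_set (wmod 2 c) (band n)"
      using L2_set_mult_ineq[of "\<lambda>k. \<bar>of_int k\<bar> powr (\<alpha> - 1)" "wmod 2 c" "band n"] by simp
    also have "\<dots> \<le> sqrt Z * sqrt (snorm 2 c)"
    proof (intro mult_mono)
      have "(\<Sum>k\<in>band n. (\<bar>real_of_int k\<bar> powr (\<alpha> - 1))\<^sup>2) = (\<Sum>k\<in>band n. \<bar>of_int k\<bar> powr (2 * \<alpha> - 2))"
        by (simp add: power2_eq_square algebra_simps flip: powr_add)
      also have "\<dots> \<le> Z" unfolding Z_def by (rule finite_sum_le_infsum[OF Zs]) auto
      finally show "L2_set (\<lambda>k. \<bar>of_int k\<bar> powr (\<alpha> - 1)) (band n) \<le> sqrt Z" by (simp add: L2_set_def)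
      show "L2_set (wmod 2 c) (band n) \<le> sqrt (snorm 2 c)"
        unfolding L2_set_def snorm_def by (intro real_sqrt_le_mono finite_sum_le_infsum assms) auto
    qed (auto simp: Z0 L2_set_nonneg)
    finally show ?thesis .
  qed
  from band_bound_summable[OF _ this]
  show "(\<lambda>k. \<bar>of_int k\<bar> powr (1 + \<alpha>) * cmod (c k)) summable_on UNIV" "holder_sum \<alpha> c \<le> sqrt Z * sqrt (snorm 2 c)"
    unfolding holder_sum_def by auto
qed

text \<open>The constant of \<open>holder_sum_le\<close> at \<alpha> = 0: it bounds the first-order
  Wiener norm by the H^2 norm.\<close>

definition "wK = sqrt (\<Sum>\<^sub>\<infinity>k::int. \<bar>real_of_int k\<bar> powr (- 2))"

lemma adm_wnorm:
  assumes "adm c"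
  shows "c 0 = 0" "hermitian c" "wsummable 1 c" "wsummable 0 c" "wnorm 1 c \<le> wK * sqrt (snorm 2 c)" "wnorm 0 c \<le> wK * sqrt (snorm 2 c)"
proof -
  show c: "c 0 = 0" "hermitian c" using assms by (auto simp: adm_def hermitian_def)
  have eq: "(\<lambda>k. \<bar>of_int k\<bar> powr (1 + 0) * cmod (c k)) = wmod 1 c" by (auto simp: wmod_def)
  note h = holder_sum_le[of 0 c, unfolded holder_sum_def eq]
  show 1: "wsummable 1 c" "wnorm 1 c \<le> wK * sqrt (snorm 2 c)"
    using h assms unfolding wnorm_def wK_def adm_def by auto
  show "wsummable 0 c" by (rule wsummable_Suc0[OF c(1) 1(1)])
  show "wnorm 0 c \<le> wK * sqrt (snorm 2 c)" using wnorm_mono[of c 0 1] c(1) 1 by linarith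
qed

text \<open>All that the Bochner spaces require of a norm: it vanishes at zero, is nonnegative, and
  is Lipschitz for the H^2 distance on Fourier series. One proof of strong measurability and
  integrability then serves every space in the theorem, and neither subadditivity nor homogeneity on
  arbitrary functions is involved.\<close>

definition h2_seminorm :: "((real \<Rightarrow> real) \<Rightarrow> real) \<Rightarrow> real \<Rightarrow> bool" where
  "h2_seminorm N K \<longleftrightarrow> N (fser (\<lambda>_. 0)) = 0 \<and> (\<forall>c. adm c \<longrightarrow> 0 \<le> N (fser c)) \<and>
     (\<forall>c d. adm c \<longrightarrow> adm d \<longrightarrow> N (fser c) \<le> N (fser d) + K * sqrt (snorm 2 (\<lambda>k. c k - d k)))"

lemma h2_seminorm_le:
  assumes "h2_seminorm N K" "adm c"
  shows "N (fser c) \<le> K * sqrt (snorm 2 c)"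
  using assms adm_zero unfolding h2_seminorm_def by force

section \<open>Bochner spaces by approximation with simple functions of time\<close>

context
  fixes T C :: real and c :: "real \<Rightarrow> int \<Rightarrow> complex" and X :: "(real \<Rightarrow> real) set" and N K
  assumes T: "T > 0" and herm: "\<And>t. t \<in> {0..T} \<Longrightarrow> hermitian (c t)"
    and lip: "\<And>t s k. \<lbrakk>t \<in> {0..T}; s \<in> {0..T}\<rbrakk> \<Longrightarrow> cmod (c t k - c s k) \<le> \<bar>of_int k\<bar>\<^sup>2 * C * \<bar>t - s\<bar>"
    and fin: "AE t in lebesgue_on {0..T}. ssummable 2 (c t)"
    and int: "integrable (lebesgue_on {0..T}) (\<lambda>t. snorm 2 (c t))"
    and X: "\<And>d. adm d \<Longrightarrow> fser d \<in> X" and N: "h2_seminorm N K"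
begin

text \<open>On mode \<open>k\<close> the coefficients are Lipschitz in time with constant \<open>k\<^sup>2 C\<close>, so with mesh \<open>n\<^sup>-\<^sup>6\<close> the
  \<open>H\<^sup>2\<close> error of the step functions on the modes up to \<open>n\<close> tends to zero.\<close>

definition grid :: "nat \<Rightarrow> int \<Rightarrow> real" where "grid n j = of_int j / real n ^ 6"

definition approx :: "nat \<Rightarrow> real \<Rightarrow> int \<Rightarrow> complex" where
  "approx n t = trunc n (c (grid n \<lfloor>t * real n ^ 6\<rfloor>))"

lemma grid_bounds:
  assumes "t \<in> {0..T}"
  shows "grid n \<lfloor>t * real n ^ 6\<rfloor> \<in> {0..T}" "n > 0 \<Longrightarrow> \<bar>t - grid n \<lfloor>t * real n ^ 6\<rfloor>\<bar> \<le> 1 / real n ^ 6"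
proof -
  have "grid n \<lfloor>t * real n ^ 6\<rfloor> \<in> {0..T} \<and> (n > 0 \<longrightarrow> \<bar>t - grid n \<lfloor>t * real n ^ 6\<rfloor>\<bar> \<le> 1 / real n ^ 6)"
  proof (cases "n = 0")
    case False
    define q where "q = real n ^ 6"
    have q: "q > 0" using False by (simp add: q_def)
    have "of_int \<lfloor>t * q\<rfloor> \<le> t * q" "t * q \<le> of_int \<lfloor>t * q\<rfloor> + 1" by linarith+
    then have "of_int \<lfloor>t * q\<rfloor> / q \<le> t" "t \<le> of_int \<lfloor>t * q\<rfloor> / q + 1 / q" using q by (auto simp: field_simps)
    moreover have "0 \<le> of_int \<lfloor>t * q\<rfloor> / q" using q assms by simp
    ultimately show ?thesis using assms by (simp add: grid_def q_def[symmetric])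
  \<comment> \<open>For \<open>n = 0\<close> the division by zero puts the grid time at 0, which
    lies in the interval.\<close>
  qed (use T in \<open>auto simp: grid_def\<close>)
  then show "grid n \<lfloor>t * real n ^ 6\<rfloor> \<in> {0..T}" "n > 0 \<Longrightarrow> \<bar>t - grid n \<lfloor>t * real n ^ 6\<rfloor>\<bar> \<le> 1 / real n ^ 6" by auto
qed

text \<open>Membership in H^2 is known only at almost every time and may fail at a grid time;
  truncation makes the value admissible all the same.\<close>

lemma approx_adm: "t \<in> {0..T} \<Longrightarrow> adm (approx n t)"
  unfolding approx_def by (rule trig_poly_adm[OF trunc_trig_poly[OF herm[OF grid_bounds(1)]]])

text \<open>On a bounded interval the floor takes finitely many values, and anything composed with
  it is again simple. So the range of \<open>h\<close> may be a space of functions.\<close>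

lemma simple_floor:
  "simple_function (lebesgue_on {0..T}) (\<lambda>t. h \<lfloor>t * q\<rfloor>)"
proof -
  have "simple_function (lebesgue_on {0..T}) (\<lambda>t. \<lfloor>t * q\<rfloor>)"
    unfolding simple_function_def
  proof (intro conjI ballI)
    have "\<bar>t * q\<bar> \<le> T * \<bar>q\<bar>" if "t \<in> {0..T}" for t
      unfolding abs_mult using that by (intro mult_right_mono) auto
    then have "(\<lambda>t. \<lfloor>t * q\<rfloor>) ` {0..T} \<subseteq> {\<lfloor>- (T * \<bar>q\<bar>)\<rfloor>..\<lfloor>T * \<bar>q\<bar>\<rfloor>}"
      by (auto intro!: floor_mono) (smt (verit))+
    then show "finite ((\<lambda>t. \<lfloor>t * q\<rfloor>) ` space (lebesgue_on {0..T}))"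
      by (simp add: finite_subset)
    fix j
    have "(\<lambda>t. \<lfloor>t * q\<rfloor>) \<in> measurable borel (count_space UNIV)" by measurable
    from measurable_sets[OF this, of "{j}"] have "(\<lambda>t. \<lfloor>t * q\<rfloor>) -` {j} \<in> sets borel" by simp
    then show "(\<lambda>t. \<lfloor>t * q\<rfloor>) -` {j} \<inter> space (lebesgue_on {0..T}) \<in> sets (lebesgue_on {0..T})"
      by (auto simp: sets_restrict_space image_iff Int_commute intro!: bexI[of _ "(\<lambda>t. \<lfloor>t * q\<rfloor>) -` {j}"])
  qed
  from simple_function_compose[OF this, of h] show ?thesis by (simp add: o_def)
qed

lemma approx_tendsto:
  assumes t: "t \<in> {0..T}" and s: "ssummable 2 (c t)"
  shows "(\<lambda>n. sqrt (snorm 2 (\<lambda>k. c t k - approx n t k))) \<longlonglongrightarrow> 0"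
proof -
  have "(\<lambda>n. snorm 2 (\<lambda>k. c t k - approx n t k)) \<longlonglongrightarrow> 0"
  proof (rule tendsto_sandwich[OF _ _ tendsto_const])
    let ?b = "\<lambda>n. (snorm 2 (c t) - (\<Sum>k\<in>band n. (wmod 2 (c t) k)\<^sup>2)) + 3 * C\<^sup>2 * inverse (real n)"
    have "?b \<longlonglongrightarrow> (snorm 2 (c t) - snorm 2 (c t)) + 3 * C\<^sup>2 * 0"
      unfolding snorm_def by (intro tendsto_intros band_sums s lim_inverse_n)
    then show "?b \<longlonglongrightarrow> 0" by simp
    show "\<forall>\<^sub>F n in sequentially. snorm 2 (\<lambda>k. c t k - approx n t k) \<le> ?b n"
    proof (rule eventually_sequentiallyI[of 1])
      fix n :: nat assume n: "1 \<le> n"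
      define g where "g = grid n \<lfloor>t * real n ^ 6\<rfloor>"
      have g: "g \<in> {0..T}" "\<bar>t - g\<bar> \<le> 1 / real n ^ 6" using grid_bounds[OF t] n by (auto simp: g_def)
      \<comment> \<open>\<open>u\<close> is the tail of \<open>c t\<close> outside the band and
        \<open>v\<close> the error inside it. On the band, moving \<open>t\<close> to the grid costs
        at most \<open>real n ^ 2 * (real n ^ 2 * \<bar>C\<bar> * (1 / real n ^ 6))\<close> per
        mode; the squares of 2n + 1 such errors add up to a multiple of 1/n.\<close>
      define u where "u k = (if k \<in> band n then 0 else (wmod 2 (c t) k)\<^sup>2)" for k
      define v where "v k = (if k \<in> band n then (wmod 2 (\<lambda>k. c t k - c g k) k)\<^sup>2 else 0)" for k
      have us: "u summable_on UNIV" by (rule summable_on_comparison_test[OF s]) (auto simp: u_def)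
      have vs: "v summable_on UNIV" by (rule finite_nonzero_values_imp_summable_on) (rule finite_subset[OF _ finite_band[of n]], auto simp: v_def)
      have "snorm 2 (\<lambda>k. c t k - approx n t k) = (\<Sum>\<^sub>\<infinity>k. u k + v k)"
        unfolding snorm_def by (rule infsum_cong) (auto simp: u_def v_def approx_def trunc_def g_def wmod_def)
      also have "\<dots> = infsum u UNIV + infsum v UNIV" by (rule infsum_add[OF us vs])
      also have "infsum v UNIV = sum v (band n)"
        by (subst infsum_cong_neutral[of "band n" _ _ v]) (auto simp: v_def)
      also have "infsum u UNIV = snorm 2 (c t) - (\<Sum>k\<in>band n. (wmod 2 (c t) k)\<^sup>2)"
      proof -
        define w where "w k = (if k \<in> band n then (wmod 2 (c t) k)\<^sup>2 else 0)" for k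
        have ws: "w summable_on UNIV" by (rule finite_nonzero_values_imp_summable_on) (rule finite_subset[OF _ finite_band[of n]], auto simp: w_def)
        have "snorm 2 (c t) = (\<Sum>\<^sub>\<infinity>k. u k + w k)" unfolding snorm_def by (rule infsum_cong) (auto simp: u_def w_def)
        also have "\<dots> = infsum u UNIV + infsum w UNIV" by (rule infsum_add[OF us ws])
        also have "infsum w UNIV = infsum w (band n)" by (rule infsum_cong_neutral) (auto simp: w_def)
        also have "\<dots> = (\<Sum>k\<in>band n. (wmod 2 (c t) k)\<^sup>2)" by (simp add: w_def)
        finally show ?thesis by simp
      qed
      also have "sum v (band n) \<le> (\<Sum>k\<in>band n. (C / real n ^ 2)\<^sup>2)"
      proof (rule sum_mono)
        fix k assume k: "k \<in> band n"
        have k2: "\<bar>real_of_int k\<bar>\<^sup>2 \<le> real n ^ 2" using band_abs_le[OF k] by (intro power_mono) auto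
        have "cmod (c t k - c g k) \<le> \<bar>of_int k\<bar>\<^sup>2 * C * \<bar>t - g\<bar>" by (rule lip[OF t g(1)])
        also have "\<dots> \<le> \<bar>of_int k\<bar>\<^sup>2 * \<bar>C\<bar> * \<bar>t - g\<bar>" by (intro mult_right_mono mult_left_mono) auto
        also have "\<dots> \<le> real n ^ 2 * \<bar>C\<bar> * (1 / real n ^ 6)" using k2 g by (intro mult_mono) auto
        finally have "wmod 2 (\<lambda>k. c t k - c g k) k \<le> real n ^ 2 * (real n ^ 2 * \<bar>C\<bar> * (1 / real n ^ 6))"
          unfolding wmod_def using k2 by (intro mult_mono) auto
        also have "\<dots> = \<bar>C\<bar> / real n ^ 2"
          using n by (simp add: field_simps flip: power_add)
        finally have "(wmod 2 (\<lambda>k. c t k - c g k) k)\<^sup>2 \<le> (\<bar>C\<bar> / real n ^ 2)\<^sup>2" by (intro power_mono) auto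
        then show "v k \<le> (C / real n ^ 2)\<^sup>2" using k by (simp add: v_def power_divide)
      qed
      also have "\<dots> = real (2 * n + 1) * (C / real n ^ 2)\<^sup>2" by (simp add: band_def)
      also have "\<dots> \<le> 3 * C\<^sup>2 * inverse (real n)"
      proof -
        have "real (2 * n + 1) / real n ^ 4 \<le> 3 * inverse (real n)"
        proof -
          have "real (2 * n + 1) * real n \<le> 3 * real n * real n" using n by (intro mult_right_mono) auto
          also have "\<dots> = 3 * real n ^ 2" by (simp add: power2_eq_square)
          also have "\<dots> \<le> 3 * real n ^ 4" using n by (intro mult_left_mono power_increasing) auto
          finally show ?thesis using n by (simp add: field_simps)
        qed
        then have "C\<^sup>2 * (real (2 * n + 1) / real n ^ 4) \<le> C\<^sup>2 * (3 * inverse (real n))"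
          by (intro mult_left_mono) auto
        then show ?thesis by (simp add: power_divide mult_ac)
      qed
      finally show "snorm 2 (\<lambda>k. c t k - approx n t k) \<le> ?b n" by simp
    qed
  qed auto
  from tendsto_real_sqrt[OF this] show ?thesis by simp
qed

lemma strongly_measurable_fser: "strongly_measurable T X N (\<lambda>t. fser (c t))"
  unfolding strongly_measurable_def
proof (intro exI[of _ "\<lambda>n t. fser (approx n t)"] conjI allI ballI)
  show "simple_function (lebesgue_on {0..T}) (\<lambda>t. fser (approx n t))" for n
    unfolding approx_def by (rule simple_floor)
  show "fser (approx n t) \<in> X" if "t \<in> {0..T}" for n t by (intro X approx_adm that)
  have "AE t in lebesgue_on {0..T}. t \<in> {0..T}" by (rule AE_I2) simp
  with fin show "AE t in lebesgue_on {0..T}. fser (c t) \<in> X \<and> (\<lambda>n. N (\<lambda>x. fser (c t) x - fser (approx n t) x)) \<longlonglongrightarrow> 0"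
  proof eventually_elim
    case (elim t)
    then have ct: "adm (c t)" by (simp add: adm_def herm)
    have d: "adm (\<lambda>k. c t k - approx n t k)" for n by (intro adm_diff ct approx_adm elim)
    have eq: "(\<lambda>x. fser (c t) x - fser (approx n t) x) = fser (\<lambda>k. c t k - approx n t k)" for n
      by (rule ext, rule fser_diff[symmetric]) (intro adm_wnorm(4) ct approx_adm elim)+
    have "(\<lambda>n. N (fser (\<lambda>k. c t k - approx n t k))) \<longlonglongrightarrow> 0"
    proof (rule tendsto_sandwich[OF _ _ tendsto_const])
      show "(\<lambda>n. K * sqrt (snorm 2 (\<lambda>k. c t k - approx n t k))) \<longlonglongrightarrow> 0"
        using tendsto_mult_left[OF approx_tendsto[OF elim(2,1)], of K] by simp
    qed (use d N h2_seminorm_le[OF N] in \<open>auto simp: h2_seminorm_def\<close>)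
    then show ?case unfolding eq using X[OF ct] by simp
  qed
qed

text \<open>The Lipschitz property in \<open>h2_seminorm\<close> makes the norm of the solution an
  almost everywhere limit of norms of step functions; no measurability of \<open>N\<close> itself is
  assumed.\<close>

lemma seminorm_measurable: "(\<lambda>t. N (fser (c t))) \<in> borel_measurable (lebesgue_on {0..T})"
proof -
  have m: "(\<lambda>t. N (fser (approx n t))) \<in> borel_measurable (lebesgue_on {0..T})" for n
    unfolding approx_def by (intro borel_measurable_simple_function simple_floor)
  have "AE t in lebesgue_on {0..T}. t \<in> {0..T}" by (rule AE_I2) simp
  with fin have ae: "AE t in lebesgue_on {0..T}. lim (\<lambda>n. N (fser (approx n t))) = N (fser (c t))"
  proof eventually_elim
    case (elim t)
    then have ct: "adm (c t)" by (simp add: adm_def herm)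
    have a: "adm (approx n t)" for n by (intro approx_adm elim)
    have sw: "snorm 2 (\<lambda>k. approx n t k - c t k) = snorm 2 (\<lambda>k. c t k - approx n t k)" for n
      unfolding snorm_def wmod_def by (simp add: norm_minus_commute)
    have "(\<lambda>n. N (fser (approx n t)) - N (fser (c t))) \<longlonglongrightarrow> 0"
    proof (rule Lim_null_comparison)
      show "(\<lambda>n. K * sqrt (snorm 2 (\<lambda>k. c t k - approx n t k))) \<longlonglongrightarrow> 0"
        using tendsto_mult_left[OF approx_tendsto[OF elim(2,1)], of K] by simp
      have "N (fser (approx n t)) \<le> N (fser (c t)) + K * sqrt (snorm 2 (\<lambda>k. approx n t k - c t k))"
        "N (fser (c t)) \<le> N (fser (approx n t)) + K * sqrt (snorm 2 (\<lambda>k. c t k - approx n t k))" for n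
        using N a ct unfolding h2_seminorm_def by blast+
      then have "\<bar>N (fser (approx n t)) - N (fser (c t))\<bar> \<le> K * sqrt (snorm 2 (\<lambda>k. c t k - approx n t k))" for n
        unfolding sw abs_le_iff by (simp add: algebra_simps)
      then show "\<forall>\<^sub>F n in sequentially. norm (N (fser (approx n t)) - N (fser (c t))) \<le> K * sqrt (snorm 2 (\<lambda>k. c t k - approx n t k))"
        by simp
    qed
    then show ?case by (intro limI) (simp add: LIM_zero_iff)
  qed
  have "(\<lambda>t. lim (\<lambda>n. N (fser (approx n t)))) \<in> borel_measurable (lebesgue_on {0..T})"
    by (intro borel_measurable_lim_metric m)
  then show ?thesis by (rule borel_measurable_lebesgue_on_AE[OF _ _ ae]) simp
qed

lemma bochner_Lp_fser:
  assumes p: "1 \<le> p" "p \<le> 2"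
  shows "(\<lambda>t. fser (c t)) \<in> bochner_Lp p T X N"
proof -
  interpret finite_measure "lebesgue_on {0..T}" by (rule finite_measure_lebesgue_on) simp
  have "integrable (lebesgue_on {0..T}) (\<lambda>t. N (fser (c t)) powr p)"
  proof (rule Bochner_Integration.integrable_bound)
    show "integrable (lebesgue_on {0..T}) (\<lambda>t. 1 + K\<^sup>2 * snorm 2 (c t))" using int by auto
    show "(\<lambda>t. N (fser (c t)) powr p) \<in> borel_measurable (lebesgue_on {0..T})"
      using seminorm_measurable by measurable
    have "AE t in lebesgue_on {0..T}. t \<in> {0..T}" by (rule AE_I2) simp
    with fin show "AE t in lebesgue_on {0..T}. norm (N (fser (c t)) powr p) \<le> norm (1 + K\<^sup>2 * snorm 2 (c t))"
    proof eventually_elim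
      case (elim t)
      then have ct: "adm (c t)" by (simp add: adm_def herm)
      define y where "y = N (fser (c t))"
      have y: "0 \<le> y" "y \<le> K * sqrt (snorm 2 (c t))"
        using N ct h2_seminorm_le[OF N ct] unfolding h2_seminorm_def y_def by auto
      have "y\<^sup>2 \<le> (K * sqrt (snorm 2 (c t)))\<^sup>2" using y by (intro power_mono) auto
      then have y2: "y\<^sup>2 \<le> K\<^sup>2 * snorm 2 (c t)" by (simp add: power_mult_distrib)
      \<comment> \<open>For exponents between 1 and 2 the square is enough: a value up to 1 has
        power at most 1, a larger one has power at most its square.\<close>
      have "y powr p \<le> 1 + y\<^sup>2"
      proof (cases "y \<le> 1")
        case True
        then have "y powr p \<le> 1" using y p by (intro powr_le1) auto
        then show ?thesis by (smt (verit) zero_le_power2)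
      next
        case False
        then have "y powr p \<le> y powr 2" using p by (intro powr_mono) auto
        then show ?thesis using False by simp
      qed
      with y2 show ?case unfolding y_def[symmetric] by simp
    qed
  qed
  then show ?thesis unfolding bochner_Lp_def using strongly_measurable_fser by simp
qed

end

section \<open>The norms that are controlled by the H^2 norm\<close>

lemma W11_seminorm: "h2_seminorm W11_norm (4 * pi * wK)"
  unfolding h2_seminorm_def
proof (intro conjI allI impI)
  have z: "adm (\<lambda>_. 0)" by (rule adm_zero)
  have f0: "fser (\<lambda>_. 0) = (\<lambda>x. 0)" by (rule ext) (simp add: fser_def)
  have "dcoef (\<lambda>_. 0) = (\<lambda>_. 0)" by (rule ext) (simp add: dcoef_def)
  then show "W11_norm (fser (\<lambda>_. 0)) = 0"
    unfolding W11_norm_fser[OF adm_wnorm(1,3)[OF z]] by (simp add: f0 L1_norm_def)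
  show "0 \<le> W11_norm (fser c)" if "adm c" for c
    unfolding W11_norm_fser[OF adm_wnorm(1,3)[OF that]] by (simp add: L1_norm_def)
  fix c d assume c: "adm c" and d: "adm d"
  note ac = adm_wnorm[OF c] and ad = adm_wnorm[OF d] and acd = adm_wnorm[OF adm_diff[OF c d]]
  have "L1_norm (fser c) \<le> L1_norm (fser d) + 2 * pi * wnorm 0 (\<lambda>k. c k - d k)"
    by (rule L1_norm_fser_lip[OF ac(4) ad(4)])
  moreover have "L1_norm (fser (dcoef c)) \<le> L1_norm (fser (dcoef d)) + 2 * pi * wnorm 1 (\<lambda>k. c k - d k)"
    using L1_norm_fser_lip[of "dcoef c" "dcoef d"] ac(3) ad(3) by (simp flip: dcoef_diff)
  moreover have "2 * pi * wnorm 0 (\<lambda>k. c k - d k) + 2 * pi * wnorm 1 (\<lambda>k. c k - d k) \<le> 4 * pi * wK * sqrt (snorm 2 (\<lambda>k. c k - d k))"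
  proof -
    have "2 * pi * (wnorm 0 (\<lambda>k. c k - d k) + wnorm 1 (\<lambda>k. c k - d k)) \<le> 2 * pi * (2 * (wK * sqrt (snorm 2 (\<lambda>k. c k - d k))))"
      using acd(5,6) by (intro mult_left_mono) auto
    then show ?thesis by (simp add: algebra_simps)
  qed
  ultimately show "W11_norm (fser c) \<le> W11_norm (fser d) + 4 * pi * wK * sqrt (snorm 2 (\<lambda>k. c k - d k))"
    unfolding W11_norm_fser[OF ac(1,3)] W11_norm_fser[OF ad(1,3)] by linarith
qed

lemma W1inf_seminorm: "h2_seminorm W1inf_norm (2 * wK)"
  unfolding h2_seminorm_def
proof (intro conjI allI impI)
  have z: "adm (\<lambda>_. 0)" by (rule adm_zero)
  have nn: "0 \<le> Linf_norm (fser c)" if "wsummable 0 c" for c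
    using Linf_norm_eq(2)[OF measurable_fser fser_Linf_bound] that by blast
  have "wnorm 0 (\<lambda>_. 0) = 0" by (simp add: wnorm_def wmod_def)
  then have "Linf_norm (fser (\<lambda>_. 0)) = 0"
    using Linf_norm_fser_le[OF adm_wnorm(4)[OF z]] nn[OF adm_wnorm(4)[OF z]] by simp
  moreover have "dcoef (\<lambda>_. 0) = (\<lambda>_. 0)" by (rule ext) (simp add: dcoef_def)
  ultimately show "W1inf_norm (fser (\<lambda>_. 0)) = 0"
    unfolding W1inf_norm_fser[OF adm_wnorm(1,3)[OF z]] by simp
  show "0 \<le> W1inf_norm (fser c)" if "adm c" for c
    unfolding W1inf_norm_fser[OF adm_wnorm(1,3)[OF that]]
    using nn[OF adm_wnorm(4)[OF that]] nn[of "dcoef c"] adm_wnorm(3)[OF that] by simp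
  fix c d assume c: "adm c" and d: "adm d"
  note ac = adm_wnorm[OF c] and ad = adm_wnorm[OF d] and acd = adm_wnorm[OF adm_diff[OF c d]]
  have "Linf_norm (fser c) \<le> Linf_norm (fser d) + wnorm 0 (\<lambda>k. c k - d k)"
    by (rule Linf_norm_fser_lip[OF ac(4) ad(4)])
  moreover have "Linf_norm (fser (dcoef c)) \<le> Linf_norm (fser (dcoef d)) + wnorm 1 (\<lambda>k. c k - d k)"
    using Linf_norm_fser_lip[of "dcoef c" "dcoef d"] ac(3) ad(3) by (simp flip: dcoef_diff)
  ultimately show "W1inf_norm (fser c) \<le> W1inf_norm (fser d) + 2 * wK * sqrt (snorm 2 (\<lambda>k. c k - d k))"
    unfolding W1inf_norm_fser[OF ac(1,3)] W1inf_norm_fser[OF ad(1,3)] using acd(5,6) by linarith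
qed

lemma cSUP_le_add:
  fixes f g :: "'a \<Rightarrow> real"
  assumes "A \<noteq> {}" "bdd_above (g ` A)" "\<And>x. x \<in> A \<Longrightarrow> f x \<le> g x + e"
  shows "(SUP x\<in>A. f x) \<le> (SUP x\<in>A. g x) + e"
proof (rule cSUP_least[OF assms(1)])
  fix x assume "x \<in> A"
  then have "g x \<le> (SUP x\<in>A. g x)" using assms(2) by (intro cSUP_upper) auto
  with assms(3)[OF \<open>x \<in> A\<close>] show "f x \<le> (SUP x\<in>A. g x) + e" by linarith
qed

lemma cis_diff_le: "cmod (cis a - cis b) \<le> \<bar>a - b\<bar>" "cmod (cis a - cis b) \<le> 2"
proof -
  have "cmod (cis a - cis b) \<le> cmod (cis a) + cmod (cis b)" by (rule norm_triangle_ineq4)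
  then show "cmod (cis a - cis b) \<le> 2" by simp
  have "(cmod (cis a - cis b))\<^sup>2 = (cos a - cos b)\<^sup>2 + (sin a - sin b)\<^sup>2" by (simp add: cmod_power2)
  also have "\<dots> = ((cos a)\<^sup>2 + (sin a)\<^sup>2) + ((cos b)\<^sup>2 + (sin b)\<^sup>2) - 2 * (cos a * cos b + sin a * sin b)"
    by (simp add: power2_diff algebra_simps)
  also have "\<dots> = 2 - 2 * cos (a - b)" by (simp add: cos_diff)
  also have "\<dots> = (2 * sin ((a - b) / 2))\<^sup>2"
  proof -
    have "2 * ((a - b) / 2) = a - b" by simp
    from cos_double_sin[of "(a - b) / 2", unfolded this] show ?thesis by (simp add: power_mult_distrib)
  qed
  finally have "cmod (cis a - cis b) = \<bar>2 * sin ((a - b) / 2)\<bar>"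
    by (metis norm_ge_zero real_sqrt_abs real_sqrt_unique)
  also have "\<dots> \<le> \<bar>a - b\<bar>" using abs_sin_x_le_abs_x[of "(a - b) / 2"] by simp
  finally show "cmod (cis a - cis b) \<le> \<bar>a - b\<bar>" .
qed

text \<open>Interpolates between the bounds \<open>z\<close> and 2. With \<open>z\<close> equal to
  the frequency times \<open>\<bar>x - y\<bar>\<close> it gives the Hoelder bound for a single
  exponential.\<close>

lemma le_twice_powr:
  fixes y z \<alpha> :: real
  assumes "0 \<le> \<alpha>" "\<alpha> \<le> 1" "y \<le> z" "y \<le> 2" "0 < z"
  shows "y \<le> 2 * z powr \<alpha>"
proof (cases "z \<le> 1")
  case True
  have "z = z powr 1" using assms by simp
  also have "\<dots> \<le> z powr \<alpha>" using assms True by (intro powr_mono') auto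
  finally have "z \<le> z powr \<alpha>" .
  moreover have "0 \<le> z powr \<alpha>" by simp
  ultimately show ?thesis using assms by linarith
next
  case False
  then have "1 \<le> z powr \<alpha>" using assms by (intro ge_one_powr_ge_zero) auto
  with assms show ?thesis by linarith
qed

lemma fser_dcoef_holder:
  assumes "wsummable 1 c" "(\<lambda>k. \<bar>of_int k\<bar> powr (1 + \<alpha>) * cmod (c k)) summable_on UNIV" "0 \<le> \<alpha>" "\<alpha> \<le> 1" "x \<noteq> y"
  shows "\<bar>fser (dcoef c) x - fser (dcoef c) y\<bar> \<le> 2 * holder_sum \<alpha> c * \<bar>x - y\<bar> powr \<alpha>"
proof -
  have d: "wsummable 0 (dcoef c)" using assms(1) by simp
  let ?S = "\<Sum>\<^sub>\<infinity>k. dcoef c k * cis (of_int k * x) - dcoef c k * cis (of_int k * y)"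
  have sm: "(\<lambda>k. dcoef c k * cis (of_int k * x) - dcoef c k * cis (of_int k * y)) summable_on UNIV"
    and eq: "?S = (\<Sum>\<^sub>\<infinity>k. dcoef c k * cis (of_int k * x)) - (\<Sum>\<^sub>\<infinity>k. dcoef c k * cis (of_int k * y))"
    using has_sum_add[OF has_sum_infsum[OF fser_summable(2)[OF d, of x]] has_sum_uminusI[OF has_sum_infsum[OF fser_summable(2)[OF d, of y]]]]
    by (auto simp: has_sum_iff)
  have "fser (dcoef c) x - fser (dcoef c) y = Re ?S" unfolding eq fser_def by simp
  then have "\<bar>fser (dcoef c) x - fser (dcoef c) y\<bar> \<le> cmod ?S" using abs_Re_le_cmod by metis
  also have "\<dots> \<le> (\<Sum>\<^sub>\<infinity>k. (2 * \<bar>x - y\<bar> powr \<alpha>) * (\<bar>of_int k\<bar> powr (1 + \<alpha>) * cmod (c k)))"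
  proof (rule norm_infsum_le[OF has_sum_infsum[OF sm] has_sum_infsum[OF summable_on_cmult_right[OF assms(2)]]])
    fix k :: int
    show "cmod (dcoef c k * cis (of_int k * x) - dcoef c k * cis (of_int k * y)) \<le> (2 * \<bar>x - y\<bar> powr \<alpha>) * (\<bar>of_int k\<bar> powr (1 + \<alpha>) * cmod (c k))"
    proof (cases "k = 0")
      case False
      define D where "D = cmod (cis (of_int k * x) - cis (of_int k * y))"
      have "D \<le> 2 * (\<bar>real_of_int k\<bar> * \<bar>x - y\<bar>) powr \<alpha>"
      proof (rule le_twice_powr)
        show "D \<le> \<bar>real_of_int k\<bar> * \<bar>x - y\<bar>" unfolding D_def
          using cis_diff_le(1)[of "of_int k * x" "of_int k * y"] by (simp add: abs_mult right_diff_distrib flip: abs_mult)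
        show "D \<le> 2" unfolding D_def by (rule cis_diff_le)
      qed (use assms False in auto)
      then have "\<bar>of_int k\<bar> * cmod (c k) * D \<le> \<bar>of_int k\<bar> * cmod (c k) * (2 * (\<bar>real_of_int k\<bar> powr \<alpha> * \<bar>x - y\<bar> powr \<alpha>))"
        by (intro mult_left_mono) (auto simp: powr_mult)
      moreover have "cmod (dcoef c k * cis (of_int k * x) - dcoef c k * cis (of_int k * y)) = \<bar>of_int k\<bar> * cmod (c k) * D"
        unfolding D_def right_diff_distrib[symmetric] norm_mult dcoef_def by simp
      moreover have "\<bar>real_of_int k\<bar> powr (1 + \<alpha>) = \<bar>real_of_int k\<bar> * \<bar>real_of_int k\<bar> powr \<alpha>"
        using False by (simp add: powr_add)
      ultimately show ?thesis by (simp add: mult_ac)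
    qed (simp add: dcoef_def)
  qed
  also have "\<dots> = 2 * holder_sum \<alpha> c * \<bar>x - y\<bar> powr \<alpha>"
    unfolding infsum_cmult_right' holder_sum_def by simp
  finally show ?thesis .
qed

lemma deriv_fser: "c 0 = 0 \<Longrightarrow> wsummable 1 c \<Longrightarrow> deriv (fser c) = fser (dcoef c)"
  using has_real_derivative_fser by (intro ext DERIV_imp_deriv)

lemma fser_C1_holder:
  assumes "adm c" "0 \<le> \<alpha>" "\<alpha> < 1/2"
  shows "fser c \<in> C1_holder \<alpha>"
proof -
  note a = adm_wnorm[OF assms(1)]
  have d: "wsummable 0 (dcoef c)" using a by simp
  have s: "(\<lambda>k. \<bar>of_int k\<bar> powr (1 + \<alpha>) * cmod (c k)) summable_on UNIV"
    by (rule holder_sum_le(1)) (use assms in \<open>auto simp: adm_def\<close>)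
  show ?thesis unfolding C1_holder_def mem_Collect_eq deriv_fser[OF a(1,3)]
  proof (intro conjI allI exI[of _ "2 * holder_sum \<alpha> c"] impI)
    show "periodic (fser c)" by (rule periodic_fser)
    show "fser c differentiable at x" for x
      using has_real_derivative_fser[OF a(1,3)] real_differentiable_def by blast
    show "continuous_on UNIV (fser (dcoef c))" by (rule continuous_fser[OF d])
    show "\<bar>fser (dcoef c) x - fser (dcoef c) y\<bar> \<le> 2 * holder_sum \<alpha> c * \<bar>x - y\<bar> powr \<alpha>" if "x \<noteq> y" for x y
      by (rule fser_dcoef_holder[OF a(3) s]) (use assms that in auto)
  qed
qed

text \<open>A real supremum can be used only for a nonempty set that is bounded above. The Wiener
  norms and \<open>holder_sum\<close> supply the bounds for the three suprema, after which each is
  compared term by term.\<close>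

lemma C1_holder_seminorm:
  assumes "0 \<le> \<alpha>" "\<alpha> < 1/2"
  obtains K where "h2_seminorm (C1_holder_norm \<alpha>) K"
proof
  define Z where "Z = sqrt (\<Sum>\<^sub>\<infinity>k::int. \<bar>real_of_int k\<bar> powr (2 * \<alpha> - 2))"
  let ?P = "{(x, y). x \<noteq> (y::real)}"
  define q where "q c p = \<bar>fser (dcoef c) (fst p) - fser (dcoef c) (snd p)\<bar> / \<bar>fst p - snd p\<bar> powr \<alpha>" for c p
  have "(0, 1) \<in> ?P" by simp
  then have ne: "?P \<noteq> {}" by blast
  have Neq: "C1_holder_norm \<alpha> (fser c) = (SUP x. \<bar>fser c x\<bar>) + (SUP x. \<bar>fser (dcoef c) x\<bar>) + (SUP p\<in>?P. q c p)" if "adm c" for c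
    unfolding C1_holder_norm_def deriv_fser[OF adm_wnorm(1,3)[OF that]] q_def ..
  have hs: "(\<lambda>k. \<bar>of_int k\<bar> powr (1 + \<alpha>) * cmod (c k)) summable_on UNIV" "holder_sum \<alpha> c \<le> Z * sqrt (snorm 2 c)" if "adm c" for c
    using holder_sum_le[of \<alpha> c] assms that unfolding Z_def adm_def by auto
  have qle: "q c p \<le> 2 * holder_sum \<alpha> c" if c: "adm c" and p: "p \<in> ?P" for c p
  proof -
    have "\<bar>fser (dcoef c) (fst p) - fser (dcoef c) (snd p)\<bar> \<le> 2 * holder_sum \<alpha> c * \<bar>fst p - snd p\<bar> powr \<alpha>"
      by (rule fser_dcoef_holder[OF adm_wnorm(3)[OF c] hs(1)[OF c]]) (use assms p in auto)
    then show ?thesis unfolding q_def using p by (subst pos_divide_le_eq) auto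
  qed
  have d: "wsummable 0 (dcoef c)" if "adm c" for c using adm_wnorm(3)[OF that] by simp
  have bd: "bdd_above (range (\<lambda>x. \<bar>fser c x\<bar>))" "bdd_above (range (\<lambda>x. \<bar>fser (dcoef c) x\<bar>))" "bdd_above (q c ` ?P)" if "adm c" for c
    using fser_bound[OF adm_wnorm(4)[OF that]] fser_bound[OF d[OF that]] qle[OF that] by (auto intro!: bdd_aboveI2)
  have nn: "0 \<le> (SUP x. \<bar>fser c x\<bar>)" "0 \<le> (SUP x. \<bar>fser (dcoef c) x\<bar>)" "0 \<le> (SUP p\<in>?P. q c p)" if "adm c" for c
  proof -
    show "0 \<le> (SUP x. \<bar>fser c x\<bar>)" by (rule cSUP_upper2[OF bd(1)[OF that] UNIV_I, of _ 0]) simp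
    show "0 \<le> (SUP x. \<bar>fser (dcoef c) x\<bar>)" by (rule cSUP_upper2[OF bd(2)[OF that] UNIV_I, of _ 0]) simp
    show "0 \<le> (SUP p\<in>?P. q c p)" by (rule cSUP_upper2[OF bd(3)[OF that], of "(0, 1)"]) (auto simp: q_def)
  qed
  show "h2_seminorm (C1_holder_norm \<alpha>) (2 * wK + 2 * Z)"
    unfolding h2_seminorm_def
  proof (intro conjI allI impI)
    have f0: "fser (\<lambda>_. 0) = (\<lambda>x. 0)" by (rule ext) (simp add: fser_def)
    have d0: "dcoef (\<lambda>_. 0) = (\<lambda>_. 0)" by (rule ext) (simp add: dcoef_def)
    have "q (\<lambda>_. 0) = (\<lambda>p. 0)" unfolding q_def d0 f0 by auto
    then show "C1_holder_norm \<alpha> (fser (\<lambda>_. 0)) = 0"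
      unfolding Neq[OF adm_zero] d0 using ne by (simp add: f0)
    show "0 \<le> C1_holder_norm \<alpha> (fser c)" if "adm c" for c
      unfolding Neq[OF that] using nn[OF that] by simp
    fix c e assume c: "adm c" and e: "adm e"
    note ac = adm_wnorm[OF c] and ae = adm_wnorm[OF e] and ace = adm_wnorm[OF adm_diff[OF c e]]
    have 1: "(SUP x. \<bar>fser c x\<bar>) \<le> (SUP x. \<bar>fser e x\<bar>) + wnorm 0 (\<lambda>k. c k - e k)"
    proof (rule cSUP_le_add[OF _ bd(1)[OF e]])
      fix x
      show "\<bar>fser c x\<bar> \<le> \<bar>fser e x\<bar> + wnorm 0 (\<lambda>k. c k - e k)"
        using fser_bound[OF ace(4), of x] unfolding fser_diff[OF ac(4) ae(4)] by linarith
    qed simp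
    have dd: "fser (dcoef (\<lambda>k. c k - e k)) x = fser (dcoef c) x - fser (dcoef e) x" for x
      unfolding dcoef_diff by (rule fser_diff[OF d[OF c] d[OF e]])
    have 2: "(SUP x. \<bar>fser (dcoef c) x\<bar>) \<le> (SUP x. \<bar>fser (dcoef e) x\<bar>) + wnorm 1 (\<lambda>k. c k - e k)"
    proof (rule cSUP_le_add[OF _ bd(2)[OF e]])
      fix x
      have "\<bar>fser (dcoef (\<lambda>k. c k - e k)) x\<bar> \<le> wnorm 1 (\<lambda>k. c k - e k)"
        using fser_bound[OF d[OF adm_diff[OF c e]], of x] by simp
      then show "\<bar>fser (dcoef c) x\<bar> \<le> \<bar>fser (dcoef e) x\<bar> + wnorm 1 (\<lambda>k. c k - e k)"
        unfolding dd by linarith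
    qed simp
    have 3: "(SUP p\<in>?P. q c p) \<le> (SUP p\<in>?P. q e p) + 2 * holder_sum \<alpha> (\<lambda>k. c k - e k)"
    proof (rule cSUP_le_add[OF ne bd(3)[OF e]])
      fix p assume p: "p \<in> ?P"
      have "q c p \<le> q e p + q (\<lambda>k. c k - e k) p"
        unfolding q_def dd add_divide_distrib[symmetric] by (rule divide_right_mono) auto
      then show "q c p \<le> q e p + 2 * holder_sum \<alpha> (\<lambda>k. c k - e k)"
        using qle[OF adm_diff[OF c e] p] by linarith
    qed
    have "wnorm 0 (\<lambda>k. c k - e k) + wnorm 1 (\<lambda>k. c k - e k) + 2 * holder_sum \<alpha> (\<lambda>k. c k - e k) \<le> (2 * wK + 2 * Z) * sqrt (snorm 2 (\<lambda>k. c k - e k))"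
      using ace(5,6) hs(2)[OF adm_diff[OF c e]] by (simp add: algebra_simps)
    with 1 2 3 show "C1_holder_norm \<alpha> (fser c) \<le> C1_holder_norm \<alpha> (fser e) + (2 * wK + 2 * Z) * sqrt (snorm 2 (\<lambda>k. c k - e k))"
      unfolding Neq[OF c] Neq[OF e] by linarith
  qed
qed

lemma powr_le_power:
  assumes "k \<noteq> 0" "s \<le> real p"
  shows "\<bar>real_of_int k\<bar> powr (2 * s) \<le> (\<bar>real_of_int k\<bar> ^ p)\<^sup>2"
proof -
  have k: "1 \<le> \<bar>real_of_int k\<bar>" using assms(1) by linarith
  have "\<bar>real_of_int k\<bar> powr (2 * s) \<le> \<bar>real_of_int k\<bar> powr (real (2 * p))"
    using assms k by (intro powr_mono) auto
  also have "\<dots> = \<bar>real_of_int k\<bar> ^ (2 * p)" using assms by (subst powr_realpow) auto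
  finally show ?thesis by (simp add: power_mult[symmetric] mult.commute)
qed

lemma fser_Hdot:
  assumes "hermitian c" "wsummable 0 c" "ssummable p c" "0 \<le> s" "s \<le> real p"
  shows "fser c \<in> Hdot s" "(Hdot_norm s (fser c))\<^sup>2 \<le> snorm p c"
proof -
  have le1: "1 * (cmod (c k))\<^sup>2 \<le> (wmod p c k)\<^sup>2" for k
  proof (cases "k = 0")
    case False
    then have "1 \<le> \<bar>real_of_int k\<bar> ^ p" by (intro one_le_power) linarith
    then have "1 * cmod (c k) \<le> \<bar>real_of_int k\<bar> ^ p * cmod (c k)" by (intro mult_right_mono) auto
    then have "(cmod (c k))\<^sup>2 \<le> (wmod p c k)\<^sup>2" unfolding wmod_def by (intro power_mono) auto
    then show ?thesis by simp
  qed (use hermitian_zero[OF assms(1)] in simp)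
  have les: "\<bar>of_int k\<bar> powr (2 * s) * (cmod (c k))\<^sup>2 \<le> (wmod p c k)\<^sup>2" for k
  proof (cases "k = 0")
    case False
    then have "\<bar>of_int k\<bar> powr (2 * s) * (cmod (c k))\<^sup>2 \<le> (\<bar>real_of_int k\<bar> ^ p)\<^sup>2 * (cmod (c k))\<^sup>2"
      by (intro mult_right_mono powr_le_power assms) auto
    then show ?thesis by (simp add: wmod_def power_mult_distrib)
  qed (use hermitian_zero[OF assms(1)] in simp)
  have "(\<lambda>k. (1 + \<bar>of_int k\<bar> powr (2 * s)) * (cmod (c k))\<^sup>2) summable_on UNIV"
  proof (rule summable_on_comparison_test)
    show "(\<lambda>k. 2 * (wmod p c k)\<^sup>2) summable_on UNIV" using assms(3) by (rule summable_on_cmult_right)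
    show "(1 + \<bar>of_int k\<bar> powr (2 * s)) * (cmod (c k))\<^sup>2 \<le> 2 * (wmod p c k)\<^sup>2" for k
      unfolding distrib_right using le1[of k] les[of k] by linarith
  qed simp
  then show "fser c \<in> Hdot s"
    by (simp add: Hdot_def fser_L2 assms mean_fser fourier_fser)
  have "(\<Sum>\<^sub>\<infinity>k::int. \<bar>of_int k\<bar> powr (2 * s) * (cmod (c k))\<^sup>2) \<le> snorm p c"
    unfolding snorm_def
    by (rule infsum_mono[OF summable_on_comparison_test[OF assms(3) les] assms(3) les]) simp
  moreover have "0 \<le> (\<Sum>\<^sub>\<infinity>k::int. \<bar>of_int k\<bar> powr (2 * s) * (cmod (c k))\<^sup>2)" by (rule infsum_nonneg) simp
  ultimately show "(Hdot_norm s (fser c))\<^sup>2 \<le> snorm p c"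
    by (simp add: Hdot_norm_def fourier_fser assms)
qed

lemma Hdot_norm_fser:
  assumes "hermitian c" "wsummable 0 c"
  shows "Hdot_norm (real p) (fser c) = sqrt (snorm p c)"
proof -
  have "(\<Sum>\<^sub>\<infinity>k::int. \<bar>of_int k\<bar> powr (2 * real p) * (cmod (c k))\<^sup>2) = snorm p c"
    unfolding snorm_def
  proof (rule infsum_cong)
    fix k :: int
    show "\<bar>of_int k\<bar> powr (2 * real p) * (cmod (c k))\<^sup>2 = (wmod p c k)\<^sup>2"
    proof (cases "k = 0")
      case False
      then have "\<bar>real_of_int k\<bar> powr (real (2 * p)) = \<bar>real_of_int k\<bar> ^ (2 * p)" by (subst powr_realpow) auto
      then show ?thesis by (simp add: wmod_def power_mult_distrib power_mult[symmetric] mult.commute)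
    qed (use hermitian_zero[OF assms(1)] in \<open>simp add: wmod_def\<close>)
  qed
  then show ?thesis by (simp add: Hdot_norm_def fourier_fser assms)
qed

lemma Hdot_seminorm:
  assumes "p \<le> 2"
  shows "h2_seminorm (Hdot_norm (real p)) 1"
  unfolding h2_seminorm_def
proof (intro conjI allI impI)
  have eq: "Hdot_norm (real p) (fser c) = sqrt (snorm p c)" if "adm c" for c
    using Hdot_norm_fser adm_wnorm[OF that] by blast
  have ss: "ssummable p c" if "adm c" for c
    using ssummable_mono[of c p 2] assms that adm_wnorm(1)[OF that] by (auto simp: adm_def)
  show "Hdot_norm (real p) (fser (\<lambda>_. 0)) = 0" unfolding eq[OF adm_zero] by (simp add: snorm_def wmod_def)
  show "0 \<le> Hdot_norm (real p) (fser c)" if "adm c" for c unfolding eq[OF that] by simp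
  fix c d assume c: "adm c" and d: "adm d"
  have "sqrt (snorm p c) \<le> sqrt (snorm p d) + sqrt (snorm p (\<lambda>k. c k - d k))"
    by (rule snorm_triangle[OF ss[OF c] ss[OF d]])
  moreover have "sqrt (snorm p (\<lambda>k. c k - d k)) \<le> sqrt (snorm 2 (\<lambda>k. c k - d k))"
  proof (intro real_sqrt_le_mono snorm_mono)
    show "c 0 - d 0 = 0" using adm_wnorm(1)[OF c] adm_wnorm(1)[OF d] by simp
    show "ssummable 2 (\<lambda>k. c k - d k)" using adm_diff[OF c d] unfolding adm_def by (rule conjunct2)
  qed (rule assms)
  ultimately show "Hdot_norm (real p) (fser c) \<le> Hdot_norm (real p) (fser d) + 1 * sqrt (snorm 2 (\<lambda>k. c k - d k))"
    unfolding eq[OF c] eq[OF d] by linarith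
qed

text \<open>Dominated convergence for series along an arbitrary filter: a finite band converges term
  by term, and the rest is at most the tail of the majorant.\<close>

lemma infsum_tendsto_zero:
  fixes a :: "'x \<Rightarrow> int \<Rightarrow> real"
  assumes nn: "\<And>x k. 0 \<le> a x k" and dom: "\<forall>\<^sub>F x in Fil. \<forall>k. a x k \<le> e k"
    and e: "e summable_on UNIV" and lim: "\<And>k. ((\<lambda>x. a x k) \<longlongrightarrow> 0) Fil"
  shows "((\<lambda>x. \<Sum>\<^sub>\<infinity>k. a x k) \<longlongrightarrow> 0) Fil"
proof (rule tendstoI)
  fix \<epsilon> :: real assume \<epsilon>: "\<epsilon> > 0"
  have "\<forall>\<^sub>F n in sequentially. dist (sum e (band n)) (infsum e UNIV) < \<epsilon> / 2"
    by (rule tendstoD[OF band_sums[OF e]]) (use \<epsilon> in simp)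
  then obtain n where n: "\<bar>sum e (band n) - infsum e UNIV\<bar> < \<epsilon> / 2"
    unfolding eventually_sequentially dist_real_def by blast
  have "((\<lambda>x. \<Sum>k\<in>band n. a x k) \<longlongrightarrow> (\<Sum>k\<in>band n. 0)) Fil" by (intro tendsto_sum lim)
  then have "\<forall>\<^sub>F x in Fil. dist (\<Sum>k\<in>band n. a x k) 0 < \<epsilon> / 2" by (intro tendstoD) (use \<epsilon> in auto)
  with dom show "\<forall>\<^sub>F x in Fil. dist (\<Sum>\<^sub>\<infinity>k. a x k) 0 < \<epsilon>"
  proof eventually_elim
    case (elim x)
    have as: "a x summable_on UNIV" by (rule summable_on_comparison_test[OF e]) (use elim nn in auto)
    have b: "infsum h UNIV = sum h (band n) + infsum h (- band n)" if "h summable_on UNIV" for h :: "int \<Rightarrow> real"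
      using infsum_Un_disjoint[of h "band n" "- band n"] summable_on_subset_banach[OF that, of "- band n"] by simp
    have "infsum (a x) (- band n) \<le> infsum e (- band n)"
      by (rule infsum_mono) (use elim as e in \<open>auto intro: summable_on_subset_banach\<close>)
    moreover have "0 \<le> (\<Sum>\<^sub>\<infinity>k. a x k)" "0 \<le> sum (a x) (band n)" using nn by (auto intro: infsum_nonneg sum_nonneg)
    ultimately show ?case using b[OF as] b[OF e] n elim by (simp add: dist_real_def)
  qed
qed

lemma lipschitz_imp_continuous_on:
  fixes h :: "real \<Rightarrow> 'b::real_normed_vector"
  assumes "\<And>t s. t \<in> S \<Longrightarrow> s \<in> S \<Longrightarrow> norm (h t - h s) \<le> L * \<bar>t - s\<bar>"
  shows "continuous_on S h"
proof (rule lipschitz_on_continuous_on)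
  show "\<bar>L\<bar>-lipschitz_on S h"
  proof (rule lipschitz_onI)
    fix t s assume "t \<in> S" "s \<in> S"
    then have "norm (h t - h s) \<le> L * \<bar>t - s\<bar>" by (rule assms)
    also have "\<dots> \<le> \<bar>L\<bar> * \<bar>t - s\<bar>" by (intro mult_right_mono) auto
    finally show "dist (h t) (h s) \<le> \<bar>L\<bar> * dist t s" by (simp add: dist_norm)
  qed simp
qed

lemma has_vector_derivative_of_integral_eq:
  fixes y :: "real \<Rightarrow> 'b::banach"
  assumes t: "t \<in> {0..T}" and eq: "\<And>t. t \<in> {0..T} \<Longrightarrow> y t = y0 + integral {0..t} W"
    and W: "continuous_on {0..T} W"
  shows "(y has_vector_derivative W t) (at t within {0..T})"
proof -
  have "((\<lambda>u. y0 + integral {0..u} W) has_vector_derivative (0 + W t)) (at t within {0..T})"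
    by (intro has_vector_derivative_add has_vector_derivative_const integral_has_vector_derivative W t)
  then have d: "((\<lambda>u. y0 + integral {0..u} W) has_vector_derivative W t) (at t within {0..T})"
    by simp
  show ?thesis by (rule has_vector_derivative_transform[OF t _ d]) (rule eq)
qed

lemma trunc_fser_continuous:
  assumes "\<And>k. continuous_on S (\<lambda>t. y t k)"
  shows "continuous_on (S \<times> Z) (\<lambda>(t, z). fser (trunc n (y t)) z)"
proof -
  have c: "continuous_on (S \<times> Z) (\<lambda>p. y (fst p) k)" for k
    by (rule continuous_on_compose2[OF assms[of k] continuous_on_fst]) auto
  have "continuous_on (S \<times> Z) (\<lambda>p. \<Sum>k\<in>band n. Re (y (fst p) k * cis (of_int k * snd p)))"
    by (intro continuous_intros c)
  then show ?thesis by (simp add: trunc_fser case_prod_beta)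
qed

section \<open>Regularity from dissipation\<close>

text \<open>The setting is \<open>x\<close> in L^2(0,T; H^2) with velocity \<open>W\<close> in
  L^2(0,T; L^2), expressed through finite bands only. Halfway between the two spaces lies H^1, into
  which \<open>x\<close> is then continuous.\<close>

context
  fixes T B :: real and x W :: "real \<Rightarrow> int \<Rightarrow> complex" and x0 :: "int \<Rightarrow> complex"
  assumes T: "T > 0" and xc: "\<And>k. continuous_on {0..T} (\<lambda>t. x t k)" and Wc: "\<And>k. continuous_on {0..T} (\<lambda>t. W t k)"
    and xe: "\<And>t k. t \<in> {0..T} \<Longrightarrow> x t k = x0 k + integral {0..t} (\<lambda>s. W s k)"
    and B: "\<And>N. integral {0..T} (\<lambda>t. \<Sum>k\<in>band N. (wmod 2 (x t) k)\<^sup>2 + (cmod (W t k))\<^sup>2) \<le> B"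
    and x0: "ssummable 1 x0" and herm: "\<And>t. t \<in> {0..T} \<Longrightarrow> hermitian (x t)"
begin

text \<open>A majorant, uniform in time, of the energy in mode \<open>k\<close>: the initial energy
  plus the time integral of everything that can change it.\<close>

definition edom :: "int \<Rightarrow> real" where
  "edom k = (wmod 1 x0 k)\<^sup>2 + integral {0..T} (\<lambda>t. (wmod 2 (x t) k)\<^sup>2 + (cmod (W t k))\<^sup>2)"

lemma dens_cont: "continuous_on {0..T} (\<lambda>t. (wmod 2 (x t) k)\<^sup>2 + (cmod (W t k))\<^sup>2)"
  unfolding wmod_def by (intro continuous_intros xc Wc)

lemma edom_nonneg: "0 \<le> edom k"
  unfolding edom_def by (intro add_nonneg_nonneg integral_nonneg integrable_continuous_real dens_cont) auto

lemma edom_summable: "edom summable_on UNIV"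
proof (rule band_bound_summable(1)[of edom "snorm 1 x0 + B"])
  fix n
  have "sum edom (band n) = (\<Sum>k\<in>band n. (wmod 1 x0 k)\<^sup>2) + integral {0..T} (\<lambda>t. \<Sum>k\<in>band n. (wmod 2 (x t) k)\<^sup>2 + (cmod (W t k))\<^sup>2)"
    unfolding edom_def sum.distrib[of "\<lambda>k. (wmod 1 x0 k)\<^sup>2"]
    by (subst integral_sum) (auto intro: integrable_continuous_real dens_cont)
  also have "\<dots> \<le> snorm 1 x0 + B"
    unfolding snorm_def by (intro add_mono B finite_sum_le_infsum x0) auto
  finally show "sum edom (band n) \<le> snorm 1 x0 + B" .
qed (rule edom_nonneg)

text \<open>The energy of one mode has derivative twice the squared frequency times the real part of
  \<open>cnj (x s k) * W s k\<close>. The arithmetic-geometric mean inequality distributes the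
  frequencies as order 2 on \<open>x\<close> and order 0 on \<open>W\<close>, which are the two
  integrable densities. Working in a single mode avoids any chain rule in a function space.\<close>

lemma energy_mode_le:
  assumes t: "t \<in> {0..T}"
  shows "(wmod 1 (x t) k)\<^sup>2 \<le> edom k"
proof -
  let ?D = "\<lambda>s. 2 * (Re (x s k) * Re (W s k) + Im (x s k) * Im (W s k))"
  let ?M = "\<lambda>t. (wmod 2 (x t) k)\<^sup>2 + (cmod (W t k))\<^sup>2"
  have 0: "0 \<in> {0..T}" using T by simp
  have "(?D has_integral ((Re (x t k))\<^sup>2 + (Im (x t k))\<^sup>2) - ((Re (x 0 k))\<^sup>2 + (Im (x 0 k))\<^sup>2)) {0..t}"
  proof (rule fundamental_theorem_of_calculus)
    show "0 \<le> t" using t by simp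
    fix s assume s: "s \<in> {0..t}"
    then have "s \<in> {0..T}" using t by auto
    from has_vector_derivative_of_integral_eq[OF this xe Wc, of k]
    have "((\<lambda>t. Re (x t k)) has_real_derivative Re (W s k)) (at s within {0..T})"
      "((\<lambda>t. Im (x t k)) has_real_derivative Im (W s k)) (at s within {0..T})"
      by (auto simp: has_vector_derivative_complex_iff)
    from DERIV_add[OF DERIV_power[OF this(1), of 2] DERIV_power[OF this(2), of 2]]
    have "((\<lambda>t. (Re (x t k))\<^sup>2 + (Im (x t k))\<^sup>2) has_real_derivative ?D s) (at s within {0..T})"
      by (simp add: algebra_simps)
    then show "((\<lambda>t. (Re (x t k))\<^sup>2 + (Im (x t k))\<^sup>2) has_vector_derivative ?D s) (at s within {0..t})"
      using t by (auto simp: has_real_derivative_iff_has_vector_derivative intro: has_vector_derivative_within_subset)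
  qed
  then have "(?D has_integral ((cmod (x t k))\<^sup>2 - (cmod (x 0 k))\<^sup>2)) {0..t}" by (simp add: cmod_power2)
  then have Di: "((\<lambda>s. \<bar>of_int k\<bar>\<^sup>2 * ?D s) has_integral \<bar>of_int k\<bar>\<^sup>2 * ((cmod (x t k))\<^sup>2 - (cmod (x 0 k))\<^sup>2)) {0..t}"
    by (rule has_integral_mult_right)
  have Mi: "(?M has_integral integral {0..t} ?M) {0..t}"
    by (intro integrable_integral integrable_continuous_real continuous_on_subset[OF dens_cont]) (use t in auto)
  have le: "\<bar>of_int k\<bar>\<^sup>2 * ?D s \<le> ?M s" for s
  proof -
    have "Re (x s k) * Re (W s k) + Im (x s k) * Im (W s k) = Re (cnj (x s k) * W s k)" by simp
    also have "\<dots> \<le> cmod (x s k) * cmod (W s k)" using complex_Re_le_cmod[of "cnj (x s k) * W s k"] by (simp add: norm_mult)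
    finally have "\<bar>of_int k\<bar>\<^sup>2 * ?D s \<le> \<bar>of_int k\<bar>\<^sup>2 * (2 * (cmod (x s k) * cmod (W s k)))" by (intro mult_left_mono) auto
    also have "\<dots> = 2 * wmod 2 (x s) k * cmod (W s k)" by (simp add: wmod_def)
    also have "\<dots> \<le> ?M s" by (rule sum_squares_bound)
    finally show ?thesis .
  qed
  have "\<bar>of_int k\<bar>\<^sup>2 * ((cmod (x t k))\<^sup>2 - (cmod (x 0 k))\<^sup>2) \<le> integral {0..t} ?M"
    by (rule has_integral_le[OF Di Mi le])
  also have "\<dots> \<le> integral {0..T} ?M"
    by (rule integral_subset_le)
      (use t in \<open>auto intro!: integrable_continuous_real continuous_on_subset[OF dens_cont]\<close>)
  finally have "\<bar>of_int k\<bar>\<^sup>2 * (cmod (x t k))\<^sup>2 \<le> \<bar>of_int k\<bar>\<^sup>2 * (cmod (x 0 k))\<^sup>2 + integral {0..T} ?M"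
    by (simp add: algebra_simps)
  moreover have "x 0 k = x0 k" using xe[OF 0] by simp
  ultimately show ?thesis by (simp add: edom_def wmod_def power_mult_distrib)
qed

lemma x_ssummable: "t \<in> {0..T} \<Longrightarrow> ssummable 1 (x t)"
  by (rule summable_on_comparison_test[OF edom_summable energy_mode_le]) auto

lemma x_continuous_H1:
  assumes t: "t \<in> {0..T}"
  shows "((\<lambda>s. snorm 1 (\<lambda>k. x s k - x t k)) \<longlongrightarrow> 0) (at t within {0..T})"
  unfolding snorm_def
proof (rule infsum_tendsto_zero)
  show "\<forall>\<^sub>F s in at t within {0..T}. \<forall>k. (wmod 1 (\<lambda>k. x s k - x t k) k)\<^sup>2 \<le> 4 * edom k"
  proof -
    have "(wmod 1 (\<lambda>k. x s k - x t k) k)\<^sup>2 \<le> 4 * edom k" if s: "s \<in> {0..T}" for s k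
    proof -
      have "wmod 1 (\<lambda>k. x s k - x t k) k \<le> wmod 1 (x s) k + wmod 1 (x t) k"
        unfolding wmod_def distrib_left[symmetric] by (intro mult_left_mono norm_triangle_ineq4) auto
      then have "(wmod 1 (\<lambda>k. x s k - x t k) k)\<^sup>2 \<le> (wmod 1 (x s) k + wmod 1 (x t) k)\<^sup>2" by (intro power_mono) auto
      also have "\<dots> \<le> 2 * (wmod 1 (x s) k)\<^sup>2 + 2 * (wmod 1 (x t) k)\<^sup>2" by (rule square_add_le)
      also have "\<dots> \<le> 4 * edom k" using energy_mode_le[OF s, of k] energy_mode_le[OF t, of k] by linarith
      finally show ?thesis .
    qed
    then show ?thesis by (auto simp: eventually_at_filter)
  qed
  show "(\<lambda>k. 4 * edom k) summable_on UNIV" by (rule summable_on_cmult_right[OF edom_summable])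
  fix k
  have "((\<lambda>s. x s k) \<longlongrightarrow> x t k) (at t within {0..T})" using xc[of k] t by (auto simp: continuous_on_def)
  then have "((\<lambda>s. (\<bar>of_int k\<bar> ^ 1 * cmod (x s k - x t k))\<^sup>2) \<longlongrightarrow> (\<bar>of_int k\<bar> ^ 1 * cmod (x t k - x t k))\<^sup>2) (at t within {0..T})"
    by (intro tendsto_intros)
  then show "((\<lambda>s. (wmod 1 (\<lambda>k. x s k - x t k) k)\<^sup>2) \<longlongrightarrow> 0) (at t within {0..T})"
    by (simp add: wmod_def)
qed simp

text \<open>The majorant for the moduli instead of the energies: for nonzero \<open>k\<close>, twice
  a modulus is at most its first-order square plus the inverse square of the frequency.\<close>

definition mdom :: "int \<Rightarrow> real" where "mdom k = edom k + \<bar>of_int k\<bar> powr (- 2)"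

lemma mdom_summable: "mdom summable_on UNIV"
  unfolding mdom_def by (intro summable_on_add edom_summable summable_int_powr) simp

lemma mdom_bound:
  assumes "t \<in> {0..T}"
  shows "cmod (x t k) \<le> mdom k"
proof (cases "k = 0")
  case True
  then show ?thesis using herm[OF assms] edom_nonneg[of 0] by (simp add: hermitian_zero mdom_def)
next
  case False
  then have k: "1 \<le> \<bar>real_of_int k\<bar>" by linarith
  then have p: "\<bar>real_of_int k\<bar> powr (- 2) = (inverse \<bar>real_of_int k\<bar>)\<^sup>2"
    using powr_realpow[of "\<bar>real_of_int k\<bar>" 2] by (simp add: powr_minus power_inverse)
  have "2 * (\<bar>real_of_int k\<bar> * cmod (x t k)) * inverse \<bar>real_of_int k\<bar> \<le> (\<bar>real_of_int k\<bar> * cmod (x t k))\<^sup>2 + (inverse \<bar>real_of_int k\<bar>)\<^sup>2"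
    by (rule sum_squares_bound)
  moreover have "2 * (\<bar>real_of_int k\<bar> * cmod (x t k)) * inverse \<bar>real_of_int k\<bar> = 2 * cmod (x t k)"
    using k by (simp add: field_simps)
  moreover have "(\<bar>real_of_int k\<bar> * cmod (x t k))\<^sup>2 \<le> edom k"
    using energy_mode_le[OF assms, of k] by (simp add: wmod_def)
  ultimately have "2 * cmod (x t k) \<le> mdom k" unfolding mdom_def p by linarith
  moreover have "0 \<le> mdom k" unfolding mdom_def using edom_nonneg[of k] by simp
  ultimately show ?thesis using norm_ge_zero[of "x t k"] by linarith
qed

lemma x_wsummable: "t \<in> {0..T} \<Longrightarrow> wsummable 0 (x t)"
  by (rule summable_on_comparison_test[OF mdom_summable]) (auto simp: wmod_def mdom_bound)

lemma wtail_uniform: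
  assumes t: "t \<in> {0..T}"
  shows "wtail n (x t) \<le> infsum mdom UNIV - sum mdom (band n)"
proof -
  let ?h = "\<lambda>k. if k \<in> band n then 0 else mdom k"
  have hs: "?h summable_on UNIV"
    by (rule summable_on_comparison_test[OF mdom_summable])
      (use mdom_bound[OF t] norm_ge_zero order_trans in \<open>auto intro: order_trans[OF norm_ge_zero]\<close>)
  have "wtail n (x t) \<le> infsum ?h UNIV"
    unfolding wtail_def wnorm_def
    by (rule infsum_mono[OF wsummable_diff(1)[OF x_wsummable[OF t] trunc_wsummable] hs])
      (auto simp: wmod_def trunc_def mdom_bound[OF t])
  also have "infsum ?h UNIV = infsum mdom (- band n)"
    by (rule infsum_cong_neutral) auto
  also have "infsum mdom UNIV = sum mdom (band n) + infsum mdom (- band n)"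
    using infsum_Un_disjoint[of mdom "band n" "- band n"] summable_on_subset_banach[OF mdom_summable, of "- band n"] by simp
  then have "infsum mdom (- band n) = infsum mdom UNIV - sum mdom (band n)" by simp
  finally show ?thesis .
qed

text \<open>The Wiener tail is bounded by the tail of \<open>mdom\<close>, which does not depend on
  time, so the partial sums converge uniformly in time and space. Joint continuity is what yields
  measurability on the space-time rectangle.\<close>

lemma fser_jointly_continuous: "continuous_on ({0..T} \<times> Z) (\<lambda>(t, z). fser (x t) z)"
proof (rule uniform_limit_theorem)
  show "\<forall>\<^sub>F n in sequentially. continuous_on ({0..T} \<times> Z) (\<lambda>(t, z). fser (trunc n (x t)) z)"
    by (intro always_eventually allI trunc_fser_continuous xc)
  show "uniform_limit ({0..T} \<times> Z) (\<lambda>n (t, z). fser (trunc n (x t)) z) (\<lambda>(t, z). fser (x t) z) sequentially"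
  proof (rule uniform_limitI)
    fix e :: real assume "e > 0"
    from tendstoD[OF band_sums[OF mdom_summable] this]
    show "\<forall>\<^sub>F n in sequentially. \<forall>p\<in>{0..T} \<times> Z. dist (case p of (t, z) \<Rightarrow> fser (trunc n (x t)) z) (case p of (t, z) \<Rightarrow> fser (x t) z) < e"
    proof eventually_elim
      case (elim n)
      show ?case
      proof (clarify)
        fix t z assume t: "t \<in> {0..T}"
        have "\<bar>fser (x t) z - fser (trunc n (x t)) z\<bar> \<le> infsum mdom UNIV - sum mdom (band n)"
          using fser_trunc_diff[OF x_wsummable[OF t], of z n] wtail_uniform[OF t, of n] by linarith
        with elim show "dist (fser (trunc n (x t)) z) (fser (x t) z) < e"
          by (simp add: dist_real_def abs_minus_commute)
      qed
    qed
  qed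
qed simp

lemma fser_Linf_spacetime:
  assumes E: "\<And>t. t \<in> {0..T} \<Longrightarrow> wnorm 0 (x t) \<le> E"
  shows "(\<lambda>t. fser (x t)) \<in> Linf_spacetime T"
proof -
  let ?S = "{0..T} \<times> {-pi..pi}"
  have S: "?S \<in> sets lebesgue"
    by (intro sets_completionI_sets) (simp add: borel_closed closed_Times)
  have m: "(\<lambda>(t, z). fser (x t) z) \<in> borel_measurable (lebesgue_on ?S)"
    by (rule continuous_imp_measurable_on_sets_lebesgue[OF fser_jointly_continuous S])
  have m': "(\<lambda>(t, z). ereal \<bar>fser (x t) z\<bar>) \<in> borel_measurable (lebesgue_on ?S)"
  proof -
    have "(\<lambda>p. ereal \<bar>(\<lambda>(t, z). fser (x t) z) p\<bar>) \<in> borel_measurable (lebesgue_on ?S)"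
      using m by measurable
    then show ?thesis by (simp add: case_prod_beta)
  qed
  have "esssup (lebesgue_on ?S) (\<lambda>(t, z). ereal \<bar>fser (x t) z\<bar>) \<le> ereal E"
  proof (rule esssup_I[OF m'], rule AE_I2)
    fix p assume "p \<in> space (lebesgue_on ?S)"
    then obtain t z where p: "p = (t, z)" "t \<in> {0..T}" by auto
    have "\<bar>fser (x t) z\<bar> \<le> E" using fser_bound[OF x_wsummable[OF p(2)], of z] E[OF p(2)] by linarith
    then show "(case p of (t, z) \<Rightarrow> ereal \<bar>fser (x t) z\<bar>) \<le> ereal E" using p by simp
  qed
  then have "esssup (lebesgue_on ?S) (\<lambda>(t, z). ereal \<bar>fser (x t) z\<bar>) < \<infinity>"
    by (rule le_less_trans) simp
  with m show ?thesis by (simp add: Linf_spacetime_def)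
qed

lemma fser_continuous_into: "(\<lambda>t. fser (x t)) \<in> continuous_into T (Hdot 1) (Hdot_norm 1)"
  unfolding continuous_into_def mem_Collect_eq
proof (intro ballI conjI)
  fix t assume t: "t \<in> {0..T}"
  show "fser (x t) \<in> Hdot 1"
    using fser_Hdot(1)[of "x t" 1 1] herm[OF t] x_wsummable[OF t] x_ssummable[OF t] by simp
  have eq: "Hdot_norm 1 (\<lambda>z. fser (x s) z - fser (x t) z) = sqrt (snorm 1 (\<lambda>k. x s k - x t k))" if s: "s \<in> {0..T}" for s
  proof -
    have "(\<lambda>z. fser (x s) z - fser (x t) z) = fser (\<lambda>k. x s k - x t k)"
      by (rule ext, rule fser_diff[OF x_wsummable[OF s] x_wsummable[OF t], symmetric])
    moreover have "Hdot_norm (real 1) (fser (\<lambda>k. x s k - x t k)) = sqrt (snorm 1 (\<lambda>k. x s k - x t k))"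
      by (intro Hdot_norm_fser hermitian_diff wsummable_diff herm x_wsummable s t)
    ultimately show ?thesis by simp
  qed
  have "((\<lambda>s. sqrt (snorm 1 (\<lambda>k. x s k - x t k))) \<longlongrightarrow> sqrt 0) (at t within {0..T})"
    by (intro tendsto_real_sqrt x_continuous_H1 t)
  then show "((\<lambda>s. Hdot_norm 1 (\<lambda>z. fser (x s) z - fser (x t) z)) \<longlongrightarrow> 0) (at t within {0..T})"
    using eq by (subst tendsto_cong[where g="\<lambda>s. sqrt (snorm 1 (\<lambda>k. x s k - x t k))"]) (auto simp: eventually_at_filter)
qed

end

section \<open>Products of Fourier series\<close>

text \<open>Products have to be taken before the real part, which is not multiplicative;
  \<open>cser_real\<close> returns to \<open>fser\<close> for symmetric coefficients.\<close>

definition cser :: "(int \<Rightarrow> complex) \<Rightarrow> real \<Rightarrow> complex" where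
  "cser c x = (\<Sum>\<^sub>\<infinity>k. c k * cis (of_int k * x))"

lemma fser_eq_Re_cser: "fser c x = Re (cser c x)" by (simp add: fser_def cser_def)

lemma cser_real:
  assumes "\<And>k. c (- k) = cnj (c k)"
  shows "cser c x = complex_of_real (fser c x)"
proof -
  have "cser c x = (\<Sum>\<^sub>\<infinity>k. c (- k) * cis (of_int (- k) * x))"
    unfolding cser_def by (rule infsum_reindex_bij_witness[where i="\<lambda>l. - l" and j="\<lambda>l. - l"]) auto
  also have "\<dots> = (\<Sum>\<^sub>\<infinity>k. cnj (c k * cis (of_int k * x)))" using assms by (simp add: cis_cnj)
  also have "\<dots> = cnj (cser c x)" by (simp only: infsum_cnj cser_def)
  finally have "Im (cser c x) = 0" by (metis Reals_cnj_iff complex_is_Real_iff)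
  then show ?thesis by (simp add: fser_eq_Re_cser complex_eq_iff)
qed

lemma cser_add: "wsummable 0 c \<Longrightarrow> wsummable 0 d \<Longrightarrow> cser (\<lambda>k. c k + d k) x = cser c x + cser d x"
  unfolding cser_def distrib_right by (intro infsum_add fser_summable)

lemma cser_cmult: "cser (\<lambda>k. a * c k) x = a * cser c x"
  unfolding cser_def mult.assoc by (rule infsum_cmult_right')

lemma wsummable_cmult: "wsummable p c \<Longrightarrow> wsummable p (\<lambda>k. a * c k)" "wnorm p (\<lambda>k. a * c k) = cmod a * wnorm p c"
proof -
  have eq: "wmod p (\<lambda>k. a * c k) k = cmod a * wmod p c k" for k by (simp add: wmod_def norm_mult mult_ac)
  show "wsummable p c \<Longrightarrow> wsummable p (\<lambda>k. a * c k)" unfolding eq by (rule summable_on_cmult_right)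
  show "wnorm p (\<lambda>k. a * c k) = cmod a * wnorm p c" unfolding wnorm_def eq by (rule infsum_cmult_right')
qed

definition fconv :: "(int \<Rightarrow> complex) \<Rightarrow> (int \<Rightarrow> complex) \<Rightarrow> int \<Rightarrow> complex" where
  "fconv u w k = (\<Sum>\<^sub>\<infinity>l. u (k - l) * w l)"

lemma infsum_translate: "(\<Sum>\<^sub>\<infinity>k. a (k - l)) = (\<Sum>\<^sub>\<infinity>k. a k)" for a :: "int \<Rightarrow> 'a::{comm_monoid_add,t2_space}"
  by (rule infsum_reindex_bij_witness[where i="\<lambda>k. k + l" and j="\<lambda>k. k - l"]) auto

lemma summable_on_translate:
  fixes a :: "int \<Rightarrow> 'a::{comm_monoid_add,t2_space}"
  assumes "a summable_on UNIV"
  shows "(\<lambda>k. a (k - l)) summable_on UNIV"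
proof -
  have "(\<lambda>k. a (k - l)) summable_on UNIV \<longleftrightarrow> a summable_on UNIV"
    by (rule summable_on_reindex_bij_witness[where i="\<lambda>k. k + l" and j="\<lambda>k. k - l"]) auto
  then show ?thesis using assms by simp
qed

text \<open>The Cauchy product: the double family is absolutely summable, so its sums may be
  interchanged, and frequencies add under multiplication.\<close>

lemma cser_mult:
  assumes u: "wsummable 0 u" and w: "wsummable 0 w"
  shows "cser u x * cser w x = cser (fconv u w) x"
proof -
  define h where "h l k = u (k - l) * w l * cis (of_int k * x)" for k l
  have us: "(\<lambda>k. cmod (u k)) summable_on UNIV" and ws: "(\<lambda>k. cmod (w k)) summable_on UNIV"
    using u w by (simp_all add: wmod_def[abs_def])
  have hn: "cmod (h l k) = cmod (w l) * cmod (u (k - l))" for l k by (simp add: h_def norm_mult)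
  have "(\<lambda>p. norm (h (fst p) (snd p))) summable_on (SIGMA l:UNIV. UNIV)"
    unfolding Infinite_Sum.abs_summable_on_Sigma_iff
  proof (intro conjI ballI)
    show "(\<lambda>k. norm (h (fst (l, k)) (snd (l, k)))) summable_on UNIV" for l
      unfolding fst_conv snd_conv hn by (intro summable_on_cmult_right summable_on_translate us)
    have "(\<Sum>\<^sub>\<infinity>k. cmod (h l k)) = (\<Sum>\<^sub>\<infinity>k. cmod (u k)) * cmod (w l)" for l
      unfolding hn infsum_cmult_right' infsum_translate[of "\<lambda>k. cmod (u k)"] by (rule mult.commute)
    then show "(\<lambda>l. norm (\<Sum>\<^sub>\<infinity>k. cmod (h (fst (l, k)) (snd (l, k))))) summable_on UNIV"
      using summable_on_cmult_right[OF ws, of "\<Sum>\<^sub>\<infinity>k. cmod (u k)"]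
      by (simp add: infsum_nonneg)
  qed
  from abs_summable_summable[OF this]
  have "(\<lambda>(l, k). h l k) summable_on UNIV \<times> UNIV" by (simp add: case_prod_unfold)
  from infsum_swap_banach[OF this]
  have sw: "(\<Sum>\<^sub>\<infinity>l. \<Sum>\<^sub>\<infinity>k. h l k) = (\<Sum>\<^sub>\<infinity>k. \<Sum>\<^sub>\<infinity>l. h l k)" .
  have "(\<Sum>\<^sub>\<infinity>k. h l k) = cser u x * (w l * cis (of_int l * x))" for l
  proof -
    have "h l k = (u (k - l) * cis (of_int (k - l) * x)) * (w l * cis (of_int l * x))" for k
    proof -
      have "cis (of_int (k - l) * x) * cis (of_int l * x) = cis (of_int k * x)" by (simp add: cis_mult algebra_simps)
      then show ?thesis unfolding h_def by (metis (no_types, lifting) mult.assoc mult.left_commute)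
    qed
    then have "(\<Sum>\<^sub>\<infinity>k. h l k) = (\<Sum>\<^sub>\<infinity>k. u (k - l) * cis (of_int (k - l) * x)) * (w l * cis (of_int l * x))"
      by (simp only: infsum_cmult_left')
    then show ?thesis unfolding infsum_translate[of "\<lambda>k. u k * cis (of_int k * x)"] cser_def .
  qed
  then have "(\<Sum>\<^sub>\<infinity>l. \<Sum>\<^sub>\<infinity>k. h l k) = cser u x * cser w x" by (simp only: infsum_cmult_right' cser_def)
  moreover have "(\<Sum>\<^sub>\<infinity>l. h l k) = fconv u w k * cis (of_int k * x)" for k
    unfolding h_def fconv_def by (rule infsum_cmult_left')
  ultimately show ?thesis using sw by (simp add: cser_def)
qed

lemma fconv_wsummable:
  assumes u: "wsummable 0 u" and w: "wsummable 0 w"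
  shows "wsummable 0 (fconv u w)" "wnorm 0 (fconv u w) \<le> wnorm 0 u * wnorm 0 w"
proof -
  have s: "(\<lambda>l. wmod 0 u (k - l) * wmod 0 w l) summable_on UNIV" for k by (rule conv_summable) (use u w in auto)
  have le: "wmod 0 (fconv u w) k \<le> conv (wmod 0 u) (wmod 0 w) k" for k
  proof -
    have "(\<lambda>l. norm (u (k - l) * w l)) summable_on UNIV" using s[of k] by (simp add: wmod_def norm_mult)
    from norm_infsum_bound[OF this] show ?thesis by (simp add: wmod_def fconv_def conv_def norm_mult)
  qed
  have b: "sum (wmod 0 (fconv u w)) (band n) \<le> wnorm 0 u * wnorm 0 w" for n
  proof -
    have "sum (wmod 0 (fconv u w)) (band n) \<le> sum (conv (wmod 0 u) (wmod 0 w)) (band n)" by (intro sum_mono le)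
    also have "\<dots> \<le> wnorm 0 u * wnorm 0 w" unfolding wnorm_def by (rule sum_conv_le) (use u w in auto)
    finally show ?thesis .
  qed
  show "wsummable 0 (fconv u w)" "wnorm 0 (fconv u w) \<le> wnorm 0 u * wnorm 0 w"
    using band_bound_summable[OF wmod_nonneg b] unfolding wnorm_def by auto
qed

lemma fconv_minus:
  assumes "\<And>k. u (- k) = cnj (u k)" "\<And>k. w (- k) = cnj (w k)"
  shows "fconv u w (- k) = cnj (fconv u w k)"
proof -
  have "fconv u w (- k) = (\<Sum>\<^sub>\<infinity>l. u (- (k - l)) * w (- l))"
    unfolding fconv_def by (rule infsum_reindex_bij_witness[where i="\<lambda>l. - l" and j="\<lambda>l. - l"]) auto
  also have "\<dots> = cnj (fconv u w k)" unfolding assms by (simp add: fconv_def flip: infsum_cnj)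
  finally show ?thesis .
qed

section \<open>The weak formulation\<close>

text \<open>Coefficients of the flux \<open>(u + H) * (p * u' + q * v')\<close>, where primes denote
  space derivatives; \<open>row\<close> below is the corresponding velocity. The equation for f is
  the instance \<open>F\<close>, \<open>br\<close>, \<open>b\<close>, and the equation for g the
  instance \<open>G\<close>, \<open>bm\<close>, \<open>bm\<close> with the unknowns
  exchanged.\<close>

definition flux_coef :: "real \<Rightarrow> real \<Rightarrow> real \<Rightarrow> (int \<Rightarrow> complex) \<Rightarrow> (int \<Rightarrow> complex) \<Rightarrow> int \<Rightarrow> complex" where
  "flux_coef H p q u v k = of_real p * (of_real H * dcoef u k + fconv u (dcoef u) k)
     + of_real q * (of_real H * dcoef v k + fconv u (dcoef v) k)"

definition row :: "real \<Rightarrow> real \<Rightarrow> real \<Rightarrow> (int \<Rightarrow> complex) \<Rightarrow> (int \<Rightarrow> complex) \<Rightarrow> int \<Rightarrow> complex" where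
  "row H p q u v k = - of_real (\<bar>of_int k\<bar>\<^sup>2 * H * p) * u k - of_real (\<bar>of_int k\<bar>\<^sup>2 * H * q) * v k
     + of_real p * bil u u k + of_real q * bil u v k"

lemma fconv_dcoef: "fconv u (dcoef v) k = \<i> * wprod u v k"
proof -
  have "fconv u (dcoef v) k = (\<Sum>\<^sub>\<infinity>l. \<i> * (u (k - l) * (of_int l * v l)))"
    unfolding fconv_def dcoef_def by (rule infsum_cong) (simp add: mult_ac)
  then show ?thesis by (simp only: infsum_cmult_right' wprod_def)
qed

lemma row_eq_dcoef_flux: "row H p q u v k = dcoef (flux_coef H p q u v) k"
proof -
  have k2: "complex_of_real (\<bar>of_int k\<bar>\<^sup>2 * H * p) = of_int k * of_int k * of_real H * of_real p" for p
    by (simp add: power2_eq_square)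
  have ii: "\<i> * (\<i> * z) = - z" for z by (simp flip: mult.assoc)
  show ?thesis
    unfolding row_def flux_coef_def dcoef_def[of "\<lambda>k. _ k"] fconv_dcoef bil_def k2
    by (simp add: dcoef_def flux_coef_def fconv_dcoef algebra_simps ii)
qed

lemma flux_coef_minus:
  assumes "hermitian u" "hermitian v"
  shows "flux_coef H p q u v (- k) = cnj (flux_coef H p q u v k)"
  using hermitian_minus[OF assms(1)] hermitian_minus[OF hermitian_dcoef[OF assms(1)]] hermitian_minus[OF hermitian_dcoef[OF assms(2)]]
  by (simp add: flux_coef_def fconv_minus)

lemma flux_coef_wsummable:
  assumes u: "u 0 = 0" "wsummable 1 u" and v: "wsummable 1 v" and pq: "0 \<le> p" "0 \<le> q" "0 \<le> H"
  shows "wsummable 0 (flux_coef H p q u v)"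
    "wnorm 0 (flux_coef H p q u v) \<le> (H + wnorm 0 u) * (p + q) * (wnorm 1 u + wnorm 1 v)"
proof -
  have u0: "wsummable 0 u" by (rule wsummable_Suc0[OF u])
  have d: "wsummable 0 (dcoef u)" "wsummable 0 (dcoef v)" using u v by auto
  note c = fconv_wsummable[OF u0 d(1)] fconv_wsummable[OF u0 d(2)]
  show "wsummable 0 (flux_coef H p q u v)"
    unfolding flux_coef_def by (intro wsummable_add wsummable_cmult c d)
  have "wnorm 0 (flux_coef H p q u v) \<le> p * (H * wnorm 1 u + wnorm 0 u * wnorm 1 u) + q * (H * wnorm 1 v + wnorm 0 u * wnorm 1 v)"
  proof -
    have "wnorm 0 (flux_coef H p q u v) \<le> wnorm 0 (\<lambda>k. of_real p * (of_real H * dcoef u k + fconv u (dcoef u) k))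
       + wnorm 0 (\<lambda>k. of_real q * (of_real H * dcoef v k + fconv u (dcoef v) k))"
      unfolding flux_coef_def by (intro wsummable_add wsummable_cmult c d)
    also have "\<dots> = p * wnorm 0 (\<lambda>k. of_real H * dcoef u k + fconv u (dcoef u) k) + q * wnorm 0 (\<lambda>k. of_real H * dcoef v k + fconv u (dcoef v) k)"
      using pq by (simp add: wsummable_cmult(2))
    also have "\<dots> \<le> p * (wnorm 0 (\<lambda>k. of_real H * dcoef u k) + wnorm 0 (fconv u (dcoef u))) + q * (wnorm 0 (\<lambda>k. of_real H * dcoef v k) + wnorm 0 (fconv u (dcoef v)))"
      using pq by (intro add_mono mult_left_mono wsummable_add wsummable_cmult c d)
    also have "\<dots> \<le> p * (H * wnorm 1 u + wnorm 0 u * wnorm 1 u) + q * (H * wnorm 1 v + wnorm 0 u * wnorm 1 v)"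
      using pq c by (intro add_mono mult_left_mono) (auto simp: wsummable_cmult(2))
    finally show ?thesis .
  qed
  also have "\<dots> = (H + wnorm 0 u) * (p * wnorm 1 u + q * wnorm 1 v)" by (simp add: algebra_simps)
  also have "\<dots> \<le> (H + wnorm 0 u) * ((p + q) * (wnorm 1 u + wnorm 1 v))"
    using pq by (intro mult_left_mono) (auto simp: algebra_simps)
  finally show "wnorm 0 (flux_coef H p q u v) \<le> (H + wnorm 0 u) * (p + q) * (wnorm 1 u + wnorm 1 v)" by (simp add: mult.assoc)
qed

lemma fser_flux_coef:
  assumes u: "hermitian u" "wsummable 1 u" and v: "hermitian v" "wsummable 1 v"
  shows "fser (flux_coef H p q u v) x = (fser u x + H) * (p * fser (dcoef u) x + q * fser (dcoef v) x)"
proof -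
  have u0: "wsummable 0 u" by (rule wsummable_Suc0[OF hermitian_zero[OF u(1)] u(2)])
  have d: "wsummable 0 (dcoef u)" "wsummable 0 (dcoef v)" using u v by auto
  note c = fconv_wsummable(1)[OF u0 d(1)] fconv_wsummable(1)[OF u0 d(2)]
  have cs: "cser (\<lambda>k. of_real H * dcoef y k + fconv u (dcoef y) k) x = of_real H * cser (dcoef y) x + cser (fconv u (dcoef y)) x"
    if "wsummable 0 (dcoef y)" for y
    by (simp only: cser_add[OF wsummable_cmult(1)[OF that] fconv_wsummable(1)[OF u0 that]] cser_cmult)
  have "complex_of_real (fser (flux_coef H p q u v) x) = cser (flux_coef H p q u v) x"
    by (rule cser_real[symmetric]) (rule flux_coef_minus[OF u(1) v(1)])
  also have "\<dots> = of_real p * (of_real H * cser (dcoef u) x + cser u x * cser (dcoef u) x)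
     + of_real q * (of_real H * cser (dcoef v) x + cser u x * cser (dcoef v) x)"
    unfolding flux_coef_def cser_mult[OF u0 d(1)] cser_mult[OF u0 d(2)]
    by (subst cser_add, (intro wsummable_add wsummable_cmult c d)+)
      (simp only: cser_cmult cs d)
  also have "\<dots> = complex_of_real ((fser u x + H) * (p * fser (dcoef u) x + q * fser (dcoef v) x))"
    using cser_real[of u x] cser_real[of "dcoef u" x] cser_real[of "dcoef v" x]
      hermitian_minus[OF u(1)] hermitian_minus[OF hermitian_dcoef[OF u(1)]] hermitian_minus[OF hermitian_dcoef[OF v(1)]]
    by (simp add: algebra_simps)
  finally show ?thesis by (simp only: of_real_eq_iff)
qed

text \<open>Test functions are controlled only on the half-open interval, and the value at
  \<open>t = T\<close> is arbitrary; it is discarded as a null set. Time integrals are thereby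
  confined to a compact interval on which the test function is bounded.\<close>

lemma LINT_extend_zero:
  fixes A :: "real \<Rightarrow> real"
  assumes "0 \<le> T1" "T1 < T" "A \<in> borel_measurable (lebesgue_on {0..T1})" "\<And>t. T1 < t \<Longrightarrow> t < T \<Longrightarrow> A t = 0"
  shows "(LINT t|lebesgue_on {0..T}. A t) = (LINT t|lebesgue_on {0..T1}. A t)"
    "A \<in> borel_measurable (lebesgue_on {0..T})"
proof -
  let ?A = "\<lambda>t. if t \<in> {0..T1} then A t else 0"
  have m: "?A \<in> borel_measurable (lebesgue_on {0..T})"
    by (subst borel_measurable_if_lebesgue_on) (use assms in auto)
  have "AE t in lebesgue. t \<notin> {T}" by (intro AE_not_in) (auto simp: null_sets_completionI)
  then have "AE t in lebesgue_on {0..T}. t \<notin> {T}" by (subst AE_restrict_space_iff) (auto elim: eventually_mono)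
  moreover have "AE t in lebesgue_on {0..T}. t \<in> {0..T}" by (rule AE_I2) simp
  ultimately have ae: "AE t in lebesgue_on {0..T}. ?A t = A t"
    by eventually_elim (use assms in auto)
  show mA: "A \<in> borel_measurable (lebesgue_on {0..T})"
    by (rule borel_measurable_lebesgue_on_AE[OF m _ ae]) simp
  have "(LINT t|lebesgue_on {0..T}. A t) = (LINT t|lebesgue_on {0..T}. ?A t)"
    by (rule integral_cong_AE[OF mA m]) (use ae in \<open>auto elim: eventually_mono\<close>)
  also have "\<dots> = (LINT t|lebesgue_on {0..T1}. A t)" by (rule integral_restrict) (use assms in auto)
  finally show "(LINT t|lebesgue_on {0..T}. A t) = (LINT t|lebesgue_on {0..T1}. A t)" .
qed

text \<open>\<open>test_function\<close> provides joint continuity of the partial derivatives. For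
  the function itself it is recovered here from a Lipschitz bound in \<open>x\<close>, uniform in
  \<open>t\<close>, and continuity in \<open>t\<close> at each fixed \<open>x\<close>.\<close>

lemma continuous_on_lipschitz_snd:
  fixes \<phi> :: "real \<Rightarrow> real \<Rightarrow> real"
  assumes lip: "\<And>t x y. \<lbrakk>t \<in> A; x \<in> B; y \<in> B\<rbrakk> \<Longrightarrow> \<bar>\<phi> t x - \<phi> t y\<bar> \<le> M * \<bar>x - y\<bar>"
    and cont: "\<And>y. y \<in> B \<Longrightarrow> continuous_on A (\<lambda>t. \<phi> t y)"
  shows "continuous_on (A \<times> B) (\<lambda>(t, x). \<phi> t x)"
  unfolding continuous_on_def
proof (clarify)
  fix s y assume s: "s \<in> A" and y: "y \<in> B"
  let ?F = "at (s, y) within A \<times> B"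
  have 1: "((\<lambda>p. \<phi> (fst p) y) \<longlongrightarrow> \<phi> s y) ?F"
  proof -
    have "continuous_on (A \<times> B) (\<lambda>p. \<phi> (fst p) y)"
      by (rule continuous_on_compose2[OF cont[OF y] continuous_on_fst]) auto
    then show ?thesis using s y by (force simp: continuous_on_def)
  qed
  have 2: "((\<lambda>p. \<phi> (fst p) (snd p) - \<phi> (fst p) y) \<longlongrightarrow> 0) ?F"
  proof (rule Lim_null_comparison)
    show "\<forall>\<^sub>F p in ?F. norm (\<phi> (fst p) (snd p) - \<phi> (fst p) y) \<le> M * \<bar>snd p - y\<bar>"
      unfolding eventually_at_filter using lip y by (intro always_eventually) auto
    have "((\<lambda>p. M * \<bar>snd p - y\<bar>) \<longlongrightarrow> M * \<bar>snd (s, y) - y\<bar>) ?F" by (intro tendsto_intros)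
    then show "((\<lambda>p. M * \<bar>snd p - y\<bar>) \<longlongrightarrow> 0) ?F" by simp
  qed
  from tendsto_add[OF 1 2] show "((\<lambda>(t, x). \<phi> t x) \<longlongrightarrow> \<phi> s y) ?F" by (simp add: case_prod_unfold)
qed

lemma LINT_torus_tendsto:
  assumes c: "wsummable 0 c" and h: "continuous_on {-pi..pi} h"
  shows "(\<lambda>n. LINT x|torus. fser (trunc n c) x * h x) \<longlonglongrightarrow> (LINT x|torus. fser c x * h x)"
proof (rule integral_dominated_convergence[where w="\<lambda>x. wnorm 0 c * \<bar>h x\<bar>"])
  have m: "h \<in> borel_measurable torus" using continuous_imp_integrable_real[OF h] by auto
  show "(\<lambda>x. fser c x * h x) \<in> borel_measurable torus" using m measurable_fser[OF c] by auto
  show "(\<lambda>x. fser (trunc n c) x * h x) \<in> borel_measurable torus" for n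
    using m measurable_fser[OF trunc_wsummable] by auto
  show "integrable torus (\<lambda>x. wnorm 0 c * \<bar>h x\<bar>)" using continuous_imp_integrable_real[OF h] by auto
  show "AE x in torus. (\<lambda>n. fser (trunc n c) x * h x) \<longlonglongrightarrow> fser c x * h x"
    by (intro AE_I2 tendsto_mult_right fser_trunc_tendsto c)
  show "AE x in torus. norm (fser (trunc n c) x * h x) \<le> wnorm 0 c * \<bar>h x\<bar>" for n
  proof (rule AE_I2)
    fix x
    have "\<bar>fser (trunc n c) x\<bar> \<le> wnorm 0 (trunc n c)" by (rule fser_bound[OF trunc_wsummable])
    also have "\<dots> \<le> wnorm 0 c" unfolding wnorm_def
      by (rule infsum_mono[OF trunc_wsummable c]) (auto simp: trunc_def wmod_def)
    finally show "norm (fser (trunc n c) x * h x) \<le> wnorm 0 c * \<bar>h x\<bar>" by (simp add: abs_mult mult_right_mono)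
  qed
qed

lemma LINT_torus_fser_bound:
  assumes c: "wsummable 0 c" and h: "continuous_on {-pi..pi} h" "\<And>x. x \<in> {-pi..pi} \<Longrightarrow> \<bar>h x\<bar> \<le> M"
  shows "\<bar>LINT x|torus. fser c x * h x\<bar> \<le> 2 * pi * (wnorm 0 c * M)"
    "wnorm 0 (trunc n c) \<le> wnorm 0 c"
proof -
  interpret finite_measure torus by (rule finite_measure_lebesgue_on) simp
  have i: "integrable torus (\<lambda>x. fser c x * h x)"
    by (intro continuous_imp_integrable_real continuous_intros continuous_fser c h)
  have "\<bar>LINT x|torus. fser c x * h x\<bar> \<le> (LINT x|torus. \<bar>fser c x * h x\<bar>)" by (rule integral_abs_bound)
  also have "\<dots> \<le> (LINT x|torus. wnorm 0 c * M)"
  proof (rule integral_mono)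
    fix x assume "x \<in> space torus"
    then show "\<bar>fser c x * h x\<bar> \<le> wnorm 0 c * M"
      unfolding abs_mult using fser_bound[OF c, of x] h(2)[of x] by (intro mult_mono) auto
  qed (use i in auto)
  also have "\<dots> = 2 * pi * (wnorm 0 c * M)" by (simp add: measure_restrict_space)
  finally show "\<bar>LINT x|torus. fser c x * h x\<bar> \<le> 2 * pi * (wnorm 0 c * M)" .
  show "wnorm 0 (trunc n c) \<le> wnorm 0 c" unfolding wnorm_def
      by (rule infsum_mono[OF trunc_wsummable c]) (auto simp: trunc_def wmod_def)
qed

text \<open>Identifies a function that is known through its coefficients, such as the datum, with
  its Fourier series.\<close>

lemma fourier_add_AE:
  assumes u: "integrable torus u" and c: "hermitian c" "wsummable 0 c" and eq: "\<And>k. fourier u k = c k"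
  shows "AE x in torus. u x = fser c x"
proof -
  have i: "integrable torus (\<lambda>x. complex_of_real (w x) * exp (- \<i> * of_int k * complex_of_real x))" if "integrable torus w" for w k
    unfolding exp_eq_cis
    by (rule integrable_bounded_mult[where B=1]) (use that in \<open>auto intro!: measurable_torus_continuous continuous_intros\<close>)
  have "fourier (\<lambda>x. u x - fser c x) k = fourier u k - fourier (fser c) k" for k
    unfolding fourier_def diff_divide_distrib[symmetric]
    by (subst Bochner_Integration.integral_diff[OF i[OF u] i[OF integrable_fser[OF c(2)]], symmetric])
      (simp add: left_diff_distrib)
  then have "fourier (\<lambda>x. u x - fser c x) k = 0" for k by (simp add: eq fourier_fser c)
  from fourier_zero_imp_AE_zero[OF Bochner_Integration.integrable_diff[OF u integrable_fser[OF c(2)]] this]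
  show ?thesis by simp
qed

text \<open>One equation of the system for the unknown \<open>u\<close>, with \<open>v\<close> as
  its partner. The second-order norms are finite only almost everywhere in time, while the mode
  equations hold at all times.\<close>

context
  fixes T E H p q :: real and u v :: "real \<Rightarrow> int \<Rightarrow> complex" and u0 :: "real \<Rightarrow> real"
  assumes T: "T > 0" and pos: "0 \<le> p" "0 \<le> q" "0 \<le> H"
    and hu: "\<And>t. t \<in> {0..T} \<Longrightarrow> hermitian (u t)" and hv: "\<And>t. t \<in> {0..T} \<Longrightarrow> hermitian (v t)"
    and wu: "\<And>t. t \<in> {0..T} \<Longrightarrow> wsummable 0 (u t)" and uE: "\<And>t. t \<in> {0..T} \<Longrightarrow> wnorm 0 (u t) \<le> E"
    and uc: "\<And>k. continuous_on {0..T} (\<lambda>t. u t k)"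
    and Wc: "\<And>k. continuous_on {0..T} (\<lambda>t. row H p q (u t) (v t) k)"
    and Qc: "\<And>k. continuous_on {0..T} (\<lambda>t. flux_coef H p q (u t) (v t) k)"
    and ueq: "\<And>t k. t \<in> {0..T} \<Longrightarrow> u t k = u 0 k + integral {0..t} (\<lambda>s. row H p q (u s) (v s) k)"
    and aeW: "AE t in lebesgue_on {0..T}. wsummable 2 (u t) \<and> wsummable 2 (v t)"
    and intW: "integrable (lebesgue_on {0..T}) (\<lambda>t. wnorm 2 (u t) + wnorm 2 (v t))"
    and u0i: "integrable torus u0" and u0c: "\<And>k. fourier u0 k = u 0 k"
begin

abbreviation "Q t \<equiv> flux_coef H p q (u t) (v t)"
abbreviation "flux t x \<equiv> (fser (u t) x + H) * (p * wderiv (fser (u t)) x + q * wderiv (fser (v t)) x)"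

lemma E_nonneg: "0 \<le> E"
  using uE[of 0] wnorm_nonneg[of 0 "u 0"] T by (simp del: wnorm_nonneg)

lemma Q_wsummable:
  assumes t: "t \<in> {0..T}" and w: "wsummable 2 (u t)" "wsummable 2 (v t)"
  shows "wsummable 0 (Q t)" "wnorm 0 (Q t) \<le> (H + E) * (p + q) * (wnorm 2 (u t) + wnorm 2 (v t))"
    "AE x in torus. flux t x = fser (Q t) x" "flux t \<in> borel_measurable torus"
proof -
  note z = hermitian_zero[OF hu[OF t]] hermitian_zero[OF hv[OF t]]
  have w1: "wsummable 1 (u t)" "wsummable 1 (v t)"
    using wsummable_mono[OF z(1) _ w(1), of 1] wsummable_mono[OF z(2) _ w(2), of 1] by simp_all
  show "wsummable 0 (Q t)" by (rule flux_coef_wsummable[OF z(1) w1 pos])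
  have "wnorm 0 (Q t) \<le> (H + wnorm 0 (u t)) * (p + q) * (wnorm 1 (u t) + wnorm 1 (v t))"
    by (rule flux_coef_wsummable[OF z(1) w1 pos])
  also have "\<dots> \<le> (H + E) * (p + q) * (wnorm 2 (u t) + wnorm 2 (v t))"
  proof (intro mult_mono add_mono)
    show "wnorm 1 (u t) \<le> wnorm 2 (u t)" "wnorm 1 (v t) \<le> wnorm 2 (v t)"
      using wnorm_mono[OF z(1) _ w(1), of 1] wnorm_mono[OF z(2) _ w(2), of 1] by simp_all
  qed (use pos uE[OF t] E_nonneg in auto)
  finally show "wnorm 0 (Q t) \<le> (H + E) * (p + q) * (wnorm 2 (u t) + wnorm 2 (v t))" .
  show "AE x in torus. flux t x = fser (Q t) x"
    using wderiv_fser_AE[OF z(1) w1(1)] wderiv_fser_AE[OF z(2) w1(2)]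
    by eventually_elim (simp only: fser_flux_coef[OF hu[OF t] w1(1) hv[OF t] w1(2)])
  have "wderiv (fser (u t)) \<in> borel_measurable torus" "wderiv (fser (v t)) \<in> borel_measurable torus"
    by (intro L1_measurable wderiv_fser_L1 z w1)+
  then show "flux t \<in> borel_measurable torus" using measurable_fser[OF wu[OF t]] by measurable
qed

text \<open>A time-integrable majorant of the Wiener norm of the flux, valid at the times where the
  second-order norms are finite.\<close>

definition "Dom t = (H + E) * (p + q) * (wnorm 2 (u t) + wnorm 2 (v t))"

lemma Dom_integrable: "integrable (lebesgue_on {0..T}) Dom"
  unfolding Dom_def using intW by (rule integrable_mult_right)

lemma dcoef_trunc_flux: "trunc n (row H p q (u t) (v t)) = trunc n (dcoef (Q t))"
  by (rule ext) (simp add: trunc_def row_eq_dcoef_flux)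

section \<open>The weak identity for one test function\<close>

context
  fixes \<phi> \<phi>t \<phi>x T1 Mt Mx
  assumes tf: "test_function T \<phi> \<phi>t \<phi>x" and T1: "0 < T1" "T1 < T"
    and zero: "\<And>t x. T1 \<le> t \<Longrightarrow> t < T \<Longrightarrow> \<phi> t x = 0"
    and zt: "\<And>t x. T1 < t \<Longrightarrow> t < T \<Longrightarrow> \<phi>t t x = 0" and zx: "\<And>t x. T1 \<le> t \<Longrightarrow> t < T \<Longrightarrow> \<phi>x t x = 0"
    and Mt: "\<And>t x. t \<in> {0..T1} \<Longrightarrow> x \<in> {-pi..pi} \<Longrightarrow> \<bar>\<phi>t t x\<bar> \<le> Mt"
    and Mx: "\<And>t x. t \<in> {0..T1} \<Longrightarrow> x \<in> {-pi..pi} \<Longrightarrow> \<bar>\<phi>x t x\<bar> \<le> Mx"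
begin

lemma tf_props:
  assumes "t \<in> {0..T1}"
  shows "periodic (\<phi> t)" "((\<lambda>s. \<phi> s x) has_real_derivative \<phi>t t x) (at t within {0..T1})"
    "(\<phi> t has_real_derivative \<phi>x t x) (at x)" "continuous_on UNIV (\<phi>x t)" "continuous_on UNIV (\<phi>t t)"
proof -
  have t: "t \<in> {0..<T}" using assms T1 by auto
  show "periodic (\<phi> t)" using tf t by (simp add: test_function_def)
  have "((\<lambda>s. \<phi> s x) has_real_derivative \<phi>t t x) (at t within {0..<T})" using tf t by (simp add: test_function_def)
  then show "((\<lambda>s. \<phi> s x) has_real_derivative \<phi>t t x) (at t within {0..T1})"
    by (rule DERIV_subset) (use T1 in auto)
  show "(\<phi> t has_real_derivative \<phi>x t x) (at x)" using tf t by (simp add: test_function_def)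
  have c: "continuous_on ({0..<T} \<times> UNIV) (\<lambda>(t, x). \<phi>x t x)" "continuous_on ({0..<T} \<times> UNIV) (\<lambda>(t, x). \<phi>t t x)"
    using tf by (simp_all add: test_function_def)
  have "continuous_on UNIV (\<lambda>x. case (t, x) of (t, x) \<Rightarrow> \<phi>x t x)"
    by (rule continuous_on_compose2[OF c(1)]) (use t in \<open>auto intro!: continuous_intros\<close>)
  then show "continuous_on UNIV (\<phi>x t)" by simp
  have "continuous_on UNIV (\<lambda>x. case (t, x) of (t, x) \<Rightarrow> \<phi>t t x)"
    by (rule continuous_on_compose2[OF c(2)]) (use t in \<open>auto intro!: continuous_intros\<close>)
  then show "continuous_on UNIV (\<phi>t t)" by simp
qed

lemma tf_cont:
  "continuous_on ({0..T1} \<times> {-pi..pi}) (\<lambda>(t, x). \<phi>t t x)"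
  "continuous_on ({0..T1} \<times> {-pi..pi}) (\<lambda>(t, x). \<phi> t x)"
proof -
  show "continuous_on ({0..T1} \<times> {-pi..pi}) (\<lambda>(t, x). \<phi>t t x)"
    by (rule continuous_on_subset[of "{0..<T} \<times> UNIV"]) (use tf T1 in \<open>auto simp: test_function_def\<close>)
  show "continuous_on ({0..T1} \<times> {-pi..pi}) (\<lambda>(t, x). \<phi> t x)"
  proof (rule continuous_on_lipschitz_snd)
    fix t x y assume t: "t \<in> {0..T1}" and xy: "x \<in> {-pi..pi}" "y \<in> {-pi..pi}"
    have "norm (\<phi> t x - \<phi> t y) \<le> Mx * norm (x - y)"
      by (rule field_differentiable_bound[of "{-pi..pi}" "\<phi> t" "\<phi>x t"])
        (use tf_props(3)[OF t] Mx[OF t] xy in \<open>auto intro: has_field_derivative_at_within\<close>)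
    then show "\<bar>\<phi> t x - \<phi> t y\<bar> \<le> Mx * \<bar>x - y\<bar>" by simp
  next
    fix y
    show "continuous_on {0..T1} (\<lambda>t. \<phi> t y)"
      using tf_props(2) by (meson DERIV_continuous_on)
  qed
qed

text \<open>The partial sums are those of the limit itself, and truncation commutes with
  differentiation, so no error term appears. At fixed \<open>x\<close> the product rule in time
  leaves only the boundary term at 0, because the test function vanishes at \<open>T1\<close>. The
  integrand is continuous, so the order of integration may be exchanged before the space derivative
  is moved to the test function.\<close>

lemma galerkin_identity:
  "(LINT x|torus. fser (trunc n (u 0)) x * \<phi> 0 x) =
     - (LINT t|lebesgue_on {0..T1}. (LINT x|torus. fser (trunc n (u t)) x * \<phi>t t x) - (LINT x|torus. fser (trunc n (Q t)) x * \<phi>x t x))"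
  "continuous_on {0..T1} (\<lambda>t. LINT x|torus. fser (trunc n (u t)) x * \<phi>t t x)"
  "continuous_on {0..T1} (\<lambda>t. LINT x|torus. fser (trunc n (Q t)) x * \<phi>x t x)"
proof -
  let ?W = "\<lambda>t. row H p q (u t) (v t)"
  let ?K = "\<lambda>t x. fser (trunc n (u t)) x * \<phi>t t x + fser (trunc n (?W t)) x * \<phi> t x"
  have sub: "{0..T1} \<subseteq> {0..T}" using T1 by auto
  have cu: "continuous_on ({0..T1} \<times> {-pi..pi}) (\<lambda>(t, x). fser (trunc n (u t)) x)"
    by (intro trunc_fser_continuous continuous_on_subset[OF uc sub])
  have cW: "continuous_on ({0..T1} \<times> {-pi..pi}) (\<lambda>(t, x). fser (trunc n (?W t)) x)"
    by (intro trunc_fser_continuous continuous_on_subset[OF Wc sub])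
  have c1: "continuous_on ({0..T1} \<times> {-pi..pi}) (\<lambda>(t, x). fser (trunc n (u t)) x * \<phi>t t x)"
    using continuous_on_mult[OF cu tf_cont(1)] by (simp add: case_prod_unfold)
  have c2: "continuous_on ({0..T1} \<times> {-pi..pi}) (\<lambda>(t, x). fser (trunc n (?W t)) x * \<phi> t x)"
    using continuous_on_mult[OF cW tf_cont(2)] by (simp add: case_prod_unfold)
  have cK: "continuous_on ({0..T1} \<times> {-pi..pi}) (\<lambda>(t, x). ?K t x)"
    using continuous_on_add[OF c1 c2] by (simp add: case_prod_unfold)
  have slice: "continuous_on {-pi..pi} (h t)" if "continuous_on ({0..T1} \<times> {-pi..pi}) (\<lambda>(t, x). h t x)" "t \<in> {0..T1}" for h :: "real \<Rightarrow> real \<Rightarrow> real" and t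
  proof -
    have "continuous_on {-pi..pi} (\<lambda>x. case (t, x) of (t, x) \<Rightarrow> h t x)"
      by (rule continuous_on_compose2[OF that(1)]) (use that(2) in \<open>auto intro!: continuous_intros\<close>)
    then show ?thesis by simp
  qed
  have int1: "continuous_on {0..T1} (\<lambda>t. integral {-pi..pi} (h t))" if "continuous_on ({0..T1} \<times> {-pi..pi}) (\<lambda>(t, x). h t x)" for h :: "real \<Rightarrow> real \<Rightarrow> real"
    using integral_continuous_on_param[of "{0..T1}" "-pi" pi h] that by simp
  have L: "(LINT x|torus. h t x) = integral {-pi..pi} (h t)" if "continuous_on ({0..T1} \<times> {-pi..pi}) (\<lambda>(t, x). h t x)" "t \<in> {0..T1}" for h :: "real \<Rightarrow> real \<Rightarrow> real" and t
    by (rule LINT_continuous[OF slice[OF that]])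
  have parts: "(LINT x|torus. fser (trunc n (Q t)) x * \<phi>x t x) = - (LINT x|torus. fser (trunc n (?W t)) x * \<phi> t x)" if t: "t \<in> {0..T1}" for t
    unfolding dcoef_trunc_flux
    by (rule integral_by_parts_periodic)
      (intro periodic_fser has_real_derivative_trunc_fser continuous_fser trunc_wsummable tf_props t)+
  show cA: "continuous_on {0..T1} (\<lambda>t. LINT x|torus. fser (trunc n (u t)) x * \<phi>t t x)"
    using int1[OF c1] by (rule continuous_on_eq) (simp add: L[OF c1])
  have cB: "continuous_on {0..T1} (\<lambda>t. LINT x|torus. fser (trunc n (?W t)) x * \<phi> t x)"
    using int1[OF c2] by (rule continuous_on_eq) (simp add: L[OF c2])
  show cB': "continuous_on {0..T1} (\<lambda>t. LINT x|torus. fser (trunc n (Q t)) x * \<phi>x t x)"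
    using continuous_on_minus[OF cB] by (rule continuous_on_eq) (simp add: parts)
  have inner: "integral {0..T1} (\<lambda>t. ?K t x) = - (fser (trunc n (u 0)) x * \<phi> 0 x)" if x: "x \<in> {-pi..pi}" for x
  proof -
    have "((\<lambda>t. ?K t x) has_integral (fser (trunc n (u T1)) x * \<phi> T1 x - fser (trunc n (u 0)) x * \<phi> 0 x)) {0..T1}"
    proof (rule fundamental_theorem_of_calculus)
      fix t assume t: "t \<in> {0..T1}"
      have tT: "t \<in> {0..T}" using t T1 by auto
      have "((\<lambda>t. u t k) has_vector_derivative ?W t k) (at t within {0..T1})" for k
        by (rule has_vector_derivative_within_subset[OF has_vector_derivative_of_integral_eq[OF tT ueq Wc] sub])
      then have "((\<lambda>t. u t k * cis (of_int k * x)) has_vector_derivative ?W t k * cis (of_int k * x)) (at t within {0..T1})" for k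
        by (rule has_vector_derivative_mult_left)
      then have "((\<lambda>t. Re (u t k * cis (of_int k * x))) has_real_derivative Re (?W t k * cis (of_int k * x))) (at t within {0..T1})" for k
        by (simp only: has_vector_derivative_complex_iff)
      then have du: "((\<lambda>t. fser (trunc n (u t)) x) has_real_derivative fser (trunc n (?W t)) x) (at t within {0..T1})"
        unfolding trunc_fser by (intro DERIV_sum)
      from DERIV_mult[OF du tf_props(2)[OF t, of x]]
      show "((\<lambda>t. fser (trunc n (u t)) x * \<phi> t x) has_vector_derivative ?K t x) (at t within {0..T1})"
        by (simp add: has_real_derivative_iff_has_vector_derivative add.commute mult.commute)
    qed (use T1 in simp)
    then show ?thesis using zero[of T1 x] T1 by (simp add: integral_unique)
  qed
  have "(LINT x|torus. fser (trunc n (u 0)) x * \<phi> 0 x) = integral {-pi..pi} (\<lambda>x. fser (trunc n (u 0)) x * \<phi> 0 x)"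
  proof (rule LINT_continuous, rule continuous_intros)
    show "continuous_on {-pi..pi} (fser (trunc n (u 0)))" by (rule continuous_fser[OF trunc_wsummable])
    show "continuous_on {-pi..pi} (\<phi> 0)" by (rule slice[OF tf_cont(2)]) (use T1 in auto)
  qed
  also have "\<dots> = integral {-pi..pi} (\<lambda>x. - integral {0..T1} (\<lambda>t. ?K t x))"
    by (rule integral_cong) (simp add: inner)
  also have "\<dots> = - integral {-pi..pi} (\<lambda>x. integral {0..T1} (\<lambda>t. ?K t x))" by simp
  also have "integral {-pi..pi} (\<lambda>x. integral {0..T1} (\<lambda>t. ?K t x)) = integral {0..T1} (\<lambda>t. integral {-pi..pi} (\<lambda>x. ?K t x))"
    using integral_swap_continuous[of 0 "-pi" T1 pi ?K] cK by (simp add: cbox_Pair_eq)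
  also have "\<dots> = integral {0..T1} (\<lambda>t. (LINT x|torus. fser (trunc n (u t)) x * \<phi>t t x) - (LINT x|torus. fser (trunc n (Q t)) x * \<phi>x t x))"
  proof (rule integral_cong)
    fix t assume t: "t \<in> {0..T1}"
    have "integral {-pi..pi} (\<lambda>x. ?K t x) = integral {-pi..pi} (\<lambda>x. fser (trunc n (u t)) x * \<phi>t t x) + integral {-pi..pi} (\<lambda>x. fser (trunc n (?W t)) x * \<phi> t x)"
      by (intro Henstock_Kurzweil_Integration.integral_add integrable_continuous_real slice[OF c1 t] slice[OF c2 t])
    then show "integral {-pi..pi} (\<lambda>x. ?K t x) = (LINT x|torus. fser (trunc n (u t)) x * \<phi>t t x) - (LINT x|torus. fser (trunc n (Q t)) x * \<phi>x t x)"
      by (simp add: parts[OF t] L[OF c1 t] L[OF c2 t])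
  qed
  also have "\<dots> = (LINT t|lebesgue_on {0..T1}. (LINT x|torus. fser (trunc n (u t)) x * \<phi>t t x) - (LINT x|torus. fser (trunc n (Q t)) x * \<phi>x t x))"
    by (rule LINT_continuous[symmetric]) (intro continuous_intros cA cB')
  finally show "(LINT x|torus. fser (trunc n (u 0)) x * \<phi> 0 x) =
     - (LINT t|lebesgue_on {0..T1}. (LINT x|torus. fser (trunc n (u t)) x * \<phi>t t x) - (LINT x|torus. fser (trunc n (Q t)) x * \<phi>x t x))" .
qed

lemma AE_T1: "AE t in lebesgue_on {0..T}. P t \<Longrightarrow> AE t in lebesgue_on {0..T1}. P t"
  using T1 by (subst (asm) AE_restrict_space_iff) (auto simp: AE_restrict_space_iff elim!: eventually_mono)

text \<open>The term with the time derivative converges at every time under a constant majorant,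
  since the Wiener norm is at most \<open>E\<close>. The flux term converges at almost every time
  under a multiple of \<open>Dom\<close>.\<close>

lemma limit_identity:
  "- (LINT x|torus. u0 x * \<phi> 0 x) - (LINT t|lebesgue_on {0..T}. LINT x|torus. fser (u t) x * \<phi>t t x)
    = - (LINT t|lebesgue_on {0..T}. LINT x|torus. flux t x * \<phi>x t x)"
proof -
  let ?M = "lebesgue_on {0..T1}"
  define A where "A n t = (LINT x|torus. fser (trunc n (u t)) x * \<phi>t t x)" for n t
  define B where "B n t = (LINT x|torus. fser (trunc n (Q t)) x * \<phi>x t x)" for n t
  define A' where "A' t = (LINT x|torus. fser (u t) x * \<phi>t t x)" for t
  define B' where "B' t = (LINT x|torus. flux t x * \<phi>x t x)" for t
  have mA: "A n \<in> borel_measurable ?M" and mB: "B n \<in> borel_measurable ?M" for n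
    using continuous_imp_integrable_real[OF galerkin_identity(2)[of n]] continuous_imp_integrable_real[OF galerkin_identity(3)[of n]]
    unfolding A_def B_def by auto
  have tT: "t \<in> {0..T}" if "t \<in> {0..T1}" for t using that T1 by auto
  have cs: "continuous_on {-pi..pi} (\<phi>t t)" "continuous_on {-pi..pi} (\<phi>x t)" if "t \<in> {0..T1}" for t
    using tf_props(4,5)[OF that] by (auto intro: continuous_on_subset)
  have limA: "(\<lambda>n. A n t) \<longlonglongrightarrow> A' t" if "t \<in> {0..T1}" for t
    unfolding A_def A'_def by (rule LINT_torus_tendsto[OF wu[OF tT[OF that]] cs(1)[OF that]])
  have in1: "AE t in ?M. t \<in> {0..T1}" by (rule AE_I2) simp
  have aeW1: "AE t in ?M. wsummable 2 (u t) \<and> wsummable 2 (v t)" by (rule AE_T1[OF aeW])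
  have limB: "AE t in ?M. (\<lambda>n. B n t) \<longlonglongrightarrow> B' t"
    using in1 aeW1
  proof eventually_elim
    case (elim t)
    note Qw = Q_wsummable[OF tT[OF elim(1)] conjunct1[OF elim(2)] conjunct2[OF elim(2)]]
    have m: "\<phi>x t \<in> borel_measurable torus" by (rule measurable_torus_continuous[OF tf_props(4)[OF elim(1)]])
    have "B' t = (LINT x|torus. fser (Q t) x * \<phi>x t x)"
      unfolding B'_def
    proof (rule integral_cong_AE)
      show "(\<lambda>x. flux t x * \<phi>x t x) \<in> borel_measurable torus" using Qw(4) m by (rule borel_measurable_times)
      show "(\<lambda>x. fser (Q t) x * \<phi>x t x) \<in> borel_measurable torus" using measurable_fser[OF Qw(1)] m by (rule borel_measurable_times)
      show "AE x in torus. flux t x * \<phi>x t x = fser (Q t) x * \<phi>x t x"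
        using Qw(3) by eventually_elim simp
    qed
    then show ?case unfolding B_def using LINT_torus_tendsto[OF Qw(1) cs(2)[OF elim(1)]] by simp
  qed
  have AB: "AE t in ?M. (\<lambda>n. A n t - B n t) \<longlonglongrightarrow> A' t - B' t"
    using limB in1 by eventually_elim (intro tendsto_diff limA)
  have mA': "A' \<in> borel_measurable ?M"
    by (rule borel_measurable_LIMSEQ_metric[of A, OF mA]) (use limA in simp)
  have mB': "B' \<in> borel_measurable ?M"
  proof -
    have ae: "AE t in ?M. lim (\<lambda>n. B n t) = B' t" using limB by eventually_elim (rule limI)
    show ?thesis by (rule borel_measurable_lebesgue_on_AE[OF borel_measurable_lim_metric[OF mB] _ ae]) simp
  qed
  define D where "D t = 2 * pi * (E * Mt)" for t :: real
  define D' where "D' t = 2 * pi * (Dom t * Mx)" for t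
  have Di: "integrable ?M D" "integrable ?M D'"
  proof -
    interpret finite_measure ?M by (rule finite_measure_lebesgue_on) simp
    show "integrable ?M D" unfolding D_def by simp
    have "integrable ?M Dom"
      using Dom_integrable by (rule integrable_subinterval) (use T1 in auto)
    then show "integrable ?M D'" unfolding D'_def by simp
  qed
  have M0: "0 \<le> Mt" "0 \<le> Mx" using Mt[of 0 0] Mx[of 0 0] T1 by force+
  have bA: "\<bar>A n t\<bar> \<le> D t" if t: "t \<in> {0..T1}" for n t
  proof -
    have "wnorm 0 (trunc n (u t)) \<le> E"
      using LINT_torus_fser_bound(2)[OF wu[OF tT[OF t]] cs(1)[OF t] Mt[OF t], of n] uE[OF tT[OF t]] by linarith
    then have "wnorm 0 (trunc n (u t)) * Mt \<le> E * Mt" using M0 by (intro mult_right_mono)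
    then show ?thesis
      using LINT_torus_fser_bound(1)[OF trunc_wsummable cs(1)[OF t] Mt[OF t], of n "u t"]
      unfolding A_def D_def by (smt (verit) mult_left_mono pi_gt_zero)
  qed
  have bA': "\<bar>A' t\<bar> \<le> D t" if t: "t \<in> {0..T1}" for t
    by (rule LIMSEQ_le_const2[OF tendsto_rabs[OF limA[OF t]]]) (use bA[OF t] in blast)
  have bB: "AE t in ?M. \<forall>n. \<bar>B n t\<bar> \<le> D' t"
    using in1 aeW1
  proof eventually_elim
    case (elim t)
    note Qw = Q_wsummable[OF tT[OF elim(1)] conjunct1[OF elim(2)] conjunct2[OF elim(2)]]
    show ?case
    proof
      fix n
      have "wnorm 0 (trunc n (Q t)) \<le> Dom t"
        using LINT_torus_fser_bound(2)[OF Qw(1) cs(2)[OF elim(1)] Mx[OF elim(1)], of n] Qw(2) unfolding Dom_def by linarith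
      then have "wnorm 0 (trunc n (Q t)) * Mx \<le> Dom t * Mx" using M0 by (intro mult_right_mono)
      then show "\<bar>B n t\<bar> \<le> D' t"
        using LINT_torus_fser_bound(1)[OF trunc_wsummable cs(2)[OF elim(1)] Mx[OF elim(1)], of n "Q t"]
        unfolding B_def D'_def by (smt (verit) mult_left_mono pi_gt_zero)
    qed
  qed
  have bB': "AE t in ?M. \<bar>B' t\<bar> \<le> D' t"
    using bB limB
  proof eventually_elim
    case (elim t)
    show ?case by (rule LIMSEQ_le_const2[OF tendsto_rabs[OF elim(2)]]) (use elim(1) in blast)
  qed
  have iA': "integrable ?M A'"
  proof (rule Bochner_Integration.integrable_bound[OF Di(1) mA'])
    show "AE t in ?M. norm (A' t) \<le> norm (D t)"
      using in1
    proof eventually_elim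
      case (elim t)
      from bA'[OF this] show ?case by simp
    qed
  qed
  have iB': "integrable ?M B'"
  proof (rule Bochner_Integration.integrable_bound[OF Di(2) mB'])
    show "AE t in ?M. norm (B' t) \<le> norm (D' t)" using bB' by eventually_elim simp
  qed
  have "(\<lambda>n. LINT t|?M. A n t - B n t) \<longlonglongrightarrow> (LINT t|?M. A' t - B' t)"
  proof (rule integral_dominated_convergence[where w="\<lambda>t. D t + D' t"])
    show "AE t in ?M. norm (A n t - B n t) \<le> D t + D' t" for n
      using bB in1
    proof eventually_elim
      case (elim t)
      then have "\<bar>B n t\<bar> \<le> D' t" "\<bar>A n t\<bar> \<le> D t" using bA by auto
      then show ?case by simp
    qed
  qed (use mA mB mA' mB' Di AB in auto)
  moreover have "(\<lambda>n. LINT t|?M. A n t - B n t) = (\<lambda>n. - (LINT x|torus. fser (trunc n (u 0)) x * \<phi> 0 x))"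
    using galerkin_identity(1) by (auto simp: A_def B_def)
  moreover have "(\<lambda>n. - (LINT x|torus. fser (trunc n (u 0)) x * \<phi> 0 x)) \<longlonglongrightarrow> - (LINT x|torus. fser (u 0) x * \<phi> 0 x)"
  proof (intro tendsto_minus LINT_torus_tendsto)
    show "wsummable 0 (u 0)" by (rule wu) (use T in simp)
    have 0: "0 \<in> {0..T1}" using T1 by simp
    have "isCont (\<phi> 0) x" for x by (rule DERIV_isCont[OF tf_props(3)[OF 0]])
    then show "continuous_on {-pi..pi} (\<phi> 0)" by (intro continuous_at_imp_continuous_on) simp
  qed
  ultimately have "(LINT t|?M. A' t - B' t) = - (LINT x|torus. fser (u 0) x * \<phi> 0 x)"
    by (simp only: LIMSEQ_unique)
  then have eq: "(LINT t|?M. A' t) - (LINT t|?M. B' t) = - (LINT x|torus. fser (u 0) x * \<phi> 0 x)"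
    using iA' iB' by simp
  have "(LINT x|torus. u0 x * \<phi> 0 x) = (LINT x|torus. fser (u 0) x * \<phi> 0 x)"
  proof (rule integral_cong_AE)
    have 0: "0 \<in> {0..T}" "0 \<in> {0..T1}" using T T1 by auto
    have "isCont (\<phi> 0) x" for x by (rule DERIV_isCont[OF tf_props(3)[OF 0(2)]])
    then have m: "\<phi> 0 \<in> borel_measurable torus"
      by (intro measurable_torus_continuous continuous_at_imp_continuous_on) auto
    show "(\<lambda>x. u0 x * \<phi> 0 x) \<in> borel_measurable torus" "(\<lambda>x. fser (u 0) x * \<phi> 0 x) \<in> borel_measurable torus"
      using m u0i measurable_fser[OF wu[OF 0(1)]] by auto
    show "AE x in torus. u0 x * \<phi> 0 x = fser (u 0) x * \<phi> 0 x"
      using fourier_add_AE[OF u0i hu[OF 0(1)] wu[OF 0(1)] u0c] by eventually_elim simp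
  qed
  moreover have "(LINT t|lebesgue_on {0..T}. A' t) = (LINT t|?M. A' t)"
  proof (rule LINT_extend_zero[OF _ T1(2) mA'])
    show "A' t = 0" if "T1 < t" "t < T" for t unfolding A'_def using zt[OF that] by simp
  qed (use T1 in simp)
  moreover have "(LINT t|lebesgue_on {0..T}. B' t) = (LINT t|?M. B' t)"
  proof (rule LINT_extend_zero[OF _ T1(2) mB'])
    show "B' t = 0" if "T1 < t" "t < T" for t unfolding B'_def using zx[of t] that by simp
  qed (use T1 in simp)
  ultimately have "- (LINT x|torus. u0 x * \<phi> 0 x) - (LINT t|lebesgue_on {0..T}. A' t) = - (LINT t|lebesgue_on {0..T}. B' t)"
    using eq by linarith
  then show ?thesis unfolding A'_def B'_def .
qed

end

lemma test_function_support:
  assumes tf: "test_function T \<phi> \<phi>t \<phi>x"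
  obtains T1 Mt Mx where "0 < T1" "T1 < T"
    "\<And>t x. T1 \<le> t \<Longrightarrow> t < T \<Longrightarrow> \<phi> t x = 0"
    "\<And>t x. T1 < t \<Longrightarrow> t < T \<Longrightarrow> \<phi>t t x = 0" "\<And>t x. T1 \<le> t \<Longrightarrow> t < T \<Longrightarrow> \<phi>x t x = 0"
    "\<And>t x. t \<in> {0..T1} \<Longrightarrow> x \<in> {-pi..pi} \<Longrightarrow> \<bar>\<phi>t t x\<bar> \<le> Mt"
    "\<And>t x. t \<in> {0..T1} \<Longrightarrow> x \<in> {-pi..pi} \<Longrightarrow> \<bar>\<phi>x t x\<bar> \<le> Mx"
proof -
  obtain T' where T': "T' < T" "\<And>t x. t \<in> {0..<T} \<Longrightarrow> T' \<le> t \<Longrightarrow> \<phi> t x = 0"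
    using tf unfolding test_function_def by blast
  \<comment> \<open>Positive, and strictly between the end \<open>T'\<close> of the support and
    \<open>T\<close>. The test function vanishes at \<open>T1\<close> itself, which removes the
    boundary term there.\<close>
  define T1 where "T1 = (max T' 0 + T) / 2"
  have T1: "0 < T1" "T1 < T" "T' < T1" using T T'(1) by (auto simp: T1_def)
  have zero: "\<phi> t x = 0" if "T1 \<le> t" "t < T" for t x using T'(2)[of t x] that T1 by auto
  have zt: "\<phi>t t x = 0" if "T1 < t" "t < T" for t x
  proof -
    have "((\<lambda>s. \<phi> s x) has_real_derivative \<phi>t t x) (at t within {0..<T})"
      using tf that T1 by (simp add: test_function_def)
    then have "((\<lambda>s. \<phi> s x) has_real_derivative \<phi>t t x) (at t within {T1<..<T})"
      by (rule DERIV_subset) (use T1 in auto)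
    then have d: "((\<lambda>s. \<phi> s x) has_real_derivative \<phi>t t x) (at t)"
      using that by (simp add: at_within_open_NO_MATCH at_within_open[of t "{T1<..<T}"])
    have "((\<lambda>s. 0) has_real_derivative 0) (at t)" by simp
    then have "((\<lambda>s. \<phi> s x) has_real_derivative 0) (at t)"
      by (rule has_field_derivative_transform_within_open[where S="{T1<..<T}"]) (use that zero in auto)
    with d show ?thesis by (rule DERIV_unique)
  qed
  have zx: "\<phi>x t x = 0" if "T1 \<le> t" "t < T" for t x
  proof -
    have "(\<phi> t has_real_derivative \<phi>x t x) (at x)" using tf that T1 by (simp add: test_function_def)
    moreover have "\<phi> t = (\<lambda>x. 0)" using zero that by auto
    ultimately show ?thesis using DERIV_unique[of "\<phi> t" "\<phi>x t x" x 0] by simp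
  qed
  have bound: "\<exists>M. \<forall>t\<in>{0..T1}. \<forall>x\<in>{-pi..pi}. \<bar>h t x\<bar> \<le> M"
    if "continuous_on ({0..<T} \<times> UNIV) (\<lambda>(t, x). h t x)" for h :: "real \<Rightarrow> real \<Rightarrow> real"
  proof -
    have "compact ((\<lambda>(t, x). h t x) ` ({0..T1} \<times> {-pi..pi}))"
      by (intro compact_continuous_image compact_Times compact_Icc continuous_on_subset[OF that]) (use T1 in auto)
    then obtain M where "\<forall>y\<in>(\<lambda>(t, x). h t x) ` ({0..T1} \<times> {-pi..pi}). norm y \<le> M"
      using compact_imp_bounded bounded_iff by blast
    then show ?thesis by (intro exI[of _ M]) force
  qed
  obtain Mt where Mt: "\<forall>t\<in>{0..T1}. \<forall>x\<in>{-pi..pi}. \<bar>\<phi>t t x\<bar> \<le> Mt"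
    using bound[of \<phi>t] tf by (auto simp: test_function_def)
  obtain Mx where Mx: "\<forall>t\<in>{0..T1}. \<forall>x\<in>{-pi..pi}. \<bar>\<phi>x t x\<bar> \<le> Mx"
    using bound[of \<phi>x] tf by (auto simp: test_function_def)
  show ?thesis by (rule that[of T1 Mt Mx, OF T1(1,2) zero zt zx]) (use Mt Mx in auto)
qed

lemma weak_law: "weak_conservation_law T u0 (\<lambda>t. fser (u t)) (\<lambda>t x. flux t x)"
  unfolding weak_conservation_law_def
proof (intro allI impI)
  fix \<phi> \<phi>t \<phi>x assume tf: "test_function T \<phi> \<phi>t \<phi>x"
  show "- (LINT x|torus. u0 x * \<phi> 0 x) - (LINT t|lebesgue_on {0..T}. LINT x|torus. fser (u t) x * \<phi>t t x)
    = - (LINT t|lebesgue_on {0..T}. LINT x|torus. flux t x * \<phi>x t x)"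
    by (rule test_function_support[OF tf]) (rule limit_identity[OF tf])
qed

text \<open>\<open>wderiv\<close> is chosen separately at each time, so measurability in time is not
  immediate. It comes from the truncated fluxes, whose integrals are continuous in time and converge
  almost everywhere.\<close>

lemma flux_integrable: "integrable (lebesgue_on {0..T}) (\<lambda>t. LINT x|torus. \<bar>flux t x\<bar>)"
proof -
  let ?M = "lebesgue_on {0..T}"
  define A where "A n t = (LINT x|torus. \<bar>fser (trunc n (Q t)) x\<bar>)" for n t
  define B where "B t = (LINT x|torus. \<bar>flux t x\<bar>)" for t
  have in1: "AE t in ?M. t \<in> {0..T}" by (rule AE_I2) simp
  have cA: "continuous_on {0..T} (A n)" for n
  proof -
    have "continuous_on ({0..T} \<times> {-pi..pi}) (\<lambda>(t, x). fser (trunc n (Q t)) x)"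
      by (intro trunc_fser_continuous Qc)
    then have c: "continuous_on ({0..T} \<times> {-pi..pi}) (\<lambda>(t, x). \<bar>fser (trunc n (Q t)) x\<bar>)"
      using continuous_on_rabs by (fastforce simp: case_prod_unfold)
    have "continuous_on {0..T} (\<lambda>t. integral {-pi..pi} (\<lambda>x. \<bar>fser (trunc n (Q t)) x\<bar>))"
      using integral_continuous_on_param[of "{0..T}" "-pi" pi "\<lambda>t x. \<bar>fser (trunc n (Q t)) x\<bar>"] c by simp
    moreover have "A n t = integral {-pi..pi} (\<lambda>x. \<bar>fser (trunc n (Q t)) x\<bar>)" for t
      unfolding A_def by (intro LINT_continuous continuous_intros continuous_fser trunc_wsummable)
    ultimately show ?thesis by simp
  qed
  have mA: "A n \<in> borel_measurable ?M" for n
    using continuous_imp_integrable_real[OF cA] by auto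
  have BQ: "AE t in ?M. (\<lambda>n. A n t) \<longlonglongrightarrow> B t \<and> \<bar>B t\<bar> \<le> 2 * pi * Dom t"
    using in1 aeW
  proof eventually_elim
    case (elim t)
    note Qw = Q_wsummable[OF elim(1) conjunct1[OF elim(2)] conjunct2[OF elim(2)]]
    interpret torus: finite_measure torus by (rule finite_measure_lebesgue_on) simp
    have eqB: "B t = (LINT x|torus. \<bar>fser (Q t) x\<bar>)"
      unfolding B_def
    proof (rule integral_cong_AE)
      show "(\<lambda>x. \<bar>flux t x\<bar>) \<in> borel_measurable torus" using Qw(4) by (rule borel_measurable_abs)
      show "(\<lambda>x. \<bar>fser (Q t) x\<bar>) \<in> borel_measurable torus" using measurable_fser[OF Qw(1)] by (rule borel_measurable_abs)
      show "AE x in torus. \<bar>flux t x\<bar> = \<bar>fser (Q t) x\<bar>" using Qw(3) by eventually_elim simp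
    qed
    have "(\<lambda>n. A n t) \<longlonglongrightarrow> (LINT x|torus. \<bar>fser (Q t) x\<bar>)"
      unfolding A_def
    proof (rule integral_dominated_convergence[where w="\<lambda>x. wnorm 0 (Q t)"])
      show "(\<lambda>x. \<bar>fser (Q t) x\<bar>) \<in> borel_measurable torus" using measurable_fser[OF Qw(1)] by (rule borel_measurable_abs)
      show "(\<lambda>x. \<bar>fser (trunc n (Q t)) x\<bar>) \<in> borel_measurable torus" for n
        using measurable_fser[OF trunc_wsummable] by (rule borel_measurable_abs)
      show "AE x in torus. (\<lambda>n. \<bar>fser (trunc n (Q t)) x\<bar>) \<longlonglongrightarrow> \<bar>fser (Q t) x\<bar>"
        by (intro AE_I2 tendsto_rabs fser_trunc_tendsto Qw)
      have "wnorm 0 (trunc n (Q t)) \<le> wnorm 0 (Q t)" for n unfolding wnorm_def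
        by (rule infsum_mono[OF trunc_wsummable Qw(1)]) (auto simp: trunc_def wmod_def)
      then show "AE x in torus. norm \<bar>fser (trunc n (Q t)) x\<bar> \<le> wnorm 0 (Q t)" for n
        using fser_bound[OF trunc_wsummable, of n "Q t"] by (intro AE_I2) (simp, meson order_trans)
    qed simp
    moreover have "\<bar>B t\<bar> \<le> 2 * pi * Dom t"
    proof -
      have "\<bar>LINT x|torus. \<bar>fser (Q t) x\<bar>\<bar> \<le> 2 * pi * wnorm 0 (Q t)"
        using LINT_torus_bound[of "\<lambda>x. \<bar>fser (Q t) x\<bar>" "wnorm 0 (Q t)"] fser_bound[OF Qw(1)] by simp
      also have "\<dots> \<le> 2 * pi * Dom t" unfolding Dom_def using Qw(2) by (intro mult_left_mono) auto
      finally show ?thesis using eqB by simp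
    qed
    ultimately show ?case using eqB by simp
  qed
  have ae: "AE t in ?M. lim (\<lambda>n. A n t) = B t" using BQ by eventually_elim (simp add: limI)
  have mB: "B \<in> borel_measurable ?M"
    by (rule borel_measurable_lebesgue_on_AE[OF borel_measurable_lim_metric[OF mA] _ ae]) simp
  have "integrable ?M B"
  proof (rule Bochner_Integration.integrable_bound[OF _ mB])
    show "integrable ?M (\<lambda>t. 2 * pi * Dom t)" by (rule integrable_mult_right[OF Dom_integrable])
    show "AE t in ?M. norm (B t) \<le> norm (2 * pi * Dom t)"
      using BQ by eventually_elim (simp only: real_norm_def, linarith)
  qed
  then show ?thesis unfolding B_def .
qed

end

section \<open>Time integrals as vector measures\<close>

lemma lebesgue_on_subset:
  fixes f :: "real \<Rightarrow> 'b::euclidean_space"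
  assumes f: "integrable (lebesgue_on S) f" and B: "B \<subseteq> S" "B \<in> sets lebesgue" and S: "S \<in> sets lebesgue"
  shows "integrable (lebesgue_on B) f"
    "(LINT t|lebesgue_on B. f t) = (LINT t|lebesgue_on S. indicator B t *\<^sub>R f t)"
    "integrable (lebesgue_on S) (\<lambda>t. indicator B t *\<^sub>R f t)"
proof -
  have "integrable lebesgue (\<lambda>t. indicator S t *\<^sub>R f t)"
    using f S by (simp add: integrable_restrict_space)
  from integrable_mult_indicator[OF B(2) this]
  have i: "integrable lebesgue (\<lambda>t. indicator B t *\<^sub>R f t)"
    by (rule Bochner_Integration.integrable_cong[THEN iffD1, rotated 2]) (use B in \<open>auto simp: indicator_def\<close>)
  then show "integrable (lebesgue_on B) f" using B by (simp add: integrable_restrict_space)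
  have "(LINT t|lebesgue_on S. (if t \<in> B then f t else 0)) = (LINT t|lebesgue_on B. f t)"
    by (rule integral_restrict[OF B S])
  moreover have "(\<lambda>t. if t \<in> B then f t else 0) = (\<lambda>t. indicator B t *\<^sub>R f t)" by auto
  ultimately show "(LINT t|lebesgue_on B. f t) = (LINT t|lebesgue_on S. indicator B t *\<^sub>R f t)" by simp
  have "B \<in> sets (lebesgue_on S)" using B S by (auto simp: sets_restrict_space_iff)
  then show "integrable (lebesgue_on S) (\<lambda>t. indicator B t *\<^sub>R f t)" by (rule integrable_mult_indicator[OF _ f])
qed

context
  fixes T E :: real and x :: "real \<Rightarrow> int \<Rightarrow> complex"
  assumes T: "T > 0" and herm: "\<And>t. t \<in> {0..T} \<Longrightarrow> hermitian (x t)"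
    and ws: "\<And>t. t \<in> {0..T} \<Longrightarrow> wsummable 0 (x t)" and xE: "\<And>t. t \<in> {0..T} \<Longrightarrow> wnorm 0 (x t) \<le> E"
    and xc: "\<And>k. continuous_on {0..T} (\<lambda>t. x t k)"
    and aeW: "AE t in lebesgue_on {0..T}. wsummable 2 (x t)"
    and intW: "integrable (lebesgue_on {0..T}) (\<lambda>t. wnorm 2 (x t))"
begin

abbreviation "BS \<equiv> sets (restrict_space borel {0..T})"

text \<open>The coefficients of the time integral of the solution over \<open>B\<close>, which is
  the value of the vector measure on \<open>B\<close>.\<close>

definition tmean :: "real set \<Rightarrow> int \<Rightarrow> complex" where
  "tmean B k = (LINT t|lebesgue_on B. x t k)"

text \<open>The positive measure that controls the vector measure: three times its value bounds the
  W^(2,\<infinity>) norm of the value on \<open>B\<close>.\<close>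

definition omega :: "real set \<Rightarrow> real" where
  "omega B = (LINT t|lebesgue_on B. wnorm 2 (x t))"

lemma BS_D: "B \<in> BS \<Longrightarrow> B \<subseteq> {0..T}" "B \<in> BS \<Longrightarrow> B \<in> sets lebesgue"
  by (auto simp: sets_restrict_space intro!: sets_completionI_sets)

lemma xi: "integrable (lebesgue_on {0..T}) (\<lambda>t. x t k)"
  by (rule continuous_imp_integrable_real[OF xc])

lemma xi_B: "B \<in> BS \<Longrightarrow> integrable (lebesgue_on B) (\<lambda>t. x t k)"
  by (rule lebesgue_on_subset(1)[OF xi BS_D]) auto

lemma wmod_cont: "continuous_on {0..T} (\<lambda>t. wmod 2 (x t) k)"
  unfolding wmod_def by (intro continuous_intros xc)

lemma AE_BS: "B \<in> BS \<Longrightarrow> AE t in lebesgue_on B. wsummable 2 (x t)"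
proof -
  assume B: "B \<in> BS"
  have "AE t in lebesgue. t \<in> {0..T} \<longrightarrow> wsummable 2 (x t)"
    using aeW by (subst (asm) AE_restrict_space_iff) auto
  then show "AE t in lebesgue_on B. wsummable 2 (x t)"
    by (subst AE_restrict_space_iff) (use BS_D[OF B] in \<open>auto elim!: eventually_mono\<close>)
qed

lemma tmean_hermitian:
  assumes B: "B \<in> BS"
  shows "hermitian (tmean B)"
  unfolding hermitian_def
proof (intro conjI allI)
  have "tmean B 0 = (LINT t|lebesgue_on B. 0)"
    unfolding tmean_def by (rule Bochner_Integration.integral_cong) (use BS_D[OF B] herm in \<open>auto simp: hermitian_zero\<close>)
  then show "tmean B 0 = 0" by simp
  fix k
  have "tmean B (- k) = (LINT t|lebesgue_on B. cnj (x t k))"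
    unfolding tmean_def by (rule Bochner_Integration.integral_cong) (use BS_D[OF B] herm in \<open>auto simp: hermitian_minus\<close>)
  then show "tmean B (- k) = cnj (tmean B k)" by (simp add: tmean_def)
qed

text \<open>The norm of an integral is at most the integral of the norm, mode by mode and then
  summed over bands. Thus the value on every Borel set is regular, although the density is so only
  at almost every time.\<close>

lemma tmean_wsummable:
  assumes B: "B \<in> BS"
  shows "wsummable 2 (tmean B)" "wnorm 2 (tmean B) \<le> omega B" "wsummable 0 (tmean B)" "tmean B 0 = 0"
proof -
  have wi: "integrable (lebesgue_on B) (\<lambda>t. wmod 2 (x t) k)" for k
    by (rule lebesgue_on_subset(1)[OF continuous_imp_integrable_real[OF wmod_cont] BS_D[OF B]]) simp
  have b: "sum (wmod 2 (tmean B)) (band n) \<le> omega B" for n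
  proof -
    have "sum (wmod 2 (tmean B)) (band n) \<le> (\<Sum>k\<in>band n. LINT t|lebesgue_on B. wmod 2 (x t) k)"
    proof (rule sum_mono)
      fix k
      have "cmod (tmean B k) \<le> (LINT t|lebesgue_on B. cmod (x t k))" unfolding tmean_def by (rule integral_norm_bound)
      then have "\<bar>of_int k\<bar> ^ 2 * cmod (tmean B k) \<le> \<bar>of_int k\<bar> ^ 2 * (LINT t|lebesgue_on B. cmod (x t k))"
        by (intro mult_left_mono) auto
      then show "wmod 2 (tmean B) k \<le> (LINT t|lebesgue_on B. wmod 2 (x t) k)"
        unfolding wmod_def by (simp only: integral_mult_right_zero)
    qed
    also have "\<dots> = (LINT t|lebesgue_on B. (\<Sum>k\<in>band n. wmod 2 (x t) k))"
      by (rule Bochner_Integration.integral_sum[symmetric]) (rule wi)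
    also have "\<dots> \<le> omega B"
      unfolding omega_def
    proof (rule integral_mono_AE)
      show "integrable (lebesgue_on B) (\<lambda>t. \<Sum>k\<in>band n. wmod 2 (x t) k)" by (intro Bochner_Integration.integrable_sum wi)
      show "integrable (lebesgue_on B) (\<lambda>t. wnorm 2 (x t))" by (rule lebesgue_on_subset(1)[OF intW BS_D[OF B]]) simp
      show "AE t in lebesgue_on B. (\<Sum>k\<in>band n. wmod 2 (x t) k) \<le> wnorm 2 (x t)"
        using AE_BS[OF B] by eventually_elim (auto simp: wnorm_def intro: finite_sum_le_infsum)
    qed
    finally show ?thesis .
  qed
  from band_bound_summable[OF wmod_nonneg b]
  show "wsummable 2 (tmean B)" "wnorm 2 (tmean B) \<le> omega B" by (auto simp: wnorm_def)
  show "tmean B 0 = 0" by (rule hermitian_zero[OF tmean_hermitian[OF B]])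
  show "wsummable 0 (tmean B)"
    by (rule wsummable_mono[OF \<open>tmean B 0 = 0\<close> _ \<open>wsummable 2 (tmean B)\<close>]) simp
qed

lemma omega_eq: "B \<in> BS \<Longrightarrow> omega B = (LINT t|lebesgue_on {0..T}. indicator B t *\<^sub>R wnorm 2 (x t))"
  unfolding omega_def by (rule lebesgue_on_subset(2)[OF intW BS_D]) auto

lemma tmean_Un:
  assumes B: "B \<in> BS" "C \<in> BS" "B \<inter> C = {}"
  shows "tmean (B \<union> C) k = tmean B k + tmean C k"
proof -
  have BC: "B \<union> C \<in> BS" using B by auto
  have eq: "tmean B k = (LINT t|lebesgue_on {0..T}. indicator B t *\<^sub>R x t k)" if "B \<in> BS" for B
    unfolding tmean_def by (rule lebesgue_on_subset(2)[OF xi BS_D[OF that]]) simp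
  have i: "integrable (lebesgue_on {0..T}) (\<lambda>t. indicator B t *\<^sub>R x t k)" if "B \<in> BS" for B
    by (rule lebesgue_on_subset(3)[OF xi BS_D[OF that]]) simp
  have "(\<lambda>t. indicator (B \<union> C) t *\<^sub>R x t k) = (\<lambda>t. indicator B t *\<^sub>R x t k + indicator C t *\<^sub>R x t k)"
    using B(3) by (auto simp: indicator_def fun_eq_iff)
  then show ?thesis unfolding eq[OF BC] eq[OF B(1)] eq[OF B(2)]
    by (simp only: Bochner_Integration.integral_add[OF i[OF B(1)] i[OF B(2)]])
qed

text \<open>After \<open>n\<close> pieces the defect of additivity is the value on the remaining set
  \<open>R n\<close>. These sets eventually leave out every point, so \<open>omega (R n)\<close>
  tends to zero by dominated convergence. For the variation, disjointness bounds the sum of the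
  indicators by 1, so three times the total mass of \<open>omega\<close> suffices.\<close>

lemma radon_vector_measure_tmean: "radon_vector_measure T W2inf W2inf_norm (\<lambda>B. fser (tmean B))"
  unfolding radon_vector_measure_def
proof (intro conjI ballI allI impI)
  show "fser (tmean B) \<in> W2inf" if "B \<in> BS" for B
    by (rule fser_W2inf[OF tmean_wsummable(4,1)[OF that]])
  have N: "0 \<le> W2inf_norm (fser (tmean B))" "W2inf_norm (fser (tmean B)) \<le> 3 * omega B" if "B \<in> BS" for B
    using W2inf_norm_fser_le[OF tmean_wsummable(4,1)[OF that]] tmean_wsummable(2)[OF that] by auto
  show "(\<lambda>n. W2inf_norm (\<lambda>z. fser (tmean (\<Union>i. B i)) z - (\<Sum>i<n. fser (tmean (B i)) z))) \<longlonglongrightarrow> 0"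
    if B: "range B \<subseteq> BS \<and> disjoint_family B" for B :: "nat \<Rightarrow> real set"
  proof -
    have Bi: "B i \<in> BS" for i using B by auto
    define R where "R n = (\<Union>i. B i) - (\<Union>i<n. B i)" for n
    have R: "R n \<in> BS" for n unfolding R_def using Bi by (intro sets.Diff sets.countable_UN) auto
    have split: "R n = B n \<union> R (Suc n)" "B n \<inter> R (Suc n) = {}" for n
    proof -
      have "B n \<inter> B i = {}" if "i < n" for i using B that by (auto simp: disjoint_family_on_def)
      then show "R n = B n \<union> R (Suc n)" "B n \<inter> R (Suc n) = {}"
        unfolding R_def by (auto simp: less_Suc_eq)
    qed
    have eq: "fser (tmean (\<Union>i. B i)) z - (\<Sum>i<n. fser (tmean (B i)) z) = fser (tmean (R n)) z" for n z
    proof (induction n)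
      case 0
      then show ?case by (simp add: R_def)
    next
      case (Suc n)
      have "tmean (R n) = (\<lambda>k. tmean (B n) k + tmean (R (Suc n)) k)"
        by (rule ext) (subst split(1), rule tmean_Un[OF Bi R split(2)])
      then have "fser (tmean (R n)) z = fser (tmean (B n)) z + fser (tmean (R (Suc n))) z"
        by (simp only: fser_add[OF tmean_wsummable(3)[OF Bi] tmean_wsummable(3)[OF R]])
      with Suc show ?case by simp
    qed
    have "(\<lambda>n. omega (R n)) \<longlonglongrightarrow> (LINT t|lebesgue_on {0..T}. 0)"
      unfolding omega_eq[OF R]
    proof (rule integral_dominated_convergence[where w="\<lambda>t. wnorm 2 (x t)"])
      show "(\<lambda>t. indicator (R n) t *\<^sub>R wnorm 2 (x t)) \<in> borel_measurable (lebesgue_on {0..T})" for n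
        by (rule borel_measurable_integrable, rule lebesgue_on_subset(3)[OF intW BS_D[OF R]]) simp
      show "AE t in lebesgue_on {0..T}. (\<lambda>n. indicator (R n) t *\<^sub>R wnorm 2 (x t)) \<longlonglongrightarrow> 0"
      proof (rule AE_I2)
        fix t
        have "\<exists>m. \<forall>n\<ge>m. t \<notin> R n"
        proof (cases "t \<in> (\<Union>i. B i)")
          case True
          then obtain i where "t \<in> B i" by auto
          then show ?thesis unfolding R_def by (intro exI[of _ "Suc i"]) auto
        qed (auto simp: R_def)
        then obtain m where "\<And>n. n \<ge> m \<Longrightarrow> t \<notin> R n" by auto
        then show "(\<lambda>n. indicator (R n) t *\<^sub>R wnorm 2 (x t)) \<longlonglongrightarrow> 0"
          by (intro tendsto_eventually eventually_sequentiallyI[of m]) auto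
      qed
    qed (use intW in \<open>auto simp: indicator_def\<close>)
    then have lim: "(\<lambda>n. 3 * omega (R n)) \<longlonglongrightarrow> 0" using tendsto_mult_left[of "\<lambda>n. omega (R n)" 0 sequentially 3] by simp
    show ?thesis unfolding eq
      by (rule tendsto_sandwich[OF _ _ tendsto_const lim]) (use N[OF R] in auto)
  qed
  show "\<exists>C. \<forall>P. finite P \<and> P \<subseteq> BS \<and> disjoint P \<longrightarrow> (\<Sum>B\<in>P. W2inf_norm (fser (tmean B))) \<le> C"
  proof (intro exI[of _ "3 * omega {0..T}"] allI impI)
    fix P assume P: "finite P \<and> P \<subseteq> BS \<and> disjoint P"
    have BP: "B \<in> BS" if "B \<in> P" for B using P that by auto
    have whole: "{0..T} \<in> BS" by (auto simp: sets_restrict_space intro!: image_eqI[of _ _ "{0..T}"])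
    have ii: "integrable (lebesgue_on {0..T}) (\<lambda>t. indicator B t *\<^sub>R wnorm 2 (x t))" if "B \<in> P" for B
      by (rule lebesgue_on_subset(3)[OF intW BS_D[OF BP[OF that]]]) simp
    have "(\<Sum>B\<in>P. W2inf_norm (fser (tmean B))) \<le> (\<Sum>B\<in>P. 3 * omega B)"
      by (intro sum_mono N BP)
    also have "\<dots> = 3 * (\<Sum>B\<in>P. LINT t|lebesgue_on {0..T}. indicator B t *\<^sub>R wnorm 2 (x t))"
      by (simp add: sum_distrib_left omega_eq BP)
    also have "(\<Sum>B\<in>P. LINT t|lebesgue_on {0..T}. indicator B t *\<^sub>R wnorm 2 (x t)) =
        (LINT t|lebesgue_on {0..T}. (\<Sum>B\<in>P. indicator B t *\<^sub>R wnorm 2 (x t)))"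
      by (rule Bochner_Integration.integral_sum[symmetric]) (rule ii)
    also have "\<dots> \<le> omega {0..T}"
      unfolding omega_def
    proof (rule integral_mono[OF Bochner_Integration.integrable_sum[OF ii] intW])
      fix t
      have "(\<Sum>B\<in>P. indicator B t :: real) \<le> 1"
      proof (cases "\<exists>B0\<in>P. t \<in> B0")
        case True
        then obtain B0 where B0: "B0 \<in> P" "t \<in> B0" by auto
        have "indicator B t = (if B = B0 then 1 else 0 :: real)" if "B \<in> P" for B
          using B0 P that by (auto simp: indicator_def disjoint_def)
        then have "(\<Sum>B\<in>P. indicator B t :: real) = (\<Sum>B\<in>P. if B = B0 then 1 else 0)" by (rule sum.cong[OF refl])
        then show ?thesis using P B0 by simp
      next
        case False
        then have "(\<Sum>B\<in>P. indicator B t :: real) = 0" by (intro sum.neutral) auto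
        then show ?thesis by simp
      qed
      then have "(\<Sum>B\<in>P. indicator B t) * wnorm 2 (x t) \<le> 1 * wnorm 2 (x t)" by (intro mult_right_mono) auto
      then show "(\<Sum>B\<in>P. indicator B t *\<^sub>R wnorm 2 (x t)) \<le> wnorm 2 (x t)" by (simp add: sum_distrib_right)
    qed
    finally show "(\<Sum>B\<in>P. W2inf_norm (fser (tmean B))) \<le> 3 * omega {0..T}" by simp
  qed
qed

text \<open>Integration in time is exchanged with the Fourier series: for partial sums this is
  linearity, and in the limit \<open>E\<close> dominates.\<close>

lemma fser_tmean:
  assumes B: "B \<in> BS"
  shows "integrable (lebesgue_on B) (\<lambda>t. fser (x t) z)" "fser (tmean B) z = (LINT t|lebesgue_on B. fser (x t) z)"
proof -
  have tB: "t \<in> {0..T}" if "t \<in> B" for t using BS_D(1)[OF B] that by auto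
  have ci: "integrable (lebesgue_on B) (\<lambda>t. x t k * cis (of_int k * z))" for k
    using xi_B[OF B] by (rule integrable_mult_left)
  have ti: "integrable (lebesgue_on B) (\<lambda>t. fser (trunc n (x t)) z)" for n
    unfolding trunc_fser by (intro Bochner_Integration.integrable_sum integrable_Re ci)
  have Bm: "B \<in> lmeasurable"
    by (rule bounded_set_imp_lmeasurable[OF bounded_subset[OF bounded_closed_interval BS_D(1)[OF B]] BS_D(2)[OF B]])
  interpret finite_measure "lebesgue_on B" by (rule finite_measure_lebesgue_on[OF Bm])
  have lim: "(\<lambda>n. fser (trunc n (x t)) z) \<longlonglongrightarrow> fser (x t) z" if "t \<in> B" for t
    by (rule fser_trunc_tendsto[OF ws[OF tB[OF that]]])
  have bd: "\<bar>fser (trunc n (x t)) z\<bar> \<le> E" if "t \<in> B" for t n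
  proof -
    have "\<bar>fser (trunc n (x t)) z\<bar> \<le> wnorm 0 (trunc n (x t))" by (rule fser_bound[OF trunc_wsummable])
    also have "\<dots> \<le> wnorm 0 (x t)" by (rule trunc_wnorm[OF herm[OF tB[OF that]] ws[OF tB[OF that]]])
    also have "\<dots> \<le> E" by (rule xE[OF tB[OF that]])
    finally show ?thesis .
  qed
  have m: "(\<lambda>t. fser (x t) z) \<in> borel_measurable (lebesgue_on B)"
    by (rule borel_measurable_LIMSEQ_metric[of "\<lambda>n t. fser (trunc n (x t)) z"]) (use ti lim in auto)
  show "integrable (lebesgue_on B) (\<lambda>t. fser (x t) z)"
  proof (rule integrable_const_bound[OF _ m])
    show "AE t in lebesgue_on B. norm (fser (x t) z) \<le> E"
    proof (rule AE_I2)
      fix t assume "t \<in> space (lebesgue_on B)"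
      then have t: "t \<in> B" by simp
      show "norm (fser (x t) z) \<le> E" using fser_bound[OF ws[OF tB[OF t]], of z] xE[OF tB[OF t]] by simp
    qed
  qed
  have "(\<lambda>n. LINT t|lebesgue_on B. fser (trunc n (x t)) z) \<longlonglongrightarrow> (LINT t|lebesgue_on B. fser (x t) z)"
    by (rule integral_dominated_convergence[where w="\<lambda>t. E"]) (use m ti lim bd in auto)
  moreover have "(LINT t|lebesgue_on B. fser (trunc n (x t)) z) = fser (trunc n (tmean B)) z" for n
  proof -
    have "(LINT t|lebesgue_on B. fser (trunc n (x t)) z) = (\<Sum>k\<in>band n. LINT t|lebesgue_on B. Re (x t k * cis (of_int k * z)))"
      unfolding trunc_fser by (rule Bochner_Integration.integral_sum) (rule integrable_Re[OF ci])
    also have "\<dots> = (\<Sum>k\<in>band n. Re (tmean B k * cis (of_int k * z)))"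
    proof (rule sum.cong[OF refl])
      fix k
      have "(LINT t|lebesgue_on B. Re (x t k * cis (of_int k * z))) = Re (LINT t|lebesgue_on B. x t k * cis (of_int k * z))"
        by (rule integral_Re[OF ci])
      then show "(LINT t|lebesgue_on B. Re (x t k * cis (of_int k * z))) = Re (tmean B k * cis (of_int k * z))"
        by (simp only: integral_mult_left_zero tmean_def)
    qed
    finally show ?thesis by (simp only: trunc_fser)
  qed
  ultimately have "(\<lambda>n. fser (trunc n (tmean B)) z) \<longlonglongrightarrow> (LINT t|lebesgue_on B. fser (x t) z)" by simp
  with fser_trunc_tendsto[OF tmean_wsummable(3)[OF B]]
  show "fser (tmean B) z = (LINT t|lebesgue_on B. fser (x t) z)" by (rule LIMSEQ_unique)
qed

lemma fser_radon_measures: "(\<lambda>t. fser (x t)) \<in> radon_measures T W2inf W2inf_norm"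
  unfolding radon_measures_def mem_Collect_eq
  by (rule exI[of _ "\<lambda>B. fser (tmean B)"]) (use radon_vector_measure_tmean fser_tmean in \<open>auto intro!: AE_I2\<close>)

end

section \<open>The global solution\<close>

text \<open>\<open>d\<close> is the other unknown in a joint dissipation bound; being nonnegative,
  it may be dropped.\<close>

lemma continuous_levi:
  fixes a :: "int \<Rightarrow> real \<Rightarrow> real"
  assumes c: "\<And>k. continuous_on {0..T} (a k)" and nn: "\<And>k t. 0 \<le> a k t"
    and B: "\<And>N. integral {0..T} (\<lambda>t. \<Sum>k\<in>band N. a k t + d k t) \<le> B"
    and d: "\<And>k. continuous_on {0..T} (d k)" "\<And>k t. 0 \<le> d k t"
  shows "AE t in lebesgue_on {0..T}. (\<lambda>k. a k t) summable_on UNIV"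
    "integrable (lebesgue_on {0..T}) (\<lambda>t. \<Sum>\<^sub>\<infinity>k. a k t)" "(LINT t|lebesgue_on {0..T}. (\<Sum>\<^sub>\<infinity>k. a k t)) \<le> B"
proof -
  have b: "(LINT t|lebesgue_on {0..T}. (\<Sum>k\<in>band N. a k t)) \<le> B" for N
  proof -
    have "(LINT t|lebesgue_on {0..T}. (\<Sum>k\<in>band N. a k t)) = integral {0..T} (\<lambda>t. \<Sum>k\<in>band N. a k t)"
      by (intro LINT_continuous continuous_intros c)
    also have "\<dots> \<le> integral {0..T} (\<lambda>t. \<Sum>k\<in>band N. a k t + d k t)"
      by (intro integral_le integrable_continuous_real continuous_intros c d sum_mono) (simp add: d)
    also note B
    finally show ?thesis .
  qed
  have i: "integrable (lebesgue_on {0..T}) (a k)" for k by (rule continuous_imp_integrable_real[OF c])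
  show "AE t in lebesgue_on {0..T}. (\<lambda>k. a k t) summable_on UNIV"
    "integrable (lebesgue_on {0..T}) (\<lambda>t. \<Sum>\<^sub>\<infinity>k. a k t)" "(LINT t|lebesgue_on {0..T}. (\<Sum>\<^sub>\<infinity>k. a k t)) \<le> B"
    using infsum_levi[OF _ i nn b] by auto
qed

section \<open>Properties of the pair of unknowns\<close>

locale film_sol = film_data +
  fixes f g :: "real \<Rightarrow> int \<Rightarrow> complex"
  assumes st: "\<And>t. t \<ge> 0 \<Longrightarrow> state (f t) (g t)"
    and wiener_decay: "\<And>t. t \<ge> 0 \<Longrightarrow> wnorm 0 (f t) + wnorm 0 (g t) \<le> E * exp (- sig * t)"
    and energy_decay: "\<And>t. t \<ge> 0 \<Longrightarrow> snorm 1 (f t) + snorm 1 (g t) \<le> E1 * exp (- kap * t)"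
    and eqf: "\<And>t k. t \<ge> 0 \<Longrightarrow> f t k = fh k + integral {0..t} (\<lambda>s. Vf (f s) (g s) k)"
    and eqg: "\<And>t k. t \<ge> 0 \<Longrightarrow> g t k = gh k + integral {0..t} (\<lambda>s. Vg (f s) (g s) k)"
    and S2: "\<And>T N. T \<ge> 0 \<Longrightarrow> integral {0..T} (\<lambda>t. \<Sum>k\<in>band N. (wmod 2 (f t) k)\<^sup>2 + (wmod 2 (g t) k)\<^sup>2) \<le> E1 / kap"
    and W2: "\<And>T N. T \<ge> 0 \<Longrightarrow> integral {0..T} (\<lambda>t. \<Sum>k\<in>band N. wmod 2 (f t) k + wmod 2 (g t) k) \<le> E / sig"
    and lipf: "\<And>t s k. t \<ge> 0 \<Longrightarrow> s \<ge> 0 \<Longrightarrow> cmod (f t k - f s k) \<le> \<bar>of_int k\<bar>\<^sup>2 * CV * \<bar>t - s\<bar>"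
    and lipg: "\<And>t s k. t \<ge> 0 \<Longrightarrow> s \<ge> 0 \<Longrightarrow> cmod (g t k - g s k) \<le> \<bar>of_int k\<bar>\<^sup>2 * CV * \<bar>t - s\<bar>"
begin

lemma fg_hermitian: "t \<ge> 0 \<Longrightarrow> hermitian (f t)" "t \<ge> 0 \<Longrightarrow> hermitian (g t)"
  and fg_wsummable: "t \<ge> 0 \<Longrightarrow> wsummable 0 (f t)" "t \<ge> 0 \<Longrightarrow> wsummable 0 (g t)"
  and fg_ssummable: "t \<ge> 0 \<Longrightarrow> ssummable 1 (f t)" "t \<ge> 0 \<Longrightarrow> ssummable 1 (g t)"
  using st by (auto simp: state_def)

lemma fg_initial: "f 0 = fh" "g 0 = gh"
  using eqf[of 0] eqg[of 0] by auto

lemma fg_continuous: "continuous_on {0..T} (\<lambda>t. f t k)" "continuous_on {0..T} (\<lambda>t. g t k)"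
  by (rule lipschitz_imp_continuous_on, rule lipf; simp) (rule lipschitz_imp_continuous_on, rule lipg; simp)

lemma fg_tendsto:
  assumes "t \<in> {0..T}"
  shows "((\<lambda>s. f s k) \<longlongrightarrow> f t k) (at t within {0..T})" "((\<lambda>s. g s k) \<longlongrightarrow> g t k) (at t within {0..T})"
  using fg_continuous[of T k] assms by (auto simp: continuous_on_def)

lemma eventually_within: "(\<And>s. s \<in> {0..T} \<Longrightarrow> P s) \<Longrightarrow> \<forall>\<^sub>F s in at t within {0..T}. P s"
  by (auto simp: eventually_at_filter)

lemma V_continuous: "continuous_on {0..T} (\<lambda>t. Vf (f t) (g t) k)" "continuous_on {0..T} (\<lambda>t. Vg (f t) (g t) k)"
  unfolding continuous_on_def
  by (intro ballI V_tendsto fg_tendsto eventually_within st; simp)+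

lemma wprod_continuous:
  assumes "u = f \<or> u = g" "v = f \<or> v = g"
  shows "continuous_on {0..T} (\<lambda>t. wprod (u t) (v t) k)"
  unfolding continuous_on_def
proof
  fix t assume t: "t \<in> {0..T}"
  have p: "u s 0 = 0 \<and> ssummable 1 (u s) \<and> ssummable 1 (v s) \<and> snorm 1 (u s) \<le> E1 \<and> snorm 1 (v s) \<le> E1"
    if "s \<in> {0..T}" for s
    using assms fg_hermitian[of s] fg_ssummable[of s] state_bounds(3,4)[OF st[of s]] that
    by (auto simp: hermitian_zero simp del: One_nat_def)
  have l: "((\<lambda>s. u s j) \<longlongrightarrow> u t j) (at t within {0..T})" "((\<lambda>s. v s j) \<longlongrightarrow> v t j) (at t within {0..T})" for j
    using assms fg_tendsto[OF t, of j] by auto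
  show "((\<lambda>t. wprod (u t) (v t) k) \<longlongrightarrow> wprod (u t) (v t) k) (at t within {0..T})"
    by (rule wprod_tendsto[OF l eventually_within[OF p]]) (use p[OF t] in auto)
qed

lemma flux_coef_continuous:
  assumes "u = f \<or> u = g" "v = f \<or> v = g"
  shows "continuous_on {0..T} (\<lambda>t. flux_coef H p q (u t) (v t) k)"
proof -
  have c: "continuous_on {0..T} (\<lambda>t. u t k)" "continuous_on {0..T} (\<lambda>t. v t k)"
    using assms fg_continuous by auto
  show ?thesis
    unfolding flux_coef_def fconv_dcoef unfolding dcoef_def
    by (intro continuous_on_add continuous_on_mult continuous_on_const c wprod_continuous[OF assms(1) assms(1)]
      wprod_continuous[OF assms(1) assms(2)])
qed

lemma V_row: "Vf u v = row F br b u v" "Vg v u = row G bm bm u v"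
  by (rule ext, simp add: Vf_def row_def) (rule ext, simp add: Vg_def row_def)

lemma h2_bounds:
  assumes "T \<ge> 0"
  shows "AE t in lebesgue_on {0..T}. ssummable 2 (f t)" "AE t in lebesgue_on {0..T}. ssummable 2 (g t)"
    "integrable (lebesgue_on {0..T}) (\<lambda>t. snorm 2 (f t))" "integrable (lebesgue_on {0..T}) (\<lambda>t. snorm 2 (g t))"
    "(LINT t|lebesgue_on {0..T}. snorm 2 (f t)) \<le> E1 / kap" "(LINT t|lebesgue_on {0..T}. snorm 2 (g t)) \<le> E1 / kap"
proof -
  have c: "continuous_on {0..T} (\<lambda>t. (wmod 2 (f t) k)\<^sup>2)" "continuous_on {0..T} (\<lambda>t. (wmod 2 (g t) k)\<^sup>2)" for k
    unfolding wmod_def by (intro continuous_intros fg_continuous)+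
  have B': "integral {0..T} (\<lambda>t. \<Sum>k\<in>band N. (wmod 2 (g t) k)\<^sup>2 + (wmod 2 (f t) k)\<^sup>2) \<le> E1 / kap" for N
    using S2[OF assms, of N] by (simp add: add.commute)
  note F = continuous_levi[of T "\<lambda>k t. (wmod 2 (f t) k)\<^sup>2" "\<lambda>k t. (wmod 2 (g t) k)\<^sup>2", OF c(1) _ S2[OF assms] c(2)]
  note G = continuous_levi[of T "\<lambda>k t. (wmod 2 (g t) k)\<^sup>2" "\<lambda>k t. (wmod 2 (f t) k)\<^sup>2", OF c(2) _ B' c(1)]
  show "AE t in lebesgue_on {0..T}. ssummable 2 (f t)" "AE t in lebesgue_on {0..T}. ssummable 2 (g t)"
    "integrable (lebesgue_on {0..T}) (\<lambda>t. snorm 2 (f t))" "integrable (lebesgue_on {0..T}) (\<lambda>t. snorm 2 (g t))"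
    "(LINT t|lebesgue_on {0..T}. snorm 2 (f t)) \<le> E1 / kap" "(LINT t|lebesgue_on {0..T}. snorm 2 (g t)) \<le> E1 / kap"
    unfolding snorm_def using F G by auto
qed

lemma a2_bounds:
  assumes "T \<ge> 0"
  shows "AE t in lebesgue_on {0..T}. wsummable 2 (f t)" "AE t in lebesgue_on {0..T}. wsummable 2 (g t)"
    "integrable (lebesgue_on {0..T}) (\<lambda>t. wnorm 2 (f t))" "integrable (lebesgue_on {0..T}) (\<lambda>t. wnorm 2 (g t))"
proof -
  have c: "continuous_on {0..T} (\<lambda>t. wmod 2 (f t) k)" "continuous_on {0..T} (\<lambda>t. wmod 2 (g t) k)" for k
    unfolding wmod_def by (intro continuous_intros fg_continuous)+
  have B': "integral {0..T} (\<lambda>t. \<Sum>k\<in>band N. wmod 2 (g t) k + wmod 2 (f t) k) \<le> E / sig" for N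
    using W2[OF assms, of N] by (simp add: add.commute)
  note F = continuous_levi[of T "\<lambda>k t. wmod 2 (f t) k" "\<lambda>k t. wmod 2 (g t) k", OF c(1) wmod_nonneg W2[OF assms] c(2) wmod_nonneg]
  note G = continuous_levi[of T "\<lambda>k t. wmod 2 (g t) k" "\<lambda>k t. wmod 2 (f t) k", OF c(2) wmod_nonneg B' c(1) wmod_nonneg]
  show "AE t in lebesgue_on {0..T}. wsummable 2 (f t)" "AE t in lebesgue_on {0..T}. wsummable 2 (g t)"
    using F(1) G(1) by simp_all
  show "integrable (lebesgue_on {0..T}) (\<lambda>t. wnorm 2 (f t))" "integrable (lebesgue_on {0..T}) (\<lambda>t. wnorm 2 (g t))"
    using F(2) G(2) by (simp_all add: wnorm_def)
qed

text \<open>The first summand bounds the second-order norms and the second one the velocities. The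
  factor 2 appears because f and g are each bounded by \<open>E1 / kap\<close>.\<close>

definition "DB = 2 * (E1 / kap) + VK * (2 * (E1 / kap))"

text \<open>At almost every time the second-order norms are finite and \<open>V_square_sum\<close>
  applies, so the velocity inherits square integrability in time. This is the hypothesis under which
  continuity into H^1 was derived.\<close>

lemma velocity_bound:
  assumes T: "T > 0"
  shows "integral {0..T} (\<lambda>t. \<Sum>k\<in>band N. (wmod 2 (f t) k)\<^sup>2 + (cmod (Vf (f t) (g t) k))\<^sup>2) \<le> DB"
    "integral {0..T} (\<lambda>t. \<Sum>k\<in>band N. (wmod 2 (g t) k)\<^sup>2 + (cmod (Vg (f t) (g t) k))\<^sup>2) \<le> DB"
proof -
  let ?M = "lebesgue_on {0..T}"
  let ?f = "\<lambda>t. \<Sum>k\<in>band N. (wmod 2 (f t) k)\<^sup>2 + (cmod (Vf (f t) (g t) k))\<^sup>2"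
  let ?g = "\<lambda>t. \<Sum>k\<in>band N. (wmod 2 (g t) k)\<^sup>2 + (cmod (Vg (f t) (g t) k))\<^sup>2"
  let ?h = "\<lambda>t. (snorm 2 (f t) + snorm 2 (g t)) + VK * (snorm 2 (f t) + snorm 2 (g t))"
  have T0: "0 \<le> T" using T by simp
  have cf: "continuous_on {0..T} ?f" and cg: "continuous_on {0..T} ?g"
    unfolding wmod_def by (intro continuous_intros fg_continuous V_continuous)+
  have hi: "integrable ?M ?h"
    by (intro Bochner_Integration.integrable_add integrable_mult_right h2_bounds T0)
  have "(LINT t|?M. ?h t) = ((LINT t|?M. snorm 2 (f t)) + (LINT t|?M. snorm 2 (g t)))
      + VK * ((LINT t|?M. snorm 2 (f t)) + (LINT t|?M. snorm 2 (g t)))"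
    by (simp add: h2_bounds T0)
  also have "\<dots> \<le> (E1 / kap + E1 / kap) + VK * (E1 / kap + E1 / kap)"
    by (intro add_mono mult_left_mono h2_bounds T0 VK_nonneg)
  finally have hB: "(LINT t|?M. ?h t) \<le> DB" by (simp add: DB_def)
  have "AE t in ?M. t \<in> {0..T}" by (rule AE_I2) simp
  with h2_bounds(1,2)[OF T0] a2_bounds(1,2)[OF T0]
  have ae: "AE t in ?M. ?f t \<le> ?h t \<and> ?g t \<le> ?h t"
  proof eventually_elim
    case (elim t)
    then have t: "t \<ge> 0" by simp
    have V: "(\<Sum>k\<in>band N. (cmod (Vf (f t) (g t) k))\<^sup>2) + (\<Sum>k\<in>band N. (cmod (Vg (f t) (g t) k))\<^sup>2) \<le> VK * (snorm 2 (f t) + snorm 2 (g t))"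
      by (rule V_square_sum) (use elim st[OF t] in \<open>auto simp: state_def hermitian_zero\<close>)
    have "(\<Sum>k\<in>band N. (wmod 2 (f t) k)\<^sup>2) \<le> snorm 2 (f t)" "(\<Sum>k\<in>band N. (wmod 2 (g t) k)\<^sup>2) \<le> snorm 2 (g t)"
      unfolding snorm_def by (rule finite_sum_le_infsum[OF elim(1)], auto) (rule finite_sum_le_infsum[OF elim(2)], auto)
    moreover have "0 \<le> (\<Sum>k\<in>band N. (cmod (Vf (f t) (g t) k))\<^sup>2)" "0 \<le> (\<Sum>k\<in>band N. (cmod (Vg (f t) (g t) k))\<^sup>2)"
      by (auto intro: sum_nonneg)
    ultimately show ?case unfolding sum.distrib using V snorm_nonneg[of 2 "f t"] snorm_nonneg[of 2 "g t"] by linarith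
  qed
  have "integral {0..T} ?f = (LINT t|?M. ?f t)" by (rule LINT_continuous[symmetric, OF cf])
  also have "\<dots> \<le> (LINT t|?M. ?h t)"
    by (rule integral_mono_AE[OF continuous_imp_integrable_real[OF cf] hi]) (use ae in eventually_elim, simp)
  finally show "integral {0..T} ?f \<le> DB" using hB by linarith
  have "integral {0..T} ?g = (LINT t|?M. ?g t)" by (rule LINT_continuous[symmetric, OF cg])
  also have "\<dots> \<le> (LINT t|?M. ?h t)"
    by (rule integral_mono_AE[OF continuous_imp_integrable_real[OF cg] hi]) (use ae in eventually_elim, simp)
  finally show "integral {0..T} ?g \<le> DB" using hB by linarith
qed

lemma regularity:
  assumes T: "T > 0" and u: "u = f \<or> u = g"
  shows "(\<lambda>t. fser (u t)) \<in> Linf_spacetime T"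
    "(\<lambda>t. fser (u t)) \<in> continuous_into T (Hdot 1) (Hdot_norm 1)"
    "(\<lambda>t. fser (u t)) \<in> radon_measures T W2inf W2inf_norm"
    "\<lbrakk>\<And>d. adm d \<Longrightarrow> fser d \<in> X; h2_seminorm N K; 1 \<le> p; p \<le> 2\<rbrakk> \<Longrightarrow> (\<lambda>t. fser (u t)) \<in> bochner_Lp p T X N"
proof -
  have T0: "0 \<le> T" using T by simp
  have pos: "0 \<le> t" if "t \<in> {0..T}" for t using that by simp
  have E': "wnorm 0 (u t) \<le> E" if "t \<in> {0..T}" for t
    using u state_bounds(1,2)[OF st[OF pos[OF that]]] by auto
  have h: "hermitian (u t)" "wsummable 0 (u t)" if "t \<in> {0..T}" for t
    using u fg_hermitian[OF pos[OF that]] fg_wsummable[OF pos[OF that]] by auto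
  have uc: "continuous_on {0..T} (\<lambda>t. u t k)" for k using u fg_continuous by auto
  obtain W x0 where W: "\<And>k. continuous_on {0..T} (\<lambda>t. W t k)"
      "\<And>t k. t \<in> {0..T} \<Longrightarrow> u t k = x0 k + integral {0..t} (\<lambda>s. W s k)"
      "\<And>N. integral {0..T} (\<lambda>t. \<Sum>k\<in>band N. (wmod 2 (u t) k)\<^sup>2 + (cmod (W t k))\<^sup>2) \<le> DB"
      "ssummable 1 x0"
  proof (cases "u = f")
    case True
    show ?thesis
      by (rule that[of "\<lambda>t. Vf (f t) (g t)" fh])
        (use True V_continuous eqf velocity_bound(1)[OF T] ssm in \<open>auto simp del: One_nat_def\<close>)
  next
    case False
    then have "u = g" using u by simp
    then show ?thesis
      by (intro that[of "\<lambda>t. Vg (f t) (g t)" gh])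
        (use V_continuous eqg velocity_bound(2)[OF T] ssm in \<open>auto simp del: One_nat_def\<close>)
  qed
  show "(\<lambda>t. fser (u t)) \<in> Linf_spacetime T"
    by (rule fser_Linf_spacetime[OF T uc W(1,2,3,4) h(1) E'])
  show "(\<lambda>t. fser (u t)) \<in> continuous_into T (Hdot 1) (Hdot_norm 1)"
    by (rule fser_continuous_into[OF T uc W(1,2,3,4) h(1)])
  have a2: "AE t in lebesgue_on {0..T}. wsummable 2 (u t)" "integrable (lebesgue_on {0..T}) (\<lambda>t. wnorm 2 (u t))"
    using u a2_bounds[OF T0] by auto
  show "(\<lambda>t. fser (u t)) \<in> radon_measures T W2inf W2inf_norm"
    by (rule fser_radon_measures[OF T h E' uc a2])
  have s2: "AE t in lebesgue_on {0..T}. ssummable 2 (u t)" "integrable (lebesgue_on {0..T}) (\<lambda>t. snorm 2 (u t))"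
    using u h2_bounds[OF T0] by auto
  have lip: "cmod (u t k - u s k) \<le> \<bar>of_int k\<bar>\<^sup>2 * CV * \<bar>t - s\<bar>" if "t \<in> {0..T}" "s \<in> {0..T}" for t s k
    using u lipf[OF pos[OF that(1)] pos[OF that(2)]] lipg[OF pos[OF that(1)] pos[OF that(2)]] by auto
  show "\<lbrakk>\<And>d. adm d \<Longrightarrow> fser d \<in> X; h2_seminorm N K; 1 \<le> p; p \<le> 2\<rbrakk> \<Longrightarrow> (\<lambda>t. fser (u t)) \<in> bochner_Lp p T X N"
    by (rule bochner_Lp_fser[OF T h(1) lip s2])
qed

lemma weak_solution:
  assumes T: "T > 0" and f0: "integrable torus f0" "\<And>k. fourier f0 k = fh k" and g0: "integrable torus g0" "\<And>k. fourier g0 k = gh k"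
  shows "weak_solution_M0 b bm br F G T f0 g0 (\<lambda>t. fser (f t)) (\<lambda>t. fser (g t))"
proof -
  have T0: "0 \<le> T" using T by simp
  have pos': "0 \<le> t" if "t \<in> {0..T}" for t using that by simp
  note sb = state_bounds[OF st[OF pos']]
  note h = fg_hermitian[OF pos'] and w = fg_wsummable[OF pos']
  note FGp = less_imp_le[OF FG_pos(1)] less_imp_le[OF FG_pos(2)]
  have pp: "0 \<le> br" "0 \<le> b" "0 \<le> bm" using pos by auto
  have ef: "f t k = f 0 k + integral {0..t} (\<lambda>s. row F br b (f s) (g s) k)"
    and eg: "g t k = g 0 k + integral {0..t} (\<lambda>s. row G bm bm (g s) (f s) k)" if "t \<in> {0..T}" for t k
    using eqf[OF pos'[OF that], of k] eqg[OF pos'[OF that], of k] by (simp_all add: V_row fg_initial)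
  have ae: "AE t in lebesgue_on {0..T}. wsummable 2 (f t) \<and> wsummable 2 (g t)"
    "AE t in lebesgue_on {0..T}. wsummable 2 (g t) \<and> wsummable 2 (f t)"
    using a2_bounds(1,2)[OF T0] by (eventually_elim, simp)+
  have ii: "integrable (lebesgue_on {0..T}) (\<lambda>t. wnorm 2 (f t) + wnorm 2 (g t))"
    "integrable (lebesgue_on {0..T}) (\<lambda>t. wnorm 2 (g t) + wnorm 2 (f t))"
    using a2_bounds(3,4)[OF T0] by auto
  have rc: "continuous_on {0..T} (\<lambda>t. row F br b (f t) (g t) k)" "continuous_on {0..T} (\<lambda>t. row G bm bm (g t) (f t) k)" for k
    using V_continuous[of T k] by (simp_all add: V_row)
  have qc: "continuous_on {0..T} (\<lambda>t. flux_coef F br b (f t) (g t) k)" "continuous_on {0..T} (\<lambda>t. flux_coef G bm bm (g t) (f t) k)" for k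
    by (rule flux_coef_continuous; simp)+
  have i0: "fourier f0 k = f 0 k" "fourier g0 k = g 0 k" for k using f0(2) g0(2) by (simp_all add: fg_initial)
  note lf = weak_law[OF T pp(1,2) FGp(1) h(1) h(2) w(1) sb(1) fg_continuous(1) rc(1) qc(1) ef ae(1) ii(1) f0(1) i0(1)]
    flux_integrable[OF T pp(1,2) FGp(1) h(1) h(2) w(1) sb(1) fg_continuous(1) rc(1) qc(1) ef ae(1) ii(1) f0(1) i0(1)]
  note lg = weak_law[OF T pp(3,3) FGp(2) h(2) h(1) w(2) sb(2) fg_continuous(2) rc(2) qc(2) eg ae(2) ii(2) g0(1) i0(2)]
    flux_integrable[OF T pp(3,3) FGp(2) h(2) h(1) w(2) sb(2) fg_continuous(2) rc(2) qc(2) eg ae(2) ii(2) g0(1) i0(2)]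
  have gfl: "(fser (g t) x + G) * (bm * wderiv (fser (g t)) x + bm * wderiv (fser (f t)) x)
     = (fser (g t) x + G) * (bm * (wderiv (fser (f t)) x + wderiv (fser (g t)) x))" for t x
    by (simp add: algebra_simps)
  have bo: "(\<lambda>t. fser (f t)) \<in> bochner_Lp 1 T W11 W11_norm" "(\<lambda>t. fser (g t)) \<in> bochner_Lp 1 T W11 W11_norm"
    by (rule regularity(4)[OF T _ _ W11_seminorm]; use fser_W11 adm_wnorm in auto)+
  have me: "AE t in lebesgue_on {0..T}. mean (fser (f t)) = 0 \<and> mean (fser (g t)) = 0"
    by (rule AE_I2) (simp add: mean_fser fg_hermitian fg_wsummable)
  show ?thesis
    unfolding weak_solution_M0_def Let_def
    using bo me lf lg unfolding gfl by blast
qed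

lemma decay_Linf:
  assumes "t \<ge> 0"
  shows "Linf_norm (fser (f t)) + Linf_norm (fser (g t)) \<le> E * exp (- sig * t)"
  using Linf_norm_fser_le[OF fg_wsummable(1)[OF assms]] Linf_norm_fser_le[OF fg_wsummable(2)[OF assms]]
    wiener_decay[OF assms] by linarith

text \<open>On mean-zero functions the norm of order \<open>s \<le> 1\<close> is at most that of
  order 1, so a single rate serves all \<open>s\<close>.\<close>

lemma decay_energy:
  assumes "t \<ge> 0" "0 \<le> s" "s \<le> 1"
  shows "sobolev_energy s (fser (f t)) (fser (g t)) \<le> E1 * exp (- kap * t)"
proof -
  have "(Hdot_norm s (fser (f t)))\<^sup>2 \<le> snorm 1 (f t)" "(Hdot_norm s (fser (g t)))\<^sup>2 \<le> snorm 1 (g t)"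
    using fser_Hdot(2)[OF fg_hermitian(1) fg_wsummable(1) fg_ssummable(1), OF assms(1) assms(1) assms(1), of s]
      fser_Hdot(2)[OF fg_hermitian(2) fg_wsummable(2) fg_ssummable(2), OF assms(1) assms(1) assms(1), of s] assms by simp_all
  then show ?thesis unfolding sobolev_energy_def using energy_decay[OF assms(1)] by linarith
qed

lemma dissipated_energy:
  assumes "T > 0"
  shows "(LINT t|lebesgue_on {0..T}. sobolev_energy 2 (fser (f t)) (fser (g t))) \<le> 2 * (E1 / kap)"
proof -
  have T0: "0 \<le> T" using assms by simp
  have "sobolev_energy 2 (fser (f t)) (fser (g t)) = snorm 2 (f t) + snorm 2 (g t)" if "t \<in> {0..T}" for t
    using Hdot_norm_fser[OF fg_hermitian(1) fg_wsummable(1), of t 2] Hdot_norm_fser[OF fg_hermitian(2) fg_wsummable(2), of t 2] that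
    by (simp add: sobolev_energy_def)
  then have "(LINT t|lebesgue_on {0..T}. sobolev_energy 2 (fser (f t)) (fser (g t))) =
      (LINT t|lebesgue_on {0..T}. snorm 2 (f t) + snorm 2 (g t))"
    by (intro Bochner_Integration.integral_cong) auto
  also have "\<dots> = (LINT t|lebesgue_on {0..T}. snorm 2 (f t)) + (LINT t|lebesgue_on {0..T}. snorm 2 (g t))"
    by (intro Bochner_Integration.integral_add h2_bounds T0)
  also have "\<dots> \<le> 2 * (E1 / kap)" using h2_bounds(5,6)[OF T0] by linarith
  finally show ?thesis .
qed

end

text \<open>H^1 embeds into the Wiener space, since for nonzero modes twice a modulus is at most its
  first-order square plus the inverse square of the frequency. The two zeroth-order norms agree in
  spite of \<open>0 powr 0 = 0\<close> because the mean vanishes.\<close>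

lemma Hdot_1_coefficients:
  assumes "u \<in> Hdot 1"
  shows "integrable torus u" "hermitian (fourier u)" "wsummable 0 (fourier u)" "ssummable 1 (fourier u)"
    "Adot_norm 0 u = wnorm 0 (fourier u)"
proof -
  have u: "u \<in> borel_measurable torus" "integrable torus (\<lambda>x. (u x)\<^sup>2)" "mean u = 0"
    and s: "(\<lambda>k::int. (1 + \<bar>of_int k\<bar> powr (2 * 1)) * (cmod (fourier u k))\<^sup>2) summable_on UNIV"
    using assms by (auto simp: Hdot_def L2_def)
  show "integrable torus u"
  proof (rule Bochner_Integration.integrable_bound[OF _ u(1)])
    interpret finite_measure torus by (rule finite_measure_lebesgue_on) simp
    show "integrable torus (\<lambda>x. 1 + (u x)\<^sup>2)" using u(2) by simp
    have "\<bar>y\<bar> \<le> 1 + y\<^sup>2" for y :: real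
      using sum_squares_bound[of 1 "\<bar>y\<bar>"] by (simp add: power2_eq_square)
    then show "AE x in torus. norm (u x) \<le> norm (1 + (u x)\<^sup>2)" by (intro AE_I2) (simp add: order_trans[OF _ abs_ge_self])
  qed
  have c0: "fourier u 0 = 0" using u(3) mean_eq_fourier[of u] by simp
  have "fourier u (- k) = cnj (fourier u k)" for k
  proof -
    have "cnj (LINT x|torus. complex_of_real (u x) * exp (- \<i> * of_int k * complex_of_real x))
      = (LINT x|torus. cnj (complex_of_real (u x) * exp (- \<i> * of_int k * complex_of_real x)))"
      by (rule Bochner_Integration.integral_cnj[symmetric])
    also have "\<dots> = (LINT x|torus. complex_of_real (u x) * exp (- \<i> * of_int (- k) * complex_of_real x))"
      unfolding exp_eq_cis by (simp add: cis_cnj)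
    finally show ?thesis by (simp add: fourier_def)
  qed
  with c0 show "hermitian (fourier u)" by (simp add: hermitian_def)
  show ss: "ssummable 1 (fourier u)"
  proof (rule summable_on_comparison_test[OF s])
    fix k :: int
    have "(wmod 1 (fourier u) k)\<^sup>2 = \<bar>of_int k\<bar> powr (2 * 1) * (cmod (fourier u k))\<^sup>2"
      by (cases "k = 0") (simp_all add: wmod_def power_mult_distrib)
    then show "(wmod 1 (fourier u) k)\<^sup>2 \<le> (1 + \<bar>of_int k\<bar> powr (2 * 1)) * (cmod (fourier u k))\<^sup>2"
      by (simp add: distrib_right)
  qed simp
  show "wsummable 0 (fourier u)"
  proof (rule summable_on_comparison_test)
    show "(\<lambda>k. (wmod 1 (fourier u) k)\<^sup>2 + \<bar>of_int k\<bar> powr (-2)) summable_on UNIV"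
      by (intro summable_on_add ss summable_int_powr) simp
    fix k :: int
    show "wmod 0 (fourier u) k \<le> (wmod 1 (fourier u) k)\<^sup>2 + \<bar>of_int k\<bar> powr (-2)"
    proof (cases "k = 0")
      case False
      then have k: "1 \<le> \<bar>real_of_int k\<bar>" by linarith
      then have p: "\<bar>real_of_int k\<bar> powr (- 2) = (inverse \<bar>real_of_int k\<bar>)\<^sup>2"
        using powr_realpow[of "\<bar>real_of_int k\<bar>" 2] by (simp add: powr_minus power_inverse)
      have "2 * wmod 1 (fourier u) k * inverse \<bar>real_of_int k\<bar> \<le> (wmod 1 (fourier u) k)\<^sup>2 + (inverse \<bar>real_of_int k\<bar>)\<^sup>2"
        by (rule sum_squares_bound)
      moreover have "2 * wmod 1 (fourier u) k * inverse \<bar>real_of_int k\<bar> = 2 * wmod 0 (fourier u) k"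
        using k by (simp add: wmod_def field_simps)
      ultimately show ?thesis unfolding p using wmod_nonneg[of 0 "fourier u" k] by linarith
    qed (simp add: c0 wmod_def)
  qed simp
  show "Adot_norm 0 u = wnorm 0 (fourier u)"
    unfolding Adot_norm_def wnorm_def
  proof (rule infsum_cong)
    fix k :: int
    show "\<bar>of_int k\<bar> powr 0 * cmod (fourier u k) = wmod 0 (fourier u) k"
      by (cases "k = 0") (simp_all add: wmod_def c0)
  qed
qed

theorem theorem4:
  fixes \<mu>\<^sub>p \<mu>\<^sub>m \<rho>\<^sub>p \<rho>\<^sub>m b b\<^sub>\<mu> b\<^sub>\<rho> F G \<E> \<sigma>\<^sub>1 \<sigma>\<^sub>2 :: real
    and f0 g0 fb0 gb0 :: "real \<Rightarrow> real"
  assumes "\<mu>\<^sub>p > 0" "\<mu>\<^sub>m > 0" "\<rho>\<^sub>p > 0" "\<rho>\<^sub>m > 0"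
    and b: "b = \<rho>\<^sub>p" "b\<^sub>\<mu> = \<mu>\<^sub>m / \<mu>\<^sub>p * b" "b\<^sub>\<rho> = \<rho>\<^sub>m / \<rho>\<^sub>p * b"
    and "periodic f0" "periodic g0" "\<And>x. f0 x > 0" "\<And>x. g0 x > 0"
    and means: "F = mean f0" "G = mean g0"
    and bars: "fb0 = (\<lambda>x. f0 x - F)" "gb0 = (\<lambda>x. g0 x - G)"
    and "fb0 \<in> Hdot 1" "gb0 \<in> Hdot 1"
    and energy: "\<E> = wiener_energy 0 fb0 gb0"
    and sigma: "\<sigma>\<^sub>1 = F * b\<^sub>\<rho> - G * b\<^sub>\<mu> - \<E> * (2 * b\<^sub>\<rho> + 2 * b + 4 * b\<^sub>\<mu>)"
               "\<sigma>\<^sub>2 = G * b\<^sub>\<mu> - F * b - \<E> * (2 * b\<^sub>\<rho> + 2 * b + 4 * b\<^sub>\<mu>)"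
    and "\<E> < min F G"
    and "min \<sigma>\<^sub>1 \<sigma>\<^sub>2 > 0"
    and "F * b\<^sub>\<rho> - 1/2 * (G * b\<^sub>\<mu> + F * b) - (b\<^sub>\<rho> + b\<^sub>\<mu> + 5 * b\<^sub>\<mu> / 2 + 5 * b / 2) * \<E> > 0"
    and "G * b\<^sub>\<mu> - 1/2 * (G * b\<^sub>\<mu> + F * b) - (b\<^sub>\<rho> + b\<^sub>\<mu> + 5 * b\<^sub>\<mu> / 2 + 5 * b / 2) * \<E> > 0"
  shows "\<exists>\<delta>>0. \<exists>c\<^sub>1>0. \<exists>c\<^sub>2>0. \<exists>c\<^sub>3>0. \<exists>c :: real \<Rightarrow> real. (\<forall>s\<in>{0..<1}. c s > 0) \<and>
    (\<exists>f g :: real \<Rightarrow> real \<Rightarrow> real.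
       global_weak_solution_M0 b b\<^sub>\<mu> b\<^sub>\<rho> F G fb0 gb0 f g \<and>
       (\<forall>T>0. \<forall>\<alpha>\<in>{0..<1/2}. \<forall>u\<in>{f, g}.
          u \<in> Linf_spacetime T \<inter> bochner_Lp 2 T W1inf W1inf_norm
              \<inter> bochner_Lp 1 T (C1_holder \<alpha>) (C1_holder_norm \<alpha>)
              \<inter> radon_measures T W2inf W2inf_norm
              \<inter> bochner_Lp 2 T (Hdot 1) (Hdot_norm 1)) \<and>
       (AE T in lborel. T > 0 \<longrightarrow>
          Linf_norm (f T) + Linf_norm (g T) \<le> \<E> * exp (- \<delta> * T)) \<and>
       (\<forall>T>0. \<forall>u\<in>{f, g}.
          u \<in> continuous_into T (Hdot 1) (Hdot_norm 1) \<inter> bochner_Lp 2 T (Hdot 2) (Hdot_norm 2)) \<and>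
       (\<forall>T>0. sobolev_energy 1 (f T) (g T)
               + c\<^sub>1 * (LINT s|lebesgue_on {0..T}. sobolev_energy 2 (f s) (g s)) \<le> c\<^sub>2) \<and>
       (\<forall>s\<in>{0..<1}. \<forall>T>0. sobolev_energy s (f T) (g T) \<le> c\<^sub>3 * exp (- c s * T)))"
proof -
  have p: "b > 0" "b\<^sub>\<mu> > 0" "b\<^sub>\<rho> > 0" using assms(1-4) b by auto
  note cf = Hdot_1_coefficients[OF \<open>fb0 \<in> Hdot 1\<close>] and cg = Hdot_1_coefficients[OF \<open>gb0 \<in> Hdot 1\<close>]
  have En: "\<E> = wnorm 0 (fourier fb0) + wnorm 0 (fourier gb0)"
    using energy cf(5) cg(5) by (simp add: wiener_energy_def)
  have E0: "0 \<le> \<E>" unfolding En by simp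
  interpret film_data b\<^sub>\<rho> b b\<^sub>\<mu> F G \<E> "fourier fb0" "fourier gb0"
  proof
    show "0 < F * b\<^sub>\<rho> - G * b\<^sub>\<mu> - \<E> * (2 * b\<^sub>\<rho> + 2 * b + 4 * b\<^sub>\<mu>)"
      "0 < G * b\<^sub>\<mu> - F * b - \<E> * (2 * b\<^sub>\<rho> + 2 * b + 4 * b\<^sub>\<mu>)"
      using \<open>min \<sigma>\<^sub>1 \<sigma>\<^sub>2 > 0\<close> sigma by auto
  qed (use p E0 En assms cf cg in auto)
  obtain f g where sol: "film_sol b\<^sub>\<rho> b b\<^sub>\<mu> F G \<E> (fourier fb0) (fourier gb0) f g"
  proof (rule limit_exists)
    fix f g
    assume "\<And>t. t \<ge> 0 \<Longrightarrow> state (f t) (g t)"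
      "\<And>t. t \<ge> 0 \<Longrightarrow> wnorm 0 (f t) + wnorm 0 (g t) \<le> \<E> * exp (- sig * t)"
      "\<And>t. t \<ge> 0 \<Longrightarrow> snorm 1 (f t) + snorm 1 (g t) \<le> E1 * exp (- kap * t)"
      "\<And>t k. t \<ge> 0 \<Longrightarrow> f t k = fourier fb0 k + integral {0..t} (\<lambda>s. Vf (f s) (g s) k)"
      "\<And>t k. t \<ge> 0 \<Longrightarrow> g t k = fourier gb0 k + integral {0..t} (\<lambda>s. Vg (f s) (g s) k)"
      "\<And>T N. T \<ge> 0 \<Longrightarrow> integral {0..T} (\<lambda>t. \<Sum>k\<in>band N. (wmod 2 (f t) k)\<^sup>2 + (wmod 2 (g t) k)\<^sup>2) \<le> E1 / kap"
      "\<And>T N. T \<ge> 0 \<Longrightarrow> integral {0..T} (\<lambda>t. \<Sum>k\<in>band N. wmod 2 (f t) k + wmod 2 (g t) k) \<le> \<E> / sig"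
      "\<And>t s k. t \<ge> 0 \<Longrightarrow> s \<ge> 0 \<Longrightarrow> cmod (f t k - f s k) \<le> \<bar>of_int k\<bar>\<^sup>2 * CV * \<bar>t - s\<bar>"
      "\<And>t s k. t \<ge> 0 \<Longrightarrow> s \<ge> 0 \<Longrightarrow> cmod (g t k - g s k) \<le> \<bar>of_int k\<bar>\<^sup>2 * CV * \<bar>t - s\<bar>"
    then have "film_sol b\<^sub>\<rho> b b\<^sub>\<mu> F G \<E> (fourier fb0) (fourier gb0) f g" by unfold_locales
    then show thesis by (rule that)
  qed
  interpret film_sol b\<^sub>\<rho> b b\<^sub>\<mu> F G \<E> "fourier fb0" "fourier gb0" f g by (rule sol)
  let ?f = "\<lambda>t. fser (f t)" and ?g = "\<lambda>t. fser (g t)"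
  have reg: "u \<in> Linf_spacetime T \<inter> bochner_Lp 2 T W1inf W1inf_norm
        \<inter> bochner_Lp 1 T (C1_holder \<alpha>) (C1_holder_norm \<alpha>) \<inter> radon_measures T W2inf W2inf_norm
        \<inter> bochner_Lp 2 T (Hdot 1) (Hdot_norm 1) \<and>
      u \<in> continuous_into T (Hdot 1) (Hdot_norm 1) \<inter> bochner_Lp 2 T (Hdot 2) (Hdot_norm 2)"
    if T: "T > 0" and a: "\<alpha> \<in> {0..<1/2}" and u: "u \<in> {?f, ?g}" for T \<alpha> u
  proof -
    obtain x where x: "x = f \<or> x = g" and u: "u = (\<lambda>t. fser (x t))" using u by auto
    obtain K where K: "h2_seminorm (C1_holder_norm \<alpha>) K" using C1_holder_seminorm[of \<alpha>] a by auto
    have ad: "ssummable 2 d" if "adm d" for d using that by (simp add: adm_def)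
    have w: "fser d \<in> W1inf" if "adm d" for d using fser_W1inf adm_wnorm[OF that] by blast
    have c: "fser d \<in> C1_holder \<alpha>" if "adm d" for d using fser_C1_holder[OF that] a by simp
    have h: "fser d \<in> Hdot s" if "adm d" "0 \<le> s" "s \<le> 2" for d s
      using fser_Hdot(1)[OF adm_wnorm(2,4)[OF that(1)] ad[OF that(1)], of s] that by simp
    show ?thesis
      using regularity(1-3)[OF T x] regularity(4)[OF T x w W1inf_seminorm, of 2] regularity(4)[OF T x c K, of 1]
        regularity(4)[OF T x h Hdot_seminorm[of 1], of 1 2] regularity(4)[OF T x h Hdot_seminorm[of 2], of 2 2]
      unfolding u by simp
  qed
  \<comment> \<open>The choice is \<open>c\<^sub>1 = 1\<close>; the additive 1 keeps the right-hand
    constant positive when the datum vanishes.\<close>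
  have i: "sobolev_energy 1 (?f T) (?g T) + 1 * (LINT s|lebesgue_on {0..T}. sobolev_energy 2 (?f s) (?g s)) \<le> E1 + 2 * (E1 / kap) + 1"
    if "T > 0" for T
  proof -
    have "E1 * exp (- kap * T) \<le> E1 * 1" using E1_nonneg kap_pos that by (intro mult_left_mono) auto
    moreover have "sobolev_energy 1 (?f T) (?g T) \<le> E1 * exp (- kap * T)" by (rule decay_energy) (use that in auto)
    ultimately show ?thesis using dissipated_energy[OF that] by linarith
  qed
  have ii: "sobolev_energy s (?f T) (?g T) \<le> (E1 + 1) * exp (- kap * T)" if "s \<in> {0..<1}" "T > 0" for s T
  proof -
    have "E1 * exp (- kap * T) \<le> (E1 + 1) * exp (- kap * T)" by (intro mult_right_mono) auto
    moreover have "sobolev_energy s (?f T) (?g T) \<le> E1 * exp (- kap * T)" by (rule decay_energy) (use that in auto)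
    ultimately show ?thesis by linarith
  qed
  let ?C = "E1 + 2 * (E1 / kap) + 1"
  have C: "0 < ?C" "0 < E1 + 1" using E1_nonneg kap_pos by (auto intro!: add_nonneg_pos add_nonneg_nonneg)
  show ?thesis
  \<comment> \<open>All witnesses preceding the solution depend on the parameters and the datum
    only. The rate \<open>kap\<close> of the H^1 energy serves for every \<open>s\<close>.\<close>
  proof (rule exI[of _ sig], rule conjI[OF sig_pos], rule exI[of _ 1], rule conjI[OF zero_less_one],
        rule exI[of _ ?C], rule conjI[OF C(1)], rule exI[of _ "E1 + 1"], rule conjI[OF C(2)],
        rule exI[of _ "\<lambda>_. kap"], rule conjI[OF ballI[OF kap_pos]], rule exI[of _ ?f], rule exI[of _ ?g], intro conjI)
    show "global_weak_solution_M0 b b\<^sub>\<mu> b\<^sub>\<rho> F G fb0 gb0 ?f ?g"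
      unfolding global_weak_solution_M0_def by (intro allI impI weak_solution cf cg refl)
    show "AE T in lborel. T > 0 \<longrightarrow> Linf_norm (?f T) + Linf_norm (?g T) \<le> \<E> * exp (- sig * T)"
      using decay_Linf by (intro AE_I2) simp
    show "\<forall>T>0. \<forall>\<alpha>\<in>{0..<1/2}. \<forall>u\<in>{?f, ?g}.
        u \<in> Linf_spacetime T \<inter> bochner_Lp 2 T W1inf W1inf_norm
            \<inter> bochner_Lp 1 T (C1_holder \<alpha>) (C1_holder_norm \<alpha>)
            \<inter> radon_measures T W2inf W2inf_norm
            \<inter> bochner_Lp 2 T (Hdot 1) (Hdot_norm 1)"
      by (intro allI impI ballI reg[THEN conjunct1])
    show "\<forall>T>0. \<forall>u\<in>{?f, ?g}.
        u \<in> continuous_into T (Hdot 1) (Hdot_norm 1) \<inter> bochner_Lp 2 T (Hdot 2) (Hdot_norm 2)"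
      by (intro allI impI ballI reg[where \<alpha> = 0, THEN conjunct2]) auto
    show "\<forall>T>0. sobolev_energy 1 (?f T) (?g T)
             + 1 * (LINT s|lebesgue_on {0..T}. sobolev_energy 2 (?f s) (?g s)) \<le> E1 + 2 * (E1 / kap) + 1"
      by (intro allI impI i)
    show "\<forall>s\<in>{0..<1}. \<forall>T>0. sobolev_energy s (?f T) (?g T) \<le> (E1 + 1) * exp (- kap * T)"
      by (intro allI impI ballI ii)
  qed
qed

end
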